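(* Let $\Lambda=kQ/(\rho)$ be a string algebra, let $S$ be a primitive simple $\Lambda$-module, and write $S=M({}^\infty P^\infty,V)$ where $P$ is a primitive cycle with head $v$ and sign $\epsilon$, and $V=k[T,T^{-1}]/(f(T))$ with $f(T)\in k[T]$ irreducible and $f(0)=1$. Suppose that $M$ is a finitely controlled $\Lambda$-module and $N$ is a submodule of $M$ with $\tau^1(M)\subseteq N$ and $M/N\cong S$. Suppose that $N$ is a direct sum of string and finite-dimensional band modules, \[ N=\bigoplus_{\lambda\in\Phi}N_\lambda , \] indexed by some set $\Phi$. Then there is some $\mu\in\Phi$ with $N_\mu$ of the form $M(C)$ for some word $C$ which has a $P$-peak, such that $M=N'_\mu\oplus N'$, where \[ N'=\bigoplus_{\lambda\in\Phi\smallsetminus\{\mu\}}N_\lambda \] and $N'_\mu$ is a submodule of $M$ with $N'_\mu\cong N_\mu$.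
   Context: String algebras. Let $k$ be a field, $Q$ a quiver (not necessarily finite), $kQ$ its path algebra; a product $xy$ of arrows is a path when the tail of $x$ equals the head of $y$ (first $y$, then $x$). Let $\rho$ be a set of paths of length $\ge 2$ ("zero relations"). $\Lambda=kQ/(\rho)$ is a string algebra if (a) every vertex of $Q$ is the head of at most two arrows and the tail of at most two arrows, and (b) for any arrow $y$ there is at most one path $xy$ of length 2 with $xy\notin\rho$ and at most one path $yz$ of length 2 with $yz\notin\rho$. $e_v$ is the trivial path at the vertex $v$. A $\Lambda$-module is a left module $M$ with $\Lambda M=M$ (equivalently $M=\bigoplus_v e_vM$). $M$ is finitely controlled if for every vertex $v$ the set $e_vM$ is contained in a finitely generated submodule of $M$. Words. A letter is an arrow $x$ (direct letter) or its formal inverse $x^{-1}$ (inverse letter); the head of $x^{-1}$ is the tail of $x$ and vice versa; $(x^{-1})^{-1}=x$. Let $I$ be $\{0,1,\dots,n\}$ ($n\ge0$), $\mathbb N=\{0,1,2,\dots\}$, $-\mathbb N=\{0,-1,-2,\dots\}$ or $\mathbb Z$. If $I\ne\{0\}$, an $I$-word $C$ is a sequence of letters $C_i$, one for each $i\in I$ with $i-1\in I$, such that for consecutive letters $C_i,C_{i+1}$ the tail of $C_i$ is the head of $C_{i+1}$ and $C_i^{-1}\neq C_{i+1}$, and no zero relation $x_1\dots x_m\in\rho$ nor its inverse $x_m^{-1}\dots x_1^{-1}$ occurs as a sequence of consecutive letters. For $I=\{0\}$ there are trivial words $1_{v,\epsilon}$ for each vertex $v$ and $\epsilon=\pm1$.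 A word with $I=\{0,\dots,n\}$ is finite of length $n$. For $i\in I$, $v_i(C)$ is the tail of $C_i$ or the head of $C_{i+1}$ (and $v$ for $1_{v,\epsilon}$). A word is direct (inverse) if all its letters are. The inverse $C^{-1}$ is obtained by inverting the letters and reversing their order, with $(1_{v,\epsilon})^{-1}=1_{v,-\epsilon}$. For a $\mathbb Z$-word $C=\dots C_0|C_1\dots$, the shift is $C[n]=\dots C_n|C_{n+1}\dots$. $C$ is periodic if it is a $\mathbb Z$-word with $C=C[n]$ for some $n>0$; the minimal such $n$ is the period. Modules. For an $I$-word $C$, $M(C)$ has $k$-basis $b_i$ ($i\in I$), with $e_vb_i=b_i$ if $v_i(C)=v$ and $0$ otherwise, and for an arrow $x$: $xb_i=b_{i-1}$ if $i-1\in I$ and $C_i=x$; $xb_i=b_{i+1}$ if $i+1\in I$ and $C_{i+1}=x^{-1}$; $xb_i=0$ otherwise. If $C$ is periodic of period $n$, $M(C)$ is a $\Lambda$-$k[T,T^{-1}]$-bimodule with $T$ acting by $b_i\mapsto b_{i-n}$, and $M(C,V)=M(C)\otimes_{k[T,T^{-1}]}V$ for a $k[T,T^{-1}]$-module $V$. A string module is $M(C)$ with $C$ non-periodic. A band module is $M(C,V)$ with $C$ periodic and $V$ an indecomposable $k[T,T^{-1}]$-module. Signs and composition. Fix a sign $\pm1$ for each letter such that if distinct letters $\ell,\ell'$ have the same head and sign then $\{\ell,\ell'\}=\{x^{-1},y\}$ for some zero relation $xy\in\rho$. The head of a finite word or $\mathbb N$-word $C$ is $v_0(C)$; its sign is that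 of $C_1$, or $\epsilon$ for $1_{v,\epsilon}$. The composition $CD$ is the concatenation, defined if the tail of $C$ equals the head of $D$, $C^{-1}$ and $D$ have opposite signs, and the result is a word (the tail of a finite word of length $n$ is $v_n(C)$, of a $(-\mathbb N)$-word $v_0(C)$). If $E=E_1\dots E_n$ is a non-trivial finite word all of whose powers are words, $E^\infty=E_1\dots E_nE_1\dots$ (an $\mathbb N$-word) and ${}^\infty E^\infty=\dots E_1\dots E_n|E_1\dots E_nE_1\dots$. For an $I$-word $C$ and $i\in I$, $C_{>i}=C_{i+1}C_{i+2}\dots$ and $C_{\le i}=\dots C_{i-1}C_i$ (appropriately signed trivial words at the ends, so that $C$ is a shift of $C_{\le i}C_{>i}$). The words $C_{>i}$ and $(C_{\le i})^{-1}$ have head $v_i(C)$ and opposite signs; for $\delta=\pm1$, $C(i,\delta)$ denotes the one with sign $\delta$. Primitive cycles and torsion. A primitive cycle is a non-trivial finite direct word $P$ such that ${}^\infty P^\infty$ is a periodic word of period equal to the length of $P$. For a vertex $v$, $z_v\in e_v\Lambda e_v$ is the sum of all (at most two) primitive cycles with head $v$. Every $\Lambda$-module $M$ is a $k[z]$-module via $zm=z_vm$ for $m\in e_vM$, and this commutes with the action of $\Lambda$. Put $\tau^1(M)=\{m\in M: f(z)m=0\text{ for some }f(z)\in k[z]\text{ with }f(0)=1\}$, a $\Lambda$-submodule; $M$ is primitive torsion if $M=\tau^1(M)$. A primitive simple is a simple, primitive torsion $\Lambda$-module; every primitive simple has the form $M({}^\infty P^\infty,k[T,T^{-1}]/(f(T)))$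 with $P$ a primitive cycle and $f(T)\in k[T]$ irreducible with $f(0)=1$. Peaks. Let $P$ be a primitive cycle of sign $\epsilon$ and $C$ an $I$-word. $i\in I$ is $P$-deep for $C$ if $C(i,-\epsilon)=(P^{-1})^\infty$. $i$ is a $P$-peak for $C$ if it is $P$-deep for $C$ and $C(i,\epsilon)$ is not of the form $PD$ for some word $D$. $C$ has a $P$-peak if some $i\in I$ is a $P$-peak for $C$. *)

theory Defs
  imports
    "HOL-Computational_Algebra.Polynomial"
    "HOL-Library.Poly_Mapping"
    "Graph_Theory.Arc_Walk"
    "HOL-Algebra.Free_Abelian_Groups"
    "HOL-Algebra.QuotRing"
    "HOL-Algebra.Module"
begin

section \<open>Left modules over a ring that need not have an identity\<close>

text \<open>
  The path algebra of an infinite quiver has no identity, so neither the library locale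
  \<^locale>\<open>module\<close> nor \<^const>\<open>genideal\<close> applies to it.  Structures are the library records;
  the field \<open>one\<close> of a ring without identity, and the ring fields \<open>mult\<close> and \<open>one\<close> of a module,
  are left undefined and never used.
\<close>

locale left_module = abelian_group M
  for R :: "('r, 'x) ring_scheme" and M :: "('r, 'm, 'y) module_scheme" +
  assumes smult_closed:
      "\<lbrakk>a \<in> carrier R; x \<in> carrier M\<rbrakk> \<Longrightarrow> a \<odot>\<^bsub>M\<^esub> x \<in> carrier M"
    and smult_l_distr:
      "\<lbrakk>a \<in> carrier R; b \<in> carrier R; x \<in> carrier M\<rbrakk> \<Longrightarrow>
        (a \<oplus>\<^bsub>R\<^esub> b) \<odot>\<^bsub>M\<^esub> x = a \<odot>\<^bsub>M\<^esub> x \<oplus>\<^bsub>M\<^esub> b \<odot>\<^bsub>M\<^esub> x"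
    and smult_r_distr:
      "\<lbrakk>a \<in> carrier R; x \<in> carrier M; y \<in> carrier M\<rbrakk> \<Longrightarrow>
        a \<odot>\<^bsub>M\<^esub> (x \<oplus>\<^bsub>M\<^esub> y) = a \<odot>\<^bsub>M\<^esub> x \<oplus>\<^bsub>M\<^esub> a \<odot>\<^bsub>M\<^esub> y"
    and smult_assoc:
      "\<lbrakk>a \<in> carrier R; b \<in> carrier R; x \<in> carrier M\<rbrakk> \<Longrightarrow>
        (a \<otimes>\<^bsub>R\<^esub> b) \<odot>\<^bsub>M\<^esub> x = a \<odot>\<^bsub>M\<^esub> (b \<odot>\<^bsub>M\<^esub> x)"

definition module_iso ::
  "('r, 'x) ring_scheme \<Rightarrow> ('r, 'm, 'y) module_scheme \<Rightarrow> ('r, 'n, 'z) module_scheme \<Rightarrow> bool" where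
  "module_iso R M N \<longleftrightarrow>
     (\<exists>h. bij_betw h (carrier M) (carrier N) \<and>
        (\<forall>x\<in>carrier M. \<forall>y\<in>carrier M. h (x \<oplus>\<^bsub>M\<^esub> y) = h x \<oplus>\<^bsub>N\<^esub> h y) \<and>
        (\<forall>a\<in>carrier R. \<forall>x\<in>carrier M. h (a \<odot>\<^bsub>M\<^esub> x) = a \<odot>\<^bsub>N\<^esub> h x))"

text \<open>As for \<^const>\<open>rcoset_mult\<close>, the union below is the coset of \<open>a \<odot> x\<close> for any \<open>x \<in> X\<close>.\<close>

definition quot_module :: "('r, 'm, 'y) module_scheme \<Rightarrow> 'm set \<Rightarrow> ('r, 'm set) module" where
  "quot_module M N =
     \<lparr>carrier = a_rcosets\<^bsub>M\<^esub> N, mult = undefined, one = undefined, zero = N, add = set_add M,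
      smult = (\<lambda>a X. \<Union>x\<in>X. N +>\<^bsub>M\<^esub> (a \<odot>\<^bsub>M\<^esub> x))\<rparr>"

definition gen_submodule ::
  "('r, 'x) ring_scheme \<Rightarrow> ('r, 'm, 'y) module_scheme \<Rightarrow> 'm set \<Rightarrow> 'm set" where
  "gen_submodule R M X = \<Inter>{H. submodule H R M \<and> X \<subseteq> H}"

definition submodule_sum ::
  "('r, 'x) ring_scheme \<Rightarrow> ('r, 'm, 'y) module_scheme \<Rightarrow> 'i set \<Rightarrow> ('i \<Rightarrow> 'm set) \<Rightarrow> 'm set" where
  "submodule_sum R M \<Phi> A = gen_submodule R M (\<Union>i\<in>\<Phi>. A i)"

definition is_direct_sum ::
  "('r, 'x) ring_scheme \<Rightarrow> ('r, 'm, 'y) module_scheme \<Rightarrow> 'i set \<Rightarrow> ('i \<Rightarrow> 'm set) \<Rightarrow> 'm set \<Rightarrow> bool" where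
  "is_direct_sum R M \<Phi> A N \<longleftrightarrow>
     (\<forall>i\<in>\<Phi>. submodule (A i) R M) \<and>
     N = submodule_sum R M \<Phi> A \<and>
     (\<forall>J x. finite J \<and> J \<subseteq> \<Phi> \<and> (\<forall>i\<in>J. x i \<in> A i) \<and> (\<Oplus>\<^bsub>M\<^esub>i\<in>J. x i) = \<zero>\<^bsub>M\<^esub>
        \<longrightarrow> (\<forall>i\<in>J. x i = \<zero>\<^bsub>M\<^esub>))"

definition is_direct_sum2 ::
  "('r, 'x) ring_scheme \<Rightarrow> ('r, 'm, 'y) module_scheme \<Rightarrow> 'm set \<Rightarrow> 'm set \<Rightarrow> bool" where
  "is_direct_sum2 R M A B \<longleftrightarrow>
     submodule A R M \<and> submodule B R M \<and> A <+>\<^bsub>M\<^esub> B = carrier M \<and> A \<inter> B = {\<zero>\<^bsub>M\<^esub>}"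

definition simple_module :: "('r, 'x) ring_scheme \<Rightarrow> ('r, 'm, 'y) module_scheme \<Rightarrow> bool" where
  "simple_module R M \<longleftrightarrow>
     carrier M \<noteq> {\<zero>\<^bsub>M\<^esub>} \<and> (\<forall>H. submodule H R M \<longrightarrow> H = {\<zero>\<^bsub>M\<^esub>} \<or> H = carrier M)"

definition indecomposable_module :: "('r, 'x) ring_scheme \<Rightarrow> ('r, 'm, 'y) module_scheme \<Rightarrow> bool" where
  "indecomposable_module R M \<longleftrightarrow>
     carrier M \<noteq> {\<zero>\<^bsub>M\<^esub>} \<and>
     (\<forall>A B. is_direct_sum2 R M A B \<longrightarrow> A = {\<zero>\<^bsub>M\<^esub>} \<or> B = {\<zero>\<^bsub>M\<^esub>})"

text \<open>
  \<open>M \<otimes>\<^sub>R V\<close> for a left module \<open>M\<close> with a commuting right action \<open>ract\<close> of \<open>R\<close>: the free abelian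
  group on \<open>M \<times> V\<close> modulo the usual relations, with \<open>a \<cdot> (m \<otimes> v) = (a \<cdot> m) \<otimes> v\<close>.
\<close>

definition tensor_relations ::
  "('b, 'm, 'y) module_scheme \<Rightarrow> ('m \<Rightarrow> 'r \<Rightarrow> 'm) \<Rightarrow> ('r, 'x) ring_scheme \<Rightarrow> ('r, 'w, 'z) module_scheme
     \<Rightarrow> ('m \<times> 'w \<Rightarrow>\<^sub>0 int) set" where
  "tensor_relations M ract R V =
     {frag_of (m \<oplus>\<^bsub>M\<^esub> m', v) - frag_of (m, v) - frag_of (m', v) | m m' v.
        m \<in> carrier M \<and> m' \<in> carrier M \<and> v \<in> carrier V} \<union>
     {frag_of (m, v \<oplus>\<^bsub>V\<^esub> v') - frag_of (m, v) - frag_of (m, v') | m v v'.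
        m \<in> carrier M \<and> v \<in> carrier V \<and> v' \<in> carrier V} \<union>
     {frag_of (ract m r, v) - frag_of (m, r \<odot>\<^bsub>V\<^esub> v) | m r v.
        m \<in> carrier M \<and> r \<in> carrier R \<and> v \<in> carrier V}"

definition tensor_module ::
  "('b, 'm, 'y) module_scheme \<Rightarrow> ('m \<Rightarrow> 'r \<Rightarrow> 'm) \<Rightarrow> ('r, 'x) ring_scheme \<Rightarrow> ('r, 'w, 'z) module_scheme
     \<Rightarrow> ('b, ('m \<times> 'w \<Rightarrow>\<^sub>0 int) set) module" where
  "tensor_module M ract R V =
     (let F = free_Abelian_group (carrier M \<times> carrier V);
          K = generate F (tensor_relations M ract R V)
      in \<lparr>carrier = carrier (F Mod K), mult = undefined, one = undefined,
          zero = \<one>\<^bsub>F Mod K\<^esub>, add = (\<lambda>X Y. X \<otimes>\<^bsub>F Mod K\<^esub> Y),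
          smult = (\<lambda>a X. \<Union>t\<in>X. K #>\<^bsub>F\<^esub> frag_extend (\<lambda>(m, v). frag_of (a \<odot>\<^bsub>M\<^esub> m, v)) t)\<rparr>)"

section \<open>Laurent polynomials\<close>

text \<open>
  \<open>k[T, T\<^sup>-\<^sup>1]\<close> is the group algebra of \<open>\<int>\<close>, i.e. the type of finitely supported functions
  \<open>int \<Rightarrow>\<^sub>0 'k\<close> with its convolution product; \<open>T\<^sup>j\<close> is \<open>Poly_Mapping.single j 1\<close>.
\<close>

type_synonym 'k laurent = "int \<Rightarrow>\<^sub>0 'k"

definition laurent_ring :: "'k::field laurent ring" where
  "laurent_ring = \<lparr>carrier = UNIV, mult = (*), one = 1, zero = 0, add = (+)\<rparr>"

definition laurent_regular :: "('k::field laurent, 'k laurent) module" where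
  "laurent_regular =
     \<lparr>carrier = UNIV, mult = undefined, one = undefined, zero = 0, add = (+), smult = (*)\<rparr>"

definition laurent_of_poly :: "'k::field poly \<Rightarrow> 'k laurent" where
  "laurent_of_poly f = (\<Sum>i\<le>degree f. Poly_Mapping.single (int i) (coeff f i))"

definition laurent_quot :: "'k::field poly \<Rightarrow> ('k laurent, 'k laurent set) module" where
  "laurent_quot f = quot_module laurent_regular (PIdl\<^bsub>laurent_ring\<^esub> (laurent_of_poly f))"

section \<open>String algebras\<close>

text \<open>
  A quiver is a \<^locale>\<open>wf_digraph\<close> (loops and parallel arcs are allowed).  Paths are composed from
  right to left, so a path \<open>(v, [x\<^sub>1, \<dots>, x\<^sub>n], u)\<close> with head \<open>v\<close> and tail \<open>u\<close> is a library walk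
  after reversal; \<open>(v, [], v)\<close> is the trivial path at \<open>v\<close>.
\<close>

type_synonym ('v, 'a) qpath = "'v \<times> 'a list \<times> 'v"

definition qpaths :: "('v, 'a) pre_digraph \<Rightarrow> ('v, 'a) qpath set" where
  "qpaths Q = {(v, xs, u). pre_digraph.awalk Q u (rev xs) v}"

definition path_algebra :: "('v, 'a) pre_digraph \<Rightarrow> (('v, 'a) qpath \<Rightarrow>\<^sub>0 'k::field) ring" where
  "path_algebra Q =
     \<lparr>carrier = {f. Poly_Mapping.keys f \<subseteq> qpaths Q},
      mult = (\<lambda>f g. \<Sum>(v, xs, u)\<in>Poly_Mapping.keys f. \<Sum>(v', ys, u')\<in>Poly_Mapping.keys g.
        if u = v'
        then Poly_Mapping.single (v, xs @ ys, u')
               (Poly_Mapping.lookup f (v, xs, u) * Poly_Mapping.lookup g (v', ys, u'))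
        else 0),
      one = undefined, zero = 0, add = (+)\<rparr>"

text \<open>Zero relations have positive length, hence are given by their lists of arrows.\<close>

definition zero_relations :: "('v, 'a) pre_digraph \<Rightarrow> 'a list set \<Rightarrow> bool" where
  "zero_relations Q \<rho> \<longleftrightarrow> (\<forall>r\<in>\<rho>. 2 \<le> length r \<and> (\<exists>u v. pre_digraph.awalk Q u (rev r) v))"

definition relation_ideal ::
  "('v, 'a) pre_digraph \<Rightarrow> 'a list set \<Rightarrow> (('v, 'a) qpath \<Rightarrow>\<^sub>0 'k::field) set" where
  "relation_ideal Q \<rho> =
     \<Inter>{I. additive_subgroup I (path_algebra Q) \<and>
         (\<forall>a\<in>I. \<forall>x\<in>carrier (path_algebra Q).
            x \<otimes>\<^bsub>path_algebra Q\<^esub> a \<in> I \<and> a \<otimes>\<^bsub>path_algebra Q\<^esub> x \<in> I) \<and>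
         (\<forall>r\<in>\<rho>. Poly_Mapping.single (head Q (hd r), r, tail Q (last r)) 1 \<in> I)}"

type_synonym ('v, 'a, 'k) alg_elt = "(('v, 'a) qpath \<Rightarrow>\<^sub>0 'k) set"

definition \<Lambda> :: "('v, 'a) pre_digraph \<Rightarrow> 'a list set \<Rightarrow> ('v, 'a, 'k::field) alg_elt ring" where
  "\<Lambda> Q \<rho> = path_algebra Q Quot relation_ideal Q \<rho>"

definition residue ::
  "('v, 'a) pre_digraph \<Rightarrow> 'a list set \<Rightarrow> (('v, 'a) qpath \<Rightarrow>\<^sub>0 'k::field) \<Rightarrow> ('v, 'a, 'k) alg_elt" where
  "residue Q \<rho> f = relation_ideal Q \<rho> +>\<^bsub>path_algebra Q\<^esub> f"

locale string_algebra = wf_digraph Q for Q :: "('v, 'a) pre_digraph" and \<rho> :: "'a list set" +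
  assumes zero_rels: "zero_relations Q \<rho>"
    and two_in: "\<And>v. v \<in> verts Q \<Longrightarrow> finite (in_arcs Q v) \<and> card (in_arcs Q v) \<le> 2"
    and two_out: "\<And>v. v \<in> verts Q \<Longrightarrow> finite (out_arcs Q v) \<and> card (out_arcs Q v) \<le> 2"
    and left_unique:
      "\<And>x x' y. \<lbrakk>x \<in> arcs Q; x' \<in> arcs Q; y \<in> arcs Q; tail Q x = head Q y; tail Q x' = head Q y;
         [x, y] \<notin> \<rho>; [x', y] \<notin> \<rho>\<rbrakk> \<Longrightarrow> x = x'"
    and right_unique:
      "\<And>y z z'. \<lbrakk>y \<in> arcs Q; z \<in> arcs Q; z' \<in> arcs Q; tail Q y = head Q z; tail Q y = head Q z';
         [y, z] \<notin> \<rho>; [y, z'] \<notin> \<rho>\<rbrakk> \<Longrightarrow> z = z'"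

section \<open>Words\<close>

datatype 'a letter = Dir 'a | Inv 'a

fun letter_arrow :: "'a letter \<Rightarrow> 'a" where
  "letter_arrow (Dir x) = x"
| "letter_arrow (Inv x) = x"

fun letter_inv :: "'a letter \<Rightarrow> 'a letter" where
  "letter_inv (Dir x) = Inv x"
| "letter_inv (Inv x) = Dir x"

fun letter_head :: "('v, 'a) pre_digraph \<Rightarrow> 'a letter \<Rightarrow> 'v" where
  "letter_head Q (Dir x) = head Q x"
| "letter_head Q (Inv x) = tail Q x"

definition letter_tail :: "('v, 'a) pre_digraph \<Rightarrow> 'a letter \<Rightarrow> 'v" where
  "letter_tail Q l = letter_head Q (letter_inv l)"

text \<open>
  \<open>Letters L\<close> is the word whose \<open>i\<close>-th letter is \<open>L i\<close> for \<open>i \<in> dom L\<close>.  For an \<open>I\<close>-word,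
  \<open>dom L = {i \<in> I. i - 1 \<in> I}\<close>, and \<open>I \<noteq> {0}\<close> is recovered from it by \<open>word_index\<close>.  In
  \<open>Trivial v e\<close>, the sign \<open>e\<close> is \<open>1\<close> or \<open>-1\<close>.
\<close>

datatype ('v, 'a) word = Trivial 'v int | Letters "int \<Rightarrow> 'a letter option"

fun letters :: "('v, 'a) word \<Rightarrow> int \<Rightarrow> 'a letter option" where
  "letters (Trivial v e) = Map.empty"
| "letters (Letters L) = L"

fun word_index :: "('v, 'a) word \<Rightarrow> int set" where
  "word_index (Trivial v e) = {0}"
| "word_index (Letters L) = dom L \<union> (\<lambda>i. i - 1) ` dom L"

fun is_word :: "('v, 'a) pre_digraph \<Rightarrow> 'a list set \<Rightarrow> ('v, 'a) word \<Rightarrow> bool" where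
  "is_word Q \<rho> (Trivial v e) \<longleftrightarrow> v \<in> verts Q \<and> e \<in> {1, -1}"
| "is_word Q \<rho> (Letters L) \<longleftrightarrow>
     ((\<exists>n\<ge>1. dom L = {1..n}) \<or> dom L = {1..} \<or> dom L = {..0} \<or> dom L = UNIV) \<and>
     (\<forall>l\<in>ran L. letter_arrow l \<in> arcs Q) \<and>
     (\<forall>i l l'. L i = Some l \<and> L (i + 1) = Some l' \<longrightarrow>
        letter_tail Q l = letter_head Q l' \<and> letter_inv l \<noteq> l') \<and>
     (\<forall>r\<in>\<rho>. \<forall>i.
        \<not> (\<forall>j<length r. L (i + int j) = Some (Dir (r ! j))) \<and>
        \<not> (\<forall>j<length r. L (i + int j) = Some (Inv (rev r ! j))))"

definition finite_word :: "('v, 'a) word \<Rightarrow> bool" where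
  "finite_word C \<longleftrightarrow> finite (word_index C)"

definition word_length :: "('v, 'a) word \<Rightarrow> nat" where
  "word_length C = card (dom (letters C))"

fun word_vertex :: "('v, 'a) pre_digraph \<Rightarrow> ('v, 'a) word \<Rightarrow> int \<Rightarrow> 'v" where
  "word_vertex Q (Trivial v e) i = v"
| "word_vertex Q (Letters L) i =
     (case L (i + 1) of Some l \<Rightarrow> letter_head Q l | None \<Rightarrow> letter_tail Q (the (L i)))"

definition word_head :: "('v, 'a) pre_digraph \<Rightarrow> ('v, 'a) word \<Rightarrow> 'v" where
  "word_head Q C = word_vertex Q C 0"

definition word_tail :: "('v, 'a) pre_digraph \<Rightarrow> ('v, 'a) word \<Rightarrow> 'v" where
  "word_tail Q C = word_vertex Q C (if finite_word C then int (word_length C) else 0)"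

fun word_inv :: "('v, 'a) word \<Rightarrow> ('v, 'a) word" where
  "word_inv (Trivial v e) = Trivial v (- e)"
| "word_inv (Letters L) =
     Letters (\<lambda>i. map_option letter_inv (L ((if finite (dom L) then int (card (dom L)) else 0) + 1 - i)))"

definition direct_word :: "('v, 'a) word \<Rightarrow> bool" where
  "direct_word C \<longleftrightarrow> (\<forall>l\<in>ran (letters C). \<exists>x. l = Dir x)"

definition shift_word :: "('v, 'a) word \<Rightarrow> int \<Rightarrow> ('v, 'a) word" where
  "shift_word C n = Letters (\<lambda>i. letters C (i + n))"

definition periodic_word :: "('v, 'a) pre_digraph \<Rightarrow> 'a list set \<Rightarrow> ('v, 'a) word \<Rightarrow> bool" where
  "periodic_word Q \<rho> C \<longleftrightarrow>
     is_word Q \<rho> C \<and> word_index C = UNIV \<and> (\<exists>n::nat. 0 < n \<and> C = shift_word C (int n))"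

definition period :: "('v, 'a) word \<Rightarrow> nat" where
  "period C = (LEAST n. 0 < n \<and> C = shift_word C (int n))"

text \<open>\<open>E\<^sup>\<infinity>\<close> and \<open>\<^sup>\<infinity>E\<^sup>\<infinity>\<close> are only meaningful for a non-trivial finite word \<open>E\<close>.\<close>

definition power_inf :: "('v, 'a) word \<Rightarrow> ('v, 'a) word" where
  "power_inf E =
     Letters (\<lambda>i. if 1 \<le> i then letters E ((i - 1) mod int (word_length E) + 1) else None)"

definition power_biinf :: "('v, 'a) word \<Rightarrow> ('v, 'a) word" where
  "power_biinf E = Letters (\<lambda>i. letters E ((i - 1) mod int (word_length E) + 1))"

subsection \<open>Signs and composition\<close>

definition sign_choice ::
  "('v, 'a) pre_digraph \<Rightarrow> 'a list set \<Rightarrow> ('a letter \<Rightarrow> int) \<Rightarrow> bool" where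
  "sign_choice Q \<rho> \<sigma> \<longleftrightarrow>
     (\<forall>l. letter_arrow l \<in> arcs Q \<longrightarrow> \<sigma> l \<in> {1, -1}) \<and>
     (\<forall>l l'. letter_arrow l \<in> arcs Q \<and> letter_arrow l' \<in> arcs Q \<and> l \<noteq> l' \<and>
        letter_head Q l = letter_head Q l' \<and> \<sigma> l = \<sigma> l' \<longrightarrow>
        (\<exists>x y. [x, y] \<in> \<rho> \<and> {l, l'} = {Inv x, Dir y}))"

fun word_sign :: "('a letter \<Rightarrow> int) \<Rightarrow> ('v, 'a) word \<Rightarrow> int" where
  "word_sign \<sigma> (Trivial v e) = e"
| "word_sign \<sigma> (Letters L) = \<sigma> (the (L 1))"

text \<open>The first factor is assumed finite; this is the only case in which peaks need composition.\<close>

fun word_concat :: "('v, 'a) word \<Rightarrow> ('v, 'a) word \<Rightarrow> ('v, 'a) word" where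
  "word_concat (Trivial v e) D = D"
| "word_concat C (Trivial v e) = C"
| "word_concat (Letters L) (Letters L') =
     Letters (\<lambda>i. if i \<le> int (card (dom L)) then L i else L' (i - int (card (dom L))))"

definition composable ::
  "('v, 'a) pre_digraph \<Rightarrow> 'a list set \<Rightarrow> ('a letter \<Rightarrow> int) \<Rightarrow> ('v, 'a) word \<Rightarrow> ('v, 'a) word \<Rightarrow> bool" where
  "composable Q \<rho> \<sigma> C D \<longleftrightarrow>
     is_word Q \<rho> C \<and> finite_word C \<and> is_word Q \<rho> D \<and> word_index D \<subseteq> {0..} \<and>
     word_tail Q C = word_head Q D \<and>
     word_sign \<sigma> (word_inv C) = - word_sign \<sigma> D \<and>
     is_word Q \<rho> (word_concat C D)"

text \<open>
  \<open>C\<^sub>>\<^sub>i\<close> and \<open>C\<^sub>\<le>\<^sub>i\<close>.  At the ends of \<open>C\<close> these are trivial words, whose sign is fixed by requiring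
  that \<open>C\<^sub>>\<^sub>i\<close> and \<open>(C\<^sub>\<le>\<^sub>i)\<^sup>-\<^sup>1\<close> have opposite signs.  If \<open>I\<close> is bounded below then \<open>C\<^sub>\<le>\<^sub>i\<close> is finite with
  indices \<open>{0..i}\<close>, otherwise it is a \<open>-\<nat>\<close>-word; the two cases are told apart by \<open>0 \<in> dom L\<close>.
\<close>

fun word_gt :: "('v, 'a) pre_digraph \<Rightarrow> ('a letter \<Rightarrow> int) \<Rightarrow> ('v, 'a) word \<Rightarrow> int \<Rightarrow> ('v, 'a) word" where
  "word_gt Q \<sigma> (Trivial v e) i = Trivial v e"
| "word_gt Q \<sigma> (Letters L) i =
     (if L (i + 1) = None
      then Trivial (word_vertex Q (Letters L) i) (- \<sigma> (letter_inv (the (L i))))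
      else Letters (\<lambda>j. if 1 \<le> j then L (i + j) else None))"

fun word_le :: "('v, 'a) pre_digraph \<Rightarrow> ('a letter \<Rightarrow> int) \<Rightarrow> ('v, 'a) word \<Rightarrow> int \<Rightarrow> ('v, 'a) word" where
  "word_le Q \<sigma> (Trivial v e) i = Trivial v e"
| "word_le Q \<sigma> (Letters L) i =
     (if L i = None
      then Trivial (word_vertex Q (Letters L) i) (\<sigma> (the (L (i + 1))))
      else if L 0 = None
      then Letters (\<lambda>j. if j \<le> i then L j else None)
      else Letters (\<lambda>j. if j \<le> 0 then L (i + j) else None))"

definition word_side ::
  "('v, 'a) pre_digraph \<Rightarrow> ('a letter \<Rightarrow> int) \<Rightarrow> ('v, 'a) word \<Rightarrow> int \<Rightarrow> int \<Rightarrow> ('v, 'a) word" where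
  "word_side Q \<sigma> C i \<delta> =
     (if word_sign \<sigma> (word_gt Q \<sigma> C i) = \<delta> then word_gt Q \<sigma> C i else word_inv (word_le Q \<sigma> C i))"

subsection \<open>Primitive cycles and peaks\<close>

definition primitive_cycle :: "('v, 'a) pre_digraph \<Rightarrow> 'a list set \<Rightarrow> ('v, 'a) word \<Rightarrow> bool" where
  "primitive_cycle Q \<rho> P \<longleftrightarrow>
     is_word Q \<rho> P \<and> finite_word P \<and> 0 < word_length P \<and> direct_word P \<and>
     periodic_word Q \<rho> (power_biinf P) \<and> period (power_biinf P) = word_length P"

definition is_deep ::
  "('v, 'a) pre_digraph \<Rightarrow> ('a letter \<Rightarrow> int) \<Rightarrow> ('v, 'a) word \<Rightarrow> ('v, 'a) word \<Rightarrow> int \<Rightarrow> bool" where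
  "is_deep Q \<sigma> P C i \<longleftrightarrow>
     i \<in> word_index C \<and> word_side Q \<sigma> C i (- word_sign \<sigma> P) = power_inf (word_inv P)"

definition is_peak ::
  "('v, 'a) pre_digraph \<Rightarrow> 'a list set \<Rightarrow> ('a letter \<Rightarrow> int) \<Rightarrow> ('v, 'a) word \<Rightarrow> ('v, 'a) word \<Rightarrow> int \<Rightarrow> bool" where
  "is_peak Q \<rho> \<sigma> P C i \<longleftrightarrow>
     is_deep Q \<sigma> P C i \<and>
     \<not> (\<exists>D. composable Q \<rho> \<sigma> P D \<and> word_side Q \<sigma> C i (word_sign \<sigma> P) = word_concat P D)"

definition has_peak ::
  "('v, 'a) pre_digraph \<Rightarrow> 'a list set \<Rightarrow> ('a letter \<Rightarrow> int) \<Rightarrow> ('v, 'a) word \<Rightarrow> ('v, 'a) word \<Rightarrow> bool" where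
  "has_peak Q \<rho> \<sigma> P C \<longleftrightarrow> (\<exists>i. is_peak Q \<rho> \<sigma> P C i)"

section \<open>Modules over a string algebra\<close>

definition \<Lambda>_module ::
  "('v, 'a) pre_digraph \<Rightarrow> 'a list set \<Rightarrow> (('v, 'a, 'k::field) alg_elt, 'm) module \<Rightarrow> bool" where
  "\<Lambda>_module Q \<rho> M \<longleftrightarrow>
     left_module (\<Lambda> Q \<rho>) M \<and>
     generate (add_monoid M) {a \<odot>\<^bsub>M\<^esub> x | a x. a \<in> carrier (\<Lambda> Q \<rho>) \<and> x \<in> carrier M} = carrier M"

definition scaled_vertex ::
  "('v, 'a) pre_digraph \<Rightarrow> 'a list set \<Rightarrow> 'v \<Rightarrow> 'k::field \<Rightarrow> ('v, 'a, 'k) alg_elt" where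
  "scaled_vertex Q \<rho> v c = residue Q \<rho> (Poly_Mapping.single (v, [], v) c)"

text \<open>Since \<open>M\<close> is the direct sum of the \<open>e\<^sub>vM\<close>, only finitely many \<open>v\<close> contribute to these sums.\<close>

definition module_support ::
  "('v, 'a) pre_digraph \<Rightarrow> 'a list set \<Rightarrow> (('v, 'a, 'k::field) alg_elt, 'm) module \<Rightarrow> 'm \<Rightarrow> 'v set" where
  "module_support Q \<rho> M m = {v \<in> verts Q. scaled_vertex Q \<rho> v 1 \<odot>\<^bsub>M\<^esub> m \<noteq> \<zero>\<^bsub>M\<^esub>}"

definition scalar_act ::
  "('v, 'a) pre_digraph \<Rightarrow> 'a list set \<Rightarrow> (('v, 'a, 'k::field) alg_elt, 'm) module \<Rightarrow> 'k \<Rightarrow> 'm \<Rightarrow> 'm" where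
  "scalar_act Q \<rho> M c m = (\<Oplus>\<^bsub>M\<^esub>v\<in>module_support Q \<rho> M m. scaled_vertex Q \<rho> v c \<odot>\<^bsub>M\<^esub> m)"

text \<open>
  The sum is over a finite set, as at most two primitive cycles have head \<open>v\<close>; a cycle with arrows
  \<open>xs\<close> is, as a word, \<open>Letters\<close> of the direct letters in \<open>xs\<close>.
\<close>

definition z_elt ::
  "('v, 'a) pre_digraph \<Rightarrow> 'a list set \<Rightarrow> 'v \<Rightarrow> ('v, 'a, 'k::field) alg_elt" where
  "z_elt Q \<rho> v = residue Q \<rho>
     (\<Sum>xs | primitive_cycle Q \<rho>
               (Letters (\<lambda>i. if 1 \<le> i \<and> i \<le> int (length xs) then Some (Dir (xs ! nat (i - 1))) else None)
                  :: ('v, 'a) word) \<and> head Q (hd xs) = v.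
        Poly_Mapping.single (v, xs, v) 1)"

definition z_act ::
  "('v, 'a) pre_digraph \<Rightarrow> 'a list set \<Rightarrow> (('v, 'a, 'k::field) alg_elt, 'm) module \<Rightarrow> 'm \<Rightarrow> 'm" where
  "z_act Q \<rho> M m =
     (\<Oplus>\<^bsub>M\<^esub>v\<in>module_support Q \<rho> M m. z_elt Q \<rho> v \<odot>\<^bsub>M\<^esub> (scaled_vertex Q \<rho> v 1 \<odot>\<^bsub>M\<^esub> m))"

definition poly_act ::
  "('v, 'a) pre_digraph \<Rightarrow> 'a list set \<Rightarrow> (('v, 'a, 'k::field) alg_elt, 'm) module \<Rightarrow> 'k poly \<Rightarrow> 'm \<Rightarrow> 'm" where
  "poly_act Q \<rho> M f m =
     (\<Oplus>\<^bsub>M\<^esub>i\<in>{..degree f}. scalar_act Q \<rho> M (coeff f i) ((z_act Q \<rho> M ^^ i) m))"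

definition tau1 ::
  "('v, 'a) pre_digraph \<Rightarrow> 'a list set \<Rightarrow> (('v, 'a, 'k::field) alg_elt, 'm) module \<Rightarrow> 'm set" where
  "tau1 Q \<rho> M = {m \<in> carrier M. \<exists>f. poly f 0 = 1 \<and> poly_act Q \<rho> M f m = \<zero>\<^bsub>M\<^esub>}"

definition primitive_simple ::
  "('v, 'a) pre_digraph \<Rightarrow> 'a list set \<Rightarrow> (('v, 'a, 'k::field) alg_elt, 'm) module \<Rightarrow> bool" where
  "primitive_simple Q \<rho> M \<longleftrightarrow>
     \<Lambda>_module Q \<rho> M \<and> simple_module (\<Lambda> Q \<rho>) M \<and> carrier M = tau1 Q \<rho> M"

definition finitely_controlled ::
  "('v, 'a) pre_digraph \<Rightarrow> 'a list set \<Rightarrow> (('v, 'a, 'k::field) alg_elt, 'm) module \<Rightarrow> bool" where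
  "finitely_controlled Q \<rho> M \<longleftrightarrow>
     (\<forall>v\<in>verts Q. \<exists>B. finite B \<and> B \<subseteq> carrier M \<and>
        (\<lambda>m. scaled_vertex Q \<rho> v 1 \<odot>\<^bsub>M\<^esub> m) ` carrier M \<subseteq> gen_submodule (\<Lambda> Q \<rho>) M B)"

definition finite_dimensional ::
  "('v, 'a) pre_digraph \<Rightarrow> 'a list set \<Rightarrow> (('v, 'a, 'k::field) alg_elt, 'm) module \<Rightarrow> bool" where
  "finite_dimensional Q \<rho> M \<longleftrightarrow>
     (\<exists>B. finite B \<and> B \<subseteq> carrier M \<and>
        (\<forall>m\<in>carrier M. \<exists>c. m = (\<Oplus>\<^bsub>M\<^esub>b\<in>B. scalar_act Q \<rho> M (c b) b)))"

subsection \<open>String and band modules\<close>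

text \<open>
  \<open>M(C)\<close>, with basis \<open>b\<^sub>i\<close> (\<open>i \<in> I\<close>), consists of the elements of \<open>int \<Rightarrow>\<^sub>0 'k\<close> with support
  in \<open>I\<close>, with \<open>b\<^sub>i = Poly_Mapping.single i 1\<close>.  Paths, and then elements of the path algebra, act
  by composing and adding; an element of \<open>\<Lambda>\<close> acts as any of its representatives, since the zero
  relations annihilate the \<open>b\<^sub>i\<close> of a word.
\<close>

definition vertex_op ::
  "('v, 'a) pre_digraph \<Rightarrow> ('v, 'a) word \<Rightarrow> 'v \<Rightarrow> (int \<Rightarrow>\<^sub>0 'k::field) \<Rightarrow> (int \<Rightarrow>\<^sub>0 'k)" where
  "vertex_op Q C v m =
     (\<Sum>i\<in>Poly_Mapping.keys m.
        if word_vertex Q C i = v then Poly_Mapping.single i (Poly_Mapping.lookup m i) else 0)"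

definition arrow_op :: "('v, 'a) word \<Rightarrow> 'a \<Rightarrow> (int \<Rightarrow>\<^sub>0 'k::field) \<Rightarrow> (int \<Rightarrow>\<^sub>0 'k)" where
  "arrow_op C x m =
     (\<Sum>i\<in>Poly_Mapping.keys m.
        if letters C i = Some (Dir x) then Poly_Mapping.single (i - 1) (Poly_Mapping.lookup m i)
        else if letters C (i + 1) = Some (Inv x) then Poly_Mapping.single (i + 1) (Poly_Mapping.lookup m i)
        else 0)"

fun path_op ::
  "('v, 'a) pre_digraph \<Rightarrow> ('v, 'a) word \<Rightarrow> ('v, 'a) qpath \<Rightarrow> (int \<Rightarrow>\<^sub>0 'k::field) \<Rightarrow> (int \<Rightarrow>\<^sub>0 'k)" where
  "path_op Q C (v, xs, u) m = foldr (arrow_op C) xs (vertex_op Q C u m)"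

definition path_algebra_op ::
  "('v, 'a) pre_digraph \<Rightarrow> ('v, 'a) word \<Rightarrow> (('v, 'a) qpath \<Rightarrow>\<^sub>0 'k::field)
     \<Rightarrow> (int \<Rightarrow>\<^sub>0 'k) \<Rightarrow> (int \<Rightarrow>\<^sub>0 'k)" where
  "path_algebra_op Q C f m =
     (\<Sum>p\<in>Poly_Mapping.keys f. Poly_Mapping.map ((*) (Poly_Mapping.lookup f p)) (path_op Q C p m))"

definition word_module ::
  "('v, 'a) pre_digraph \<Rightarrow> ('v, 'a) word \<Rightarrow> (('v, 'a, 'k::field) alg_elt, int \<Rightarrow>\<^sub>0 'k) module" where
  "word_module Q C =
     \<lparr>carrier = {m. Poly_Mapping.keys m \<subseteq> word_index C}, mult = undefined, one = undefined,
      zero = 0, add = (+),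
      smult = (\<lambda>a m. the_elem ((\<lambda>f. path_algebra_op Q C f m) ` a))\<rparr>"

text \<open>The right action of \<open>k[T, T\<^sup>-\<^sup>1]\<close> on \<open>M(C)\<close> for \<open>C\<close> of period \<open>n\<close>, with \<open>b\<^sub>i T\<^sup>j = b\<^bsub>i - jn\<^esub>\<close>\<close>

definition word_ract :: "('v, 'a) word \<Rightarrow> (int \<Rightarrow>\<^sub>0 'k::field) \<Rightarrow> 'k laurent \<Rightarrow> (int \<Rightarrow>\<^sub>0 'k)" where
  "word_ract C m p =
     (\<Sum>i\<in>Poly_Mapping.keys m. \<Sum>j\<in>Poly_Mapping.keys p.
        Poly_Mapping.single (i - j * int (period C)) (Poly_Mapping.lookup m i * Poly_Mapping.lookup p j))"

definition band_module ::
  "('v, 'a) pre_digraph \<Rightarrow> ('v, 'a) word \<Rightarrow> ('k::field laurent, 'w) module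
     \<Rightarrow> (('v, 'a, 'k) alg_elt, ((int \<Rightarrow>\<^sub>0 'k) \<times> 'w \<Rightarrow>\<^sub>0 int) set) module" where
  "band_module Q C V = tensor_module (word_module Q C) (word_ract C) laurent_ring V"

definition is_string_module ::
  "('v, 'a) pre_digraph \<Rightarrow> 'a list set \<Rightarrow> (('v, 'a, 'k::field) alg_elt, 'm) module \<Rightarrow> bool" where
  "is_string_module Q \<rho> M \<longleftrightarrow>
     (\<exists>C. is_word Q \<rho> C \<and> \<not> periodic_word Q \<rho> C \<and> module_iso (\<Lambda> Q \<rho>) M (word_module Q C))"

text \<open>\<open>'w\<close> is the type of the elements of \<open>V\<close>.\<close>

definition is_band_module ::
  "'w itself \<Rightarrow> ('v, 'a) pre_digraph \<Rightarrow> 'a list set \<Rightarrow> (('v, 'a, 'k::field) alg_elt, 'm) module \<Rightarrow> bool" where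
  "is_band_module W Q \<rho> M \<longleftrightarrow>
     (\<exists>C (V :: ('k laurent, 'w) module).
        periodic_word Q \<rho> C \<and> module laurent_ring V \<and> indecomposable_module laurent_ring V \<and>
        module_iso (\<Lambda> Q \<rho>) M (band_module Q C V))"

end

theory Submission
  imports Defs
begin

text \<open>
  Let the cycle \<open>P\<close> start at \<open>v\<close>.  Since \<open>f(0) = 1\<close>, a generator of \<open>S\<close> lifts to some \<open>m \<in> PM\<close> outside
  \<open>N\<close> with \<open>f(P) m \<in> PN\<close>.  If \<open>f(P) m\<close> were \<open>f(P) u\<close> with \<open>u \<in> N\<close>, up to an element killed by some
  \<open>h(P)\<close> with \<open>h(0) = 1\<close>, then \<open>m\<close> would lie in \<open>N + \<tau>\<^sup>1(M) = N\<close>; hence already some component of \<open>f(P) m\<close>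
  in a summand \<open>N\<^sub>\<mu>\<close> is not of this form.  Elements killed by a nonzero polynomial in \<open>P\<close> are, so
  \<open>N\<^sub>\<mu>\<close> is infinite-dimensional, \<open>N\<^sub>\<mu> = M(C)\<close>, and the basis vectors killed by a power of \<open>P\<close> do not
  matter.  Every other basis vector involved lies on a ray that runs along \<open>P\<close> and issues near a peak \<open>i\<close>.
  Therefore the component is \<open>c(P) b\<^sub>i\<close>, where \<open>f\<close> does not divide \<open>c\<close>, modulo the span \<open>Y\<close> of the basis vectors off one
  such ray.  With \<open>r f + s c = 1\<close>, the map \<open>M(C) \<rightarrow> M\<close> that fixes \<open>Y\<close> and sends \<open>b\<^sub>i\<close> to
  \<open>r(P) b\<^sub>i + s(P) m\<close> embeds \<open>M(C)\<close> onto a complement of \<open>N'\<close>.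
\<close>

text \<open>The argument takes place in the image of P. With f = 1 + T g, a lift m1 of the generator
  equals f(P) m1 - P g(P) m1, so its class is also that of m = - P g(P) m1, which lies in PM. There
  z acts as P alone: any other primitive cycle at v first applies an arrow that annihilates the
  image of P. So relations h(P) x = 0 in PM with h(0) = 1 give elements of \<open>tau1\<close>. In
  M(C), the part of PM(C) on a ray consists of vectors h(P) b_i with h(0) = 0. The Bezout
  coefficients are normalised to r(0) = 1 and s(0) = 0. Then b goes to b + P u, and the correction
  b_i to P u extends to a homomorphism from M(C) to M vanishing on Y, because after an arrow of the
  cycle every arrow other than the next one acts as zero. A ray may run k < n letters past its peak;
  these positions are kept with it, as otherwise the remaining basis vectors need not span a
  submodule. Divisibility by f(P) is tested only up to factors h(P) with h(0) = 1; this condition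
  survives sums, which is what leads from f(P) m to one component.\<close>

section \<open>Finitely supported functions\<close>

text \<open>Addition may shrink the support, so all sums are first extended to the union of the
  supports, where the extra terms vanish. This is how operators defined as sums over
  \<open>Poly_Mapping.keys\<close> are shown to be additive.\<close>

lemma sum_keys_add:
  fixes g :: "'b \<Rightarrow> 'c::comm_monoid_add \<Rightarrow> 'd::comm_monoid_add"
  assumes zero: "\<And>i. g i 0 = 0" and add: "\<And>i a b. g i (a + b) = g i a + g i b"
  shows "(\<Sum>i\<in>Poly_Mapping.keys (x + y). g i (Poly_Mapping.lookup (x + y) i)) =
    (\<Sum>i\<in>Poly_Mapping.keys x. g i (Poly_Mapping.lookup x i)) +
    (\<Sum>i\<in>Poly_Mapping.keys y. g i (Poly_Mapping.lookup y i))"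
proof -
  let ?K = "Poly_Mapping.keys x \<union> Poly_Mapping.keys y"
  have ext: "(\<Sum>i\<in>Poly_Mapping.keys z. g i (Poly_Mapping.lookup z i)) = (\<Sum>i\<in>?K. g i (Poly_Mapping.lookup z i))"
    if "Poly_Mapping.keys z \<subseteq> ?K" for z
    using that by (intro sum.mono_neutral_left) (auto simp: in_keys_iff zero)
  have "(\<Sum>i\<in>Poly_Mapping.keys (x + y). g i (Poly_Mapping.lookup (x + y) i)) =
      (\<Sum>i\<in>?K. g i (Poly_Mapping.lookup (x + y) i))"
    by (rule ext) (rule Poly_Mapping.keys_add)
  also have "\<dots> = (\<Sum>i\<in>?K. g i (Poly_Mapping.lookup x i)) + (\<Sum>i\<in>?K. g i (Poly_Mapping.lookup y i))"
    by (simp add: lookup_add add sum.distrib)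
  finally show ?thesis
    using ext[of x] ext[of y] by simp
qed

lemma sum_keys_single:
  assumes "g i 0 = 0"
  shows "(\<Sum>j\<in>Poly_Mapping.keys (Poly_Mapping.single i c). g j (Poly_Mapping.lookup (Poly_Mapping.single i c) j)) = g i c"
  using assms by (cases "c = 0") auto

lemma poly_mapping_sum_single:
  fixes x :: "'b \<Rightarrow>\<^sub>0 'c::comm_monoid_add"
  shows
  "(\<Sum>i\<in>Poly_Mapping.keys x. Poly_Mapping.single i (Poly_Mapping.lookup x i)) = x"
  by (rule poly_mapping_eqI)
    (simp add: lookup_sum lookup_single when_def in_keys_iff sum.delta)

text \<open>Reduces an additive statement to single terms. In the single case the index lies in the
  support of \<open>x\<close>, so conditions on that support are available there; where the sum step
  needs them too, they are made part of \<open>P\<close>.\<close>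

lemma poly_mapping_single_induct [case_names zero single add]:
  fixes x :: "'b \<Rightarrow>\<^sub>0 'c::comm_monoid_add"
  assumes zero: "P 0" and single: "\<And>i c. i \<in> Poly_Mapping.keys x \<Longrightarrow> P (Poly_Mapping.single i c)"
    and add: "\<And>y z. P y \<Longrightarrow> P z \<Longrightarrow> P (y + z)"
  shows "P x"
proof -
  have "P (\<Sum>i\<in>I. Poly_Mapping.single i (Poly_Mapping.lookup x i))"
    if "finite I" "I \<subseteq> Poly_Mapping.keys x" for I
    using that by (induction I) (auto intro: assms)
  from this[of "Poly_Mapping.keys x"] show ?thesis
    by (simp add: poly_mapping_sum_single)
qed

section \<open>The path algebra\<close>

text \<open>Keeping the two coefficients as arguments makes a term of the path algebra product
  additive in each of them, which is the form that \<open>sum_keys_add\<close> requires.\<close>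

definition path_prod :: "('v, 'a) qpath \<Rightarrow> 'k \<Rightarrow> ('v, 'a) qpath \<Rightarrow> 'k \<Rightarrow> ('v, 'a) qpath \<Rightarrow>\<^sub>0 'k::field" where
  "path_prod p c q d = (case p of (v, xs, u) \<Rightarrow> case q of (v', ys, u') \<Rightarrow>
     if u = v' then Poly_Mapping.single (v, xs @ ys, u') (c * d) else 0)"

lemma path_prod_simps [simp]:
  "path_prod (v, xs, u) c (v', ys, u') d = (if u = v' then Poly_Mapping.single (v, xs @ ys, u') (c * d) else 0)"
  by (simp add: path_prod_def)

lemma path_prod_linear:
  "path_prod p 0 q d = 0" "path_prod p c q 0 = 0"
  "path_prod p (c + c') q d = path_prod p c q d + path_prod p c' q d"
  "path_prod p c q (d + d') = path_prod p c q d + path_prod p c q d'"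
  by (cases p; cases q; simp add: distrib_left distrib_right single_add)+

definition path_mult :: "(('v, 'a) qpath \<Rightarrow>\<^sub>0 'k) \<Rightarrow> (('v, 'a) qpath \<Rightarrow>\<^sub>0 'k) \<Rightarrow> ('v, 'a) qpath \<Rightarrow>\<^sub>0 'k::field" where
  "path_mult f g = (\<Sum>p\<in>Poly_Mapping.keys f. \<Sum>q\<in>Poly_Mapping.keys g.
     path_prod p (Poly_Mapping.lookup f p) q (Poly_Mapping.lookup g q))"

lemma path_mult_add_left: "path_mult (f + f') g = path_mult f g + path_mult f' g"
  unfolding path_mult_def
  by (rule sum_keys_add) (simp_all add: path_prod_linear sum.distrib)

lemma path_mult_add_right: "path_mult f (g + g') = path_mult f g + path_mult f g'"
  unfolding path_mult_def sum.distrib[symmetric]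
  by (rule sum.cong[OF refl], rule sum_keys_add) (simp_all add: path_prod_linear)

lemma path_mult_single [simp]:
  "path_mult (Poly_Mapping.single p c) (Poly_Mapping.single q d) = path_prod p c q d"
  unfolding path_mult_def
  by (cases "c = 0"; cases "d = 0") (simp_all add: path_prod_linear)

lemma path_mult_zero [simp]: "path_mult 0 g = 0" "path_mult f 0 = 0"
  by (simp_all add: path_mult_def)

lemma path_mult_diff_left: "path_mult (f - f') g = path_mult f g - path_mult f' g"
  using path_mult_add_left[of "f - f'" f' g] by (simp add: algebra_simps)

lemma path_mult_diff_right: "path_mult f (g - g') = path_mult f g - path_mult f g'"
  using path_mult_add_right[of f "g - g'" g'] by (simp add: algebra_simps)

lemma path_mult_assoc: "path_mult (path_mult f g) h = path_mult f (path_mult g h)"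
proof (induction f rule: poly_mapping_single_induct)
  case (single p c)
  show ?case
  proof (induction g rule: poly_mapping_single_induct)
    case (single q d)
    show ?case
    proof (induction h rule: poly_mapping_single_induct)
      case (single r e)
      show ?case by (cases p; cases q; cases r) (simp add: mult.assoc)
    qed (simp_all add: path_mult_add_right)
  qed (simp_all add: path_mult_add_left path_mult_add_right)
qed (simp_all add: path_mult_add_left)

lemma path_algebra_sel [simp]:
  "carrier (path_algebra Q) = {f. Poly_Mapping.keys f \<subseteq> qpaths Q}"
  "f \<otimes>\<^bsub>path_algebra Q\<^esub> g = path_mult f g"
  "f \<oplus>\<^bsub>path_algebra Q\<^esub> g = f + g"
  "\<zero>\<^bsub>path_algebra Q\<^esub> = 0"
  by (auto simp: path_algebra_def path_mult_def intro!: sum.cong)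

lemma abelian_group_path_algebra: "abelian_group (path_algebra Q :: (('v, 'a) qpath \<Rightarrow>\<^sub>0 'k::field) ring)"
proof (rule abelian_groupI)
  fix x assume "x \<in> carrier (path_algebra Q :: (('v, 'a) qpath \<Rightarrow>\<^sub>0 'k) ring)"
  then have "- x \<in> carrier (path_algebra Q)" "- x \<oplus>\<^bsub>path_algebra Q\<^esub> x = \<zero>\<^bsub>path_algebra Q\<^esub>"
    by simp_all
  then show "\<exists>y\<in>carrier (path_algebra Q). y \<oplus>\<^bsub>path_algebra Q\<^esub> x = \<zero>\<^bsub>path_algebra Q\<^esub>" by blast
qed (auto simp: ac_simps dest!: subsetD[OF Poly_Mapping.keys_add])

context wf_digraph
begin

lemma qpaths_Cons: "(v, x # xs, u) \<in> qpaths G \<longleftrightarrow> x \<in> arcs G \<and> v = head G x \<and> (tail G x, xs, u) \<in> qpaths G"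
  by (auto simp: qpaths_def awalk_simps)

lemma qpaths_Nil: "(v, [], u) \<in> qpaths G \<longleftrightarrow> v \<in> verts G \<and> v = u"
  by (auto simp: qpaths_def awalk_Nil_iff)

lemma qpaths_append:
  "(v, xs, u) \<in> qpaths G \<Longrightarrow> (u, ys, w) \<in> qpaths G \<Longrightarrow> (v, xs @ ys, w) \<in> qpaths G"
  by (auto simp: qpaths_def)

lemma qpaths_verts: "(v, xs, u) \<in> qpaths G \<Longrightarrow> v \<in> verts G \<and> u \<in> verts G"
  by (auto simp: qpaths_def)

lemma path_mult_closed:
  assumes "Poly_Mapping.keys f \<subseteq> qpaths G" "Poly_Mapping.keys g \<subseteq> qpaths G"
  shows "Poly_Mapping.keys (path_mult f g) \<subseteq> qpaths G"
proof -
  have "Poly_Mapping.keys (path_prod p c q d) \<subseteq> qpaths G"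
    if "p \<in> qpaths G" "q \<in> qpaths G" for p q and c d :: 'c
    using that by (cases p; cases q) (auto intro: qpaths_append)
  then show ?thesis
    using assms unfolding path_mult_def
    by (intro order.trans[OF keys_sum] UN_least) blast
qed

end

section \<open>The string algebra\<close>

lemma additive_subgroup_path_algebra_iff:
  fixes J :: "(('v, 'a) qpath \<Rightarrow>\<^sub>0 'k::field) set"
  shows "additive_subgroup J (path_algebra Q) \<longleftrightarrow>
    J \<subseteq> {f. Poly_Mapping.keys f \<subseteq> qpaths Q} \<and> 0 \<in> J \<and> (\<forall>f\<in>J. \<forall>g\<in>J. f - g \<in> J)"
proof -
  interpret abelian_group "path_algebra Q :: (('v, 'a) qpath \<Rightarrow>\<^sub>0 'k) ring"
    by (rule abelian_group_path_algebra)
  have inv: "\<ominus>\<^bsub>path_algebra Q\<^esub> f = - f" if "Poly_Mapping.keys f \<subseteq> qpaths Q" for f :: "('v, 'a) qpath \<Rightarrow>\<^sub>0 'k"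
    using that by (intro minus_equality) simp_all
  show ?thesis
  proof
    assume J: "additive_subgroup J (path_algebra Q)"
    then interpret additive_subgroup J "path_algebra Q" .
    have "f - g \<in> J" if "f \<in> J" "g \<in> J" for f g
    proof -
      have "Poly_Mapping.keys g \<subseteq> qpaths Q"
        using a_subset that(2) by (simp add: subset_iff)
      then show ?thesis
        using a_closed[OF that(1) a_inv_closed[OF that(2)]] by (simp add: inv)
    qed
    then show "J \<subseteq> {f. Poly_Mapping.keys f \<subseteq> qpaths Q} \<and> 0 \<in> J \<and> (\<forall>f\<in>J. \<forall>g\<in>J. f - g \<in> J)"
      using a_subset zero_closed by simp
  next
    assume J: "J \<subseteq> {f. Poly_Mapping.keys f \<subseteq> qpaths Q} \<and> 0 \<in> J \<and> (\<forall>f\<in>J. \<forall>g\<in>J. f - g \<in> J)"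
    then have neg: "- f \<in> J" if "f \<in> J" for f
      using that by (metis diff_0)
    have plus: "f + g \<in> J" if "f \<in> J" "g \<in> J" for f g
      using J that neg[of g] by (metis diff_minus_eq_add)
    show "additive_subgroup J (path_algebra Q)"
    proof (rule additive_subgroupI, rule add.subgroupI)
      fix a assume "a \<in> J"
      then show "\<ominus>\<^bsub>path_algebra Q\<^esub> a \<in> J"
        using inv[of a] neg[of a] J by auto
    qed (use J plus in auto)
  qed
qed

context string_algebra
begin

text \<open>\<open>zero_relations\<close> asserts only that some endpoints exist, whereas
  \<open>relation_ideal\<close> uses the head of the first arrow and the tail of the last; along a
  nonempty path the two choices agree.\<close>

lemma relation_path: "r \<in> \<rho> \<Longrightarrow> (head Q (hd r), r, tail Q (last r)) \<in> qpaths Q"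
  and relation_length: "r \<in> \<rho> \<Longrightarrow> 2 \<le> length r"
proof -
  assume r: "r \<in> \<rho>"
  then show len: "2 \<le> length r"
    using zero_rels by (auto simp: zero_relations_def)
  from r obtain u v where "(v, r, u) \<in> qpaths Q"
    using zero_rels by (auto simp: zero_relations_def qpaths_def)
  moreover have "v = head Q (hd r) \<and> u = tail Q (last r)" if "(v, r, u) \<in> qpaths Q" "r \<noteq> []" for v u and r :: "'a list"
    using that
  proof (induction r arbitrary: v)
    case (Cons x r)
    then show ?case by (cases "r = []") (auto simp: qpaths_Cons qpaths_Nil)
  qed simp
  moreover have "r \<noteq> []" using len by auto
  ultimately show "(head Q (hd r), r, tail Q (last r)) \<in> qpaths Q" by metis
qed

text \<open>The relation ideal is the least member of this family. A property is therefore proved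
  for all its elements by showing that the elements with that property form a member.\<close>

definition relation_ideals :: "(('v, 'a) qpath \<Rightarrow>\<^sub>0 'k::field) set set" where
  "relation_ideals = {J. J \<subseteq> {f. Poly_Mapping.keys f \<subseteq> qpaths Q} \<and> 0 \<in> J \<and> (\<forall>f\<in>J. \<forall>g\<in>J. f - g \<in> J) \<and>
    (\<forall>a\<in>J. \<forall>x. Poly_Mapping.keys x \<subseteq> qpaths Q \<longrightarrow> path_mult x a \<in> J \<and> path_mult a x \<in> J) \<and>
    (\<forall>r\<in>\<rho>. Poly_Mapping.single (head Q (hd r), r, tail Q (last r)) 1 \<in> J)}"

lemma relation_ideal_eq: "(relation_ideal Q \<rho> :: (('v, 'a) qpath \<Rightarrow>\<^sub>0 'k::field) set) = \<Inter>relation_ideals"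
  by (simp add: relation_ideal_def relation_ideals_def additive_subgroup_path_algebra_iff conj_assoc Ball_def)

lemma relation_ideal_minimal:
  "J \<in> relation_ideals \<Longrightarrow> relation_ideal Q \<rho> \<subseteq> J"
  by (auto simp: relation_ideal_eq)

lemma carrier_relation_ideals:
  "{f :: ('v, 'a) qpath \<Rightarrow>\<^sub>0 'k::field. Poly_Mapping.keys f \<subseteq> qpaths Q} \<in> relation_ideals"
proof -
  have "Poly_Mapping.keys (f - g) \<subseteq> qpaths Q"
    if "Poly_Mapping.keys f \<subseteq> qpaths Q" "Poly_Mapping.keys g \<subseteq> qpaths Q" for f g :: "('v, 'a) qpath \<Rightarrow>\<^sub>0 'k"
    using that keys_diff[of f g] by blast
  then show ?thesis
    by (simp add: relation_ideals_def path_mult_closed relation_path)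
qed

lemma relation_ideal_mem: "relation_ideal Q \<rho> \<in> relation_ideals"
  using relation_ideal_minimal[OF carrier_relation_ideals]
  unfolding relation_ideals_def relation_ideal_eq by simp

lemma relation_idealsD:
  assumes "J \<in> relation_ideals"
  shows "0 \<in> J"
    and "f \<in> J \<Longrightarrow> g \<in> J \<Longrightarrow> f - g \<in> J"
    and "f \<in> J \<Longrightarrow> Poly_Mapping.keys x \<subseteq> qpaths Q \<Longrightarrow> path_mult x f \<in> J"
    and "f \<in> J \<Longrightarrow> Poly_Mapping.keys x \<subseteq> qpaths Q \<Longrightarrow> path_mult f x \<in> J"
    and "r \<in> \<rho> \<Longrightarrow> Poly_Mapping.single (head Q (hd r), r, tail Q (last r)) 1 \<in> J"
    and "f \<in> J \<Longrightarrow> Poly_Mapping.keys f \<subseteq> qpaths Q"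
  using assms unfolding relation_ideals_def by blast+

lemmas relation_ideal_zero = relation_idealsD(1)[OF relation_ideal_mem]
  and relation_ideal_diff = relation_idealsD(2)[OF relation_ideal_mem]
  and relation_ideal_mult = relation_idealsD(3,4)[OF relation_ideal_mem]
  and relation_ideal_relation = relation_idealsD(5)[OF relation_ideal_mem]
  and relation_ideal_closed = relation_idealsD(6)[OF relation_ideal_mem]

lemma relation_ideal_add:
  "f \<in> relation_ideal Q \<rho> \<Longrightarrow> g \<in> relation_ideal Q \<rho> \<Longrightarrow> f + g \<in> relation_ideal Q \<rho>"
  using relation_ideal_diff[of f "0 - g"] relation_ideal_diff[OF relation_ideal_zero, of g] by simp

lemma residue_mem: "g \<in> residue Q \<rho> f \<longleftrightarrow> g - f \<in> relation_ideal Q \<rho>"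
  by (auto simp: residue_def a_r_coset_def r_coset_def path_algebra_def intro: bexI[of _ "g - f"])

lemma residue_self: "f \<in> residue Q \<rho> f"
  by (simp add: residue_mem relation_ideal_zero)

lemma residue_eq_iff: "residue Q \<rho> f = residue Q \<rho> g \<longleftrightarrow> f - g \<in> relation_ideal Q \<rho>"
proof
  assume "residue Q \<rho> f = residue Q \<rho> g"
  then show "f - g \<in> relation_ideal Q \<rho>"
    using residue_self[of f] by (simp add: residue_mem)
next
  assume fg: "f - g \<in> relation_ideal Q \<rho>"
  have "h - f \<in> relation_ideal Q \<rho> \<longleftrightarrow> h - g \<in> relation_ideal Q \<rho>" for h
    using relation_ideal_add[OF _ fg, of "h - f"] relation_ideal_diff[OF _ fg, of "h - g"] by auto
  then show "residue Q \<rho> f = residue Q \<rho> g"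
    by (auto simp: residue_mem)
qed

lemma carrier_\<Lambda>: "carrier (\<Lambda> Q \<rho>) = residue Q \<rho> ` {f. Poly_Mapping.keys f \<subseteq> qpaths Q}"
  unfolding \<Lambda>_def FactRing_def A_RCOSETS_def RCOSETS_def residue_def[abs_def] a_r_coset_def
  by (simp add: path_algebra_def UNION_singleton_eq_range)

lemma residue_closed: "Poly_Mapping.keys f \<subseteq> qpaths Q \<Longrightarrow> residue Q \<rho> f \<in> carrier (\<Lambda> Q \<rho>)"
  by (simp add: carrier_\<Lambda>)

lemma \<Lambda>_zero: "\<zero>\<^bsub>\<Lambda> Q \<rho>\<^esub> = residue Q \<rho> 0"
  by (simp add: \<Lambda>_def FactRing_def residue_mem set_eq_iff)

lemma \<Lambda>_add: "residue Q \<rho> f \<oplus>\<^bsub>\<Lambda> Q \<rho>\<^esub> residue Q \<rho> g = residue Q \<rho> (f + g)"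
proof -
  have "h \<in> residue Q \<rho> (f + g) \<longleftrightarrow> (\<exists>a\<in>residue Q \<rho> f. \<exists>b\<in>residue Q \<rho> g. h = a + b)" for h
  proof
    assume "h \<in> residue Q \<rho> (f + g)"
    then have hg: "h - g \<in> residue Q \<rho> f" by (simp add: residue_mem diff_diff_eq add.commute)
    show "\<exists>a\<in>residue Q \<rho> f. \<exists>b\<in>residue Q \<rho> g. h = a + b"
      by (intro bexI[OF _ hg] bexI[OF _ residue_self[of g]]) simp
  next
    assume "\<exists>a\<in>residue Q \<rho> f. \<exists>b\<in>residue Q \<rho> g. h = a + b"
    then obtain a b where "a - f \<in> relation_ideal Q \<rho>" "b - g \<in> relation_ideal Q \<rho>" "h = a + b"
      by (auto simp: residue_mem)
    then show "h \<in> residue Q \<rho> (f + g)"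
      using relation_ideal_add[of "a - f" "b - g"] by (simp add: residue_mem add_diff_add)
  qed
  then show ?thesis
    unfolding \<Lambda>_def FactRing_def set_add_def set_mult_def by (simp add: set_eq_iff)
qed

text \<open>The product of cosets is defined as a union over all pairs of representatives. Since ab
  - fg = (a - f) b + f (b - g) lies in the ideal, every pair contributes the same coset.\<close>

lemma \<Lambda>_mult:
  assumes "Poly_Mapping.keys f \<subseteq> qpaths Q" "Poly_Mapping.keys g \<subseteq> qpaths Q"
  shows "residue Q \<rho> f \<otimes>\<^bsub>\<Lambda> Q \<rho>\<^esub> residue Q \<rho> g = residue Q \<rho> (path_mult f g)"
proof -
  have "residue Q \<rho> (path_mult a b) = residue Q \<rho> (path_mult f g)"
    if "a \<in> residue Q \<rho> f" "b \<in> residue Q \<rho> g" for a b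
  proof -
    have ab: "a - f \<in> relation_ideal Q \<rho>" "b - g \<in> relation_ideal Q \<rho>"
      using that by (simp_all add: residue_mem)
    have "Poly_Mapping.keys ((b - g) + g) \<subseteq> qpaths Q"
      using Poly_Mapping.keys_add[of "b - g" g] relation_ideal_closed[OF ab(2)] assms by blast
    then have "path_mult (a - f) b + path_mult f (b - g) \<in> relation_ideal Q \<rho>"
      using ab assms by (intro relation_ideal_add relation_ideal_mult(2)[of "a - f"] relation_ideal_mult(1)[of "b - g"]) simp_all
    then show ?thesis
      by (simp add: residue_eq_iff path_mult_diff_left path_mult_diff_right)
  qed
  then have "(\<Union>a\<in>residue Q \<rho> f. \<Union>b\<in>residue Q \<rho> g. residue Q \<rho> (path_mult a b)) =
      (\<Union>a\<in>residue Q \<rho> f. \<Union>b\<in>residue Q \<rho> g. residue Q \<rho> (path_mult f g))"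
    by (intro SUP_cong refl)
  also have "\<dots> = residue Q \<rho> (path_mult f g)"
    using residue_self[of f] residue_self[of g] by (intro equalityI UN_least subset_refl) blast
  finally have "rcoset_mult (path_algebra Q) (relation_ideal Q \<rho>) (residue Q \<rho> f) (residue Q \<rho> g) = residue Q \<rho> (path_mult f g)"
    by (simp add: rcoset_mult_def residue_def)
  then show ?thesis
    by (simp add: \<Lambda>_def FactRing_def)
qed

abbreviation vertex_elt :: "'v \<Rightarrow> 'k::field \<Rightarrow> ('v, 'a, 'k) alg_elt" where
  "vertex_elt \<equiv> scaled_vertex Q \<rho>"

definition arrow_elt :: "'a \<Rightarrow> ('v, 'a, 'k::field) alg_elt" where
  "arrow_elt x = residue Q \<rho> (Poly_Mapping.single (head Q x, [x], tail Q x) 1)"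

lemma single_keys: "p \<in> qpaths Q \<Longrightarrow> Poly_Mapping.keys (Poly_Mapping.single p c) \<subseteq> qpaths Q"
  by simp

lemma vertex_elt_closed: "v \<in> verts Q \<Longrightarrow> vertex_elt v c \<in> carrier (\<Lambda> Q \<rho>)"
  by (simp add: scaled_vertex_def residue_closed qpaths_Nil)

lemma arrow_path: "x \<in> arcs Q \<Longrightarrow> (head Q x, [x], tail Q x) \<in> qpaths Q"
  by (simp add: qpaths_Cons qpaths_Nil)

lemma arrow_elt_closed: "x \<in> arcs Q \<Longrightarrow> arrow_elt x \<in> carrier (\<Lambda> Q \<rho>)"
  by (simp add: arrow_elt_def residue_closed arrow_path)

text \<open>A path is the product of its arrows with a trivial path, and the coefficient can be put
  on that trivial path. Hence closure properties and compatibility of maps need to be checked only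
  for arrows and scaled vertices.\<close>

lemma \<Lambda>_induct [consumes 1, case_names zero vertex arrow mult add]:
  assumes a: "a \<in> carrier (\<Lambda> Q \<rho> :: ('v, 'a, 'k::field) alg_elt ring)"
    and zero: "P \<zero>\<^bsub>\<Lambda> Q \<rho>\<^esub>"
    and vertex: "\<And>v c. v \<in> verts Q \<Longrightarrow> P (vertex_elt v c)"
    and arrow: "\<And>x. x \<in> arcs Q \<Longrightarrow> P (arrow_elt x)"
    and mult: "\<And>a b. a \<in> carrier (\<Lambda> Q \<rho>) \<Longrightarrow> b \<in> carrier (\<Lambda> Q \<rho>) \<Longrightarrow> P a \<Longrightarrow> P b \<Longrightarrow> P (a \<otimes>\<^bsub>\<Lambda> Q \<rho>\<^esub> b)"
    and add: "\<And>a b. a \<in> carrier (\<Lambda> Q \<rho>) \<Longrightarrow> b \<in> carrier (\<Lambda> Q \<rho>) \<Longrightarrow> P a \<Longrightarrow> P b \<Longrightarrow> P (a \<oplus>\<^bsub>\<Lambda> Q \<rho>\<^esub> b)"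
  shows "P a"
proof -
  have path: "P (residue Q \<rho> (Poly_Mapping.single (v, xs, u) (c :: 'k)))" if "(v, xs, u) \<in> qpaths Q" for v xs u c
    using that
  proof (induction xs arbitrary: v)
    case Nil
    then have "v \<in> verts Q" "v = u" unfolding qpaths_Nil by blast+
    then show ?case using vertex[of v c] by (simp add: scaled_vertex_def)
  next
    case (Cons x xs)
    then have x: "x \<in> arcs Q" "v = head Q x" "(tail Q x, xs, u) \<in> qpaths Q"
      by (simp_all add: qpaths_Cons)
    have "arrow_elt x \<otimes>\<^bsub>\<Lambda> Q \<rho>\<^esub> residue Q \<rho> (Poly_Mapping.single (tail Q x, xs, u) c) =
        residue Q \<rho> (Poly_Mapping.single (v, x # xs, u) c)"
      using x by (simp add: arrow_elt_def \<Lambda>_mult single_keys arrow_path)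
    then show ?case
      using mult[OF arrow_elt_closed[OF x(1)] residue_closed[OF single_keys[OF x(3)]] arrow[OF x(1)] Cons.IH[OF x(3)]]
      by simp
  qed
  from a obtain f where f: "Poly_Mapping.keys f \<subseteq> qpaths Q" "a = residue Q \<rho> f"
    by (auto simp: carrier_\<Lambda>)
  have "Poly_Mapping.keys f \<subseteq> qpaths Q \<and> P (residue Q \<rho> f)"
  proof (induction rule: poly_mapping_single_induct[where x = f])
    case zero
    then show ?case using assms(2) by (simp add: \<Lambda>_zero)
  next
    case (single p c)
    obtain v xs u where "p = (v, xs, u)" by (cases p)
    moreover have "p \<in> qpaths Q" using f(1) single by (rule subsetD)
    ultimately show ?case using path[of v xs u c] by (simp add: single_keys)
  next
    case (add f g)
    have "Poly_Mapping.keys (f + g) \<subseteq> qpaths Q"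
      using add by (intro order.trans[OF Poly_Mapping.keys_add] Un_least) (simp_all only: simp_thms)
    moreover have "P (residue Q \<rho> f \<oplus>\<^bsub>\<Lambda> Q \<rho>\<^esub> residue Q \<rho> g)"
      using add by (intro assms(6) residue_closed) (simp_all only: simp_thms)
    ultimately show ?case by (simp add: \<Lambda>_add)
  qed
  then show ?thesis using f by simp
qed

lemma vertex_elt_add: "vertex_elt v (c + d) = vertex_elt v c \<oplus>\<^bsub>\<Lambda> Q \<rho>\<^esub> vertex_elt v d"
  by (simp add: scaled_vertex_def \<Lambda>_add single_add)

lemma vertex_elt_zero: "vertex_elt v 0 = \<zero>\<^bsub>\<Lambda> Q \<rho>\<^esub>"
  by (simp add: scaled_vertex_def \<Lambda>_zero)

lemma vertex_elt_mult:
  "v \<in> verts Q \<Longrightarrow> w \<in> verts Q \<Longrightarrow>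
    vertex_elt v c \<otimes>\<^bsub>\<Lambda> Q \<rho>\<^esub> vertex_elt w d = (if v = w then vertex_elt v (c * d) else \<zero>\<^bsub>\<Lambda> Q \<rho>\<^esub>)"
  by (simp add: scaled_vertex_def \<Lambda>_mult single_keys qpaths_Nil \<Lambda>_zero)

definition path_elt :: "'v \<Rightarrow> 'a list \<Rightarrow> 'v \<Rightarrow> ('v, 'a, 'k::field) alg_elt" where
  "path_elt v xs u = residue Q \<rho> (Poly_Mapping.single (v, xs, u) 1)"

lemma path_elt_closed: "(v, xs, u) \<in> qpaths Q \<Longrightarrow> path_elt v xs u \<in> carrier (\<Lambda> Q \<rho>)"
  by (simp add: path_elt_def residue_closed)

lemma path_elt_arrow: "path_elt (head Q x) [x] (tail Q x) = arrow_elt x"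
  by (simp add: path_elt_def arrow_elt_def)

lemma path_elt_mult:
  "(v, xs, u) \<in> qpaths Q \<Longrightarrow> (u, ys, w) \<in> qpaths Q \<Longrightarrow>
    path_elt v xs u \<otimes>\<^bsub>\<Lambda> Q \<rho>\<^esub> path_elt u ys w = path_elt v (xs @ ys) w"
  by (simp add: path_elt_def \<Lambda>_mult single_keys)

lemma vertex_elt_path_elt:
  "(v, xs, u) \<in> qpaths Q \<Longrightarrow> w \<in> verts Q \<Longrightarrow>
    vertex_elt w 1 \<otimes>\<^bsub>\<Lambda> Q \<rho>\<^esub> path_elt v xs u = (if w = v then path_elt v xs u else \<zero>\<^bsub>\<Lambda> Q \<rho>\<^esub>)"
  by (simp add: path_elt_def \<Lambda>_mult single_keys scaled_vertex_def qpaths_Nil \<Lambda>_zero)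

lemma vertex_elt_path_elt_commute:
  "(v, xs, u) \<in> qpaths Q \<Longrightarrow>
    vertex_elt v c \<otimes>\<^bsub>\<Lambda> Q \<rho>\<^esub> path_elt v xs u = path_elt v xs u \<otimes>\<^bsub>\<Lambda> Q \<rho>\<^esub> vertex_elt u c"
  using qpaths_verts[of v xs u]
  by (simp add: path_elt_def \<Lambda>_mult single_keys scaled_vertex_def qpaths_Nil)

lemma path_elt_vertex_elt:
  "(v, xs, u) \<in> qpaths Q \<Longrightarrow> w \<in> verts Q \<Longrightarrow>
    path_elt v xs u \<otimes>\<^bsub>\<Lambda> Q \<rho>\<^esub> vertex_elt w 1 = (if w = u then path_elt v xs u else \<zero>\<^bsub>\<Lambda> Q \<rho>\<^esub>)"
  by (simp add: path_elt_def \<Lambda>_mult single_keys scaled_vertex_def qpaths_Nil \<Lambda>_zero)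

lemma path_elt_relation:
  assumes "r \<in> \<rho>" shows "path_elt (head Q (hd r)) r (tail Q (last r)) = \<zero>\<^bsub>\<Lambda> Q \<rho>\<^esub>"
  using relation_ideal_relation[OF assms] by (simp add: path_elt_def \<Lambda>_zero residue_eq_iff)

text \<open>There are two reasons for the product to vanish, and the hypothesis covers both: the
  arrows do not compose, or their composite is a zero relation.\<close>

lemma arrow_elt_mult_relation:
  assumes "x \<in> arcs Q" "y \<in> arcs Q" "tail Q x = head Q y \<Longrightarrow> [x, y] \<in> \<rho>"
  shows "arrow_elt x \<otimes>\<^bsub>\<Lambda> Q \<rho>\<^esub> arrow_elt y = (\<zero>\<^bsub>\<Lambda> Q \<rho>\<^esub> :: ('v, 'a, 'k::field) alg_elt)"
proof (cases "tail Q x = head Q y")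
  case True
  have "(arrow_elt x \<otimes>\<^bsub>\<Lambda> Q \<rho>\<^esub> arrow_elt y :: ('v, 'a, 'k) alg_elt) = path_elt (head Q x) [x, y] (tail Q y)"
    using True assms arrow_path[of x] arrow_path[of y]
    by (simp add: path_elt_def \<Lambda>_mult single_keys arrow_elt_def)
  also have "\<dots> = \<zero>\<^bsub>\<Lambda> Q \<rho>\<^esub>"
    using path_elt_relation[OF assms(3)[OF True]] by simp
  finally show ?thesis .
next
  case False
  then show ?thesis
    using assms by (simp add: \<Lambda>_mult single_keys arrow_elt_def arrow_path \<Lambda>_zero)
qed

end

section \<open>Linear maps and isomorphisms\<close>

definition linear_on ::
  "('r, 'x) ring_scheme \<Rightarrow> ('r, 'm, 'y) module_scheme \<Rightarrow> ('r, 'n, 'z) module_scheme \<Rightarrow> ('m \<Rightarrow> 'n) \<Rightarrow> bool" where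
  "linear_on R M N h \<longleftrightarrow>
     (\<forall>x\<in>carrier M. h x \<in> carrier N) \<and>
     (\<forall>x\<in>carrier M. \<forall>y\<in>carrier M. h (x \<oplus>\<^bsub>M\<^esub> y) = h x \<oplus>\<^bsub>N\<^esub> h y) \<and>
     (\<forall>a\<in>carrier R. \<forall>x\<in>carrier M. h (a \<odot>\<^bsub>M\<^esub> x) = a \<odot>\<^bsub>N\<^esub> h x)"

lemma linear_onD:
  assumes "linear_on R M N h"
  shows "x \<in> carrier M \<Longrightarrow> h x \<in> carrier N"
    and "x \<in> carrier M \<Longrightarrow> y \<in> carrier M \<Longrightarrow> h (x \<oplus>\<^bsub>M\<^esub> y) = h x \<oplus>\<^bsub>N\<^esub> h y"
    and "a \<in> carrier R \<Longrightarrow> x \<in> carrier M \<Longrightarrow> h (a \<odot>\<^bsub>M\<^esub> x) = a \<odot>\<^bsub>N\<^esub> h x"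
  using assms by (auto simp: linear_on_def)

lemma linear_on_zero:
  assumes "linear_on R M N h" "abelian_group M" "abelian_group N"
  shows "h \<zero>\<^bsub>M\<^esub> = \<zero>\<^bsub>N\<^esub>"
proof -
  interpret M: abelian_group M by fact
  interpret N: abelian_group N by fact
  have "h \<zero>\<^bsub>M\<^esub> \<oplus>\<^bsub>N\<^esub> h \<zero>\<^bsub>M\<^esub> = h \<zero>\<^bsub>M\<^esub>"
    using linear_onD(2)[OF assms(1), of "\<zero>\<^bsub>M\<^esub>" "\<zero>\<^bsub>M\<^esub>"] by simp
  then show ?thesis
    using linear_onD(1)[OF assms(1), of "\<zero>\<^bsub>M\<^esub>"] by (simp add: N.add.l_cancel_one)
qed

lemma module_iso_linear:
  "module_iso R M N \<longleftrightarrow> (\<exists>h. bij_betw h (carrier M) (carrier N) \<and> linear_on R M N h)"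
  unfolding module_iso_def linear_on_def by (auto simp: bij_betw_def)

lemma (in left_module) linear_on_inv:
  assumes bij: "bij_betw h (carrier M) (carrier N)" and lin: "linear_on R M N h"
  shows "linear_on R N M (inv_into (carrier M) h)"
proof -
  let ?g = "inv_into (carrier M) h"
  have g: "?g y \<in> carrier M" "h (?g y) = y" if "y \<in> carrier N" for y
    using bij that by (auto simp: bij_betw_def inv_into_into f_inv_into_f)
  have gh: "?g (h x) = x" if "x \<in> carrier M" for x
    using bij that by (auto simp: bij_betw_def)
  have "?g (y \<oplus>\<^bsub>N\<^esub> z) = ?g y \<oplus>\<^bsub>M\<^esub> ?g z" if "y \<in> carrier N" "z \<in> carrier N" for y z
    using linear_onD(2)[OF lin g(1)[OF that(1)] g(1)[OF that(2)]] gh[of "?g y \<oplus>\<^bsub>M\<^esub> ?g z"] g that by simp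
  moreover have "?g (a \<odot>\<^bsub>N\<^esub> y) = a \<odot>\<^bsub>M\<^esub> ?g y" if "a \<in> carrier R" "y \<in> carrier N" for a y
    using linear_onD(3)[OF lin that(1) g(1)[OF that(2)]] gh[of "a \<odot>\<^bsub>M\<^esub> ?g y"] g that by (simp add: smult_closed)
  ultimately show ?thesis
    using g by (simp add: linear_on_def)
qed

lemma module_iso_sym:
  assumes "left_module R M" "module_iso R M N"
  shows "module_iso R N M"
  using assms left_module.linear_on_inv[OF assms(1)] bij_betw_inv_into unfolding module_iso_linear by blast

lemma module_iso_trans:
  assumes "module_iso R L M" "module_iso R M N"
  shows "module_iso R L N"
proof -
  obtain g h where "bij_betw g (carrier L) (carrier M)" "linear_on R L M g"
    "bij_betw h (carrier M) (carrier N)" "linear_on R M N h"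
    using assms by (auto simp: module_iso_linear)
  then have "bij_betw (h \<circ> g) (carrier L) (carrier N)" "linear_on R L N (h \<circ> g)"
    by (auto simp: linear_on_def intro: bij_betw_trans)
  then show ?thesis by (auto simp: module_iso_linear)
qed

section \<open>Polynomials in a cycle\<close>

text \<open>The polynomial evaluated at the cycle \<open>xs\<close> in the corner at
  \<open>v\<close>: the power with exponent 0 is the trivial path at \<open>v\<close>, which takes
  the place of the identity.\<close>

definition path_poly :: "'v \<Rightarrow> 'a list \<Rightarrow> 'k poly \<Rightarrow> ('v, 'a) qpath \<Rightarrow>\<^sub>0 'k::field" where
  "path_poly v xs p = (\<Sum>i\<le>degree p. Poly_Mapping.single (v, concat (replicate i xs), v) (coeff p i))"

lemma path_poly_eq:
  "degree p \<le> n \<Longrightarrow> path_poly v xs p = (\<Sum>i\<le>n. Poly_Mapping.single (v, concat (replicate i xs), v) (coeff p i))"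
  unfolding path_poly_def by (intro sum.mono_neutral_left) (auto simp: coeff_eq_0)

lemma path_poly_add: "path_poly v xs (p + q) = path_poly v xs p + path_poly v xs q"
proof -
  let ?n = "max (degree p) (degree q)"
  have "path_poly v xs (p + q) = (\<Sum>i\<le>?n. Poly_Mapping.single (v, concat (replicate i xs), v) (coeff (p + q) i))"
    by (rule path_poly_eq) (rule degree_add_le_max)
  then show ?thesis
    by (simp add: path_poly_eq[of p ?n] path_poly_eq[of q ?n] single_add sum.distrib)
qed

lemma path_mult_sum_right: "path_mult f (sum g I) = (\<Sum>i\<in>I. path_mult f (g i))"
  by (induction I rule: infinite_finite_induct) (simp_all add: path_mult_add_right)

lemma path_poly_smult: "path_poly v xs (Polynomial.smult a p) = path_mult (Poly_Mapping.single (v, [], v) a) (path_poly v xs p)"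
  by (simp add: path_poly_eq[OF degree_smult_le] path_poly_def path_mult_sum_right)

text \<open>Horner's rule. It drives the inductions on polynomials, and it is what turns a constant
  term 1 into a copy of the vector itself plus a vector in the image of the cycle.\<close>

lemma path_poly_pCons:
  "path_poly v xs (pCons a p) = Poly_Mapping.single (v, [], v) a + path_mult (Poly_Mapping.single (v, xs, v) 1) (path_poly v xs p)"
proof -
  have "path_poly v xs (pCons a p) =
      (\<Sum>i\<le>Suc (degree p). Poly_Mapping.single (v, concat (replicate i xs), v) (coeff (pCons a p) i))"
    by (rule path_poly_eq) (rule degree_pCons_le)
  then show ?thesis
    by (simp add: sum.atMost_Suc_shift path_poly_def path_mult_sum_right del: sum.atMost_Suc)
qed

lemma path_poly_zero [simp]: "path_poly v xs 0 = 0"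
  by (simp add: path_poly_def)

lemma path_poly_mult: "path_poly v xs (p * q) = path_mult (path_poly v xs p) (path_poly v xs q)"
  by (induction p)
    (simp_all add: path_poly_add path_poly_smult path_poly_pCons path_mult_add_left path_mult_assoc)

context string_algebra
begin

lemma path_poly_closed:
  assumes "(v, xs, v) \<in> qpaths Q"
  shows "Poly_Mapping.keys (path_poly v xs p) \<subseteq> qpaths Q"
proof -
  have "(v, concat (replicate i xs), v) \<in> qpaths Q" for i
    using assms qpaths_verts[OF assms] by (induction i) (simp_all add: qpaths_Nil qpaths_append)
  then show ?thesis
    unfolding path_poly_def by (intro order.trans[OF keys_sum] UN_least) simp
qed

definition poly_elt :: "'v \<Rightarrow> 'a list \<Rightarrow> 'k poly \<Rightarrow> ('v, 'a, 'k::field) alg_elt" where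
  "poly_elt v xs p = residue Q \<rho> (path_poly v xs p)"

lemma poly_elt_closed: "(v, xs, v) \<in> qpaths Q \<Longrightarrow> poly_elt v xs p \<in> carrier (\<Lambda> Q \<rho>)"
  by (simp add: poly_elt_def residue_closed path_poly_closed)

lemma poly_elt_add: "poly_elt v xs (p + q) = poly_elt v xs p \<oplus>\<^bsub>\<Lambda> Q \<rho>\<^esub> poly_elt v xs q"
  by (simp add: poly_elt_def path_poly_add \<Lambda>_add)

lemma poly_elt_mult:
  "(v, xs, v) \<in> qpaths Q \<Longrightarrow> poly_elt v xs (p * q) = poly_elt v xs p \<otimes>\<^bsub>\<Lambda> Q \<rho>\<^esub> poly_elt v xs q"
  by (simp add: poly_elt_def path_poly_mult \<Lambda>_mult path_poly_closed)

lemma poly_elt_const: "poly_elt v xs [:c:] = vertex_elt v c"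
  by (simp add: poly_elt_def path_poly_pCons scaled_vertex_def)

lemma poly_elt_X: "poly_elt v xs [:0, 1:] = path_elt v xs v"
  by (simp add: poly_elt_def path_poly_pCons path_elt_def)

end

section \<open>Modules over the string algebra\<close>

locale algebra_module = string_algebra Q \<rho> + left_module "\<Lambda> Q \<rho>" M
  for Q :: "('v, 'a) pre_digraph" and \<rho> :: "'a list set"
    and M :: "(('v, 'a, 'k::field) alg_elt, 'm) module" (structure)
begin

lemmas act_closed [simp, intro] = smult_closed
lemmas act_add = smult_l_distr
lemmas act_mult = smult_assoc

lemma zero_closed_\<Lambda>: "(\<zero>\<^bsub>\<Lambda> Q \<rho>\<^esub> :: ('v, 'a, 'k) alg_elt) \<in> carrier (\<Lambda> Q \<rho>)"
  by (simp add: \<Lambda>_zero residue_closed)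

lemma zero_act [simp]: "x \<in> carrier M \<Longrightarrow> \<zero>\<^bsub>\<Lambda> Q \<rho>\<^esub> \<odot> x = \<zero>"
proof -
  assume x: "x \<in> carrier M"
  have "\<zero>\<^bsub>\<Lambda> Q \<rho>\<^esub> \<odot> x \<oplus> \<zero>\<^bsub>\<Lambda> Q \<rho>\<^esub> \<odot> x = (\<zero>\<^bsub>\<Lambda> Q \<rho>\<^esub> \<oplus>\<^bsub>\<Lambda> Q \<rho>\<^esub> \<zero>\<^bsub>\<Lambda> Q \<rho>\<^esub>) \<odot> x"
    using x zero_closed_\<Lambda> by (simp add: act_add)
  also have "\<dots> = \<zero>\<^bsub>\<Lambda> Q \<rho>\<^esub> \<odot> x"
    by (simp add: \<Lambda>_zero \<Lambda>_add)
  finally show ?thesis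
    using x zero_closed_\<Lambda> by (simp add: add.l_cancel_one)
qed

lemma act_zero [simp]: "a \<in> carrier (\<Lambda> Q \<rho>) \<Longrightarrow> a \<odot> \<zero> = \<zero>"
  using smult_r_distr[of a \<zero> \<zero>] by (simp add: add.l_cancel_one)

lemma act_neg: "a \<in> carrier (\<Lambda> Q \<rho>) \<Longrightarrow> x \<in> carrier M \<Longrightarrow> a \<odot> (\<ominus> x) = \<ominus> (a \<odot> x)"
  using smult_r_distr[of a "\<ominus> x" x] by (intro minus_equality[symmetric]) (simp_all add: l_neg)

lemma act_diff:
  "a \<in> carrier (\<Lambda> Q \<rho>) \<Longrightarrow> x \<in> carrier M \<Longrightarrow> y \<in> carrier M \<Longrightarrow> a \<odot> (x \<ominus> y) = a \<odot> x \<ominus> a \<odot> y"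
  by (simp add: a_minus_def smult_r_distr act_neg)

lemma act_finsum:
  assumes "a \<in> carrier (\<Lambda> Q \<rho>)" "\<And>i. i \<in> I \<Longrightarrow> g i \<in> carrier M"
  shows "a \<odot> (\<Oplus>i\<in>I. g i) = (\<Oplus>i\<in>I. a \<odot> g i)"
  using assms(2)
proof (induction I rule: infinite_finite_induct)
  case (insert i I)
  then have "g \<in> I \<rightarrow> carrier M" "(\<lambda>i. a \<odot> g i) \<in> I \<rightarrow> carrier M" using assms(1) by auto
  then show ?case using insert assms(1) by (simp add: finsum_insert smult_r_distr)
qed (simp_all add: assms(1))

lemma finsum_mem_subgroup:
  assumes "subgroup H (add_monoid M)" "\<And>i. i \<in> I \<Longrightarrow> g i \<in> H"
  shows "(\<Oplus>i\<in>I. g i) \<in> H"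
  using assms(2)
proof (induction I rule: infinite_finite_induct)
  case (insert i I)
  have "H \<subseteq> carrier M" using subgroup.subset[OF assms(1)] by simp
  then have "g \<in> I \<rightarrow> carrier M" "g i \<in> carrier M" using insert by auto
  then show ?case using insert subgroup.m_closed[OF assms(1)] by (simp add: finsum_insert)
qed (use subgroup.one_closed[OF assms(1)] in simp_all)

lemma vertex_act_vertex_act:
  assumes "v \<in> verts Q" "w \<in> verts Q" "x \<in> carrier M"
  shows "vertex_elt v c \<odot> (vertex_elt w d \<odot> x) = (if v = w then vertex_elt v (c * d) \<odot> x else \<zero>)"
  using act_mult[OF vertex_elt_closed[OF assms(1)] vertex_elt_closed[OF assms(2)] assms(3), of c d] assms
  by (auto simp: vertex_elt_mult)

lemma path_act_append:
  assumes "(v, xs, u) \<in> qpaths Q" "(u, ys, w) \<in> qpaths Q" "x \<in> carrier M"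
  shows "path_elt v (xs @ ys) w \<odot> x = path_elt v xs u \<odot> (path_elt u ys w \<odot> x)"
  using assms act_mult[OF path_elt_closed path_elt_closed, of v xs u u ys w x] by (simp add: path_elt_mult)

lemma path_act_Cons:
  assumes "(v, y # ys, u) \<in> qpaths Q" "x \<in> carrier M"
  shows "path_elt v (y # ys) u \<odot> x = arrow_elt y \<odot> (path_elt (tail Q y) ys u \<odot> x)"
  using assms path_act_append[of v "[y]" "tail Q y" ys u x] arrow_path[of y]
  by (simp add: qpaths_Cons path_elt_arrow)

lemma vertex_act_path_act:
  assumes "(v, xs, u) \<in> qpaths Q" "x \<in> carrier M"
  shows "vertex_elt v 1 \<odot> (path_elt v xs u \<odot> x) = path_elt v xs u \<odot> x"
  using act_mult[OF vertex_elt_closed path_elt_closed[OF assms(1)] assms(2), of v 1] assms qpaths_verts[OF assms(1)]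
  by (simp add: vertex_elt_path_elt)

lemma vertex_act_path_act_commute:
  assumes "(v, xs, u) \<in> qpaths Q" "x \<in> carrier M"
  shows "vertex_elt v c \<odot> (path_elt v xs u \<odot> x) = path_elt v xs u \<odot> (vertex_elt u c \<odot> x)"
  using act_mult[OF vertex_elt_closed path_elt_closed[OF assms(1)] assms(2), of v c]
    act_mult[OF path_elt_closed[OF assms(1)] vertex_elt_closed assms(2), of u c] qpaths_verts[OF assms(1)]
  by (simp add: vertex_elt_path_elt_commute[OF assms(1)])

lemma path_act_vertex_act:
  assumes "(v, xs, u) \<in> qpaths Q" "x \<in> carrier M"
  shows "path_elt v xs u \<odot> (vertex_elt u 1 \<odot> x) = path_elt v xs u \<odot> x"
  using act_mult[OF path_elt_closed[OF assms(1)] vertex_elt_closed assms(2), of u 1] assms qpaths_verts[OF assms(1)]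
  by (simp add: path_elt_vertex_elt)

lemma submoduleI':
  assumes "H \<subseteq> carrier M" "\<zero> \<in> H" "\<And>x y. x \<in> H \<Longrightarrow> y \<in> H \<Longrightarrow> x \<oplus> y \<in> H" "\<And>x. x \<in> H \<Longrightarrow> \<ominus> x \<in> H"
    "\<And>a x. a \<in> carrier (\<Lambda> Q \<rho>) \<Longrightarrow> x \<in> H \<Longrightarrow> a \<odot> x \<in> H"
  shows "submodule H (\<Lambda> Q \<rho>) M"
  unfolding submodule_def submodule_axioms_def using assms
  by (intro conjI add.subgroupI) (auto simp: a_inv_def)

lemma submoduleD:
  assumes "submodule H (\<Lambda> Q \<rho>) M"
  shows "H \<subseteq> carrier M" "\<zero> \<in> H" "\<And>x y. x \<in> H \<Longrightarrow> y \<in> H \<Longrightarrow> x \<oplus> y \<in> H" "\<And>x. x \<in> H \<Longrightarrow> \<ominus> x \<in> H"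
    "\<And>a x. a \<in> carrier (\<Lambda> Q \<rho>) \<Longrightarrow> x \<in> H \<Longrightarrow> a \<odot> x \<in> H"
    "\<And>x y. x \<in> H \<Longrightarrow> y \<in> H \<Longrightarrow> x \<ominus> y \<in> H"
proof -
  have S: "subgroup H (add_monoid M)" "\<And>a x. a \<in> carrier (\<Lambda> Q \<rho>) \<Longrightarrow> x \<in> H \<Longrightarrow> a \<odot> x \<in> H"
    using assms unfolding submodule_def submodule_axioms_def by auto
  show 1: "H \<subseteq> carrier M" "\<zero> \<in> H" "\<And>x y. x \<in> H \<Longrightarrow> y \<in> H \<Longrightarrow> x \<oplus> y \<in> H" 
    using subgroup.subset[OF S(1)] subgroup.one_closed[OF S(1)] subgroup.m_closed[OF S(1)] by simp_all
  show 2: "\<ominus> x \<in> H" if "x \<in> H" for x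
    using subgroup.m_inv_closed[OF S(1) that] by (simp add: a_inv_def)
  show "a \<odot> x \<in> H" if "a \<in> carrier (\<Lambda> Q \<rho>)" "x \<in> H" for a x
    using S(2) that .
  show "x \<ominus> y \<in> H" if "x \<in> H" "y \<in> H" for x y
    using 1(3) 2 that by (simp add: a_minus_def)
qed

lemma submodule_subgroup: "submodule H (\<Lambda> Q \<rho>) M \<Longrightarrow> subgroup H (add_monoid M)"
  by (simp add: submodule_def)

lemma submodule_left_module:
  assumes "submodule H (\<Lambda> Q \<rho>) M"
  shows "left_module (\<Lambda> Q \<rho>) (M\<lparr>carrier := H\<rparr>)"
proof -
  note H = submoduleD[OF assms]
  have "abelian_group (M\<lparr>carrier := H\<rparr>)"
  proof (rule abelian_groupI)
    fix x assume "x \<in> carrier (M\<lparr>carrier := H\<rparr>)"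
    then show "\<exists>y\<in>carrier (M\<lparr>carrier := H\<rparr>). y \<oplus>\<^bsub>M\<lparr>carrier := H\<rparr>\<^esub> x = \<zero>\<^bsub>M\<lparr>carrier := H\<rparr>\<^esub>"
      using H(1,4) by (intro bexI[of _ "\<ominus> x"]) (auto simp: l_neg)
  qed (use H in \<open>auto simp: a_assoc subset_iff intro: a_comm\<close>)
  then show ?thesis
    using H by (auto simp: left_module_def left_module_axioms_def smult_l_distr smult_r_distr smult_assoc subset_iff)
qed

lemma linear_on_image_submodule:
  assumes "linear_on (\<Lambda> Q \<rho>) L M h" "left_module (\<Lambda> Q \<rho>) L"
  shows "submodule (h ` carrier L) (\<Lambda> Q \<rho>) M"
proof -
  interpret L: left_module "\<Lambda> Q \<rho>" L by fact
  note h = linear_onD[OF assms(1)] and h0 = linear_on_zero[OF assms(1) L.abelian_group_axioms abelian_group_axioms]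
  show ?thesis
  proof (rule submoduleI')
    show "\<zero> \<in> h ` carrier L" using h0 L.zero_closed by (metis imageI)
    fix x assume "x \<in> h ` carrier L"
    then obtain x' where x': "x' \<in> carrier L" "x = h x'" by blast
    have "h (\<ominus>\<^bsub>L\<^esub> x') \<oplus> h x' = \<zero>"
      using h(2)[of "\<ominus>\<^bsub>L\<^esub> x'" x'] x' h0 by (simp add: L.l_neg)
    then have "\<ominus> h x' = h (\<ominus>\<^bsub>L\<^esub> x')"
      using x' h(1) by (intro minus_equality) simp_all
    then show "\<ominus> x \<in> h ` carrier L" using x' by simp
    show "a \<odot> x \<in> h ` carrier L" if "a \<in> carrier (\<Lambda> Q \<rho>)" for a
      using h(3)[OF that x'(1)] L.smult_closed[OF that x'(1)] x'(2) by (metis imageI)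
    fix y assume "y \<in> h ` carrier L"
    then obtain y' where y': "y' \<in> carrier L" "y = h y'" by blast
    then show "x \<oplus> y \<in> h ` carrier L"
      using h(2)[OF x'(1) y'(1)] L.a_closed[OF x'(1) y'(1)] x'(2) by (metis imageI)
  qed (use h in auto)
qed

lemma submodule_sum2:
  assumes "submodule H (\<Lambda> Q \<rho>) M" "submodule K (\<Lambda> Q \<rho>) M"
  shows "submodule (H <+>\<^bsub>M\<^esub> K) (\<Lambda> Q \<rho>) M"
proof -
  note H = submoduleD[OF assms(1)] and K = submoduleD[OF assms(2)]
  have mem: "x \<in> H <+>\<^bsub>M\<^esub> K \<longleftrightarrow> (\<exists>h\<in>H. \<exists>k\<in>K. x = h \<oplus> k)" for x
    by (simp add: set_add_def set_mult_def)
  have HK: "h \<in> carrier M" "k \<in> carrier M" if "h \<in> H" "k \<in> K" for h k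
    using H(1) K(1) that by auto
  show ?thesis
  proof (rule submoduleI')
    show "H <+>\<^bsub>M\<^esub> K \<subseteq> carrier M" using HK by (auto simp: mem)
    show "\<zero> \<in> H <+>\<^bsub>M\<^esub> K" using H(2) K(2) by (auto simp: mem intro!: bexI[of _ \<zero>])
    fix x assume "x \<in> H <+>\<^bsub>M\<^esub> K"
    then obtain h k where x: "h \<in> H" "k \<in> K" "x = h \<oplus> k" by (auto simp: mem)
    then show "\<ominus> x \<in> H <+>\<^bsub>M\<^esub> K"
      using HK H(4) K(4) unfolding mem by (intro bexI[of _ "\<ominus> h"] bexI[of _ "\<ominus> k"]) (simp_all add: minus_add)
    show "a \<odot> x \<in> H <+>\<^bsub>M\<^esub> K" if "a \<in> carrier (\<Lambda> Q \<rho>)" for a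
      using that x HK H(5) K(5) unfolding mem by (intro bexI[of _ "a \<odot> h"] bexI[of _ "a \<odot> k"]) (simp_all add: smult_r_distr)
    fix y assume "y \<in> H <+>\<^bsub>M\<^esub> K"
    then obtain h' k' where y: "h' \<in> H" "k' \<in> K" "y = h' \<oplus> k'" by (auto simp: mem)
    then show "x \<oplus> y \<in> H <+>\<^bsub>M\<^esub> K"
      using x HK H(3) K(3) unfolding mem by (intro bexI[of _ "h \<oplus> h'"] bexI[of _ "k \<oplus> k'"]) (simp_all add: a_ac)
  qed
qed

lemma sum2_mem: "x \<in> H <+>\<^bsub>M\<^esub> K \<longleftrightarrow> (\<exists>h\<in>H. \<exists>k\<in>K. x = h \<oplus> k)"
  by (simp add: set_add_def set_mult_def)

lemma sum2_upper:
  assumes "submodule H (\<Lambda> Q \<rho>) M" "submodule K (\<Lambda> Q \<rho>) M"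
  shows "H \<subseteq> H <+>\<^bsub>M\<^esub> K" "K \<subseteq> H <+>\<^bsub>M\<^esub> K"
proof -
  note H = submoduleD[OF assms(1)] and K = submoduleD[OF assms(2)]
  show "H \<subseteq> H <+>\<^bsub>M\<^esub> K"
  proof
    fix x assume "x \<in> H"
    then show "x \<in> H <+>\<^bsub>M\<^esub> K"
      using H(1) K(2) unfolding sum2_mem by (intro bexI[of _ x] bexI[of _ \<zero>]) auto
  qed
  show "K \<subseteq> H <+>\<^bsub>M\<^esub> K"
  proof
    fix x assume "x \<in> K"
    then show "x \<in> H <+>\<^bsub>M\<^esub> K"
      using K(1) H(2) unfolding sum2_mem by (intro bexI[of _ \<zero>] bexI[of _ x]) auto
  qed
qed

lemma diff_add_cancel: "x \<in> carrier M \<Longrightarrow> y \<in> carrier M \<Longrightarrow> x \<ominus> y \<oplus> y = x"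
  by (simp add: a_minus_def a_assoc l_neg)

lemma diff_eq_zero: "x \<in> carrier M \<Longrightarrow> y \<in> carrier M \<Longrightarrow> x \<ominus> y = \<zero> \<longleftrightarrow> x = y"
  using diff_add_cancel[of x y] by (auto simp: a_minus_def r_neg)

end

section \<open>Word modules\<close>

definition scale :: "'k \<Rightarrow> (int \<Rightarrow>\<^sub>0 'k) \<Rightarrow> int \<Rightarrow>\<^sub>0 'k::field" where
  "scale c m = Poly_Mapping.map ((*) c) m"

lemma lookup_scale [simp]: "Poly_Mapping.lookup (scale c m) i = c * Poly_Mapping.lookup m i"
  by (simp add: scale_def Poly_Mapping.map.rep_eq when_def)

lemma scale_simps [simp]:
  "scale c 0 = 0" "scale 0 m = 0" "scale 1 m = m"
  "scale c (Poly_Mapping.single i e) = Poly_Mapping.single i (c * e)"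
  "scale c (scale d m) = scale (c * d) m"
  by (rule poly_mapping_eqI, simp add: lookup_single when_def mult.assoc)+

lemma scale_add: "scale (c + d) m = scale c m + scale d m" "scale c (m + m') = scale c m + scale c m'"
  by (rule poly_mapping_eqI, simp add: lookup_add algebra_simps)+

lemma letter_inv_inv [simp]: "letter_inv (letter_inv l) = l"
  by (cases l) simp_all

lemma letter_arrow_inv [simp]: "letter_arrow (letter_inv l) = letter_arrow l"
  by (cases l) simp_all

lemma letter_tail_simps [simp]: "letter_tail Q (Dir x) = tail Q x" "letter_tail Q (Inv x) = head Q x"
  by (simp_all add: letter_tail_def)

lemma is_word_letters:
  assumes "is_word Q \<rho> C" "letters C i = Some l"
  shows "letter_arrow l \<in> arcs Q" "i \<in> word_index C" "i - 1 \<in> word_index C"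
  using assms by (cases C; auto simp: ran_def)+

lemma is_word_consecutive:
  assumes "is_word Q \<rho> C" "letters C i = Some l" "letters C (i + 1) = Some l'"
  shows "letter_tail Q l = letter_head Q l'" "letter_inv l \<noteq> l'"
  using assms by (cases C; auto)+

lemma is_word_relation:
  assumes "is_word Q \<rho> C" "r \<in> \<rho>" "r \<noteq> []"
  shows "\<exists>j<length r. letters C (i + int j) \<noteq> Some (Dir (r ! j))"
    and "\<exists>j<length r. letters C (i + int j) \<noteq> Some (Inv (rev r ! j))"
  using assms by (cases C; auto)+

lemma letter_inv_eq [simp]:
  "letter_inv l = Dir x \<longleftrightarrow> l = Inv x" "letter_inv l = Inv x \<longleftrightarrow> l = Dir x"
  by (cases l; auto)+

lemma word_vertex_letters:
  assumes "is_word Q \<rho> C" "letters C i = Some l"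
  shows "word_vertex Q C i = letter_tail Q l" "word_vertex Q C (i - 1) = letter_head Q l"
proof -
  obtain L where C: "C = Letters L" using assms(2) by (cases C) auto
  show "word_vertex Q C (i - 1) = letter_head Q l" using assms(2) C by simp
  show "word_vertex Q C i = letter_tail Q l"
    using assms is_word_consecutive(1)[OF assms] C by (auto split: option.splits)
qed

section \<open>Reading a word from a position in either direction\<close>

text \<open>Letter number \<open>t\<close> joins the positions \<open>i + d * (t - 1)\<close> and
  \<open>i + d * t\<close>. Reading backwards, this is the letter with index
  \<open>i + 1 - t\<close>, and it is met inverted. Nonpositive \<open>t\<close> are the letters
  behind \<open>i\<close>. Both orientations of a ray can thus be treated by one argument.\<close>

definition oriented_letter :: "('v, 'a) word \<Rightarrow> int \<Rightarrow> int \<Rightarrow> int \<Rightarrow> 'a letter option" where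
  "oriented_letter C d i t = (if d = 1 then letters C (i + t) else map_option letter_inv (letters C (i + 1 - t)))"

lemma oriented_letter_shift:
  "d \<in> {1, -1} \<Longrightarrow> oriented_letter C d (i + d * s) t = oriented_letter C d i (s + t)"
  by (auto simp: oriented_letter_def algebra_simps)

lemma oriented_letter_consecutive:
  assumes "is_word Q \<rho> C" "d \<in> {1, -1}" "oriented_letter C d i t = Some l" "oriented_letter C d i (t + 1) = Some l'"
  shows "letter_tail Q l = letter_head Q l'" "letter_inv l \<noteq> l'"
proof -
  have "letter_tail Q l = letter_head Q l' \<and> letter_inv l \<noteq> l'"
  proof (cases "d = 1")
    case True
    then show ?thesis
      using is_word_consecutive[OF assms(1), of "i + t" l l'] assms(3,4) by (simp add: oriented_letter_def add.assoc)
  next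
    case False
    then obtain a b where ab: "letters C (i + 1 - t) = Some a" "letters C (i - t) = Some b" "l = letter_inv a" "l' = letter_inv b"
      using assms(3,4) by (auto simp: oriented_letter_def)
    then show ?thesis
      using is_word_consecutive[OF assms(1), of "i - t" b a] by (auto simp: letter_tail_def algebra_simps)
  qed
  then show "letter_tail Q l = letter_head Q l'" "letter_inv l \<noteq> l'" by simp_all
qed

lemma oriented_letter_vertex:
  assumes "is_word Q \<rho> C" "d \<in> {1, -1}" "oriented_letter C d i t = Some l"
  shows "word_vertex Q C (i + d * t) = letter_tail Q l" "word_vertex Q C (i + d * (t - 1)) = letter_head Q l"
    "letter_arrow l \<in> arcs Q" "i + d * t \<in> word_index C" "i + d * (t - 1) \<in> word_index C"
proof -
  have "word_vertex Q C (i + d * t) = letter_tail Q l \<and> word_vertex Q C (i + d * (t - 1)) = letter_head Q l \<and>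
    letter_arrow l \<in> arcs Q \<and> i + d * t \<in> word_index C \<and> i + d * (t - 1) \<in> word_index C"
  proof (cases "d = 1")
    case True
    then have l: "letters C (i + t) = Some l" using assms(3) by (simp add: oriented_letter_def)
    show ?thesis
      using word_vertex_letters[OF assms(1) l] is_word_letters[OF assms(1) l] True by (simp add: algebra_simps)
  next
    case False
    then have d: "d = -1" using assms(2) by simp
    with assms(3) obtain a where a: "letters C (i + 1 - t) = Some a" "l = letter_inv a"
      by (auto simp: oriented_letter_def)
    show ?thesis
      using word_vertex_letters[OF assms(1) a(1)] is_word_letters[OF assms(1) a(1)] a(2) d
      by (simp add: algebra_simps letter_tail_def)
  qed
  then show "word_vertex Q C (i + d * t) = letter_tail Q l" "word_vertex Q C (i + d * (t - 1)) = letter_head Q l"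
    "letter_arrow l \<in> arcs Q" "i + d * t \<in> word_index C" "i + d * (t - 1) \<in> word_index C" by simp_all
qed

lemma arrow_op_single:
  "arrow_op C x (Poly_Mapping.single i c) =
     (if letters C i = Some (Dir x) then Poly_Mapping.single (i - 1) c
      else if letters C (i + 1) = Some (Inv x) then Poly_Mapping.single (i + 1) c else 0)"
  by (cases "c = 0") (simp_all add: arrow_op_def)

lemma arrow_op_oriented:
  assumes "is_word Q \<rho> C" "d \<in> {1, -1}"
  shows "arrow_op C x (Poly_Mapping.single (i + d * t) c) =
     (if oriented_letter C d i t = Some (Dir x) then Poly_Mapping.single (i + d * (t - 1)) c
      else if oriented_letter C d i (t + 1) = Some (Inv x) then Poly_Mapping.single (i + d * (t + 1)) c else 0)"
proof (cases "d = 1")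
  case True
  then show ?thesis by (simp add: arrow_op_single oriented_letter_def algebra_simps)
next
  case False
  then have d: "d = -1" using assms(2) by simp
  \<comment> \<open>Reading backwards exchanges the two cases of \<open>arrow_op\<close>, which
    tests the direct letter first; so the cases must be shown to exclude each other.\<close>
  have "letters C (i - t) \<noteq> Some (Dir x) \<or> letters C (i - t + 1) \<noteq> Some (Inv x)"
    using is_word_consecutive(2)[OF assms(1), of "i - t" "Dir x" "Inv x"] by auto
  then show ?thesis
    unfolding d oriented_letter_def by (auto simp: arrow_op_single algebra_simps)
qed

lemma arrow_op_add: "arrow_op C x (m + m') = arrow_op C x m + arrow_op C x m'"
  unfolding arrow_op_def by (rule sum_keys_add) (simp_all add: single_add)

lemma arrow_op_zero [simp]: "arrow_op C x 0 = 0"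
  by (simp add: arrow_op_def)

lemma vertex_op_single [simp]:
  "vertex_op Q C v (Poly_Mapping.single i c) = (if word_vertex Q C i = v then Poly_Mapping.single i c else 0)"
  by (cases "c = 0") (simp_all add: vertex_op_def)

lemma vertex_op_add: "vertex_op Q C v (m + m') = vertex_op Q C v m + vertex_op Q C v m'"
  unfolding vertex_op_def by (rule sum_keys_add) (simp_all add: single_add)

lemma vertex_op_zero [simp]: "vertex_op Q C x 0 = 0"
  by (simp add: vertex_op_def)

lemma arrow_op_scale: "arrow_op C x (scale c m) = scale c (arrow_op C x m)"
  by (induction m rule: poly_mapping_single_induct) (simp_all add: arrow_op_single arrow_op_add scale_add)

lemma vertex_op_scale: "vertex_op Q C v (scale c m) = scale c (vertex_op Q C v m)"
  by (induction m rule: poly_mapping_single_induct) (simp_all add: vertex_op_add scale_add)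

lemma arrows_op_add: "foldr (arrow_op C) xs (m + m') = foldr (arrow_op C) xs m + foldr (arrow_op C) xs m'"
  by (induction xs) (simp_all add: arrow_op_add)

lemma arrows_op_zero [simp]: "foldr (arrow_op C) xs 0 = 0"
  by (induction xs) simp_all

lemma arrows_op_scale: "foldr (arrow_op C) xs (scale c m) = scale c (foldr (arrow_op C) xs m)"
  by (induction xs) (simp_all add: arrow_op_scale)

lemma path_op_linear:
  "path_op Q C p (m + m') = path_op Q C p m + path_op Q C p m'"
  "path_op Q C p (scale c m) = scale c (path_op Q C p m)"
  "path_op Q C p 0 = 0"
  by (cases p; simp add: vertex_op_add vertex_op_scale arrows_op_add arrows_op_scale)+

lemma path_algebra_op_add_left:
  "path_algebra_op Q C (f + g) m = path_algebra_op Q C f m + path_algebra_op Q C g m"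
  unfolding path_algebra_op_def scale_def[symmetric] by (rule sum_keys_add) (simp_all add: scale_add)

lemma path_algebra_op_zero_left [simp]: "path_algebra_op Q C 0 m = 0"
  by (simp add: path_algebra_op_def)

lemma path_algebra_op_diff_left:
  "path_algebra_op Q C (f - g) m = path_algebra_op Q C f m - path_algebra_op Q C g m"
  using path_algebra_op_add_left[of Q C "f - g" g m] by (simp add: algebra_simps)

lemma path_algebra_op_add_right:
  "path_algebra_op Q C f (m + m') = path_algebra_op Q C f m + path_algebra_op Q C f m'"
  unfolding path_algebra_op_def scale_def[symmetric] by (simp add: path_op_linear scale_add sum.distrib)

lemma path_algebra_op_zero_right [simp]: "path_algebra_op Q C f 0 = 0"
  unfolding path_algebra_op_def scale_def[symmetric] by (simp add: path_op_linear)

lemma path_algebra_op_single: "path_algebra_op Q C (Poly_Mapping.single p c) m = scale c (path_op Q C p m)"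
  unfolding path_algebra_op_def scale_def[symmetric] by (rule sum_keys_single) simp

lemma path_algebra_op_scale: "path_algebra_op Q C f (scale c m) = scale c (path_algebra_op Q C f m)"
  by (induction f rule: poly_mapping_single_induct)
    (simp_all add: path_algebra_op_single path_op_linear path_algebra_op_add_left scale_add mult.commute)

text \<open>The arrows are listed from head to tail and act from the right, so the last one sits on
  oriented letter 0, immediately behind \<open>i\<close>, and the first on letter
  \<open>1 - length xs\<close>. Applying the path then moves the basis vector by
  \<open>length xs\<close> steps against the direction \<open>d\<close>.\<close>

definition reads :: "('v, 'a) word \<Rightarrow> int \<Rightarrow> int \<Rightarrow> 'a list \<Rightarrow> bool" where
  "reads C d i xs \<longleftrightarrow>
     (\<forall>s<length xs. oriented_letter C d i (int s + 1 - int (length xs)) = Some (Dir (xs ! s)))"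

lemma reads_Cons:
  "reads C d i (x # xs) \<longleftrightarrow> oriented_letter C d i (- int (length xs)) = Some (Dir x) \<and> reads C d i xs"
  by (simp add: reads_def All_less_Suc2 add.commute)

lemma reads_step:
  assumes "is_word Q \<rho> C" "d \<in> {1, -1}" "reads C d i xs" "xs \<noteq> []"
  shows "foldr (arrow_op C) xs (Poly_Mapping.single i c) = Poly_Mapping.single (i - d * int (length xs)) c"
  using assms(3,4)
proof (induction xs)
  case (Cons x xs)
  have x: "oriented_letter C d i (- int (length xs)) = Some (Dir x)"
    using Cons.prems by (simp add: reads_Cons)
  have "foldr (arrow_op C) xs (Poly_Mapping.single i c) = Poly_Mapping.single (i + d * (- int (length xs))) c"
    using Cons by (cases "xs = []") (simp_all add: reads_Cons)
  then show ?case
    using arrow_op_oriented[OF assms(1,2), of x i "- int (length xs)" c] x by (simp add: algebra_simps)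
qed simp

text \<open>A path cannot turn round. Once it has moved a basis vector in one direction, going back
  would require the letter just crossed to be inverse, but it was crossed as a direct letter. So a
  basis vector survives only if the whole path is read in one direction.\<close>

lemma reads_fail:
  assumes "is_word Q \<rho> C" "\<not> reads C 1 i xs" "\<not> reads C (-1) i xs"
  shows "foldr (arrow_op C) xs (Poly_Mapping.single i c) = 0"
  using assms(2,3)
proof (induction xs)
  case (Cons x xs)
  show ?case
  proof (cases "xs = []")
    case True
    then show ?thesis
      using Cons.prems by (auto simp: reads_def oriented_letter_def arrow_op_single)
  next
    case False
    consider d where "d \<in> {1, -1}" "reads C d i xs" | "\<not> reads C 1 i xs" "\<not> reads C (-1) i xs" by blast
    then show ?thesis
    proof cases
      case 1
      obtain y ys where xs: "xs = y # ys" using False by (cases xs) auto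
      have "oriented_letter C d i (- int (length xs) + 1) = Some (Dir y)"
        using 1(2) by (simp add: xs reads_Cons)
      moreover have "oriented_letter C d i (- int (length xs)) \<noteq> Some (Dir x)"
        using Cons.prems 1 by (auto simp: reads_Cons)
      ultimately show ?thesis
        using reads_step[OF assms(1) 1 False, of c] arrow_op_oriented[OF assms(1) 1(1), of x i "- int (length xs)" c]
        by simp
    next
      case 2
      then show ?thesis using Cons.IH by simp
    qed
  qed
qed (simp add: reads_def)

text \<open>The two directions correspond to the two exclusions in the definition of a word: read
  forwards, the relation itself would occur; read backwards, its inverse, which is why the index is
  reversed in the second half.\<close>

lemma reads_not_relation:
  assumes "is_word Q \<rho> C" "r \<in> \<rho>" "r \<noteq> []"
  shows "\<not> reads C 1 i r" "\<not> reads C (-1) i r"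
proof -
  let ?n = "int (length r)"
  show "\<not> reads C 1 i r"
  proof
    assume R: "reads C 1 i r"
    obtain j where j: "j < length r" "letters C (i + 1 - ?n + int j) \<noteq> Some (Dir (r ! j))"
      using is_word_relation(1)[OF assms] by blast
    then show False using R by (auto simp: reads_def oriented_letter_def algebra_simps)
  qed
  show "\<not> reads C (-1) i r"
  proof
    assume R: "reads C (-1) i r"
    obtain j where j: "j < length r" "letters C (i + 1 + int j) \<noteq> Some (Inv (rev r ! j))"
      using is_word_relation(2)[OF assms] by blast
    let ?s = "length r - 1 - j"
    have "oriented_letter C (-1) i (int ?s + 1 - ?n) = Some (Dir (r ! ?s))"
      using R[unfolded reads_def, rule_format, of ?s] j(1) by simp
    moreover have "int ?s + 1 - ?n = - int j" using j(1) by (simp add: of_nat_diff)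
    ultimately have "letters C (i + 1 + int j) = Some (Inv (r ! ?s))"
      by (auto simp: oriented_letter_def)
    then show False using j by (simp add: rev_nth)
  qed
qed

lemma arrow_op_vertex:
  assumes "is_word Q \<rho> C"
  shows "vertex_op Q C v (arrow_op C x m) = (if v = head Q x then arrow_op C x m else 0)"
proof (induction m rule: poly_mapping_single_induct)
  case (single i c)
  show ?case
    using word_vertex_letters[OF assms, of i "Dir x"] word_vertex_letters[OF assms, of "i + 1" "Inv x"]
    by (simp add: arrow_op_single)
qed (simp_all add: vertex_op_add arrow_op_add)

lemma vertex_op_keys: "Poly_Mapping.keys m \<subseteq> I \<Longrightarrow> Poly_Mapping.keys (vertex_op Q C v m) \<subseteq> I"
  unfolding vertex_op_def by (intro order.trans[OF keys_sum] UN_least) (auto split: if_splits)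

lemma arrow_op_keys:
  assumes "is_word Q \<rho> C"
  shows "Poly_Mapping.keys (arrow_op C x m) \<subseteq> word_index C"
proof (induction m rule: poly_mapping_single_induct)
  case (single i c)
  show ?case
    using is_word_letters[OF assms, of i "Dir x"] is_word_letters[OF assms, of "i + 1" "Inv x"]
    by (auto simp: arrow_op_single)
qed (use Poly_Mapping.keys_add in \<open>fastforce simp: arrow_op_add\<close>)+

lemma path_op_keys:
  assumes "is_word Q \<rho> C" "Poly_Mapping.keys m \<subseteq> word_index C"
  shows "Poly_Mapping.keys (path_op Q C p m) \<subseteq> word_index C"
proof -
  obtain v xs u where p: "p = (v, xs, u)" by (cases p)
  show ?thesis
    using vertex_op_keys[OF assms(2)] arrow_op_keys[OF assms(1)] unfolding p by (cases xs) simp_all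
qed

lemma keys_scale: "Poly_Mapping.keys (scale c m) \<subseteq> Poly_Mapping.keys m"
  by (auto simp: in_keys_iff)

lemma path_algebra_op_keys:
  assumes "is_word Q \<rho> C" "Poly_Mapping.keys m \<subseteq> word_index C"
  shows "Poly_Mapping.keys (path_algebra_op Q C f m) \<subseteq> word_index C"
  unfolding path_algebra_op_def scale_def[symmetric]
  by (intro order.trans[OF keys_sum] UN_least order.trans[OF keys_scale] path_op_keys[OF assms])

lemma vertex_op_vertex_op: "vertex_op Q C v (vertex_op Q C w m) = (if v = w then vertex_op Q C w m else 0)"
  by (induction m rule: poly_mapping_single_induct) (simp_all add: vertex_op_add)

section \<open>The word module as a module over the string algebra\<close>

context string_algebra
begin

lemma vertex_op_path_op:
  assumes "is_word Q \<rho> C" "(v, xs, u) \<in> qpaths Q"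
  shows "vertex_op Q C w (path_op Q C (v, xs, u) m) = (if w = v then path_op Q C (v, xs, u) m else 0)"
  using assms by (cases xs) (simp_all add: arrow_op_vertex vertex_op_vertex_op qpaths_Nil qpaths_Cons)

lemma path_op_path_op:
  assumes "is_word Q \<rho> C" "(v', ys, u') \<in> qpaths Q"
  shows "path_op Q C (v, xs, u) (path_op Q C (v', ys, u') m) = (if u = v' then path_op Q C (v, xs @ ys, u') m else 0)"
  using vertex_op_path_op[OF assms, of u m] by simp

lemma path_algebra_op_mult:
  assumes "is_word Q \<rho> C" "Poly_Mapping.keys g \<subseteq> qpaths Q"
  shows "path_algebra_op Q C (path_mult f g) m = path_algebra_op Q C f (path_algebra_op Q C g m)"
proof (induction f rule: poly_mapping_single_induct)
  case (single p c)
  show ?case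
  proof (induction g rule: poly_mapping_single_induct)
    case (single q d)
    obtain v xs u v' ys u' where p: "p = (v, xs, u)" and q: "q = (v', ys, u')" by (cases p; cases q)
    have "(v', ys, u') \<in> qpaths Q" using assms(2) single q by auto
    then show ?case
      using path_op_path_op[OF assms(1), of v' ys u' v xs u m] unfolding p q
      by (simp add: path_algebra_op_single path_op_linear del: path_op.simps)
  qed (simp_all add: path_mult_add_right path_algebra_op_add_left path_algebra_op_add_right)
qed (simp_all add: path_mult_add_left path_algebra_op_add_left)

text \<open>The elements of the path algebra that annihilate M(C) form a member of
  \<open>relation_ideals\<close>, because no zero relation can be read anywhere along a
  word.\<close>

lemma path_algebra_op_relation_ideal:
  fixes f :: "('v, 'a) qpath \<Rightarrow>\<^sub>0 'k::field"
  assumes "is_word Q \<rho> C" "f \<in> relation_ideal Q \<rho>" "Poly_Mapping.keys m \<subseteq> word_index C"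
  shows "path_algebra_op Q C f m = 0"
proof -
  let ?J = "{f :: ('v, 'a) qpath \<Rightarrow>\<^sub>0 'k. Poly_Mapping.keys f \<subseteq> qpaths Q \<and>
    (\<forall>m. Poly_Mapping.keys m \<subseteq> word_index C \<longrightarrow> path_algebra_op Q C f m = 0)}"
  have "path_algebra_op Q C (Poly_Mapping.single (head Q (hd r), r, tail Q (last r)) 1) m = 0" if "r \<in> \<rho>" for r and m :: "int \<Rightarrow>\<^sub>0 'k"
  proof -
    have r: "r \<noteq> []" using relation_length[OF that] by auto
    have "foldr (arrow_op C) r m' = 0" for m' :: "int \<Rightarrow>\<^sub>0 'k"
      by (induction m' rule: poly_mapping_single_induct)
        (simp_all add: reads_fail[OF assms(1) reads_not_relation[OF assms(1) that r]] arrows_op_add)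
    then show ?thesis by (simp add: path_algebra_op_single)
  qed
  moreover have "Poly_Mapping.keys (f - g) \<subseteq> qpaths Q"
    if "Poly_Mapping.keys f \<subseteq> qpaths Q" "Poly_Mapping.keys g \<subseteq> qpaths Q" for f g :: "('v, 'a) qpath \<Rightarrow>\<^sub>0 'k"
    using that keys_diff[of f g] by blast
  ultimately have "?J \<in> relation_ideals"
    unfolding relation_ideals_def
    by (auto simp: path_algebra_op_diff_left path_algebra_op_mult[OF assms(1)] path_mult_closed relation_path
      path_algebra_op_keys[OF assms(1)] simp del: path_op.simps)
  from relation_ideal_minimal[OF this] assms(2) have "f \<in> ?J" by (rule subsetD)
  then show ?thesis
    using assms(3) by simp
qed

lemma word_module_sel [simp]:
  "carrier (word_module Q C) = {m. Poly_Mapping.keys m \<subseteq> word_index C}"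
  "m \<oplus>\<^bsub>word_module Q C\<^esub> m' = m + m'" "\<zero>\<^bsub>word_module Q C\<^esub> = 0"
  by (simp_all add: word_module_def)

text \<open>\<open>word_module\<close> applies \<open>the_elem\<close> to the results of all
  representatives; they coincide because the relation ideal acts as zero, so \<open>the_elem\<close>
  is legitimate.\<close>

lemma word_module_act:
  assumes "is_word Q \<rho> C" "Poly_Mapping.keys m \<subseteq> word_index C"
  shows "residue Q \<rho> f \<odot>\<^bsub>word_module Q C\<^esub> m = path_algebra_op Q C f m"
proof -
  have eq: "path_algebra_op Q C g m = path_algebra_op Q C f m" if "g \<in> residue Q \<rho> f" for g
    using path_algebra_op_relation_ideal[OF assms(1) _ assms(2), of "g - f"] that
    by (simp add: residue_mem path_algebra_op_diff_left)
  have "(\<lambda>g. path_algebra_op Q C g m) ` residue Q \<rho> f = (\<lambda>g. path_algebra_op Q C f m) ` residue Q \<rho> f"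
    by (rule image_cong[OF refl]) (rule eq)
  also have "\<dots> = {path_algebra_op Q C f m}"
    by (rule image_constant[OF residue_self])
  finally show ?thesis by (simp add: word_module_def)
qed

lemma left_module_word_module:
  assumes C: "is_word Q \<rho> C"
  shows "left_module (\<Lambda> Q \<rho>) (word_module Q C :: (('v, 'a, 'k::field) alg_elt, int \<Rightarrow>\<^sub>0 'k) module)"
proof -
  have add: "Poly_Mapping.keys (m + m') \<subseteq> word_index C"
    if "Poly_Mapping.keys m \<subseteq> word_index C" "Poly_Mapping.keys m' \<subseteq> word_index C" for m m' :: "int \<Rightarrow>\<^sub>0 'k"
    using that Poly_Mapping.keys_add[of m m'] by blast
  have "abelian_group (word_module Q C :: (('v, 'a, 'k::field) alg_elt, int \<Rightarrow>\<^sub>0 'k) module)"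
  proof (rule abelian_groupI)
    fix m assume "m \<in> carrier (word_module Q C :: (('v, 'a, 'k::field) alg_elt, int \<Rightarrow>\<^sub>0 'k) module)"
    then show "\<exists>y\<in>carrier (word_module Q C :: (('v, 'a, 'k::field) alg_elt, int \<Rightarrow>\<^sub>0 'k) module).
        y \<oplus>\<^bsub>word_module Q C\<^esub> m = \<zero>\<^bsub>word_module Q C\<^esub>"
      by (intro bexI[of _ "- m"]) simp_all
  qed (simp_all add: add ac_simps)
  moreover have "left_module_axioms (\<Lambda> Q \<rho>) (word_module Q C :: (('v, 'a, 'k::field) alg_elt, int \<Rightarrow>\<^sub>0 'k) module)"
  proof
    fix a b :: "('v, 'a, 'k) alg_elt" and m m' :: "int \<Rightarrow>\<^sub>0 'k"
    assume a: "a \<in> carrier (\<Lambda> Q \<rho>)" and "m \<in> carrier (word_module Q C)"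
    then have m: "Poly_Mapping.keys m \<subseteq> word_index C" by simp
    obtain f where f: "Poly_Mapping.keys f \<subseteq> qpaths Q" "a = residue Q \<rho> f"
      using a unfolding carrier_\<Lambda> by blast
    show "a \<odot>\<^bsub>word_module Q C\<^esub> m \<in> carrier (word_module Q C)"
      using f m by (simp add: word_module_act[OF C] path_algebra_op_keys[OF C])
    show "a \<odot>\<^bsub>word_module Q C\<^esub> (m \<oplus>\<^bsub>word_module Q C\<^esub> m') =
        a \<odot>\<^bsub>word_module Q C\<^esub> m \<oplus>\<^bsub>word_module Q C\<^esub> a \<odot>\<^bsub>word_module Q C\<^esub> m'"
      if "m' \<in> carrier (word_module Q C)"
      using that f m by (simp add: word_module_act[OF C] add path_algebra_op_add_right)
    assume b: "b \<in> carrier (\<Lambda> Q \<rho>)"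
    obtain g where g: "Poly_Mapping.keys g \<subseteq> qpaths Q" "b = residue Q \<rho> g"
      using b unfolding carrier_\<Lambda> by blast
    show "(a \<oplus>\<^bsub>\<Lambda> Q \<rho>\<^esub> b) \<odot>\<^bsub>word_module Q C\<^esub> m =
        a \<odot>\<^bsub>word_module Q C\<^esub> m \<oplus>\<^bsub>word_module Q C\<^esub> b \<odot>\<^bsub>word_module Q C\<^esub> m"
      using f g m by (simp add: word_module_act[OF C] \<Lambda>_add path_algebra_op_add_left)
    show "(a \<otimes>\<^bsub>\<Lambda> Q \<rho>\<^esub> b) \<odot>\<^bsub>word_module Q C\<^esub> m = a \<odot>\<^bsub>word_module Q C\<^esub> (b \<odot>\<^bsub>word_module Q C\<^esub> m)"
      using f g m by (simp add: word_module_act[OF C] \<Lambda>_mult path_algebra_op_mult[OF C] path_algebra_op_keys[OF C])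
  qed
  ultimately show ?thesis
    by (simp add: left_module_def)
qed

lemma vertex_elt_act_single:
  assumes "is_word Q \<rho> C" "i \<in> word_index C"
  shows "vertex_elt v c \<odot>\<^bsub>word_module Q C\<^esub> Poly_Mapping.single i e =
    (if word_vertex Q C i = v then Poly_Mapping.single i (c * e) else 0)"
  using assms by (simp add: scaled_vertex_def word_module_act path_algebra_op_single)

lemma path_elt_act_single:
  assumes "is_word Q \<rho> C" "i \<in> word_index C"
  shows "path_elt v xs u \<odot>\<^bsub>word_module Q C\<^esub> Poly_Mapping.single i e =
    (if word_vertex Q C i = u then foldr (arrow_op C) xs (Poly_Mapping.single i e) else 0)"
  using assms by (simp add: path_elt_def word_module_act path_algebra_op_single)

text \<open>The projection to the tail of \<open>x\<close> that comes with the path changes nothing: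
  wherever \<open>x\<close> moves a basis vector, the adjacent letter already forces the vertex to
  be that tail.\<close>

lemma arrow_elt_act_single:
  assumes "is_word Q \<rho> C" "i \<in> word_index C"
  shows "arrow_elt x \<odot>\<^bsub>word_module Q C\<^esub> Poly_Mapping.single i e = arrow_op C x (Poly_Mapping.single i e)"
proof -
  have "arrow_elt x \<odot>\<^bsub>word_module Q C\<^esub> Poly_Mapping.single i e =
      (if word_vertex Q C i = tail Q x then arrow_op C x (Poly_Mapping.single i e) else 0)"
    using path_elt_act_single[OF assms, of "head Q x" "[x]" "tail Q x" e] by (simp add: path_elt_arrow)
  moreover have "arrow_op C x (Poly_Mapping.single i e) = 0" if "word_vertex Q C i \<noteq> tail Q x"
  proof -
    have "letters C i \<noteq> Some (Dir x)"
      using that word_vertex_letters(1)[OF assms(1), of i "Dir x"] by force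
    moreover have "letters C (i + 1) \<noteq> Some (Inv x)"
      using that word_vertex_letters(2)[OF assms(1), of "i + 1" "Inv x"] by force
    ultimately show ?thesis by (simp add: arrow_op_single)
  qed
  ultimately show ?thesis by simp
qed

end

section \<open>Bezout identities for an irreducible polynomial\<close>

text \<open>A nonzero element of least degree in the ideal generated by \<open>f\<close> and
  \<open>c\<close> divides both. As \<open>f\<close> is irreducible and does not divide
  \<open>c\<close>, it is a unit.\<close>

lemma irreducible_poly_bezout:
  fixes f c :: "'k::field poly"
  assumes "irreducible f" "\<not> f dvd c"
  shows "\<exists>r s. r * f + s * c = 1"
proof -
  define J where "J = {r * f + s * c | r s. True}"
  have "f \<in> J" unfolding J_def by (auto intro: exI[of _ 1] exI[of _ 0])
  moreover have "f \<noteq> 0" using assms(1) by auto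
  ultimately have "\<exists>d. d \<in> J \<and> d \<noteq> 0" by blast
  then obtain d where d: "d \<in> J" "d \<noteq> 0" and min: "\<And>e. e \<in> J \<Longrightarrow> e \<noteq> 0 \<Longrightarrow> degree d \<le> degree e"
    using ex_has_least_nat[of "\<lambda>d. d \<in> J \<and> d \<noteq> 0" _ degree] by metis
  have mod: "e mod d \<in> J" if e: "e \<in> J" for e
  proof -
    obtain r s r' s' where "e = r * f + s * c" "d = r' * f + s' * c" using e d(1) unfolding J_def by blast
    then have "e mod d = (r - e div d * r') * f + (s - e div d * s') * c"
      by (simp add: minus_div_mult_eq_mod[symmetric] algebra_simps)
    then show ?thesis unfolding J_def by blast
  qed
  have dvd: "d dvd e" if "e \<in> J" for e
    using mod[OF that] min[of "e mod d"] degree_mod_less'[OF d(2), of e] by (meson dvd_eq_mod_eq_0 leD)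
  have "c \<in> J" unfolding J_def by (auto intro: exI[of _ 1] exI[of _ 0])
  have "\<not> f dvd d" using assms(2) dvd[OF \<open>c \<in> J\<close>] by (meson dvd_trans)
  moreover obtain e where "f = d * e" using dvd[OF \<open>f \<in> J\<close>] by blast
  ultimately have "is_unit d"
    using assms(1) by (metis dvd_refl irreducible_mult_unit_left irreducible_def dvd_mult_unit_iff)
  then obtain d' where "1 = d * d'" by blast
  moreover obtain r s where "d = r * f + s * c" using d(1) unfolding J_def by blast
  ultimately have "d' * r * f + d' * s * c = 1" by (simp add: algebra_simps)
  then show ?thesis by blast
qed

text \<open>Replacing s by s - s(0) f and r by r + s(0) c keeps the identity and makes the second
  coefficient vanish at 0, as f(0) = 1. Evaluating at 0 then forces the first one to be 1 there, as
  c(0) = 0. This form is needed so that the new image of b differs from b by a multiple of P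
  only.\<close>

lemma irreducible_poly_bezout_coeff_0:
  fixes f c :: "'k::field poly"
  assumes "irreducible f" "\<not> f dvd c" "poly f 0 = 1" "poly c 0 = 0"
  shows "\<exists>r s. pCons 1 r * f + pCons 0 s * c = 1"
proof -
  obtain r s where rs: "r * f + s * c = 1" using irreducible_poly_bezout[OF assms(1,2)] by blast
  let ?a = "[:poly s 0:]"
  have eq: "(r + ?a * c) * f + (s - ?a * f) * c = 1" using rs by (simp add: algebra_simps)
  have s: "coeff (s - ?a * f) 0 = 0" using assms(3) by (simp add: poly_0_coeff_0)
  have "poly ((r + ?a * c) * f + (s - ?a * f) * c) 0 = 1" unfolding eq by simp
  then have r: "coeff (r + ?a * c) 0 = 1" using assms(3,4) by (simp add: poly_0_coeff_0[symmetric])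
  obtain r' where r': "r + ?a * c = pCons 1 r'" using r by (metis pCons_cases coeff_pCons_0)
  obtain s' where s': "s - ?a * f = pCons 0 s'" using s by (metis pCons_cases coeff_pCons_0)
  show ?thesis using eq unfolding r' s' by blast
qed

section \<open>Replacing a summand of the submodule by a summand of the whole module\<close>

context algebra_module
begin

lemma poly_act_mult:
  "(v, xs, v) \<in> qpaths Q \<Longrightarrow> x \<in> carrier M \<Longrightarrow> poly_elt v xs (p * q) \<odot> x = poly_elt v xs p \<odot> (poly_elt v xs q \<odot> x)"
  by (simp add: poly_elt_mult act_mult poly_elt_closed)

lemma poly_act_add:
  "(v, xs, v) \<in> qpaths Q \<Longrightarrow> x \<in> carrier M \<Longrightarrow> poly_elt v xs (p + q) \<odot> x = poly_elt v xs p \<odot> x \<oplus> poly_elt v xs q \<odot> x"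
  by (simp add: poly_elt_add act_add poly_elt_closed)

lemma poly_act_pCons:
  assumes "(v, xs, v) \<in> qpaths Q" "x \<in> carrier M"
  shows "poly_elt v xs (pCons a p) \<odot> x = vertex_elt v a \<odot> x \<oplus> path_elt v xs v \<odot> (poly_elt v xs p \<odot> x)"
proof -
  have "pCons a p = [:a:] + [:0, 1:] * p" by simp
  then show ?thesis
    using assms by (metis poly_act_add poly_act_mult poly_elt_const poly_elt_X)
qed

lemma poly_act_pCons_0:
  assumes "(v, xs, v) \<in> qpaths Q" "x \<in> carrier M"
  shows "poly_elt v xs (pCons 0 p) \<odot> x = path_elt v xs v \<odot> (poly_elt v xs p \<odot> x)"
  using assms by (simp add: poly_act_pCons vertex_elt_zero path_elt_closed poly_elt_closed)

lemma poly_act_1: "vertex_elt v 1 \<odot> x = x \<Longrightarrow> poly_elt v xs 1 \<odot> x = x"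
  by (simp add: poly_elt_const one_pCons)

lemma poly_act_path:
  assumes "(v, xs, v) \<in> qpaths Q" "x \<in> carrier M"
  shows "poly_elt v xs p \<odot> (path_elt v xs v \<odot> x) = path_elt v xs v \<odot> (poly_elt v xs p \<odot> x)"
  using poly_act_mult[OF assms, of p "[:0, 1:]"] poly_act_mult[OF assms, of "[:0, 1:]" p]
  by (simp add: poly_elt_X mult.commute)

lemma poly_act_commute:
  assumes "(v, xs, v) \<in> qpaths Q" "x \<in> carrier M"
  shows "poly_elt v xs p \<odot> (poly_elt v xs q \<odot> x) = poly_elt v xs q \<odot> (poly_elt v xs p \<odot> x)"
  using poly_act_mult[OF assms, of p q] poly_act_mult[OF assms, of q p] by (simp add: mult.commute)

lemma linear_on_add:
  assumes "linear_on (\<Lambda> Q \<rho>) X M g" "linear_on (\<Lambda> Q \<rho>) X M h"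
  shows "linear_on (\<Lambda> Q \<rho>) X M (\<lambda>x. g x \<oplus> h x)"
  using assms by (simp add: linear_on_def smult_r_distr a_ac)

lemma submodule_linear_image:
  fixes X :: "(('v, 'a, 'k) alg_elt, 'x) module"
  assumes X: "left_module (\<Lambda> Q \<rho>) X" and Y: "submodule Y (\<Lambda> Q \<rho>) X" and g: "linear_on (\<Lambda> Q \<rho>) X M g"
  shows "submodule (g ` Y) (\<Lambda> Q \<rho>) M"
proof -
  interpret X: algebra_module Q \<rho> X
    using X string_algebra_axioms by (simp add: algebra_module_def)
  have "linear_on (\<Lambda> Q \<rho>) (X\<lparr>carrier := Y\<rparr>) M g"
    using g X.submoduleD(1)[OF Y] by (simp add: linear_on_def subset_iff)
  from linear_on_image_submodule[OF this X.submodule_left_module[OF Y]] show ?thesis by simp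
qed

text \<open>
  The map \<open>\<phi> = \<eta> + \<theta>\<close> replaces \<open>b\<close> by \<open>r(P) b + s(P) m\<close>, where \<open>r f + s c = 1\<close>.
  Modulo \<open>\<eta>(Y) + N'\<close>, on which \<open>\<phi>\<close> and \<open>\<eta>\<close> agree, \<open>f(P)\<close> sends this element to \<open>b\<close> and \<open>c(P)\<close>
  sends it to \<open>m\<close>.
\<close>

lemma split_off_extension:
  fixes X :: "(('v, 'a, 'k) alg_elt, 'x) module"
  assumes X: "left_module (\<Lambda> Q \<rho>) X" and eta: "linear_on (\<Lambda> Q \<rho>) X M \<eta>" "inj_on \<eta> (carrier X)"
    and N': "submodule N' (\<Lambda> Q \<rho>) M" and disjoint: "\<eta> ` carrier X \<inter> N' \<subseteq> {\<zero>}"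
    and max: "\<And>H. submodule H (\<Lambda> Q \<rho>) M \<Longrightarrow> \<eta> ` carrier X \<subseteq> H \<Longrightarrow> N' \<subseteq> H \<Longrightarrow> m \<in> H \<Longrightarrow> H = carrier M"
    and cycle: "(v, xs, v) \<in> qpaths Q"
    and m: "m \<in> carrier M" "vertex_elt v 1 \<odot> m = m"
    and Y: "submodule Y (\<Lambda> Q \<rho>) X" and b: "b \<in> carrier X" "vertex_elt v 1 \<odot>\<^bsub>X\<^esub> b = b"
    and f: "irreducible f" "poly f 0 = 1" and c: "\<not> f dvd c" "poly c 0 = 0"
    and rel: "poly_elt v xs f \<odot> m = \<eta> (poly_elt v xs c \<odot>\<^bsub>X\<^esub> b \<oplus>\<^bsub>X\<^esub> y) \<oplus> n'" "y \<in> Y" "n' \<in> N'"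
    and hom: "\<And>u. u \<in> carrier M \<Longrightarrow> \<exists>\<theta>. linear_on (\<Lambda> Q \<rho>) X M \<theta> \<and> (\<forall>y\<in>Y. \<theta> y = \<zero>) \<and>
      \<theta> b = path_elt v xs v \<odot> u \<and> (\<forall>H. submodule H (\<Lambda> Q \<rho>) M \<longrightarrow> u \<in> H \<longrightarrow> \<theta> ` carrier X \<subseteq> H)"
    and push: "\<And>x. x \<in> carrier X \<Longrightarrow> x \<notin> Y \<Longrightarrow> \<exists>q\<in>carrier (\<Lambda> Q \<rho>). \<exists>h. \<exists>y\<in>Y.
      q \<odot>\<^bsub>X\<^esub> x = poly_elt v xs h \<odot>\<^bsub>X\<^esub> b \<oplus>\<^bsub>X\<^esub> y \<and> poly_elt v xs h \<odot>\<^bsub>X\<^esub> b \<notin> Y"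
  shows "\<exists>\<phi>. linear_on (\<Lambda> Q \<rho>) X M \<phi> \<and> inj_on \<phi> (carrier X) \<and> is_direct_sum2 (\<Lambda> Q \<rho>) M (\<phi> ` carrier X) N'"
proof -
  interpret X: algebra_module Q \<rho> X
    using X string_algebra_axioms by (simp add: algebra_module_def)
  let ?P = "path_elt v xs v :: ('v, 'a, 'k) alg_elt" and ?e = "poly_elt v xs :: 'k poly \<Rightarrow> ('v, 'a, 'k) alg_elt"
  have P [simp]: "?P \<in> carrier (\<Lambda> Q \<rho>)" by (rule path_elt_closed[OF cycle])
  have e [simp]: "?e p \<in> carrier (\<Lambda> Q \<rho>)" for p by (rule poly_elt_closed[OF cycle])
  note eta1 = linear_onD[OF eta(1)] and Y1 = X.submoduleD[OF Y] and N1 = submoduleD[OF N']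
  note eta0 = linear_on_zero[OF eta(1) X.abelian_group_axioms abelian_group_axioms]
  have v: "v \<in> verts Q" using qpaths_verts[OF cycle] by simp
  \<comment> \<open>The Bezout coefficients are 1 + T r and T s in the present names. Consequently
    (1 + P r(P)) b + P s(P) m = b + P u for the \<open>u\<close> defined next, and
    \<open>hom\<close> provides a map with exactly this correction.\<close>
  obtain r s where rs: "pCons 1 r * f + pCons 0 s * c = 1"
    using irreducible_poly_bezout_coeff_0[OF f(1) c(1) f(2) c(2)] by blast
  define u where "u = ?e r \<odot> \<eta> b \<oplus> ?e s \<odot> m"
  have eb: "\<eta> b \<in> carrier M" "vertex_elt v 1 \<odot> \<eta> b = \<eta> b"
    using eta1(1)[OF b(1)] eta1(3)[OF vertex_elt_closed[OF v] b(1), of 1] b(2) by simp_all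
  have u: "u \<in> carrier M" using eb m by (simp add: u_def)
  obtain \<theta> where theta: "linear_on (\<Lambda> Q \<rho>) X M \<theta>" "\<And>y. y \<in> Y \<Longrightarrow> \<theta> y = \<zero>" "\<theta> b = ?P \<odot> u"
    "\<And>H. submodule H (\<Lambda> Q \<rho>) M \<Longrightarrow> u \<in> H \<Longrightarrow> \<theta> ` carrier X \<subseteq> H"
    using hom[OF u] by blast
  define \<phi> where "\<phi> x = \<eta> x \<oplus> \<theta> x" for x
  have phi: "linear_on (\<Lambda> Q \<rho>) X M \<phi>"
    using linear_on_add[OF eta(1) theta(1)] by (simp add: \<phi>_def[abs_def])
  note phi1 = linear_onD[OF phi]
  have phiY: "\<phi> y = \<eta> y" if "y \<in> Y" for y
    using that theta(2) eta1(1) Y1(1) by (simp add: \<phi>_def subset_iff)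
  have phib: "\<phi> b = ?e (pCons 1 r) \<odot> \<eta> b \<oplus> ?e (pCons 0 s) \<odot> m"
    using eb m by (simp add: \<phi>_def theta(3) u_def poly_act_pCons[OF cycle] smult_r_distr a_assoc
        vertex_elt_zero)
  define w where "w = \<eta> y \<oplus> n'"
  \<comment> \<open>All error terms are collected in \<open>K\<close>: it contains \<open>w\<close>,
    and it lies in the image of \<phi> plus N', because \<phi> and \<eta> agree on
    \<open>Y\<close>.\<close>
  define K where "K = \<eta> ` Y <+>\<^bsub>M\<^esub> N'"
  have etaY: "submodule (\<eta> ` Y) (\<Lambda> Q \<rho>) M" by (rule submodule_linear_image[OF X Y eta(1)])
  have K: "submodule K (\<Lambda> Q \<rho>) M" unfolding K_def by (rule submodule_sum2[OF etaY N'])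
  note K1 = submoduleD[OF K]
  have w: "w \<in> K"
    using rel(2,3) unfolding w_def K_def sum2_mem by blast
  have wc: "w \<in> carrier M" using w K1(1) by blast
  have n'c: "n' \<in> carrier M" using rel(3) N1(1) by auto
  have yc: "y \<in> carrier X" using rel(2) Y1(1) by auto
  have rel': "?e f \<odot> m = ?e c \<odot> \<eta> b \<oplus> w"
    using rel(1) b yc n'c eta1(1)[OF yc] eta1(2)[of "?e c \<odot>\<^bsub>X\<^esub> b" y] eta1(3)[OF e b(1)] eb
    by (simp add: w_def a_assoc)
  have phibc: "\<phi> b \<in> carrier M" using phi1(1)[OF b(1)] .
  have 1: "?e f \<odot> \<phi> b = \<eta> b \<oplus> ?e (pCons 0 s) \<odot> w"
  proof -
    have "?e f \<odot> \<phi> b = ?e (pCons 1 r) \<odot> (?e f \<odot> \<eta> b) \<oplus> ?e (pCons 0 s) \<odot> (?e f \<odot> m)"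
      using eb m by (simp add: phib smult_r_distr poly_act_commute[OF cycle, of _ f])
    also have "\<dots> = ?e (pCons 1 r * f + pCons 0 s * c) \<odot> \<eta> b \<oplus> ?e (pCons 0 s) \<odot> w"
      unfolding rel' using eb wc by (simp add: smult_r_distr a_assoc poly_act_add[OF cycle] poly_act_mult[OF cycle] del: mult_pCons_left)
    finally show ?thesis unfolding rs using poly_act_1[OF eb(2)] by simp
  qed
  have 2: "?e c \<odot> \<phi> b \<oplus> ?e (pCons 1 r) \<odot> w = m"
  proof -
    have "?e c \<odot> \<phi> b \<oplus> ?e (pCons 1 r) \<odot> w = ?e (pCons 1 r) \<odot> (?e c \<odot> \<eta> b \<oplus> w) \<oplus> ?e (pCons 0 s) \<odot> (?e c \<odot> m)"
      using eb m wc by (simp add: phib smult_r_distr poly_act_commute[OF cycle, of _ c] a_ac)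
    also have "\<dots> = ?e (pCons 1 r * f + pCons 0 s * c) \<odot> m"
      unfolding rel'[symmetric] using eb m by (simp add: poly_act_add[OF cycle] poly_act_mult[OF cycle] del: mult_pCons_left)
    finally show ?thesis unfolding rs using poly_act_1[OF m(2)] by simp
  qed
  let ?I = "\<phi> ` carrier X"
  have I: "submodule ?I (\<Lambda> Q \<rho>) M" by (rule linear_on_image_submodule[OF phi X])
  define H where "H = ?I <+>\<^bsub>M\<^esub> N'"
  have H: "submodule H (\<Lambda> Q \<rho>) M" unfolding H_def by (rule submodule_sum2[OF I N'])
  note H1 = submoduleD[OF H] and HI = sum2_upper[OF I N', folded H_def]
  have KH: "K \<subseteq> H"
  proof
    fix z assume "z \<in> K"
    then obtain y1 n1 where z: "y1 \<in> Y" "n1 \<in> N'" "z = \<eta> y1 \<oplus> n1" by (auto simp: K_def sum2_mem)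
    then have "\<phi> y1 \<in> ?I" using Y1(1) by auto
    then show "z \<in> H" using z phiY[OF z(1)] unfolding H_def sum2_mem by (intro bexI[of _ "\<phi> y1"] bexI[of _ n1]) auto
  qed
  have bH: "\<phi> b \<in> H" using HI(1) b(1) by auto
  have mH: "m \<in> H" using 2 H1(3)[OF H1(5)[OF e bH] H1(5)[OF e]] KH w by (metis subsetD)
  have "\<eta> b \<oplus> ?e (pCons 0 s) \<odot> w \<ominus> ?e (pCons 0 s) \<odot> w \<in> H"
    using 1 H1(6)[OF H1(5)[OF e bH] H1(5)[OF e]] KH w by (metis subsetD)
  then have ebH: "\<eta> b \<in> H" using eb wc by (simp add: a_minus_def a_assoc r_neg)
  have uH: "u \<in> H" unfolding u_def using H1(3,5) ebH mH by simp
  \<comment> \<open>Here the last clause of \<open>hom\<close> enters: \<theta> takes its values in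
    every submodule containing \<open>u\<close>, so \<eta> x = \<phi> x - \<theta> x stays in
    \<open>H\<close>.\<close>
  have etaH: "\<eta> ` carrier X \<subseteq> H"
  proof
    fix z assume "z \<in> \<eta> ` carrier X"
    then obtain x where x: "x \<in> carrier X" "z = \<eta> x" by blast
    have "\<phi> x \<ominus> \<theta> x \<in> H"
      using H1(6) HI(1) theta(4)[OF H uH] x(1) by blast
    then show "z \<in> H"
      using x eta1(1) linear_onD(1)[OF theta(1)] by (simp add: \<phi>_def a_minus_def a_assoc r_neg)
  qed
  have Hall: "H = carrier M" by (rule max[OF H etaH HI(2) mH])
  \<comment> \<open>If x were outside \<open>Y\<close>, \<open>push\<close> would yield h(P) b
    outside \<open>Y\<close> with h(P) \<phi>(b) in \<open>K\<close>. Applying f(P) recovers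
    \<eta>(b) from \<phi>(b) modulo \<open>K\<close>, so h(P) \<eta>(b) lies in \<open>K\<close>; as
    the image of \<eta> meets N' trivially and \<eta> is injective, h(P) b lies in \<open>Y\<close>
    after all. For x in \<open>Y\<close> the claim is one about \<eta>.\<close>
  have ker: "x = \<zero>\<^bsub>X\<^esub>" if x: "x \<in> carrier X" "\<phi> x \<in> N'" for x
  proof -
    have "x \<in> Y"
    proof (rule ccontr)
      assume "x \<notin> Y"
      then obtain q h y1 where q: "q \<in> carrier (\<Lambda> Q \<rho>)" "y1 \<in> Y" "q \<odot>\<^bsub>X\<^esub> x = ?e h \<odot>\<^bsub>X\<^esub> b \<oplus>\<^bsub>X\<^esub> y1"
        "?e h \<odot>\<^bsub>X\<^esub> b \<notin> Y"
        using push[OF x(1)] by blast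
      have y1: "y1 \<in> carrier X" using q(2) Y1(1) by auto
      have "?e h \<odot> \<phi> b \<oplus> \<eta> y1 = q \<odot> \<phi> x"
        using phi1(3)[OF q(1) x(1)] phi1(2)[of "?e h \<odot>\<^bsub>X\<^esub> b" y1] phi1(3)[OF e b(1)] q(3) y1 b(1) phiY[OF q(2)]
        by simp
      then have "?e h \<odot> \<phi> b \<oplus> \<eta> y1 \<in> K"
        using N1(5)[OF q(1) x(2)] sum2_upper(2)[OF etaY N'] by (auto simp: K_def)
      moreover have "\<eta> y1 \<in> K"
        using q(2) sum2_upper(1)[OF etaY N'] by (auto simp: K_def)
      ultimately have "?e h \<odot> \<phi> b \<oplus> \<eta> y1 \<ominus> \<eta> y1 \<in> K" by (rule K1(6))
      then have "?e h \<odot> \<phi> b \<in> K"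
        using phibc eta1(1)[OF y1] by (simp add: a_minus_def a_assoc r_neg)
      then have "?e f \<odot> (?e h \<odot> \<phi> b) \<in> K" by (rule K1(5)[OF e])
      moreover have "?e f \<odot> (?e h \<odot> \<phi> b) = ?e h \<odot> \<eta> b \<oplus> ?e h \<odot> (?e (pCons 0 s) \<odot> w)"
        using phibc eb wc by (simp add: poly_act_commute[OF cycle, of _ f] 1 smult_r_distr)
      moreover have hw: "?e h \<odot> (?e (pCons 0 s) \<odot> w) \<in> K" using K1(5) w by simp
      ultimately have "?e h \<odot> \<eta> b \<oplus> ?e h \<odot> (?e (pCons 0 s) \<odot> w) \<ominus> ?e h \<odot> (?e (pCons 0 s) \<odot> w) \<in> K"
        using K1(6)[OF _ hw] by simp
      then have "?e h \<odot> \<eta> b \<in> K"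
        using eb wc by (simp add: a_minus_def a_assoc r_neg)
      then obtain y2 n2 where yn: "y2 \<in> Y" "n2 \<in> N'" "\<eta> (?e h \<odot>\<^bsub>X\<^esub> b) = \<eta> y2 \<oplus> n2"
        using eta1(3)[OF e b(1)] by (auto simp: K_def sum2_mem)
      have y2: "y2 \<in> carrier X" using yn(1) Y1(1) by auto
      have "\<eta> (?e h \<odot>\<^bsub>X\<^esub> b \<ominus>\<^bsub>X\<^esub> y2) \<oplus> \<eta> y2 = \<eta> y2 \<oplus> n2"
        using eta1(2)[of "?e h \<odot>\<^bsub>X\<^esub> b \<ominus>\<^bsub>X\<^esub> y2" y2] y2 b(1) yn(3) by (simp add: X.diff_add_cancel)
      moreover have hy: "?e h \<odot>\<^bsub>X\<^esub> b \<ominus>\<^bsub>X\<^esub> y2 \<in> carrier X" using y2 b(1) by simp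
      moreover have "n2 \<in> carrier M" using yn(2) N1(1) by auto
      ultimately have "\<eta> (?e h \<odot>\<^bsub>X\<^esub> b \<ominus>\<^bsub>X\<^esub> y2) = n2"
        using eta1(1)[OF hy] eta1(1)[OF y2] a_comm[of "\<eta> y2" n2] by (simp add: add.right_cancel)
      then have "\<eta> (?e h \<odot>\<^bsub>X\<^esub> b \<ominus>\<^bsub>X\<^esub> y2) \<in> \<eta> ` carrier X \<inter> N'"
        using hy yn(2) by auto
      then have "\<eta> (?e h \<odot>\<^bsub>X\<^esub> b \<ominus>\<^bsub>X\<^esub> y2) = \<eta> \<zero>\<^bsub>X\<^esub>"
        using disjoint eta0 by auto
      then have "?e h \<odot>\<^bsub>X\<^esub> b \<ominus>\<^bsub>X\<^esub> y2 = \<zero>\<^bsub>X\<^esub>"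
        using eta(2) y2 b(1) by (simp add: inj_on_eq_iff)
      then have "?e h \<odot>\<^bsub>X\<^esub> b = y2" using y2 b(1) by (simp add: X.diff_eq_zero)
      then show False using q(4) yn(1) by simp
    qed
    then have "\<eta> x \<in> N'" using x(2) phiY by simp
    then have "\<eta> x = \<eta> \<zero>\<^bsub>X\<^esub>" using disjoint x(1) eta0 by auto
    then show ?thesis using eta(2) x(1) by (simp add: inj_on_eq_iff)
  qed
  have phi0: "\<phi> \<zero>\<^bsub>X\<^esub> = \<zero>" by (rule linear_on_zero[OF phi X.abelian_group_axioms abelian_group_axioms])
  have "inj_on \<phi> (carrier X)"
  proof (rule inj_onI)
    fix x x' assume x: "x \<in> carrier X" "x' \<in> carrier X" "\<phi> x = \<phi> x'"
    have "\<phi> (x \<ominus>\<^bsub>X\<^esub> x') \<oplus> \<phi> x' = \<zero> \<oplus> \<phi> x'"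
      using phi1(2)[of "x \<ominus>\<^bsub>X\<^esub> x'" x'] x phi1(1) by (simp add: X.diff_add_cancel)
    then have "\<phi> (x \<ominus>\<^bsub>X\<^esub> x') = \<zero>"
      using phi1(1) x by (simp add: add.right_cancel del: l_zero)
    then have "x \<ominus>\<^bsub>X\<^esub> x' = \<zero>\<^bsub>X\<^esub>" using ker x N1(2) by simp
    then show "x = x'" using x by (simp add: X.diff_eq_zero)
  qed
  moreover have "is_direct_sum2 (\<Lambda> Q \<rho>) M ?I N'"
  proof -
    have "?I \<inter> N' = {\<zero>}"
    proof
      show "?I \<inter> N' \<subseteq> {\<zero>}" using ker phi0 by auto
      show "{\<zero>} \<subseteq> ?I \<inter> N'" using N1(2) submoduleD(2)[OF I] by simp
    qed
    then show ?thesis using I N' Hall by (simp add: is_direct_sum2_def H_def)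
  qed
  ultimately show ?thesis using phi by blast
qed

end

section \<open>Primitive cycles\<close>

text \<open>Agrees literally with the word inside \<open>z_elt\<close>, so that the cycles summed
  there can be compared with \<open>xs\<close>.\<close>

definition cycle_word :: "'a list \<Rightarrow> ('v, 'a) word" where
  "cycle_word xs =
     Letters (\<lambda>i. if 1 \<le> i \<and> i \<le> int (length xs) then Some (Dir (xs ! nat (i - 1))) else None)"

text \<open>The periodic extension of the list, counted from 1 like the letters of a word; in
  particular number 0 is the last arrow, the one that the cycle applies first.\<close>

definition cyclic :: "'a list \<Rightarrow> int \<Rightarrow> 'a" where
  "cyclic xs t = xs ! nat ((t - 1) mod int (length xs))"

lemma primitive_cycle_cycle_word:
  assumes "primitive_cycle Q \<rho> P"
  shows "\<exists>xs. P = cycle_word xs"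
proof (cases P)
  case (Trivial v e)
  then show ?thesis using assms by (simp add: primitive_cycle_def word_length_def)
next
  case (Letters L)
  have dom: "(\<exists>n\<ge>1. dom L = {1..n}) \<or> dom L = {1..} \<or> dom L = {..0} \<or> dom L = UNIV" and fin: "finite (dom L)"
    using assms by (simp_all add: Letters primitive_cycle_def finite_word_def)
  from dom fin obtain n where n: "n \<ge> 1" "dom L = {1..n}"
    using infinite_UNIV_int infinite_Ici infinite_Iic by metis
  define xs where "xs = map (\<lambda>i. letter_arrow (the (L i))) [1..n]"
  have len: "int (length xs) = n" using n by (simp add: xs_def)
  have "L i = (if 1 \<le> i \<and> i \<le> int (length xs) then Some (Dir (xs ! nat (i - 1))) else None)" for i
  proof (cases "1 \<le> i \<and> i \<le> n")
    case True
    then have "i \<in> dom L" using n by simp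
    then obtain l where l: "L i = Some l" by blast
    then obtain x where x: "l = Dir x"
      using assms by (auto simp: Letters primitive_cycle_def direct_word_def ran_def)
    have "xs ! nat (i - 1) = x"
      using True l x by (simp add: xs_def nth_upto)
    then show ?thesis using True len l x by simp
  next
    case False
    then have "i \<notin> dom L" using n by simp
    then show ?thesis using False len by (auto simp: dom_def)
  qed
  then show ?thesis unfolding Letters cycle_word_def by blast
qed

locale primitive_path = string_algebra Q \<rho>
  for Q :: "('v, 'a) pre_digraph" and \<rho> :: "'a list set" +
  fixes xs :: "'a list"
  assumes primitive: "primitive_cycle Q \<rho> (cycle_word xs :: ('v, 'a) word)"
begin

abbreviation n :: int where "n \<equiv> int (length xs)"
abbreviation p :: "int \<Rightarrow> 'a" where "p \<equiv> cyclic xs"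
abbreviation base :: 'v where "base \<equiv> head Q (p 1)"

lemma word_length_cycle_word: "word_length (cycle_word ys :: ('v, 'a) word) = length ys"
proof -
  have "dom (letters (cycle_word ys :: ('v, 'a) word)) = {1..int (length ys)}"
    by (auto simp: cycle_word_def dom_def)
  then show ?thesis by (simp add: word_length_def)
qed

lemma n_pos: "0 < n"
  using primitive by (simp add: primitive_cycle_def word_length_cycle_word)

lemma cyclic_nth: "s < length xs \<Longrightarrow> p (int s + 1) = xs ! s"
  by (simp add: cyclic_def)

lemma power_biinf_eq: "power_biinf (cycle_word xs :: ('v, 'a) word) = Letters (\<lambda>i. Some (Dir (p i)))"
proof -
  have "0 \<le> (i - 1) mod n \<and> (i - 1) mod n + 1 \<le> n" for i
    using n_pos pos_mod_bound[of n "i - 1"] by (simp add: add1_zle_eq)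
  then show ?thesis
    unfolding power_biinf_def word_length_cycle_word by (auto simp: cycle_word_def cyclic_def fun_eq_iff)
qed

lemma periodic_power: "periodic_word Q \<rho> (power_biinf (cycle_word xs))"
  and period_power: "period (power_biinf (cycle_word xs :: ('v, 'a) word)) = length xs"
  using primitive by (simp_all add: primitive_cycle_def word_length_cycle_word)

lemma is_word_power: "is_word Q \<rho> (Letters (\<lambda>i. Some (Dir (p i))))"
  using periodic_power unfolding periodic_word_def power_biinf_eq by blast

lemma p_arc: "p t \<in> arcs Q"
  using is_word_letters(1)[OF is_word_power, of t "Dir (p t)"] by simp

lemma p_consecutive: "tail Q (p t) = head Q (p (t + 1))"
  using is_word_consecutive(1)[OF is_word_power, of t "Dir (p t)" "Dir (p (t + 1))"] by simp

lemma p_not_relation: "[p t, p (t + 1)] \<notin> \<rho>"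
proof
  assume "[p t, p (t + 1)] \<in> \<rho>"
  from is_word_relation(1)[OF is_word_power this, of t] obtain j where "j < length [p t, p (t + 1)]" "p (t + int j) \<noteq> [p t, p (t + 1)] ! j"
    by force
  then show False by (cases j) auto
qed

lemma p_periodic: "p (t + n * a) = p t"
proof -
  have "(t + n * a - 1) mod n = (t - 1) mod n" by (simp add: algebra_simps flip: mod_mult_self1[of "t - 1" a n])
  then show ?thesis by (simp add: cyclic_def)
qed

text \<open>Otherwise the remainder of \<open>t\<close> modulo \<open>n\<close> would be a positive
  period smaller than \<open>n\<close>, against the minimality of the period of a primitive
  cycle.\<close>

lemma p_shift_dvd:
  assumes "\<And>s. p (s + t) = p s"
  shows "n dvd t"
proof (rule ccontr)
  assume "\<not> n dvd t"
  let ?r = "t mod n"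
  have r: "0 < ?r" "?r < n"
    using n_pos \<open>\<not> n dvd t\<close> by (simp_all add: dvd_eq_mod_eq_0 order.not_eq_order_implies_strict[OF not_sym])
  have "p (s + ?r) = p s" for s
    using p_periodic[of "s + ?r" "t div n"] assms[of s] by (simp add: add.assoc)
  then have "power_biinf (cycle_word xs :: ('v, 'a) word) = shift_word (power_biinf (cycle_word xs)) (int (nat ?r))"
    using r by (simp add: power_biinf_eq shift_word_def)
  then have "period (power_biinf (cycle_word xs :: ('v, 'a) word)) \<le> nat ?r"
    unfolding period_def using r by (intro Least_le) simp
  then show False using r by (simp add: period_power)
qed

lemma xs_eq: "xs = map p [1..n]"
  by (rule nth_equalityI) (simp_all add: nth_upto cyclic_nth[symmetric] add.commute)

lemma base_shift: "head Q (p (n * a + 1)) = base"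
  using p_periodic[of 1 a] by (simp add: add.commute)

lemma segment_path:
  assumes "a \<le> b"
  shows "(head Q (p (a + 1)), map p [a + 1..b], head Q (p (b + 1))) \<in> qpaths Q"
proof -
  have "(head Q (p (b - int m + 1)), map p [b - int m + 1..b], head Q (p (b + 1))) \<in> qpaths Q" for m
  proof (induction m)
    case 0
    then show ?case using p_arc[of "b + 1"] by (simp add: qpaths_Nil)
  next
    case (Suc m)
    have "[b - int (Suc m) + 1..b] = (b - int m) # [b - int m + 1..b]"
      by (subst upto_rec1) simp_all
    then show ?case
      using Suc p_arc[of "b - int m"] p_consecutive[of "b - int m"] by (simp add: qpaths_Cons)
  qed
  from this[of "nat (b - a)"] show ?thesis using assms by simp
qed

lemma cycle_path: "(base, xs, base) \<in> qpaths Q"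
  using segment_path[of 0 n] base_shift[of 1] n_pos by (simp flip: xs_eq)

text \<open>By the string algebra axiom, at most one arrow has a nonzero product with
  \<open>p (t + 1)\<close> on its right, and \<open>p t\<close> is such an arrow because the
  periodic word contains no zero relation. This is the source of all vanishing along the
  cycle.\<close>

lemma other_arrow_annihilates:
  assumes "y \<in> arcs Q" "y \<noteq> p t"
  shows "arrow_elt y \<otimes>\<^bsub>\<Lambda> Q \<rho>\<^esub> arrow_elt (p (t + 1)) = (\<zero>\<^bsub>\<Lambda> Q \<rho>\<^esub> :: ('v, 'a, 'k::field) alg_elt)"
proof (rule arrow_elt_mult_relation[OF assms(1) p_arc])
  assume "tail Q y = head Q (p (t + 1))"
  then show "[y, p (t + 1)] \<in> \<rho>"
    using left_unique[of y "p t" "p (t + 1)"] assms p_arc p_consecutive[of t] p_not_relation[of t] by blast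
qed

end

section \<open>Rays along a primitive cycle\<close>

text \<open>
  Read in direction \<open>d\<close>, the word is \<open>\<dots> p\<^sub>-\<^sub>1 p\<^sub>0 | p\<^sub>1 \<dots> p\<^sub>k\<close> around the position \<open>i\<close>, and then either
  ends or continues with an inverse letter; \<open>i\<close> is the peak.
\<close>

locale ray = primitive_path Q \<rho> xs
  for Q :: "('v, 'a) pre_digraph" and \<rho> :: "'a list set" and xs :: "'a list" +
  fixes C :: "('v, 'a) word" and d i k :: int
  assumes word: "is_word Q \<rho> C" and direction: "d \<in> {1, -1}" and k_bounds: "0 \<le> k" "k < n"
    and ray_letter: "\<And>t. t \<le> k \<Longrightarrow> oriented_letter C d i t = Some (Dir (p t))"
    and ray_end: "\<And>x. oriented_letter C d i (k + 1) \<noteq> Some (Dir x)"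
begin

abbreviation pos :: "int \<Rightarrow> int" where "pos t \<equiv> i + d * t"

text \<open>The positions up to \<open>k\<close> beyond the peak belong to the zone: the direct
  letters there carry their basis vectors back to the peak, so they could not be left in a
  complementary submodule.\<close>

definition zone :: "int set" where "zone = pos ` {..k}"

lemma direction_nonzero [simp]: "d \<noteq> 0"
  using direction by auto

lemma pos_surj: "j = pos (d * (j - i))"
  using direction by auto

lemma pos_zone [simp]: "pos t \<in> zone \<longleftrightarrow> t \<le> k"
  by (auto simp: zone_def)

lemma pos_index: "t \<le> k \<Longrightarrow> pos t \<in> word_index C"
  using oriented_letter_vertex(4)[OF word direction ray_letter] .

lemma pos_vertex: "t \<le> k \<Longrightarrow> word_vertex Q C (pos t) = head Q (p (t + 1))"
  using oriented_letter_vertex(1)[OF word direction ray_letter] p_consecutive[of t] by simp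

lemma i_index: "i \<in> word_index C" and i_vertex: "word_vertex Q C i = base"
  using pos_index[of 0] pos_vertex[of 0] k_bounds by simp_all

lemma oriented_letter_flip:
  "oriented_letter C (- d) (pos t) s = map_option letter_inv (oriented_letter C d i (t + 1 - s))"
proof (cases "d = 1")
  case True
  then show ?thesis by (simp add: oriented_letter_def algebra_simps)
next
  case False
  then have "d = -1" using direction by simp
  then show ?thesis by (simp add: oriented_letter_def algebra_simps option.map_comp o_def option.map_ident)
qed

lemma reads_segment:
  assumes "a \<le> b" "b \<le> k"
  shows "reads C d (pos b) (map p [a + 1..b])"
  using assms unfolding reads_def oriented_letter_shift[OF direction]
  by (auto simp: nth_upto ray_letter algebra_simps)

lemma reads_oriented:
  assumes "reads C d (pos b) ys" "s < length ys"
  shows "oriented_letter C d i (b + 1 - int (length ys) + int s) = Some (Dir (ys ! s))"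
proof -
  have "oriented_letter C d (pos b) (int s + 1 - int (length ys)) = Some (Dir (ys ! s))"
    using assms by (simp add: reads_def)
  then show ?thesis
    unfolding oriented_letter_shift[OF direction] by (simp add: algebra_simps)
qed

lemma not_reads_backwards:
  assumes "a + int (length ys) \<le> k" "ys \<noteq> []"
  shows "\<not> reads C (- d) (pos a) ys"
proof
  assume "reads C (- d) (pos a) ys"
  then have "oriented_letter C (- d) (pos a) (1 - int (length ys)) = Some (Dir (ys ! 0))"
    using assms(2) by (auto simp: reads_def)
  then show False
    using ray_letter[OF assms(1)] by (simp add: oriented_letter_flip)
qed

text \<open>A path reaching the zone must come down the ray. Arriving from the other side would mean
  crossing, as an inverse letter, some letter numbered at most \<open>k\<close>, and these are
  direct.\<close>

lemma arrows_target:
  assumes "Poly_Mapping.lookup (foldr (arrow_op C) ys (Poly_Mapping.single j c)) (pos t) \<noteq> 0" "t \<le> k" "ys \<noteq> []"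
  shows "j = pos (t + int (length ys)) \<and> reads C d j ys"
proof -
  have "reads C d j ys \<or> reads C (- d) j ys"
  proof (rule ccontr)
    assume "\<not> (reads C d j ys \<or> reads C (- d) j ys)"
    then have "\<not> reads C 1 j ys" "\<not> reads C (- 1) j ys" using direction by auto
    then show False using assms(1) reads_fail[OF word, of j ys c] by simp
  qed
  then show ?thesis
  proof
    assume R: "reads C d j ys"
    then have "j - d * int (length ys) = pos t"
      using assms(1,3) reads_step[OF word direction, of j ys c] by (auto simp: lookup_single when_def split: if_splits)
    then show ?thesis using R by (simp add: algebra_simps)
  next
    assume R: "reads C (- d) j ys"
    then have "j + d * int (length ys) = pos t"
      using assms(1,3) reads_step[OF word _ R, of c] direction by (auto simp: lookup_single when_def split: if_splits)
    then have "j = pos (t - int (length ys))" by (simp add: algebra_simps)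
    then show ?thesis using not_reads_backwards[of "t - int (length ys)" ys] assms(2,3) R by simp
  qed
qed

text \<open>To end at \<open>pos t\<close>, the cycle must be read along the letters
  \<open>t + 1\<close> to \<open>t + n\<close>. They cannot include letter \<open>k + 1\<close>, so
  t + n \<le> k < n and t is negative. All these letters then also belong to the ray, so the cycle
  agrees with its own shift by \<open>t\<close>, and primitivity gives divisibility.\<close>

lemma cycle_target:
  assumes "Poly_Mapping.lookup (foldr (arrow_op C) xs (Poly_Mapping.single j c)) (pos t) \<noteq> 0" "t \<le> k"
  shows "n dvd t" "t < 0"
proof -
  have "xs \<noteq> []" using n_pos by auto
  from arrows_target[OF assms this] have R: "reads C d (pos (t + n)) xs" by metis
  have W: "oriented_letter C d i (t + 1 + int s) = Some (Dir (xs ! s))" if "s < length xs" for s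
    using reads_oriented[OF R that] by (simp add: algebra_simps)
  have tn: "t + n \<le> k"
  proof (rule ccontr)
    assume "\<not> t + n \<le> k"
    then have "nat (k - t) < length xs" "t + 1 + int (nat (k - t)) = k + 1" using assms(2) by auto
    then show False using W[of "nat (k - t)"] ray_end by metis
  qed
  then show "t < 0" using k_bounds by simp
  have "p (s + t) = p s" for s
  proof -
    define s' where "s' = nat ((s - 1) mod n)"
    have s': "s' < length xs" "int s' = (s - 1) mod n" using n_pos by (simp_all add: s'_def nat_less_iff)
    have "s = int s' + 1 + n * ((s - 1) div n)" unfolding s'(2) by (simp add: algebra_simps flip: minus_div_mult_eq_mod)
    then have eq: "int s' + 1 + n * ((s - 1) div n) = s" "int s' + 1 + t + n * ((s - 1) div n) = s + t"
      by linarith+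
    have "p s = p (int s' + 1)" "p (s + t) = p (int s' + 1 + t)"
      using p_periodic[of "int s' + 1" "(s - 1) div n"] p_periodic[of "int s' + 1 + t" "(s - 1) div n"]
      unfolding eq by simp_all
    moreover have "p (int s' + 1 + t) = p (int s' + 1)"
      using W[OF s'(1)] ray_letter[of "t + 1 + int s'"] tn s'(1) cyclic_nth[OF s'(1)] by (simp add: algebra_simps)
    ultimately show ?thesis by simp
  qed
  then show "n dvd t" by (rule p_shift_dvd)
qed

end

lemma (in string_algebra) word_vertex_verts:
  assumes "is_word Q \<rho> C" "j \<in> word_index C"
  shows "word_vertex Q C j \<in> verts Q"
proof (cases C)
  case (Trivial v e)
  then show ?thesis using assms(1) by simp
next
  case (Letters L)
  have head: "letter_head Q l \<in> verts Q \<and> letter_tail Q l \<in> verts Q" if "letter_arrow l \<in> arcs Q" for l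
    using that by (cases l) simp_all
  consider l where "letters C j = Some l" | l where "letters C (j + 1) = Some l"
    using assms(2) Letters by auto
  then show ?thesis
  proof cases
    case 1
    then show ?thesis using word_vertex_letters(1)[OF assms(1) 1] is_word_letters(1)[OF assms(1) 1] head by simp
  next
    case 2
    then show ?thesis using word_vertex_letters(2)[OF assms(1) 2] is_word_letters(1)[OF assms(1) 2] head by simp
  qed
qed

section \<open>Homomorphisms out of a word module\<close>

context algebra_module
begin

lemma finsum_keys_add:
  fixes x y :: "'b \<Rightarrow>\<^sub>0 'c::comm_monoid_add"
  assumes zero: "\<And>i. i \<in> I \<Longrightarrow> g i 0 = \<zero>" and add: "\<And>i a b. i \<in> I \<Longrightarrow> g i (a + b) = g i a \<oplus> g i b"
    and closed: "\<And>i a. i \<in> I \<Longrightarrow> g i a \<in> carrier M"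
    and keys: "Poly_Mapping.keys x \<subseteq> I" "Poly_Mapping.keys y \<subseteq> I"
  shows "(\<Oplus>i\<in>Poly_Mapping.keys (x + y). g i (Poly_Mapping.lookup (x + y) i)) =
    (\<Oplus>i\<in>Poly_Mapping.keys x. g i (Poly_Mapping.lookup x i)) \<oplus>
    (\<Oplus>i\<in>Poly_Mapping.keys y. g i (Poly_Mapping.lookup y i))"
proof -
  let ?K = "Poly_Mapping.keys x \<union> Poly_Mapping.keys y"
  have K: "?K \<subseteq> I" using keys by simp
  have ext: "(\<Oplus>i\<in>Poly_Mapping.keys z. g i (Poly_Mapping.lookup z i)) = (\<Oplus>i\<in>?K. g i (Poly_Mapping.lookup z i))"
    if "Poly_Mapping.keys z \<subseteq> ?K" for z
    using that K by (intro add.finprod_mono_neutral_cong_left) (auto simp: in_keys_iff zero closed subset_iff)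
  have "(\<Oplus>i\<in>Poly_Mapping.keys (x + y). g i (Poly_Mapping.lookup (x + y) i)) =
      (\<Oplus>i\<in>?K. g i (Poly_Mapping.lookup (x + y) i))"
    by (rule ext) (rule Poly_Mapping.keys_add)
  also have "\<dots> = (\<Oplus>i\<in>?K. g i (Poly_Mapping.lookup x i) \<oplus> g i (Poly_Mapping.lookup y i))"
    using K by (intro add.finprod_cong' refl) (auto simp: lookup_add add closed subset_iff)
  also have "\<dots> = (\<Oplus>i\<in>?K. g i (Poly_Mapping.lookup x i)) \<oplus> (\<Oplus>i\<in>?K. g i (Poly_Mapping.lookup y i))"
    using K by (intro finsum_addf) (auto simp: closed subset_iff)
  finally show ?thesis
    using ext[of x] ext[of y] by simp
qed

lemma arrow_act_vertex_act:
  assumes "x \<in> arcs Q" "w \<in> verts Q" "y \<in> carrier M"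
  shows "arrow_elt x \<odot> (vertex_elt w c \<odot> y) = (if w = tail Q x then vertex_elt (head Q x) c \<odot> (arrow_elt x \<odot> y) else \<zero>)"
proof (cases "w = tail Q x")
  case True
  then show ?thesis
    using vertex_act_path_act_commute[OF arrow_path[OF assms(1)] assms(3), of c] by (simp add: path_elt_arrow)
next
  case False
  have y: "vertex_elt w c \<odot> y \<in> carrier M" using assms by (simp add: vertex_elt_closed)
  have "arrow_elt x \<odot> (vertex_elt w c \<odot> y) = arrow_elt x \<odot> (vertex_elt (tail Q x) 1 \<odot> (vertex_elt w c \<odot> y))"
    using path_act_vertex_act[OF arrow_path[OF assms(1)] y] by (simp add: path_elt_arrow)
  also have "\<dots> = \<zero>"
    using False assms vertex_act_vertex_act[of "tail Q x" w y 1 c] by (simp add: arrow_elt_closed)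
  finally show ?thesis using False by simp
qed

text \<open>Vectors that transform under vertices and arrows as the basis of M(C) does define a
  homomorphism, since vertices and arrows generate the algebra. The family is indexed by the offset
  \<open>t\<close> along the chosen orientation. The final clause allows the image to be located
  without computing it.\<close>

lemma basis_hom:
  fixes C :: "('v, 'a) word" and i d :: int
  assumes C: "is_word Q \<rho> C" and d: "d \<in> {1, -1}"
    and psi: "\<And>t. i + d * t \<in> word_index C \<Longrightarrow> \<psi> t \<in> carrier M"
    and vert: "\<And>t. i + d * t \<in> word_index C \<Longrightarrow> vertex_elt (word_vertex Q C (i + d * t)) 1 \<odot> \<psi> t = \<psi> t"
    and dir: "\<And>t x. i + d * t \<in> word_index C \<Longrightarrow> x \<in> arcs Q \<Longrightarrow> oriented_letter C d i t = Some (Dir x) \<Longrightarrow>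
      arrow_elt x \<odot> \<psi> t = \<psi> (t - 1)"
    and inv: "\<And>t x. i + d * t \<in> word_index C \<Longrightarrow> x \<in> arcs Q \<Longrightarrow> oriented_letter C d i (t + 1) = Some (Inv x) \<Longrightarrow>
      arrow_elt x \<odot> \<psi> t = \<psi> (t + 1)"
    and other: "\<And>t x. i + d * t \<in> word_index C \<Longrightarrow> x \<in> arcs Q \<Longrightarrow> oriented_letter C d i t \<noteq> Some (Dir x) \<Longrightarrow>
      oriented_letter C d i (t + 1) \<noteq> Some (Inv x) \<Longrightarrow> arrow_elt x \<odot> \<psi> t = \<zero>"
  shows "\<exists>\<Psi>. linear_on (\<Lambda> Q \<rho>) (word_module Q C) M \<Psi> \<and>
    (\<forall>t c. i + d * t \<in> word_index C \<longrightarrow>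
      \<Psi> (Poly_Mapping.single (i + d * t) c) = vertex_elt (word_vertex Q C (i + d * t)) c \<odot> \<psi> t) \<and>
    (\<forall>H. submodule H (\<Lambda> Q \<rho>) M \<longrightarrow> (\<forall>t. i + d * t \<in> word_index C \<longrightarrow> \<psi> t \<in> H) \<longrightarrow>
      \<Psi> ` carrier (word_module Q C) \<subseteq> H)"
proof -
  let ?I = "word_index C" and ?X = "word_module Q C :: (('v, 'a, 'k) alg_elt, int \<Rightarrow>\<^sub>0 'k) module"
  define g where "g j c = vertex_elt (word_vertex Q C j) c \<odot> \<psi> (d * (j - i))" for j and c :: 'k
  define \<Psi> where "\<Psi> m = (\<Oplus>j\<in>Poly_Mapping.keys m. g j (Poly_Mapping.lookup m j))" for m
  interpret X: algebra_module Q \<rho> ?X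
    using left_module_word_module[OF C] string_algebra_axioms by (simp add: algebra_module_def)
  have pos: "j = i + d * (d * (j - i))" for j using d by auto
  have psi': "\<psi> (d * (j - i)) \<in> carrier M" if "j \<in> ?I" for j
    using psi[of "d * (j - i)"] that pos[of j] by simp
  have g_closed: "g j c \<in> carrier M" if "j \<in> ?I" for j c
    using psi' that word_vertex_verts[OF C that] by (simp add: g_def vertex_elt_closed)
  have g_zero: "g j 0 = \<zero>" if "j \<in> ?I" for j
    using psi' that by (simp add: g_def vertex_elt_zero)
  have g_add: "g j (a + b) = g j a \<oplus> g j b" if "j \<in> ?I" for j a b
    using psi' that word_vertex_verts[OF C that] by (simp add: g_def vertex_elt_add act_add vertex_elt_closed)
  have Psi_add: "\<Psi> (m + m') = \<Psi> m \<oplus> \<Psi> m'" if "Poly_Mapping.keys m \<subseteq> ?I" "Poly_Mapping.keys m' \<subseteq> ?I" for m m'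
    unfolding \<Psi>_def using that by (intro finsum_keys_add[of ?I]) (simp_all add: g_zero g_add g_closed)
  have Psi_closed: "\<Psi> m \<in> carrier M" if "Poly_Mapping.keys m \<subseteq> ?I" for m
    unfolding \<Psi>_def using that g_closed by (intro finsum_closed) auto
  have Psi_zero: "\<Psi> 0 = \<zero>" by (simp add: \<Psi>_def)
  have Psi_single: "\<Psi> (Poly_Mapping.single j c) = g j c" if "j \<in> ?I" for j c
    using g_closed[OF that] g_zero[OF that] by (cases "c = 0") (simp_all add: \<Psi>_def)
  have keys_act: "Poly_Mapping.keys (a \<odot>\<^bsub>?X\<^esub> m) \<subseteq> ?I" if "a \<in> carrier (\<Lambda> Q \<rho>)" "Poly_Mapping.keys m \<subseteq> ?I" for a m
    using X.act_closed[of a m] that by simp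
  \<comment> \<open>The support condition is carried along in the induction, because additivity of
    \<Psi> holds only for arguments supported in the index set of the word.\<close>
  have by_single: "\<Psi> (a \<odot>\<^bsub>?X\<^esub> m) = a \<odot> \<Psi> m"
    if a: "a \<in> carrier (\<Lambda> Q \<rho>)" and m: "Poly_Mapping.keys m \<subseteq> ?I"
      and single: "\<And>j c. j \<in> ?I \<Longrightarrow> \<Psi> (a \<odot>\<^bsub>?X\<^esub> Poly_Mapping.single j c) = a \<odot> g j c" for a m
  proof -
    have "Poly_Mapping.keys m \<subseteq> ?I \<and> \<Psi> (a \<odot>\<^bsub>?X\<^esub> m) = a \<odot> \<Psi> m"
    proof (induction rule: poly_mapping_single_induct[where x = m])
      case zero
      then show ?case using X.act_zero[OF a] a by (simp add: Psi_zero)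
    next
      case (single j c)
      then have "j \<in> ?I" using m by blast
      then show ?case using that(3)[of j c] Psi_single[of j c] by (simp add: Int_absorb2 subset_eq)
    next
      case (add y z)
      then show ?case
        using Poly_Mapping.keys_add[of y z] X.smult_r_distr[OF a, of y z] a Psi_closed[of y] Psi_closed[of z]
          keys_act[OF a, of y] keys_act[OF a, of z]
        by (auto simp: Psi_add smult_r_distr)
    qed
    then show ?thesis by simp
  qed
  have lin: "\<forall>m. Poly_Mapping.keys m \<subseteq> ?I \<longrightarrow> \<Psi> (a \<odot>\<^bsub>?X\<^esub> m) = a \<odot> \<Psi> m" if "a \<in> carrier (\<Lambda> Q \<rho>)" for a
    using that
  proof (induction rule: \<Lambda>_induct)
    case zero
    then show ?case using X.zero_act Psi_closed by (simp add: Psi_zero)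
  next
    case (vertex v e)
    have "\<Psi> (vertex_elt v e \<odot>\<^bsub>?X\<^esub> Poly_Mapping.single j c) = vertex_elt v e \<odot> g j c" if "j \<in> ?I" for j c
      using that vertex vertex_elt_act_single[OF C that, of v e c] psi'[OF that] word_vertex_verts[OF C that]
      by (simp add: Psi_single Psi_zero g_def vertex_act_vertex_act)
    then show ?case using by_single[OF vertex_elt_closed[OF vertex]] by blast
  next
    case (arrow x)
    have "\<Psi> (arrow_elt x \<odot>\<^bsub>?X\<^esub> Poly_Mapping.single j c) = arrow_elt x \<odot> g j c" if j: "j \<in> ?I" for j c
    proof -
      define t where "t = d * (j - i)"
      have jt: "j = i + d * t" using pos[of j] by (simp add: t_def)
      have t' [simp]: "d * (d * s) = s" for s using d by auto
      note ov = oriented_letter_vertex[OF C d]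
      have psit: "\<psi> t \<in> carrier M" using psi'[OF j] by (simp add: t_def)
      have rhs: "arrow_elt x \<odot> g j c =
          (if word_vertex Q C j = tail Q x then vertex_elt (head Q x) c \<odot> (arrow_elt x \<odot> \<psi> t) else \<zero>)"
        using arrow_act_vertex_act[OF arrow word_vertex_verts[OF C j] psit] by (simp add: g_def t_def)
      have lhs: "arrow_elt x \<odot>\<^bsub>?X\<^esub> Poly_Mapping.single j c =
          (if oriented_letter C d i t = Some (Dir x) then Poly_Mapping.single (i + d * (t - 1)) c
           else if oriented_letter C d i (t + 1) = Some (Inv x) then Poly_Mapping.single (i + d * (t + 1)) c else 0)"
        using arrow_elt_act_single[OF C j, of x c] arrow_op_oriented[OF C d, of x i t c] jt by simp
      consider "oriented_letter C d i t = Some (Dir x)"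
        | "oriented_letter C d i t \<noteq> Some (Dir x)" "oriented_letter C d i (t + 1) = Some (Inv x)"
        | "oriented_letter C d i t \<noteq> Some (Dir x)" "oriented_letter C d i (t + 1) \<noteq> Some (Inv x)" by blast
      then show ?thesis
      proof cases
        case 1
        then show ?thesis
          using lhs rhs ov(1,2,5)[OF 1] dir[OF _ arrow 1] j jt by (simp add: Psi_single g_def)
      next
        case 2
        have "word_vertex Q C (i + d * t) = tail Q x" using ov(2)[OF 2(2)] by simp
        then show ?thesis
          using 2 lhs rhs ov(1,4)[OF 2(2)] inv[OF _ arrow 2(2)] j jt by (simp add: Psi_single g_def)
      next
        case 3
        then show ?thesis
          using lhs rhs other[OF _ arrow 3] j jt arrow by (simp add: Psi_zero vertex_elt_closed)
      qed
    qed
    then show ?case using by_single[OF arrow_elt_closed[OF arrow]] by blast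
  next
    case (mult a b)
    then show ?case using X.act_mult keys_act Psi_closed by (simp add: act_mult)
  next
    case (add a b)
    then show ?case using X.act_add keys_act Psi_closed by (simp add: act_add Psi_add)
  qed
  have "linear_on (\<Lambda> Q \<rho>) ?X M \<Psi>"
    using lin Psi_add Psi_closed by (simp add: linear_on_def)
  moreover have "\<Psi> (Poly_Mapping.single (i + d * t) c) = vertex_elt (word_vertex Q C (i + d * t)) c \<odot> \<psi> t"
    if "i + d * t \<in> ?I" for t c
  proof -
    have "d * (d * t) = t" using d by auto
    then show ?thesis using Psi_single[OF that, of c] unfolding g_def by (simp only: add_diff_cancel_left')
  qed
  moreover have "\<Psi> ` carrier ?X \<subseteq> H"
    if H: "submodule H (\<Lambda> Q \<rho>) M" and mem: "\<And>t. i + d * t \<in> ?I \<Longrightarrow> \<psi> t \<in> H" for H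
  proof -
    have "g j c \<in> H" if "j \<in> ?I" for j c
      unfolding g_def using mem[of "d * (j - i)"] pos[of j] that word_vertex_verts[OF C that]
      by (intro submoduleD(5)[OF H] vertex_elt_closed) simp_all
    then have "\<Psi> m \<in> H" if "Poly_Mapping.keys m \<subseteq> ?I" for m
      unfolding \<Psi>_def using that by (intro finsum_mem_subgroup[OF submodule_subgroup[OF H]]) blast
    then show ?thesis by auto
  qed
  ultimately show ?thesis by blast
qed

end

section \<open>The submodule off a ray and the quotient carried by the ray\<close>

context ray
begin

definition off_zone :: "(int \<Rightarrow>\<^sub>0 'k::field) set" where
  "off_zone = {m. Poly_Mapping.keys m \<subseteq> word_index C - zone}"

lemma word_algebra_module: "algebra_module Q \<rho> (word_module Q C :: (('v, 'a, 'k::field) alg_elt, int \<Rightarrow>\<^sub>0 'k) module)"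
  using left_module_word_module[OF word] string_algebra_axioms by (simp add: algebra_module_def)

lemma off_zone_add: "m \<in> off_zone \<Longrightarrow> m' \<in> off_zone \<Longrightarrow> m + m' \<in> off_zone"
  unfolding off_zone_def using Poly_Mapping.keys_add[of m m'] by blast

text \<open>Only letter \<open>k + 1\<close> joins the zone to its complement. A direct letter there
  would carry the basis vector at \<open>pos (k + 1)\<close> into the zone, and
  \<open>ray_end\<close> excludes it; an inverse letter leads outwards and does no harm.\<close>

lemma off_zone_act:
  fixes a :: "('v, 'a, 'k::field) alg_elt"
  assumes "a \<in> carrier (\<Lambda> Q \<rho>)"
  shows "\<forall>m\<in>off_zone. a \<odot>\<^bsub>word_module Q C\<^esub> m \<in> off_zone"
proof -
  let ?X = "word_module Q C :: (('v, 'a, 'k) alg_elt, int \<Rightarrow>\<^sub>0 'k) module"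
  interpret X: algebra_module Q \<rho> ?X by (rule word_algebra_module)
  have by_single: "a \<odot>\<^bsub>?X\<^esub> m \<in> off_zone"
    if a: "a \<in> carrier (\<Lambda> Q \<rho>)" and m: "m \<in> off_zone"
      and single: "\<And>t c. \<not> t \<le> k \<Longrightarrow> pos t \<in> word_index C \<Longrightarrow> a \<odot>\<^bsub>?X\<^esub> Poly_Mapping.single (pos t) c \<in> off_zone" for a m
  proof -
    have "Poly_Mapping.keys m \<subseteq> word_index C \<and> a \<odot>\<^bsub>?X\<^esub> m \<in> off_zone"
    proof (induction rule: poly_mapping_single_induct[where x = m])
      case zero
      then show ?case using X.act_zero[OF a] by (simp add: off_zone_def)
    next
      case (single j c)
      then have "j \<in> word_index C" "j \<notin> zone" using m by (auto simp: off_zone_def)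
      then show ?case using that(3)[of "d * (j - i)" c] pos_surj[of j] pos_zone[of "d * (j - i)"] by simp
    next
      case (add y z)
      then have "a \<odot>\<^bsub>?X\<^esub> (y + z) = a \<odot>\<^bsub>?X\<^esub> y + a \<odot>\<^bsub>?X\<^esub> z"
        using X.smult_r_distr[OF a, of y z] by simp
      moreover have "Poly_Mapping.keys (y + z) \<subseteq> word_index C"
        using Poly_Mapping.keys_add[of y z] add by blast
      ultimately show ?case using add by (simp add: off_zone_add)
    qed
    then show ?thesis by simp
  qed
  show ?thesis
    using assms
  proof (induction rule: \<Lambda>_induct)
    case zero
    show ?case
    proof
      fix m :: "int \<Rightarrow>\<^sub>0 'k" assume "m \<in> off_zone"
      then have "m \<in> carrier ?X" by (auto simp: off_zone_def)
      then show "\<zero>\<^bsub>\<Lambda> Q \<rho>\<^esub> \<odot>\<^bsub>?X\<^esub> m \<in> off_zone"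
        using X.zero_act[of m] by (simp add: off_zone_def)
    qed
  next
    case (vertex v e)
    have "vertex_elt v e \<odot>\<^bsub>?X\<^esub> Poly_Mapping.single (pos t) c \<in> off_zone"
      if "\<not> t \<le> k" "pos t \<in> word_index C" for t c
      using that vertex_elt_act_single[OF word that(2), of v e c] by (simp add: off_zone_def)
    then show ?case using by_single[OF vertex_elt_closed[OF vertex]] by blast
  next
    case (arrow x)
    have "arrow_elt x \<odot>\<^bsub>?X\<^esub> Poly_Mapping.single (pos t) c \<in> off_zone"
      if t: "\<not> t \<le> k" "pos t \<in> word_index C" for t c
    proof -
      have "t \<noteq> k + 1" if "oriented_letter C d i t = Some (Dir x)" using that ray_end by blast
      then show ?thesis
        using t arrow_elt_act_single[OF word t(2), of x c] arrow_op_oriented[OF word direction, of x i t c]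
          oriented_letter_vertex(5)[OF word direction, of i t "Dir x"]
          oriented_letter_vertex(4)[OF word direction, of i "t + 1" "Inv x"]
        by (auto simp: off_zone_def)
    qed
    then show ?case using by_single[OF arrow_elt_closed[OF arrow]] by blast
  next
    case (mult a b)
    have "m \<in> carrier ?X" if "m \<in> off_zone" for m using that by (auto simp: off_zone_def)
    then show ?case using mult by (simp add: X.act_mult)
  next
    case (add a b)
    have "m \<in> carrier ?X" if "m \<in> off_zone" for m using that by (auto simp: off_zone_def)
    then show ?case using add by (simp add: X.act_add off_zone_add)
  qed
qed

lemma off_zone_submodule:
  "submodule off_zone (\<Lambda> Q \<rho>) (word_module Q C :: (('v, 'a, 'k::field) alg_elt, int \<Rightarrow>\<^sub>0 'k) module)"
proof -
  let ?X = "word_module Q C :: (('v, 'a, 'k) alg_elt, int \<Rightarrow>\<^sub>0 'k) module"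
  interpret X: algebra_module Q \<rho> ?X by (rule word_algebra_module)
  show ?thesis
  proof (rule X.submoduleI')
    fix m :: "int \<Rightarrow>\<^sub>0 'k" assume m: "m \<in> off_zone"
    then have "\<ominus>\<^bsub>?X\<^esub> m = - m"
      by (intro X.minus_equality) (auto simp: off_zone_def)
    then show "\<ominus>\<^bsub>?X\<^esub> m \<in> off_zone" using m by (simp add: off_zone_def)
    show "a \<odot>\<^bsub>?X\<^esub> m \<in> off_zone" if "a \<in> carrier (\<Lambda> Q \<rho>)" for a
      using off_zone_act[OF that] m by blast
    show "m \<oplus>\<^bsub>?X\<^esub> m' \<in> off_zone" if "m' \<in> off_zone" for m'
      using off_zone_add[OF m that] by simp
  qed (auto simp: off_zone_def)
qed

text \<open>The vector \<open>u\<close> is sent along the cycle: \<open>pos t\<close> receives the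
  product of the arrows \<open>t + 1\<close> to \<open>n\<close> applied to \<open>u\<close>. For t
  \<le> k < n this product is nonempty, so its leftmost arrow is \<open>p (t + 1)\<close> and every
  arrow other than \<open>p t\<close> kills the result. That is why the peak receives P u and not
  \<open>u\<close> itself.\<close>

lemma ray_hom:
  fixes M :: "(('v, 'a, 'k::field) alg_elt, 'm) module"
  assumes M: "left_module (\<Lambda> Q \<rho>) M" and u: "u \<in> carrier M"
  shows "\<exists>\<theta>. linear_on (\<Lambda> Q \<rho>) (word_module Q C) M \<theta> \<and> (\<forall>y\<in>off_zone. \<theta> y = \<zero>\<^bsub>M\<^esub>) \<and>
    \<theta> (Poly_Mapping.single i 1) = path_elt base xs base \<odot>\<^bsub>M\<^esub> u \<and>
    (\<forall>H. submodule H (\<Lambda> Q \<rho>) M \<longrightarrow> u \<in> H \<longrightarrow> \<theta> ` carrier (word_module Q C) \<subseteq> H)"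
proof -
  interpret M: algebra_module Q \<rho> M
    using M string_algebra_axioms by (simp add: algebra_module_def)
  define \<psi> where "\<psi> t = (if t \<le> k then path_elt (head Q (p (t + 1))) (map p [t + 1..n]) base \<odot>\<^bsub>M\<^esub> u else \<zero>\<^bsub>M\<^esub>)" for t
  have path: "(head Q (p (t + 1)), map p [t + 1..n], base) \<in> qpaths Q" if "t \<le> n" for t
    using segment_path[OF that] base_shift[of 1] by simp
  have psi: "\<psi> t \<in> carrier M" for t
    using path[of t] k_bounds u by (simp add: \<psi>_def path_elt_closed)
  have psi_step: "\<psi> t = arrow_elt (p (t + 1)) \<odot>\<^bsub>M\<^esub> (path_elt (head Q (p (t + 2))) (map p [t + 2..n]) base \<odot>\<^bsub>M\<^esub> u)"
    if "t \<le> k" for t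
  proof -
    have "[t + 1..n] = (t + 1) # [t + 2..n]"
      using that k_bounds by (subst upto_rec1) (simp_all add: add.assoc)
    then show ?thesis
      using path[of t] that k_bounds u M.path_act_Cons[of "head Q (p (t + 1))" "p (t + 1)" "map p [t + 2..n]" base u]
        p_consecutive[of "t + 1"] by (simp add: \<psi>_def add.assoc)
  qed
  have kill: "arrow_elt x \<odot>\<^bsub>M\<^esub> \<psi> t = \<zero>\<^bsub>M\<^esub>" if t: "t \<le> k" and x: "x \<in> arcs Q" "x \<noteq> p t" for t x
  proof -
    let ?y = "path_elt (head Q (p (t + 2))) (map p [t + 2..n]) base \<odot>\<^bsub>M\<^esub> u"
    have "?y \<in> carrier M" using path[of "t + 1"] t k_bounds u by (simp add: path_elt_closed add.assoc)
    then show ?thesis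
      using psi_step[OF t] M.act_mult[OF arrow_elt_closed[OF x(1)] arrow_elt_closed[OF p_arc[of "t + 1"]], of ?y]
        other_arrow_annihilates[OF x, where ?'k = 'k] by simp
  qed
  have step: "arrow_elt (p t) \<odot>\<^bsub>M\<^esub> \<psi> t = \<psi> (t - 1)" if "t \<le> k" for t
    using psi_step[of "t - 1"] that by (simp add: \<psi>_def add.commute)
  have "\<exists>\<Psi>. linear_on (\<Lambda> Q \<rho>) (word_module Q C) M \<Psi> \<and>
    (\<forall>t c. pos t \<in> word_index C \<longrightarrow>
      \<Psi> (Poly_Mapping.single (pos t) c) = vertex_elt (word_vertex Q C (pos t)) c \<odot>\<^bsub>M\<^esub> \<psi> t) \<and>
    (\<forall>H. submodule H (\<Lambda> Q \<rho>) M \<longrightarrow> (\<forall>t. pos t \<in> word_index C \<longrightarrow> \<psi> t \<in> H) \<longrightarrow>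
      \<Psi> ` carrier (word_module Q C) \<subseteq> H)"
  proof (rule M.basis_hom[OF word direction])
    fix t assume t: "pos t \<in> word_index C"
    show "\<psi> t \<in> carrier M" by (rule psi)
    show "vertex_elt (word_vertex Q C (pos t)) 1 \<odot>\<^bsub>M\<^esub> \<psi> t = \<psi> t"
    proof (cases "t \<le> k")
      case True
      then show ?thesis
        using M.vertex_act_path_act[OF path[of t] u] k_bounds by (simp add: pos_vertex \<psi>_def)
    next
      case False
      then show ?thesis
        using M.act_zero[OF vertex_elt_closed[OF word_vertex_verts[OF word t]]] by (simp add: \<psi>_def)
    qed
    fix x assume x: "x \<in> arcs Q"
    show "arrow_elt x \<odot>\<^bsub>M\<^esub> \<psi> t = \<psi> (t - 1)" if "oriented_letter C d i t = Some (Dir x)"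
    proof (cases "t \<le> k")
      case True
      then show ?thesis using that ray_letter[OF True] step[OF True] by simp
    next
      case False
      moreover have "t \<noteq> k + 1" using that ray_end by blast
      ultimately show ?thesis using M.act_zero[OF arrow_elt_closed[OF x]] by (simp add: \<psi>_def)
    qed
    \<comment> \<open>An inverse letter numbered \<open>t + 1\<close> lies past the ray, so the
      right side is zero. So is the left side: if \<open>t = k\<close>, then \<open>x\<close>
      differs from \<open>p k\<close>, since a word never contains a letter followed by its
      inverse.\<close>
    show "arrow_elt x \<odot>\<^bsub>M\<^esub> \<psi> t = \<psi> (t + 1)" if inv: "oriented_letter C d i (t + 1) = Some (Inv x)"
    proof -
      have t1: "\<not> t + 1 \<le> k" using inv ray_letter[of "t + 1"] by auto
      have "arrow_elt x \<odot>\<^bsub>M\<^esub> \<psi> t = \<zero>\<^bsub>M\<^esub>"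
      proof (cases "t \<le> k")
        case True
        then have "x \<noteq> p t"
          using oriented_letter_consecutive(2)[OF word direction ray_letter[OF True] inv] by simp
        then show ?thesis by (rule kill[OF True x])
      next
        case False
        then show ?thesis using M.act_zero[OF arrow_elt_closed[OF x]] by (simp add: \<psi>_def)
      qed
      then show ?thesis using t1 by (simp add: \<psi>_def)
    qed
    show "arrow_elt x \<odot>\<^bsub>M\<^esub> \<psi> t = \<zero>\<^bsub>M\<^esub>" if "oriented_letter C d i t \<noteq> Some (Dir x)"
    proof (cases "t \<le> k")
      case True
      then show ?thesis using that ray_letter[OF True] kill[OF True x] by auto
    next
      case False
      then show ?thesis using M.act_zero[OF arrow_elt_closed[OF x]] by (simp add: \<psi>_def)
    qed
  qed
  then obtain \<Psi> where "linear_on (\<Lambda> Q \<rho>) (word_module Q C) M \<Psi> \<and>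
    (\<forall>t c. pos t \<in> word_index C \<longrightarrow>
      \<Psi> (Poly_Mapping.single (pos t) c) = vertex_elt (word_vertex Q C (pos t)) c \<odot>\<^bsub>M\<^esub> \<psi> t) \<and>
    (\<forall>H. submodule H (\<Lambda> Q \<rho>) M \<longrightarrow> (\<forall>t. pos t \<in> word_index C \<longrightarrow> \<psi> t \<in> H) \<longrightarrow>
      \<Psi> ` carrier (word_module Q C) \<subseteq> H)" ..
  note Psi = this[THEN conjunct1] this[THEN conjunct2, THEN conjunct1, rule_format]
    this[THEN conjunct2, THEN conjunct2, rule_format]
  have "\<Psi> (Poly_Mapping.single i 1) = path_elt base xs base \<odot>\<^bsub>M\<^esub> u"
  proof -
    have "\<Psi> (Poly_Mapping.single i 1) = vertex_elt base 1 \<odot>\<^bsub>M\<^esub> \<psi> 0"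
      using Psi(2)[of 0 1] i_index i_vertex by simp
    also have "\<psi> 0 = path_elt base xs base \<odot>\<^bsub>M\<^esub> u"
      using k_bounds by (simp add: \<psi>_def flip: xs_eq)
    finally show ?thesis using M.vertex_act_path_act[OF cycle_path u] by simp
  qed
  moreover have "\<Psi> y = \<zero>\<^bsub>M\<^esub>" if y: "y \<in> off_zone" for y
  proof -
    have "Poly_Mapping.keys y \<subseteq> word_index C \<and> \<Psi> y = \<zero>\<^bsub>M\<^esub>"
    proof (induction rule: poly_mapping_single_induct[where x = y])
      case zero
      interpret X: algebra_module Q \<rho> "word_module Q C :: (('v, 'a, 'k) alg_elt, int \<Rightarrow>\<^sub>0 'k) module"
        by (rule word_algebra_module)
      show ?case
        using linear_on_zero[OF Psi(1) X.abelian_group_axioms M.abelian_group_axioms] by simp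
    next
      case (single j c)
      then have j: "j \<in> word_index C" "j \<notin> zone" using y by (auto simp: off_zone_def)
      then have "\<not> d * (j - i) \<le> k" using pos_surj[of j] pos_zone[of "d * (j - i)"] by simp
      then show ?case
        using Psi(2)[of "d * (j - i)" c] j(1) pos_surj[of j]
          M.act_zero[OF vertex_elt_closed[OF word_vertex_verts[OF word j(1)], where c = c]] by (simp add: \<psi>_def)
    next
      case (add y z)
      then show ?case
        using Poly_Mapping.keys_add[of y z] linear_onD(2)[OF Psi(1), of y z] by auto
    qed
    then show ?thesis by simp
  qed
  moreover have "\<Psi> ` carrier (word_module Q C) \<subseteq> H" if H: "submodule H (\<Lambda> Q \<rho>) M" "u \<in> H" for H
  proof -
    have "\<psi> t \<in> H" for t
      using M.submoduleD(2)[OF H(1)] M.submoduleD(5)[OF H(1) path_elt_closed[OF path[of t]] H(2)] k_bounds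
      by (simp add: \<psi>_def)
    then show ?thesis using Psi(3)[OF H(1)] by blast
  qed
  ultimately show ?thesis using Psi(1) by blast
qed

end

definition restriction :: "('b \<Rightarrow>\<^sub>0 'k) \<Rightarrow> 'b set \<Rightarrow> 'b \<Rightarrow>\<^sub>0 'k::comm_monoid_add" where
  "restriction m Z = (\<Sum>j\<in>Poly_Mapping.keys m \<inter> Z. Poly_Mapping.single j (Poly_Mapping.lookup m j))"

lemma lookup_restriction: "Poly_Mapping.lookup (restriction m Z) j = (if j \<in> Z then Poly_Mapping.lookup m j else 0)"
  by (simp add: restriction_def lookup_sum lookup_single when_def sum.delta in_keys_iff)

lemma (in string_algebra) act_lookup_nonzero:
  fixes a :: "('v, 'a, 'k::field) alg_elt"
  assumes C: "is_word Q \<rho> C" and a: "a \<in> carrier (\<Lambda> Q \<rho>)" and x: "Poly_Mapping.keys x \<subseteq> word_index C"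
    and nz: "Poly_Mapping.lookup (a \<odot>\<^bsub>word_module Q C\<^esub> x) l \<noteq> 0"
  shows "\<exists>j\<in>Poly_Mapping.keys x. \<exists>c. Poly_Mapping.lookup (a \<odot>\<^bsub>word_module Q C\<^esub> Poly_Mapping.single j c) l \<noteq> 0"
proof (rule ccontr)
  assume no: "\<not> ?thesis"
  let ?X = "word_module Q C :: (('v, 'a, 'k) alg_elt, int \<Rightarrow>\<^sub>0 'k) module"
  interpret X: algebra_module Q \<rho> ?X
    using left_module_word_module[OF C] string_algebra_axioms by (simp add: algebra_module_def)
  have "Poly_Mapping.keys x \<subseteq> word_index C \<and> Poly_Mapping.lookup (a \<odot>\<^bsub>?X\<^esub> x) l = 0"
  proof (induction rule: poly_mapping_single_induct[where x = x])
    case zero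
    then show ?case using X.act_zero[OF a] by simp
  next
    case (single j c)
    have "Poly_Mapping.keys (Poly_Mapping.single j c) \<subseteq> word_index C" using single x by auto
    moreover have "Poly_Mapping.lookup (a \<odot>\<^bsub>?X\<^esub> Poly_Mapping.single j c) l = 0" using no single by blast
    ultimately show ?case ..
  next
    case (add y z)
    then have "a \<odot>\<^bsub>?X\<^esub> (y + z) = a \<odot>\<^bsub>?X\<^esub> y + a \<odot>\<^bsub>?X\<^esub> z" using X.smult_r_distr[OF a, of y z] by simp
    moreover have "Poly_Mapping.keys (y + z) \<subseteq> word_index C" using Poly_Mapping.keys_add[of y z] add by blast
    ultimately show ?case using add by (simp add: lookup_add)
  qed
  then show False using nz by simp
qed

lemma (in primitive_path) cycle_act_single:
  assumes "is_word Q \<rho> C" "j \<in> word_index C"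
  shows "path_elt base xs base \<odot>\<^bsub>word_module Q C\<^esub> Poly_Mapping.single j c =
    (if word_vertex Q C j = base then foldr (arrow_op C) xs (Poly_Mapping.single j c) else 0)"
  using path_elt_act_single[OF assms] .

lemma (in primitive_path) segment_period: "map p [n * a + 1..n * a + n] = xs"
proof -
  have "map p [n * a + 1..n * a + n] = map p [1..n]"
  proof (rule nth_equalityI)
    fix s assume "s < length (map p [n * a + 1..n * a + n])"
    then have "s < length xs" by simp
    then show "map p [n * a + 1..n * a + n] ! s = map p [1..n] ! s"
      using p_periodic[of "1 + int s" a] by (simp add: nth_upto algebra_simps)
  qed simp
  then show ?thesis by (simp flip: xs_eq)
qed

context ray
begin

text \<open>Each turn of the cycle moves the basis vector \<open>n\<close> positions down the ray,
  where the same cycle can be read again, as the ray has no lower end.\<close>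

lemma monom_act:
  "poly_elt base xs (monom c a) \<odot>\<^bsub>word_module Q C\<^esub> Poly_Mapping.single i (1 :: 'k::field) =
    Poly_Mapping.single (pos (- (n * int a))) c"
proof -
  let ?X = "word_module Q C :: (('v, 'a, 'k) alg_elt, int \<Rightarrow>\<^sub>0 'k) module"
  interpret X: algebra_module Q \<rho> ?X by (rule word_algebra_module)
  have b: "Poly_Mapping.single i 1 \<in> carrier ?X" using i_index by simp
  show ?thesis
  proof (induction a)
    case 0
    then show ?case
      using vertex_elt_act_single[OF word i_index, of base c 1] i_vertex by (simp add: monom_0 poly_elt_const)
  next
    case (Suc a)
    let ?t = "- (n * int a)"
    have t: "?t \<le> k" using k_bounds n_pos by (simp add: order.trans[of _ 0])
    have vert: "word_vertex Q C (pos ?t) = base"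
      using pos_vertex[OF t] base_shift[of "- int a"] by simp
    have "map p [?t - n + 1..?t] = xs" using segment_period[of "- int a - 1"] by (simp add: algebra_simps)
    then have "reads C d (pos ?t) xs"
      using reads_segment[of "?t - n" ?t] t n_pos by simp
    then have "foldr (arrow_op C) xs (Poly_Mapping.single (pos ?t) c) = Poly_Mapping.single (pos ?t - d * n) c"
      using reads_step[OF word direction] n_pos by simp
    then have "poly_elt base xs (monom c (Suc a)) \<odot>\<^bsub>?X\<^esub> Poly_Mapping.single i 1 = Poly_Mapping.single (pos ?t - d * n) c"
      using X.poly_act_pCons_0[OF cycle_path b, of "monom c a"] Suc vert
        cycle_act_single[OF word pos_index[OF t], of c] by (simp add: monom_Suc)
    moreover have "pos ?t - d * n = pos (- (n * int (Suc a)))" by (simp add: algebra_simps)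
    ultimately show ?case by (simp only:)
  qed
qed

lemma poly_act_sum:
  fixes h :: "'b \<Rightarrow> 'k::field poly"
  assumes "Poly_Mapping.keys x \<subseteq> word_index C"
  shows "poly_elt base xs (\<Sum>j\<in>J. h j) \<odot>\<^bsub>word_module Q C\<^esub> x = (\<Sum>j\<in>J. poly_elt base xs (h j) \<odot>\<^bsub>word_module Q C\<^esub> x)"
proof -
  let ?X = "word_module Q C :: (('v, 'a, 'k) alg_elt, int \<Rightarrow>\<^sub>0 'k) module"
  interpret X: algebra_module Q \<rho> ?X by (rule word_algebra_module)
  have "poly_elt base xs 0 \<odot>\<^bsub>?X\<^esub> x = 0"
    using X.zero_act[of x] assms by (simp add: poly_elt_def \<Lambda>_zero)
  then show ?thesis
    using X.poly_act_add[OF cycle_path, of x] assms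
    by (induction J rule: infinite_finite_induct) simp_all
qed

lemma zone_keys:
  fixes x :: "int \<Rightarrow>\<^sub>0 'k::field"
  assumes x: "Poly_Mapping.keys x \<subseteq> word_index C" and t: "t \<le> k"
    and nz: "Poly_Mapping.lookup (path_elt base xs base \<odot>\<^bsub>word_module Q C\<^esub> x) (pos t) \<noteq> 0"
  shows "n dvd t" "t < 0"
proof -
  have P: "(path_elt base xs base :: ('v, 'a, 'k) alg_elt) \<in> carrier (\<Lambda> Q \<rho>)"
    by (rule path_elt_closed[OF cycle_path])
  from act_lookup_nonzero[OF word P x nz] obtain j c where "j \<in> Poly_Mapping.keys x"
    "Poly_Mapping.lookup (path_elt base xs base \<odot>\<^bsub>word_module Q C\<^esub> Poly_Mapping.single j (c :: 'k)) (pos t) \<noteq> 0"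
    by (elim bexE exE)
  then have "Poly_Mapping.lookup (foldr (arrow_op C) xs (Poly_Mapping.single j c)) (pos t) \<noteq> 0"
    using cycle_act_single[OF word, of j c] x by (auto split: if_splits)
  from cycle_target[OF this t] show "n dvd t" "t < 0" .
qed

text \<open>By \<open>zone_keys\<close> the image of the cycle meets the zone only at the positions
  \<open>pos (- (n * a))\<close> with a > 0. These carry the vectors P^a b_i, so the coefficients
  there are the coefficients of \<open>h\<close>, which has no constant term.\<close>

lemma zone_part:
  fixes x :: "int \<Rightarrow>\<^sub>0 'k::field"
  assumes x: "Poly_Mapping.keys x \<subseteq> word_index C"
  defines "z \<equiv> path_elt base xs base \<odot>\<^bsub>word_module Q C\<^esub> x"
  shows "\<exists>h. poly h 0 = 0 \<and> poly_elt base xs h \<odot>\<^bsub>word_module Q C\<^esub> Poly_Mapping.single i 1 = restriction z zone"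
    and "z - restriction z zone \<in> off_zone"
proof -
  let ?X = "word_module Q C :: (('v, 'a, 'k) alg_elt, int \<Rightarrow>\<^sub>0 'k) module"
  interpret X: algebra_module Q \<rho> ?X by (rule word_algebra_module)
  have P: "(path_elt base xs base :: ('v, 'a, 'k) alg_elt) \<in> carrier (\<Lambda> Q \<rho>)"
    by (rule path_elt_closed[OF cycle_path])
  have zc: "Poly_Mapping.keys z \<subseteq> word_index C"
    using X.act_closed[OF P, of x] x by (simp add: z_def)
  \<comment> \<open>The number of turns from the peak down to position \<open>j\<close>; as
    \<open>d\<close> is its own inverse, \<open>d * (j - i)\<close> recovers the offset
    \<open>t\<close> from \<open>j = pos t\<close>.\<close>
  define e where "e j = nat (- (d * (j - i)) div n)" for j
  define h where "h = (\<Sum>j\<in>Poly_Mapping.keys z \<inter> zone. monom (Poly_Mapping.lookup z j) (e j))"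
  have e: "e j \<noteq> 0 \<and> pos (- (n * int (e j))) = j" if j: "j \<in> Poly_Mapping.keys z \<inter> zone" for j
  proof -
    obtain t where t: "j = pos t" "t \<le> k" using j by (auto simp: zone_def)
    have "Poly_Mapping.lookup z (pos t) \<noteq> 0" using j t by (simp add: in_keys_iff)
    then have dvd: "n dvd t" "t < 0" using zone_keys[OF x t(2)] by (simp_all add: z_def)
    have dt: "d * (j - i) = t" using t(1) direction by auto
    have "e j = nat (- t div n)" unfolding e_def dt ..
    moreover have "0 < - t div n" using dvd n_pos by (auto simp: pos_imp_zdiv_pos_iff zdvd_imp_le)
    moreover have "n * (- t div n) = - t" using dvd(1) by simp
    ultimately show ?thesis using t(1) by simp
  qed
  have "poly (monom (Poly_Mapping.lookup z j) (e j)) 0 = 0" if "j \<in> Poly_Mapping.keys z \<inter> zone" for j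
    using e[OF that] by (simp add: poly_monom)
  then have "poly h 0 = 0" by (simp add: h_def poly_sum)
  moreover have "poly_elt base xs h \<odot>\<^bsub>?X\<^esub> Poly_Mapping.single i 1 = restriction z zone"
    using e i_index unfolding h_def restriction_def
    by (subst poly_act_sum) (auto simp: monom_act intro!: sum.cong)
  ultimately show "\<exists>h. poly h 0 = 0 \<and> poly_elt base xs h \<odot>\<^bsub>?X\<^esub> Poly_Mapping.single i 1 = restriction z zone"
    by blast
  have "j \<in> word_index C - zone" if "j \<in> Poly_Mapping.keys (z - restriction z zone)" for j
    using that zc by (auto simp: in_keys_iff lookup_minus lookup_restriction split: if_splits)
  then show "z - restriction z zone \<in> off_zone" by (auto simp: off_zone_def)
qed

text \<open>Take a position \<open>pos t\<close> of the zone in the support of \<open>x\<close>, and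
  let \<open>q\<close> be the path down the ray from it to a multiple of \<open>n\<close>, followed
  by one more turn. The extra turn puts q x into the image of the cycle, so \<open>zone_part\<close>
  applies; the coefficient of x at \<open>pos t\<close> survives because no other basis vector is
  carried by \<open>q\<close> to the same end.\<close>

lemma push_into_zone:
  fixes x :: "int \<Rightarrow>\<^sub>0 'k::field"
  assumes x: "x \<in> carrier (word_module Q C :: (('v, 'a, 'k) alg_elt, int \<Rightarrow>\<^sub>0 'k) module)" "x \<notin> off_zone"
  shows "\<exists>q\<in>carrier (\<Lambda> Q \<rho>). \<exists>h. \<exists>y\<in>off_zone.
    q \<odot>\<^bsub>word_module Q C\<^esub> x = poly_elt base xs h \<odot>\<^bsub>word_module Q C\<^esub> Poly_Mapping.single i 1 \<oplus>\<^bsub>word_module Q C\<^esub> y \<and>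
    poly_elt base xs h \<odot>\<^bsub>word_module Q C\<^esub> Poly_Mapping.single i (1 :: 'k) \<notin> off_zone"
proof -
  let ?X = "word_module Q C :: (('v, 'a, 'k) alg_elt, int \<Rightarrow>\<^sub>0 'k) module"
  interpret X: algebra_module Q \<rho> ?X by (rule word_algebra_module)
  have xc: "Poly_Mapping.keys x \<subseteq> word_index C" using x(1) by simp
  then obtain j where j: "j \<in> Poly_Mapping.keys x" "j \<in> zone" using x(2) by (auto simp: off_zone_def)
  then obtain t where t: "j = pos t" "t \<le> k" by (auto simp: zone_def)
  \<comment> \<open>Enough turns that even one turn above the end \<open>l\<close> is still at or
    below \<open>t\<close>: l + n is minus n times the absolute value of \<open>t\<close>.\<close>
  define a where "a = nat \<bar>t\<bar> + 1"
  define l where "l = - (n * int a)"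
  have "\<bar>t\<bar> * 1 \<le> \<bar>t\<bar> * n" using n_pos by (intro mult_left_mono) linarith+
  then have tn: "l + n \<le> t" by (simp add: l_def a_def algebra_simps)
  have lt: "l \<le> t" "l \<le> k" using tn n_pos t(2) by simp_all
  let ?ys = "map p [l + n + 1..t]" and ?w = "head Q (p (t + 1))"
  have seg: "map p [l + 1..t] = xs @ ?ys"
  proof -
    have "[l + 1..t] = [l + 1..l + n] @ [l + n + 1..t]"
      using tn n_pos by (intro upto_split2) linarith+
    then show ?thesis using segment_period[of "- int a"] by (simp add: l_def)
  qed
  have base: "head Q (p (l + n + 1)) = base" "head Q (p (l + 1)) = base"
    using base_shift[of "1 - int a"] base_shift[of "- int a"] by (simp_all add: l_def algebra_simps)
  have ys: "(base, ?ys, ?w) \<in> qpaths Q" using segment_path[OF tn] base by simp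
  let ?q = "path_elt base (xs @ ?ys) ?w :: ('v, 'a, 'k) alg_elt"
  have qp: "(base, xs @ ?ys, ?w) \<in> qpaths Q" using qpaths_append[OF cycle_path ys] .
  have q: "?q \<in> carrier (\<Lambda> Q \<rho>)" by (rule path_elt_closed[OF qp])
  define x' where "x' = path_elt base ?ys ?w \<odot>\<^bsub>?X\<^esub> x"
  have x': "Poly_Mapping.keys x' \<subseteq> word_index C"
    using X.act_closed[OF path_elt_closed[OF ys] x(1)] by (simp add: x'_def)
  have qx: "?q \<odot>\<^bsub>?X\<^esub> x = path_elt base xs base \<odot>\<^bsub>?X\<^esub> x'"
    unfolding x'_def by (rule X.path_act_append[OF cycle_path ys x(1)])
  have len: "int (length (xs @ ?ys)) = t - l" using arg_cong[OF seg, of length] lt(1) by simp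
  have "Poly_Mapping.lookup (?q \<odot>\<^bsub>?X\<^esub> x) (pos l) = Poly_Mapping.lookup x (pos t)"
  proof -
    have single_q: "Poly_Mapping.lookup (?q \<odot>\<^bsub>?X\<^esub> Poly_Mapping.single j' c) (pos l) = (c when j' = pos t)"
      if "j' \<in> word_index C" for j' c
    proof (cases "j' = pos t")
      case True
      have "reads C d (pos t) (xs @ ?ys)" using reads_segment[OF lt(1) t(2)] by (simp add: seg)
      moreover have "xs @ ?ys \<noteq> []" using n_pos by auto
      ultimately have "foldr (arrow_op C) (xs @ ?ys) (Poly_Mapping.single (pos t) c) = Poly_Mapping.single (pos t - d * (t - l)) c"
        using reads_step[OF word direction, of "pos t" "xs @ ?ys" c] unfolding len by simp
      moreover have "pos t - d * (t - l) = pos l" by (simp add: algebra_simps)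
      ultimately show ?thesis
        using True path_elt_act_single[OF word that, of base "xs @ ?ys" ?w c] pos_vertex[OF t(2)] by simp
    next
      case False
      have "Poly_Mapping.lookup (foldr (arrow_op C) (xs @ ?ys) (Poly_Mapping.single j' c)) (pos l) = 0"
      proof (rule ccontr)
        assume "Poly_Mapping.lookup (foldr (arrow_op C) (xs @ ?ys) (Poly_Mapping.single j' c)) (pos l) \<noteq> 0"
        from arrows_target[OF this lt(2)] have "j' = pos (l + int (length (xs @ ?ys)))" using n_pos by auto
        then show False using False unfolding len by simp
      qed
      then show ?thesis using False path_elt_act_single[OF word that, of base "xs @ ?ys" ?w c] by simp
    qed
    have "Poly_Mapping.keys x \<subseteq> word_index C \<and>
      Poly_Mapping.lookup (?q \<odot>\<^bsub>?X\<^esub> x) (pos l) = Poly_Mapping.lookup x (pos t)"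
    proof (induction rule: poly_mapping_single_induct[where x = x])
      case zero
      then show ?case using X.act_zero[OF q] by simp
    next
      case (single j' c)
      then have j': "j' \<in> word_index C" using xc by blast
      have "Poly_Mapping.keys (Poly_Mapping.single j' c) \<subseteq> word_index C" using j' by simp
      moreover have "Poly_Mapping.lookup (Poly_Mapping.single j' c) (pos t) = (c when j' = pos t)"
        by (simp add: lookup_single)
      ultimately show ?case using single_q[OF j', of c] by (simp only: simp_thms)
    next
      case (add y z)
      then have "?q \<odot>\<^bsub>?X\<^esub> (y + z) = ?q \<odot>\<^bsub>?X\<^esub> y + ?q \<odot>\<^bsub>?X\<^esub> z" using X.smult_r_distr[OF q, of y z] by simp
      moreover have "Poly_Mapping.keys (y + z) \<subseteq> word_index C" using Poly_Mapping.keys_add[of y z] add by blast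
      ultimately show ?case using add by (simp add: lookup_add)
    qed
    then show ?thesis ..
  qed
  then have nz: "Poly_Mapping.lookup (?q \<odot>\<^bsub>?X\<^esub> x) (pos l) \<noteq> 0" using j(1) t(1) by (simp add: in_keys_iff)
  obtain h where h: "poly_elt base xs h \<odot>\<^bsub>?X\<^esub> Poly_Mapping.single i 1 = restriction (?q \<odot>\<^bsub>?X\<^esub> x) zone"
    using zone_part(1)[OF x'] unfolding qx by blast
  have off: "?q \<odot>\<^bsub>?X\<^esub> x - restriction (?q \<odot>\<^bsub>?X\<^esub> x) zone \<in> off_zone"
    using zone_part(2)[OF x'] unfolding qx .
  have "Poly_Mapping.lookup (restriction (?q \<odot>\<^bsub>?X\<^esub> x) zone) (pos l) \<noteq> 0"
    using nz lt(2) by (simp add: lookup_restriction)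
  then have "restriction (?q \<odot>\<^bsub>?X\<^esub> x) zone \<notin> off_zone"
    using lt(2) by (auto simp: off_zone_def in_keys_iff[symmetric] subset_iff)
  then show ?thesis
    using q h off by (intro bexI[of _ ?q] exI[of _ h] bexI[OF _ off]) simp_all
qed

end

section \<open>Peaks\<close>

lemma oriented_letter_reverse:
  "d \<in> {1, -1} \<Longrightarrow> oriented_letter C (- d) j s = map_option letter_inv (oriented_letter C d j (1 - s))"
  by (auto simp: oriented_letter_def option.map_comp o_def option.map_ident add_diff_eq)

text \<open>\<open>word_le\<close> keeps the indices of \<open>C\<close> if these are bounded below
  and shifts them by \<open>i\<close> otherwise, and \<open>word_inv\<close> reflects finite and
  infinite words differently; the two conventions compensate and give one formula.\<close>

lemma letters_word_inv_le:
  assumes "is_word Q \<rho> (Letters L)" "L i \<noteq> None"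
  shows "word_inv (word_le Q \<sigma> (Letters L) i) =
    Letters (\<lambda>j. if 1 \<le> j then map_option letter_inv (L (i + 1 - j)) else None)"
proof -
  have dom: "(\<exists>m\<ge>1. dom L = {1..m}) \<or> dom L = {1..} \<or> dom L = {..0} \<or> dom L = UNIV"
    using assms(1) by simp
  have i: "i \<in> dom L" using assms(2) by auto
  show ?thesis
  proof (cases "L 0 = None")
    case True
    let ?M = "\<lambda>j. if j \<le> i then L j else None"
    have "0 \<notin> dom L" using True by auto
    then have "(\<exists>m. dom L = {1..m}) \<or> dom L = {1..}"
      using dom by (metis UNIV_I atMost_iff order_refl)
    moreover have "dom ?M = dom L \<inter> {..i}" by (auto split: if_splits)
    ultimately have "dom ?M = {1..i} \<and> 1 \<le> i"
      using i by (elim disjE exE; simp only:) auto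
    then have card: "(if finite (dom ?M) then int (card (dom ?M)) else 0) = i" by auto
    have "word_inv (Letters ?M) = Letters (\<lambda>j. map_option letter_inv (?M (i + 1 - j)))"
      unfolding word_inv.simps card ..
    then show ?thesis using True assms(2) by (auto simp: fun_eq_iff)
  next
    case False
    let ?M = "\<lambda>j. if j \<le> 0 then L (i + j) else None"
    have "0 \<in> dom L" using False by auto
    then have "dom L = {..0} \<or> dom L = UNIV"
      using dom by (metis atLeastAtMost_iff atLeast_iff not_one_le_zero)
    moreover have "dom ?M = {j. j \<le> 0 \<and> i + j \<in> dom L}" by (auto split: if_splits)
    ultimately have "dom ?M = {..0}" using i by (elim disjE; simp only:) auto
    then have card: "(if finite (dom ?M) then int (card (dom ?M)) else 0) = 0" by (simp add: infinite_Iic)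
    have "word_inv (Letters ?M) = Letters (\<lambda>j. map_option letter_inv (?M (0 + 1 - j)))"
      unfolding word_inv.simps card ..
    then show ?thesis using False assms(2) by (auto simp: fun_eq_iff add_diff_eq)
  qed
qed

lemma letters_concat:
  assumes "dom L = {1..int m}" "1 \<le> j" "j \<le> int m"
  shows "letters (word_concat (Letters L) D) j = L j"
  using assms by (cases D) simp_all

context primitive_path
begin

lemma letters_cycle_word: "letters (cycle_word xs :: ('v, 'a) word) t = (if 1 \<le> t \<and> t \<le> n then Some (Dir (p t)) else None)"
  by (simp add: cycle_word_def cyclic_def)

text \<open>Walking down the cycle from its head meets the inverses of the arrows numbered 0, -1, -2
  and so on, which is what a ray looks like from its peak.\<close>

lemma power_inf_inv: "power_inf (word_inv (cycle_word xs :: ('v, 'a) word)) =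
  Letters (\<lambda>j. if 1 \<le> j then Some (Inv (p (1 - j))) else None)"
proof -
  obtain L where L: "(cycle_word xs :: ('v, 'a) word) = Letters L" by (simp add: cycle_word_def)
  have letters: "L t = (if 1 \<le> t \<and> t \<le> n then Some (Dir (p t)) else None)" for t
    using letters_cycle_word[of t] by (simp add: L)
  then have dom: "dom L = {1..n}" by (auto simp: dom_def split: if_splits)
  have inv: "word_inv (Letters L) = Letters (\<lambda>t. map_option letter_inv (L (n + 1 - t)))"
    by (simp add: dom)
  have "dom (\<lambda>t. map_option letter_inv (L (n + 1 - t))) = {1..n}"
    by (auto simp: dom_def letters split: if_splits)
  then have len: "int (word_length (word_inv (Letters L) :: ('v, 'a) word)) = n"
    unfolding inv word_length_def by simp
  have "letters (word_inv (Letters L) :: ('v, 'a) word) ((j - 1) mod n + 1) = Some (Inv (p (1 - j)))" for j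
  proof -
    have "1 \<le> n - (j - 1) mod n" "n - (j - 1) mod n \<le> n"
      using n_pos pos_mod_bound[of n "j - 1"] pos_mod_sign[of n "j - 1"] by linarith+
    moreover have "p (n - (j - 1) mod n) = p (1 - j)"
    proof -
      have "n - (j - 1) mod n = 1 - j + n * ((j - 1) div n + 1)"
        by (simp add: algebra_simps flip: minus_div_mult_eq_mod)
      then show ?thesis by (simp only: p_periodic)
    qed
    ultimately show ?thesis unfolding inv by (simp add: letters)
  qed
  then show ?thesis
    unfolding power_inf_def L len by (simp add: fun_eq_iff)
qed

end

text \<open>The inverse of a letter and the letter after it are distinct with the same head. Equal
  signs would make them the inverse of x and the letter y for a zero relation xy, and then xy or its
  inverse would occur in the word.\<close>

lemma sign_opposite:
  assumes \<sigma>: "sign_choice Q \<rho> \<sigma>" and C: "is_word Q \<rho> C" and a: "letters C j = Some a" and b: "letters C (j + 1) = Some b"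
  shows "\<sigma> b = - \<sigma> (letter_inv a)"
proof (rule ccontr)
  assume ne: "\<sigma> b \<noteq> - \<sigma> (letter_inv a)"
  have arcs: "letter_arrow b \<in> arcs Q" "letter_arrow (letter_inv a) \<in> arcs Q"
    using is_word_letters(1)[OF C a] is_word_letters(1)[OF C b] by simp_all
  then have "\<sigma> b \<in> {1, -1}" "\<sigma> (letter_inv a) \<in> {1, -1}" using \<sigma> by (auto simp: sign_choice_def)
  then have "\<sigma> (letter_inv a) = \<sigma> b" using ne by auto
  moreover have "letter_inv a \<noteq> b" "letter_head Q (letter_inv a) = letter_head Q b"
    using is_word_consecutive[OF C a b] by (simp_all add: letter_tail_def)
  ultimately obtain x y where xy: "[x, y] \<in> \<rho>" "{letter_inv a, b} = {Inv x, Dir y}"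
    using \<sigma> arcs unfolding sign_choice_def by metis
  have two: "(\<exists>i<length [x, y]. Q' i) \<longleftrightarrow> Q' 0 \<or> Q' 1" for Q' :: "nat \<Rightarrow> bool"
    by (auto simp: less_Suc_eq)
  from xy(2) consider "letter_inv a = Inv x" "b = Dir y" | "letter_inv a = Dir y" "b = Inv x"
    by (auto simp: doubleton_eq_iff)
  then show False
  proof cases
    case 1
    then show False using is_word_relation(1)[OF C xy(1), of j] a b unfolding two by simp
  next
    case 2
    then show False using is_word_relation(2)[OF C xy(1), of j] a b unfolding two by simp
  qed
qed

context ray
begin

text \<open>From \<open>i\<close> towards negative offsets one reads the inverses of
  \<open>p 0\<close>, \<open>p (- 1)\<close> and so on, so \<open>i\<close> is deep; letter
  \<open>k + 1\<close> on the other side keeps that side from starting with the full cycle. For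
  \<open>d = 1\<close> the deep side is the inverse of \<open>word_le\<close>, for
  \<open>d = -1\<close> it is \<open>word_gt\<close>, and \<open>opp\<close> matches the
  signs.\<close>

lemma peak:
  assumes \<sigma>: "sign_choice Q \<rho> \<sigma>"
  shows "is_peak Q \<rho> \<sigma> (cycle_word xs) C i"
proof -
  have "C \<noteq> Trivial v e" for v e
    using ray_letter[of 0] k_bounds by (auto simp: oriented_letter_def split: if_splits)
  then obtain L where L: "C = Letters L" by (cases C) auto
  let ?P = "cycle_word xs :: ('v, 'a) word"
  obtain LP where LP: "?P = Letters LP" by (simp add: cycle_word_def)
  have LP_letters: "LP t = (if 1 \<le> t \<and> t \<le> n then Some (Dir (p t)) else None)" for t
    using letters_cycle_word[of t] by (simp add: LP)
  have LP_dom: "dom LP = {1..int (length xs)}" by (auto simp: dom_def LP_letters split: if_splits)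
  have sign_P: "word_sign \<sigma> ?P = \<sigma> (Dir (p 1))"
  proof -
    have "1 \<le> n" using n_pos by linarith
    then have "LP 1 = Some (Dir (p 1))" unfolding LP_letters by (intro if_P conjI order_refl)
    then show ?thesis by (simp add: LP)
  qed
  have opp: "\<sigma> (Inv (p 0)) = - \<sigma> (Dir (p 1))"
    using sign_opposite[OF \<sigma> is_word_power, of 0 "Dir (p 0)" "Dir (p 1)"] by simp
  have "\<sigma> (Dir (p 1)) \<in> {1, -1}" using \<sigma> p_arc[of 1] by (auto simp: sign_choice_def)
  then have nz: "\<sigma> (Dir (p 1)) \<noteq> - \<sigma> (Dir (p 1))" by auto
  \<comment> \<open>As k < n, letter \<open>k + 1\<close> of any word starting with the cycle is
    direct, whereas the ray has no direct letter there. The second alternative covers a side that is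
    a trivial word.\<close>
  have no_cycle: "w \<noteq> word_concat ?P D" if "letters w (k + 1) = oriented_letter C d i (k + 1) \<or> letters w (k + 1) = None" for w D
  proof
    assume "w = word_concat ?P D"
    then have "letters w (k + 1) = Some (Dir (p (k + 1)))"
      using letters_concat[OF LP_dom, of "k + 1" D] k_bounds by (simp add: LP LP_letters)
    then show False using that ray_end by (metis option.distinct(1))
  qed
  have side: "word_side Q \<sigma> C i (- word_sign \<sigma> ?P) = power_inf (word_inv ?P) \<and>
    (\<forall>D. word_side Q \<sigma> C i (word_sign \<sigma> ?P) \<noteq> word_concat ?P D)"
  proof (cases "d = 1")
    case True
    have ol: "oriented_letter C d i t = L (i + t)" for t using True by (simp add: oriented_letter_def L)
    have Li: "L i = Some (Dir (p 0))" using ray_letter[of 0] k_bounds ol[of 0] by simp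
    have "word_inv (word_le Q \<sigma> C i) = power_inf (word_inv ?P)"
      unfolding L power_inf_inv
      using letters_word_inv_le[OF word[unfolded L], of i \<sigma>] Li ray_letter[of "1 - j" for j] k_bounds ol[of "1 - j" for j]
      by (auto simp: fun_eq_iff add_diff_eq)
    moreover have "word_sign \<sigma> (word_gt Q \<sigma> C i) = word_sign \<sigma> ?P"
    proof (cases "L (i + 1)")
      case None
      then show ?thesis using Li opp sign_P by (simp add: L)
    next
      case (Some l)
      then show ?thesis
        using sign_opposite[OF \<sigma> word, of i "Dir (p 0)" l] Li opp sign_P by (simp add: L)
    qed
    moreover have "word_gt Q \<sigma> C i \<noteq> word_concat ?P D" for D
      by (rule no_cycle) (use ol[of "k + 1"] k_bounds in \<open>simp add: L\<close>)
    ultimately show ?thesis using nz sign_P by (simp add: word_side_def)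
  next
    case False
    then have d: "d = -1" using direction by simp
    have ol: "oriented_letter C d i t = map_option letter_inv (L (i + 1 - t))" for t by (simp add: oriented_letter_def L d)
    have Lt: "L (i + 1 - t) = Some (Inv (p t))" if "t \<le> k" for t
      using ray_letter[OF that] unfolding ol by auto
    have L1: "L (i + 1) = Some (Inv (p 0))" using Lt[of 0] k_bounds by simp
    have "L (i + j) = Some (Inv (p (1 - j)))" if "1 \<le> j" for j
      using Lt[of "1 - j"] that k_bounds by simp
    then have "word_gt Q \<sigma> C i = power_inf (word_inv ?P)"
      unfolding power_inf_inv by (simp add: L L1 fun_eq_iff)
    moreover have "word_sign \<sigma> (word_gt Q \<sigma> C i) = - word_sign \<sigma> ?P"
      using opp sign_P by (simp add: L L1)
    moreover have "word_inv (word_le Q \<sigma> C i) \<noteq> word_concat ?P D" for D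
    proof (cases "L i")
      case None
      then show ?thesis by (intro no_cycle) (simp add: L)
    next
      case (Some l)
      then have "word_inv (word_le Q \<sigma> C i) = Letters (\<lambda>j. if 1 \<le> j then map_option letter_inv (L (i + 1 - j)) else None)"
        using letters_word_inv_le[OF word[unfolded L], of i \<sigma>] by (simp add: L)
      then show ?thesis by (intro no_cycle) (use ol[of "k + 1"] k_bounds in simp)
    qed
    ultimately show ?thesis using nz sign_P by (simp add: word_side_def)
  qed
  then show ?thesis
    using i_index by (simp add: is_peak_def is_deep_def)
qed

end

context primitive_path
begin

text \<open>
  A basis vector on which no power of the cycle vanishes starts an infinite path that follows the
  cycle in one direction; since the word is not periodic, the path can be traced back to a peak.
\<close>

lemma nilpotent_or_ray:
  fixes C :: "('v, 'a) word"
  assumes C: "is_word Q \<rho> C" "\<not> periodic_word Q \<rho> C" and j: "j \<in> word_index C"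
    and not_nil: "\<And>r. poly_elt base xs (monom 1 r) \<odot>\<^bsub>word_module Q C\<^esub> Poly_Mapping.single j (1 :: 'k::field) \<noteq> 0"
  shows "\<exists>d i k t. ray Q \<rho> xs C d i k \<and> t \<le> k \<and> j = i + d * t"
proof -
  let ?X = "word_module Q C :: (('v, 'a, 'k) alg_elt, int \<Rightarrow>\<^sub>0 'k) module"
  interpret X: algebra_module Q \<rho> ?X
    using left_module_word_module[OF C(1)] string_algebra_axioms by (simp add: algebra_module_def)
  let ?f = "\<lambda>r. poly_elt base xs (monom 1 r) \<odot>\<^bsub>?X\<^esub> Poly_Mapping.single j 1"
  have b: "Poly_Mapping.single j 1 \<in> carrier ?X" using j by simp
  have step: "?f (Suc r) = path_elt base xs base \<odot>\<^bsub>?X\<^esub> ?f r" for r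
    using X.poly_act_pCons_0[OF cycle_path b, of "monom 1 r"] by (simp add: monom_Suc)
  have xs0: "xs \<noteq> []" using n_pos by auto
  have reads: "\<exists>d\<in>{1, -1}. reads C d l xs" if "?f r = Poly_Mapping.single l 1" for r l
  proof (rule ccontr)
    assume "\<not> ?thesis"
    then have "foldr (arrow_op C) xs (Poly_Mapping.single l (1 :: 'k)) = 0" by (simp add: reads_fail[OF C(1)])
    moreover have "l \<in> word_index C"
      using that X.act_closed[OF poly_elt_closed[OF cycle_path] b, of "monom 1 r"] by simp
    ultimately have "?f (Suc r) = 0"
      unfolding step that using cycle_act_single[OF C(1), of l "1 :: 'k"] by simp
    then show False using not_nil by blast
  qed
  have next_step: "?f (Suc r) = Poly_Mapping.single (l - d * n) 1"
    if "?f r = Poly_Mapping.single l 1" "d \<in> {1, -1}" "reads C d l xs" for r l d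
  proof -
    have l: "l \<in> word_index C"
      using that X.act_closed[OF poly_elt_closed[OF cycle_path] b, of "monom 1 r"] by simp
    have "?f (Suc r) = (if word_vertex Q C l = base then Poly_Mapping.single (l - d * n) 1 else 0)"
      unfolding step that(1)
      using cycle_act_single[OF C(1) l, of "1 :: 'k"] reads_step[OF C(1) that(2,3) xs0, of "1 :: 'k"] by simp
    then show ?thesis using not_nil[of "Suc r"] by (simp split: if_splits)
  qed
  have f0: "?f 0 = Poly_Mapping.single j 1"
    using vertex_elt_act_single[OF C(1) j, of base 1 "1 :: 'k"] not_nil[of 0]
    by (simp add: monom_0 poly_elt_const split: if_splits)
  obtain d where d: "d \<in> {1, -1}" "reads C d j xs" using reads[OF f0] by blast
  have all: "?f r = Poly_Mapping.single (j - d * (n * int r)) 1 \<and> reads C d (j - d * (n * int r)) xs" for r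
  proof (induction r)
    case 0
    then show ?case using f0 d by simp
  next
    case (Suc r)
    let ?l = "j - d * (n * int (Suc r))"
    have l: "j - d * (n * int r) - d * n = ?l" by (simp add: algebra_simps)
    have f: "?f (Suc r) = Poly_Mapping.single ?l 1"
      using next_step[OF _ d(1), of r "j - d * (n * int r)"] Suc unfolding l by simp
    obtain d' where d': "d' \<in> {1, -1}" "reads C d' ?l xs" using reads[OF f] by blast
    \<comment> \<open>Two successive turns go the same way, since otherwise the letter between them
      would be direct in both directions of reading.\<close>
    have "d' = d"
    proof (rule ccontr)
      assume "d' \<noteq> d"
      then have "d' = - d" using d(1) d'(1) by auto
      have "oriented_letter C d (j - d * (n * int r)) (1 - n) = Some (Dir (xs ! 0))"
        using Suc xs0 by (auto simp: reads_def)
      moreover have "j - d * (n * int r) = ?l + d * n" by (simp add: algebra_simps)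
      ultimately have "oriented_letter C d ?l 1 = Some (Dir (xs ! 0))"
        using oriented_letter_shift[OF d(1), of C ?l n "1 - n"] by simp
      moreover have "oriented_letter C d' ?l 0 = Some (Dir (xs ! (length xs - 1)))"
        using d'(2)[unfolded reads_def, rule_format, of "length xs - 1"] xs0 by (simp add: of_nat_diff Suc_leI)
      ultimately show False
        unfolding \<open>d' = - d\<close> using oriented_letter_reverse[OF d(1), of C ?l 0] by simp
    qed
    then show ?case using f d' by simp
  qed
  \<comment> \<open>Letter \<open>t\<close> is crossed during turn number \<open>r\<close>, the
    integral part of -t divided by n, and the remainder \<open>u\<close> gives its place within the
    cycle.\<close>
  have past: "oriented_letter C d j t = Some (Dir (p t))" if "t \<le> 0" for t
  proof -
    define r where "r = nat (- t div n)"
    define u where "u = - t mod n"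
    have r: "int r = - t div n" using that n_pos by (simp add: r_def pos_imp_zdiv_nonneg_iff)
    have u: "0 \<le> u" "u < n" using n_pos by (simp_all add: u_def)
    have t: "t = - (n * int r) - u" unfolding r u_def by (simp add: algebra_simps flip: minus_div_mult_eq_mod)
    let ?s = "nat (n - 1 - u)"
    have s: "?s < length xs" "int ?s = n - 1 - u" using u by simp_all
    have "oriented_letter C d (j - d * (n * int r)) (int ?s + 1 - n) = Some (Dir (xs ! ?s))"
      using all[THEN conjunct2, unfolded reads_def, rule_format, OF s(1)] .
    moreover have "oriented_letter C d (j - d * (n * int r)) (int ?s + 1 - n) = oriented_letter C d j t"
      using oriented_letter_shift[OF d(1), of C j "- (n * int r)" "- u"] s(2) t by simp
    moreover have "int ?s + 1 = t + n * (int r + 1)" using s(2) t by (simp add: algebra_simps)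
    then have "xs ! ?s = p t"
      using cyclic_nth[OF s(1)] by (simp only: p_periodic)
    ultimately show ?thesis by simp
  qed
  \<comment> \<open>If every letter followed the cycle, in either orientation, the word would be
    invariant under a shift by \<open>n\<close>; this is where non-periodicity is used.\<close>
  have "\<exists>t. oriented_letter C d j t \<noteq> Some (Dir (p t))"
  proof (rule ccontr)
    assume "\<not> ?thesis"
    then have all: "oriented_letter C d j t = Some (Dir (p t))" for t by blast
    have "C \<noteq> Trivial v e" for v e using all[of 0] by (auto simp: oriented_letter_def split: if_splits)
    then obtain L where L: "C = Letters L" by (cases C) auto
    have letters: "L m = (if d = 1 then Some (Dir (p (m - j))) else Some (Inv (p (j + 1 - m))))" for m
      using all[of "m - j"] all[of "j + 1 - m"] by (auto simp: L oriented_letter_def)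
    then have "L = (\<lambda>m. L (m + n))"
      using p_periodic[of "m - j" 1 for m] p_periodic[of "j + 1 - m" "-1" for m] by (auto simp: fun_eq_iff algebra_simps)
    then have "C = shift_word C (int (length xs))" by (simp add: L shift_word_def)
    moreover have "word_index C = UNIV" using letters by (auto simp: L dom_def)
    ultimately have "periodic_word Q \<rho> C" using C(1) xs0 unfolding periodic_word_def by blast
    then show False using C(2) by simp
  qed
  then obtain t0 where t0: "oriented_letter C d j t0 \<noteq> Some (Dir (p t0))" by blast
  \<comment> \<open>The first letter, counted from \<open>j\<close>, that leaves the cycle. A
    natural number suffices because all letters numbered at most 0 follow it.\<close>
  define m where "m = (LEAST m. oriented_letter C d j (int m) \<noteq> Some (Dir (p (int m))))"
  have "0 < t0" using t0 past[of t0] by (meson not_le)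
  then have "oriented_letter C d j (int (nat t0)) \<noteq> Some (Dir (p (int (nat t0))))" using t0 by simp
  then have m: "oriented_letter C d j (int m) \<noteq> Some (Dir (p (int m)))" unfolding m_def by (rule LeastI)
  have before: "oriented_letter C d j t = Some (Dir (p t))" if "t < int m" for t
  proof (cases "t \<le> 0")
    case False
    then have "nat t < m" using that by simp
    from not_less_Least[OF this[unfolded m_def]] show ?thesis using False by simp
  qed (rule past)
  have m0: "0 < m" using m past[of 0] by (cases m) auto
  \<comment> \<open>The last letter following the cycle. The peak is placed at the last whole number
    of turns from \<open>j\<close>, and the remainder \<open>k\<close> < n is what the ray runs past
    it.\<close>
  define k0 where "k0 = int m - 1"
  define a where "a = k0 div n"
  define k where "k = k0 mod n"
  have k0: "0 \<le> k0" "k0 = n * a + k" using m0 by (simp_all add: k0_def a_def k_def)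
  define i where "i = j + d * (n * a)"
  have shift: "oriented_letter C d i t = oriented_letter C d j (n * a + t)" for t
    unfolding i_def by (rule oriented_letter_shift[OF d(1)])
  have pa: "p (n * a + t) = p t" for t using p_periodic[of t a] by (simp add: add.commute)
  have "ray Q \<rho> xs C d i k"
  proof
    show "is_word Q \<rho> C" by fact
    show "d \<in> {1, -1}" by fact
    show "0 \<le> k" "k < n" using n_pos by (simp_all add: k_def)
    show "oriented_letter C d i t = Some (Dir (p t))" if "t \<le> k" for t
      using before[of "n * a + t"] that k0(2) by (simp add: shift pa k0_def)
    \<comment> \<open>A direct letter after \<open>p k0\<close> makes no zero relation with it, so
      the string algebra axiom identifies it with the next arrow of the cycle, contrary to the
      choice of \<open>m\<close>.\<close>
    show "oriented_letter C d i (k + 1) \<noteq> Some (Dir x)" for x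
    proof
      assume "oriented_letter C d i (k + 1) = Some (Dir x)"
      then have x: "oriented_letter C d j (k0 + 1) = Some (Dir x)" using k0(2) by (simp add: shift add.assoc)
      have k0l: "oriented_letter C d j k0 = Some (Dir (p k0))" using before[of k0] by (simp add: k0_def)
      have "[p k0, x] \<notin> \<rho>"
      proof
        assume "[p k0, x] \<in> \<rho>"
        then have "\<not> reads C d (j + d * (k0 + 1)) [p k0, x]" using reads_not_relation[OF C(1)] d(1) by auto
        then show False using x k0l by (auto simp: reads_def oriented_letter_shift[OF d(1)] less_Suc_eq)
      qed
      moreover have "tail Q (p k0) = head Q x" "x \<in> arcs Q"
        using oriented_letter_consecutive(1)[OF C(1) d(1) k0l x] oriented_letter_vertex(3)[OF C(1) d(1) x] by simp_all
      ultimately have "x = p (k0 + 1)"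
        using right_unique[of "p k0" x "p (k0 + 1)"] p_arc p_consecutive p_not_relation by blast
      then show False using m x by (simp add: k0_def)
    qed
  qed
  moreover have "- (n * a) \<le> k"
  proof -
    have "0 \<le> n * a" using k0(1) n_pos by (simp add: a_def pos_imp_zdiv_nonneg_iff)
    moreover have "0 \<le> k" using n_pos by (simp add: k_def)
    ultimately show ?thesis by linarith
  qed
  moreover have "j = i + d * (- (n * a))" by (simp add: i_def)
  ultimately show ?thesis by blast
qed

end

section \<open>The primitive simple module\<close>

lemma laurent_of_poly_eq:
  "degree f \<le> m \<Longrightarrow> laurent_of_poly f = (\<Sum>i\<le>m. Poly_Mapping.single (int i) (coeff f i))"
  unfolding laurent_of_poly_def by (intro sum.mono_neutral_left) (auto simp: coeff_eq_0)

lemma laurent_of_poly_pCons: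
  "laurent_of_poly (pCons a f) = Poly_Mapping.single 0 a + Poly_Mapping.single 1 1 * laurent_of_poly f"
proof -
  have "laurent_of_poly (pCons a f) = (\<Sum>i\<le>Suc (degree f). Poly_Mapping.single (int i) (coeff (pCons a f) i))"
    by (rule laurent_of_poly_eq) (rule degree_pCons_le)
  also have "\<dots> = Poly_Mapping.single 0 a + (\<Sum>i\<le>degree f. Poly_Mapping.single (int (Suc i)) (coeff f i))"
    by (simp add: sum.atMost_Suc_shift del: sum.atMost_Suc of_nat_Suc)
  also have "(\<Sum>i\<le>degree f. Poly_Mapping.single (int (Suc i)) (coeff f i)) = Poly_Mapping.single 1 1 * laurent_of_poly f"
    by (simp add: laurent_of_poly_def sum_distrib_left mult_single)
  finally show ?thesis .
qed

lemma laurent_of_poly_0 [simp]: "laurent_of_poly 0 = 0"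
  by (simp add: laurent_of_poly_def)

context primitive_path
begin

text \<open>By \<open>power_biinf_eq\<close> this is the periodic word of the cycle, written so that
  its letters can be computed directly.\<close>

definition loop_word :: "('v, 'a) word" where
  "loop_word = Letters (\<lambda>i. Some (Dir (p i)))"

lemma loop_word_is_word: "is_word Q \<rho> loop_word"
  using is_word_power by (simp add: loop_word_def)

lemma loop_word_index [simp]: "word_index loop_word = UNIV"
  by (auto simp: loop_word_def)

lemma loop_word_vertex [simp]: "word_vertex Q loop_word i = head Q (p (i + 1))"
  by (simp add: loop_word_def)

lemma loop_arrow_op: "arrow_op loop_word x (Poly_Mapping.single i c) = (if x = p i then Poly_Mapping.single (i - 1) c else 0)"
  by (auto simp: arrow_op_single loop_word_def)

lemma loop_segment_op:
  assumes "a \<le> b"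
  shows "foldr (arrow_op loop_word) (map p [a + 1..b]) (Poly_Mapping.single b c) = Poly_Mapping.single a c"
proof -
  have "foldr (arrow_op loop_word) (map p [b - int m + 1..b]) (Poly_Mapping.single b c) = Poly_Mapping.single (b - int m) c" for m
  proof (induction m)
    case (Suc m)
    have "[b - int (Suc m) + 1..b] = (b - int m) # [b - int m + 1..b]"
      by (subst upto_rec1) simp_all
    then show ?case using Suc by (simp add: loop_arrow_op algebra_simps)
  qed simp
  from this[of "nat (b - a)"] show ?thesis using assms by simp
qed

lemma period_loop_word: "period loop_word = length xs"
  using period_power by (simp add: power_biinf_eq loop_word_def)

lemma loop_ract_add:
  "word_ract loop_word (m + m') r = word_ract loop_word m r + word_ract loop_word m' r" "word_ract loop_word m (r + r') = word_ract loop_word m r + word_ract loop_word m r'"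
proof -
  show "word_ract loop_word (m + m') r = word_ract loop_word m r + word_ract loop_word m' r"
    unfolding word_ract_def by (rule sum_keys_add) (simp_all add: single_add distrib_right sum.distrib)
  show "word_ract loop_word m (r + r') = word_ract loop_word m r + word_ract loop_word m r'"
    unfolding word_ract_def sum.distrib[symmetric]
    by (rule sum.cong[OF refl], rule sum_keys_add) (simp_all add: single_add distrib_left)
qed

lemma loop_ract_zero [simp]: "word_ract loop_word 0 r = 0" "word_ract loop_word m 0 = 0"
  by (simp_all add: word_ract_def)

lemma loop_ract_single [simp]:
  "word_ract loop_word (Poly_Mapping.single i c) (Poly_Mapping.single l e) = Poly_Mapping.single (i - l * n) (c * e)"
  unfolding word_ract_def period_loop_word by (cases "c = 0"; cases "e = 0") simp_all

lemma loop_ract_mult: "word_ract loop_word m (r * r') = word_ract loop_word (word_ract loop_word m r) r'"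
proof (induction m rule: poly_mapping_single_induct)
  case (single i c)
  show ?case
  proof (induction r rule: poly_mapping_single_induct)
    case (single l e)
    show ?case
    proof (induction r' rule: poly_mapping_single_induct)
      case (single l' e')
      show ?case by (simp add: mult_single algebra_simps)
    qed (simp_all add: loop_ract_add distrib_left)
  qed (simp_all add: loop_ract_add distrib_right)
qed (simp_all add: loop_ract_add)

lemma loop_algebra_module:
  "algebra_module Q \<rho> (word_module Q loop_word :: (('v, 'a, 'k::field) alg_elt, int \<Rightarrow>\<^sub>0 'k) module)"
  using left_module_word_module[OF loop_word_is_word] string_algebra_axioms by (simp add: algebra_module_def)

lemma loop_act_add:
  assumes "a \<in> carrier (\<Lambda> Q \<rho>)"
  shows "a \<odot>\<^bsub>word_module Q loop_word\<^esub> (m + m') = a \<odot>\<^bsub>word_module Q loop_word\<^esub> m + a \<odot>\<^bsub>word_module Q loop_word\<^esub> (m' :: int \<Rightarrow>\<^sub>0 'k::field)"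
proof -
  interpret X: algebra_module Q \<rho> "word_module Q loop_word :: (('v, 'a, 'k) alg_elt, int \<Rightarrow>\<^sub>0 'k) module"
    by (rule loop_algebra_module)
  show ?thesis using X.smult_r_distr[OF assms, of m m'] by simp
qed

lemma loop_act_zero:
  assumes "a \<in> carrier (\<Lambda> Q \<rho>)"
  shows "a \<odot>\<^bsub>word_module Q loop_word\<^esub> 0 = (0 :: int \<Rightarrow>\<^sub>0 'k::field)"
proof -
  interpret X: algebra_module Q \<rho> "word_module Q loop_word :: (('v, 'a, 'k) alg_elt, int \<Rightarrow>\<^sub>0 'k) module"
    by (rule loop_algebra_module)
  show ?thesis using X.act_zero[OF assms] by simp
qed

lemma loop_act_ract_by_single:
  assumes a: "a \<in> carrier (\<Lambda> Q \<rho>)"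
    and single: "\<And>i c l e. a \<odot>\<^bsub>word_module Q loop_word\<^esub> word_ract loop_word (Poly_Mapping.single i c) (Poly_Mapping.single l e) =
      word_ract loop_word (a \<odot>\<^bsub>word_module Q loop_word\<^esub> Poly_Mapping.single i c) (Poly_Mapping.single l (e :: 'k::field))"
  shows "a \<odot>\<^bsub>word_module Q loop_word\<^esub> word_ract loop_word m r = word_ract loop_word (a \<odot>\<^bsub>word_module Q loop_word\<^esub> m) r"
proof (induction m rule: poly_mapping_single_induct)
  case (single i c)
  show ?case
  proof (induction r rule: poly_mapping_single_induct)
    case (single l e)
    show ?case by (rule assms(2))
  qed (simp_all add: loop_ract_add loop_act_add[OF a] loop_act_zero[OF a])
qed (simp_all add: loop_ract_add loop_act_add[OF a] loop_act_zero[OF a])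

lemma p_shift: "p (i - l * n) = p i"
  using p_periodic[of i "- l"] by (simp add: algebra_simps)

text \<open>The bimodule property. It is checked on arrows, scaled vertices and single terms, where
  it says that the sequence of arrows has period \<open>n\<close>.\<close>

lemma loop_act_ract:
  assumes "a \<in> carrier (\<Lambda> Q \<rho>)"
  shows "\<forall>m. a \<odot>\<^bsub>word_module Q loop_word\<^esub> word_ract loop_word m r = word_ract loop_word (a \<odot>\<^bsub>word_module Q loop_word\<^esub> m) (r :: 'k::field laurent)"
  using assms
proof (induction rule: \<Lambda>_induct)
  case zero
  interpret X: algebra_module Q \<rho> "word_module Q loop_word :: (('v, 'a, 'k) alg_elt, int \<Rightarrow>\<^sub>0 'k) module"
    by (rule loop_algebra_module)
  show ?case using X.zero_act by simp
next
  case (vertex v c)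
  show ?case
  proof (rule allI, rule loop_act_ract_by_single[OF vertex_elt_closed[OF vertex]])
    fix i l :: int and c' e :: 'k
    have "p (i - l * n + 1) = p (i + 1)" using p_shift[of "i + 1" l] by (simp add: algebra_simps)
    then show "vertex_elt v c \<odot>\<^bsub>word_module Q loop_word\<^esub> word_ract loop_word (Poly_Mapping.single i c') (Poly_Mapping.single l e) =
        word_ract loop_word (vertex_elt v c \<odot>\<^bsub>word_module Q loop_word\<^esub> Poly_Mapping.single i c') (Poly_Mapping.single l e)"
      by (simp add: vertex_elt_act_single[OF loop_word_is_word] mult.assoc)
  qed
next
  case (arrow x)
  show ?case
  proof (rule allI, rule loop_act_ract_by_single[OF arrow_elt_closed[OF arrow]])
    fix i l :: int and c e :: 'k
    show "arrow_elt x \<odot>\<^bsub>word_module Q loop_word\<^esub> word_ract loop_word (Poly_Mapping.single i c) (Poly_Mapping.single l e) =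
        word_ract loop_word (arrow_elt x \<odot>\<^bsub>word_module Q loop_word\<^esub> Poly_Mapping.single i c) (Poly_Mapping.single l e)"
      by (simp add: arrow_elt_act_single[OF loop_word_is_word] loop_arrow_op p_shift algebra_simps)
  qed
next
  case (mult a b)
  interpret X: algebra_module Q \<rho> "word_module Q loop_word :: (('v, 'a, 'k) alg_elt, int \<Rightarrow>\<^sub>0 'k) module"
    by (rule loop_algebra_module)
  show ?case using mult by (simp add: X.act_mult)
next
  case (add a b)
  interpret X: algebra_module Q \<rho> "word_module Q loop_word :: (('v, 'a, 'k) alg_elt, int \<Rightarrow>\<^sub>0 'k) module"
    by (rule loop_algebra_module)
  show ?case using add by (simp add: X.act_add[simplified] loop_ract_add)
qed

text \<open>On a basis vector at a multiple of \<open>n\<close> the cycle acts as T does from the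
  right. This exchanges the polynomial in the cycle for one in T, which can be moved across the
  tensor product.\<close>

lemma loop_poly_act:
  "poly_elt base xs h \<odot>\<^bsub>word_module Q loop_word\<^esub> Poly_Mapping.single (n * q) 1 =
    word_ract loop_word (Poly_Mapping.single (n * q) 1) (laurent_of_poly (h :: 'k::field poly))"
proof (induction h)
  case 0
  interpret X: algebra_module Q \<rho> "word_module Q loop_word :: (('v, 'a, 'k) alg_elt, int \<Rightarrow>\<^sub>0 'k) module"
    by (rule loop_algebra_module)
  show ?case using X.zero_act[of "Poly_Mapping.single (n * q) 1"] by (simp add: poly_elt_def \<Lambda>_zero)
next
  case (pCons a h)
  interpret X: algebra_module Q \<rho> "word_module Q loop_word :: (('v, 'a, 'k) alg_elt, int \<Rightarrow>\<^sub>0 'k) module"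
    by (rule loop_algebra_module)
  let ?b = "Poly_Mapping.single (n * q) (1 :: 'k)"
  have P: "(path_elt base xs base :: ('v, 'a, 'k) alg_elt) \<in> carrier (\<Lambda> Q \<rho>)"
    by (rule path_elt_closed[OF cycle_path])
  have "map p [n * (q - 1) + 1..n * q] = xs" using segment_period[of "q - 1"] by (simp add: algebra_simps)
  then have "path_elt base xs base \<odot>\<^bsub>word_module Q loop_word\<^esub> ?b = Poly_Mapping.single (n * (q - 1)) 1"
    using path_elt_act_single[OF loop_word_is_word, of "n * q" base xs base "1 :: 'k"] base_shift[of q]
      loop_segment_op[of "n * (q - 1)" "n * q" "1 :: 'k"] n_pos by (simp add: algebra_simps)
  then have Pb: "path_elt base xs base \<odot>\<^bsub>word_module Q loop_word\<^esub> ?b = word_ract loop_word ?b (Poly_Mapping.single 1 1)"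
    by (simp add: algebra_simps)
  have "poly_elt base xs (pCons a h) \<odot>\<^bsub>word_module Q loop_word\<^esub> ?b =
      Poly_Mapping.single (n * q) a + path_elt base xs base \<odot>\<^bsub>word_module Q loop_word\<^esub> word_ract loop_word ?b (laurent_of_poly h)"
    using X.poly_act_pCons[OF cycle_path, of ?b a h] pCons vertex_elt_act_single[OF loop_word_is_word, of "n * q" base a "1 :: 'k"]
      base_shift[of q] by simp
  also have "path_elt base xs base \<odot>\<^bsub>word_module Q loop_word\<^esub> word_ract loop_word ?b (laurent_of_poly h) =
      word_ract loop_word ?b (Poly_Mapping.single 1 1 * laurent_of_poly h)"
    using loop_act_ract[OF P, of "laurent_of_poly h"] by (simp add: Pb loop_ract_mult)
  finally show ?case by (simp add: laurent_of_poly_pCons loop_ract_add)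
qed

end

section \<open>Tensor products as quotients of free abelian groups\<close>

locale tensor =
  fixes M :: "('b, 'm, 'y) module_scheme" and ract :: "'m \<Rightarrow> 'r \<Rightarrow> 'm"
    and R :: "('r, 'x) ring_scheme" and V :: "('r, 'w, 'z) module_scheme"
begin

definition F :: "('m \<times> 'w \<Rightarrow>\<^sub>0 int) monoid" where "F = free_Abelian_group (carrier M \<times> carrier V)"

definition K :: "('m \<times> 'w \<Rightarrow>\<^sub>0 int) set" where "K = generate F (tensor_relations M ract R V)"

definition pure :: "'m \<Rightarrow> 'w \<Rightarrow> ('m \<times> 'w \<Rightarrow>\<^sub>0 int) set" where
  "pure m w = K #>\<^bsub>F\<^esub> frag_of (m, w)"

definition ext :: "'b \<Rightarrow> ('m \<times> 'w \<Rightarrow>\<^sub>0 int) \<Rightarrow> ('m \<times> 'w \<Rightarrow>\<^sub>0 int)" where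
  "ext a = frag_extend (\<lambda>(m, v). frag_of (a \<odot>\<^bsub>M\<^esub> m, v))"

abbreviation T where "T \<equiv> tensor_module M ract R V"

lemma tensor_sel:
  "carrier T = carrier (F Mod K)" "X \<oplus>\<^bsub>T\<^esub> Y = X <#>\<^bsub>F\<^esub> Y" "\<zero>\<^bsub>T\<^esub> = K"
  "a \<odot>\<^bsub>T\<^esub> X = (\<Union>t\<in>X. K #>\<^bsub>F\<^esub> ext a t)"
  by (simp_all add: tensor_module_def F_def K_def ext_def Let_def FactGroup_def)

lemma F_simps [simp]:
  "t \<in> carrier F \<longleftrightarrow> Poly_Mapping.keys t \<subseteq> carrier M \<times> carrier V" "\<one>\<^bsub>F\<^esub> = 0" "s \<otimes>\<^bsub>F\<^esub> t = s + t"
  by (simp_all add: F_def)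

lemma comm_group_F: "comm_group F"
  by (simp add: F_def abelian_free_Abelian_group)

lemma group_F: "group F"
  using comm_group_F by (rule comm_group.axioms(2))

end

locale tensor_modules = tensor M ract R V
  for M :: "('b, 'm, 'y) module_scheme" and ract :: "'m \<Rightarrow> 'r \<Rightarrow> 'm"
    and R :: "('r, 'x) ring_scheme" and V :: "('r, 'w, 'z) module_scheme" +
  assumes add_closed: "m \<in> carrier M \<Longrightarrow> m' \<in> carrier M \<Longrightarrow> m \<oplus>\<^bsub>M\<^esub> m' \<in> carrier M"
    and ract_closed: "m \<in> carrier M \<Longrightarrow> r \<in> carrier R \<Longrightarrow> ract m r \<in> carrier M"
    and V_add_closed: "v \<in> carrier V \<Longrightarrow> v' \<in> carrier V \<Longrightarrow> v \<oplus>\<^bsub>V\<^esub> v' \<in> carrier V"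
    and V_smult_closed: "r \<in> carrier R \<Longrightarrow> v \<in> carrier V \<Longrightarrow> r \<odot>\<^bsub>V\<^esub> v \<in> carrier V"
begin

lemma relations_carrier: "tensor_relations M ract R V \<subseteq> carrier F"
proof -
  have D: "Poly_Mapping.keys (frag_of x - frag_of y) \<subseteq> S" if "x \<in> S" "y \<in> S" for x y :: "'m \<times> 'w" and S
    using keys_diff[of "frag_of x" "frag_of y"] that by auto
  have E: "Poly_Mapping.keys (frag_of x - frag_of y - frag_of z) \<subseteq> S" if "x \<in> S" "y \<in> S" "z \<in> S" for x y z :: "'m \<times> 'w" and S
    using keys_diff[of "frag_of x - frag_of y" "frag_of z"] D[of x S y] that by auto
  have "Poly_Mapping.keys t \<subseteq> carrier M \<times> carrier V" if "t \<in> tensor_relations M ract R V" for t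
    using that unfolding tensor_relations_def Un_iff mem_Collect_eq
    by (elim disjE exE conjE; hypsubst; intro E D SigmaI)
      (simp_all add: add_closed ract_closed V_add_closed V_smult_closed)
  then show ?thesis by (simp add: subset_eq)
qed

lemma subgroup_K: "subgroup K F"
  unfolding K_def by (rule group.generate_is_subgroup[OF group_F relations_carrier])

lemma K_simps:
  "0 \<in> K" "s \<in> K \<Longrightarrow> t \<in> K \<Longrightarrow> s + t \<in> K" "s \<in> K \<Longrightarrow> - s \<in> K" "s \<in> K \<Longrightarrow> t \<in> K \<Longrightarrow> s - t \<in> K"
  "s \<in> K \<Longrightarrow> Poly_Mapping.keys s \<subseteq> carrier M \<times> carrier V"
proof -
  show 1: "0 \<in> K" "\<And>s t. s \<in> K \<Longrightarrow> t \<in> K \<Longrightarrow> s + t \<in> K" "\<And>s. s \<in> K \<Longrightarrow> Poly_Mapping.keys s \<subseteq> carrier M \<times> carrier V"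
    using subgroup.one_closed[OF subgroup_K] subgroup.m_closed[OF subgroup_K] subgroup.mem_carrier[OF subgroup_K] by simp_all
  show 2: "- s \<in> K" if "s \<in> K" for s
  proof -
    have "inv\<^bsub>F\<^esub> s = - s" using 1(3)[OF that] by (simp add: F_def)
    then show ?thesis using subgroup.m_inv_closed[OF subgroup_K that] by simp
  qed
  show "s - t \<in> K" if "s \<in> K" "t \<in> K" for s t
    using 1(2)[OF that(1) 2[OF that(2)]] by simp
qed

lemma coset_mem: "t \<in> K #>\<^bsub>F\<^esub> g \<longleftrightarrow> t - g \<in> K"
proof -
  have "t \<in> K #>\<^bsub>F\<^esub> g \<longleftrightarrow> (\<exists>h\<in>K. t = h + g)" by (simp add: r_coset_def)
  also have "\<dots> \<longleftrightarrow> t - g \<in> K" by (auto intro: bexI[of _ "t - g"])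
  finally show ?thesis .
qed

lemma coset_eq: "K #>\<^bsub>F\<^esub> s = K #>\<^bsub>F\<^esub> t \<longleftrightarrow> s - t \<in> K"
proof
  assume "K #>\<^bsub>F\<^esub> s = K #>\<^bsub>F\<^esub> t"
  then have "s \<in> K #>\<^bsub>F\<^esub> t" using coset_mem[of s s] K_simps(1) by simp
  then show "s - t \<in> K" by (simp add: coset_mem)
next
  assume st: "s - t \<in> K"
  have "u - s \<in> K \<longleftrightarrow> u - t \<in> K" for u
    using K_simps(2)[OF _ st, of "u - s"] K_simps(4)[OF _ st, of "u - t"] by auto
  then show "K #>\<^bsub>F\<^esub> s = K #>\<^bsub>F\<^esub> t" by (simp add: set_eq_iff coset_mem)
qed

lemma coset_zero: "K #>\<^bsub>F\<^esub> 0 = K"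
  by (simp add: set_eq_iff coset_mem)

lemma relations_K: "tensor_relations M ract R V \<subseteq> K"
  unfolding K_def by (intro subsetI generate.incl)

lemma pure_add_left:
  assumes "m \<in> carrier M" "m' \<in> carrier M" "w \<in> carrier V"
  shows "frag_of (m \<oplus>\<^bsub>M\<^esub> m', w) - frag_of (m, w) - frag_of (m', w) \<in> K"
  by (rule subsetD[OF relations_K], unfold tensor_relations_def, rule UnI1, rule UnI1, rule CollectI, intro exI conjI, rule refl) (rule assms)+

lemma pure_add_right:
  assumes "m \<in> carrier M" "w \<in> carrier V" "w' \<in> carrier V"
  shows "frag_of (m, w \<oplus>\<^bsub>V\<^esub> w') - frag_of (m, w) - frag_of (m, w') \<in> K"
  by (rule subsetD[OF relations_K], unfold tensor_relations_def, rule UnI1, rule UnI2, rule CollectI, intro exI conjI, rule refl) (rule assms)+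

lemma pure_ract:
  assumes "m \<in> carrier M" "r \<in> carrier R" "w \<in> carrier V"
  shows "pure (ract m r) w = pure m (r \<odot>\<^bsub>V\<^esub> w)"
  unfolding pure_def coset_eq
  by (rule subsetD[OF relations_K], unfold tensor_relations_def, rule UnI2, rule CollectI, intro exI conjI, rule refl) (rule assms)+

lemma pure_mem_carrier: "m \<in> carrier M \<Longrightarrow> w \<in> carrier V \<Longrightarrow> pure m w \<in> carrier T"
  unfolding tensor_sel(1) pure_def FactGroup_def by (auto simp: RCOSETS_def)

lemma coset_sum:
  assumes "Poly_Mapping.keys s \<subseteq> carrier M \<times> carrier V" "Poly_Mapping.keys t \<subseteq> carrier M \<times> carrier V"
  shows "(K #>\<^bsub>F\<^esub> s) \<oplus>\<^bsub>T\<^esub> (K #>\<^bsub>F\<^esub> t) = K #>\<^bsub>F\<^esub> (s + t)"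
  using normal.rcos_sum[OF comm_group.normal_iff_subgroup[OF comm_group_F, THEN iffD2, OF subgroup_K], of s t] assms
  by (simp add: tensor_sel(2))

text \<open>Only the three kinds of generators matter: the first uses that \<open>a\<close> is
  additive, the second only that the carrier is preserved, the third that \<open>a\<close> commutes
  with the right action.\<close>

lemma ext_K:
  assumes a: "\<And>m. m \<in> carrier M \<Longrightarrow> a \<odot>\<^bsub>M\<^esub> m \<in> carrier M"
    "\<And>m m'. m \<in> carrier M \<Longrightarrow> m' \<in> carrier M \<Longrightarrow> a \<odot>\<^bsub>M\<^esub> (m \<oplus>\<^bsub>M\<^esub> m') = a \<odot>\<^bsub>M\<^esub> m \<oplus>\<^bsub>M\<^esub> a \<odot>\<^bsub>M\<^esub> m'"
    "\<And>m r. m \<in> carrier M \<Longrightarrow> r \<in> carrier R \<Longrightarrow> a \<odot>\<^bsub>M\<^esub> ract m r = ract (a \<odot>\<^bsub>M\<^esub> m) r"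
    and t: "t \<in> K"
  shows "ext a t \<in> K"
  using t unfolding K_def
proof (induction t rule: generate.induct)
  case one
  show ?case using K_simps(1) by (simp add: ext_def K_def)
next
  have gen: "ext a h \<in> K" if "h \<in> tensor_relations M ract R V" for h
    using that relations_K unfolding tensor_relations_def
    by (auto simp: ext_def frag_extend_diff a(3) a(2) intro!: pure_add_left pure_add_right a(1)
        pure_ract[unfolded pure_def coset_eq])
  {
    case (incl h)
    then show ?case using gen by (simp add: K_def)
  next
    case (inv h)
    then have "inv\<^bsub>F\<^esub> h = - h" using relations_carrier by (auto simp: F_def)
    then show ?case using gen[OF inv] K_simps(3) by (simp add: ext_def frag_extend_minus K_def)
  }
next
  case (eng h1 h2)
  then show ?case using K_simps(2) by (simp add: ext_def frag_extend_add K_def)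
qed

text \<open>Scalar multiplication in \<open>tensor_module\<close> is a union over the elements of a
  coset; as \<open>ext a\<close> preserves \<open>K\<close>, every element contributes the same
  coset.\<close>

lemma act_coset:
  assumes a: "\<And>m. m \<in> carrier M \<Longrightarrow> a \<odot>\<^bsub>M\<^esub> m \<in> carrier M"
    "\<And>m m'. m \<in> carrier M \<Longrightarrow> m' \<in> carrier M \<Longrightarrow> a \<odot>\<^bsub>M\<^esub> (m \<oplus>\<^bsub>M\<^esub> m') = a \<odot>\<^bsub>M\<^esub> m \<oplus>\<^bsub>M\<^esub> a \<odot>\<^bsub>M\<^esub> m'"
    "\<And>m r. m \<in> carrier M \<Longrightarrow> r \<in> carrier R \<Longrightarrow> a \<odot>\<^bsub>M\<^esub> ract m r = ract (a \<odot>\<^bsub>M\<^esub> m) r"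
  shows "a \<odot>\<^bsub>T\<^esub> (K #>\<^bsub>F\<^esub> g) = K #>\<^bsub>F\<^esub> ext a g"
proof -
  have "K #>\<^bsub>F\<^esub> ext a t = K #>\<^bsub>F\<^esub> ext a g" if "t \<in> K #>\<^bsub>F\<^esub> g" for t
    using ext_K[OF a, of "t - g"] that by (simp add: coset_mem coset_eq ext_def frag_extend_diff)
  then have "(\<Union>t\<in>K #>\<^bsub>F\<^esub> g. K #>\<^bsub>F\<^esub> ext a t) = (\<Union>t\<in>K #>\<^bsub>F\<^esub> g. K #>\<^bsub>F\<^esub> ext a g)"
    by (intro SUP_cong refl)
  also have "\<dots> = K #>\<^bsub>F\<^esub> ext a g"
    using coset_mem[of g g] K_simps(1) by (intro equalityI UN_least subset_refl) auto
  finally show ?thesis by (simp add: tensor_sel(4))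
qed

lemma act_pure:
  assumes a: "\<And>m. m \<in> carrier M \<Longrightarrow> a \<odot>\<^bsub>M\<^esub> m \<in> carrier M"
    "\<And>m m'. m \<in> carrier M \<Longrightarrow> m' \<in> carrier M \<Longrightarrow> a \<odot>\<^bsub>M\<^esub> (m \<oplus>\<^bsub>M\<^esub> m') = a \<odot>\<^bsub>M\<^esub> m \<oplus>\<^bsub>M\<^esub> a \<odot>\<^bsub>M\<^esub> m'"
    "\<And>m r. m \<in> carrier M \<Longrightarrow> r \<in> carrier R \<Longrightarrow> a \<odot>\<^bsub>M\<^esub> ract m r = ract (a \<odot>\<^bsub>M\<^esub> m) r"
  shows "a \<odot>\<^bsub>T\<^esub> pure m w = pure (a \<odot>\<^bsub>M\<^esub> m) w" "a \<odot>\<^bsub>T\<^esub> K = K"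
  using act_coset[OF a, of "frag_of (m, w)"] act_coset[OF a, of 0]
  by (simp_all add: pure_def ext_def coset_zero)

lemma carrier_trivial:
  assumes "\<And>m w. m \<in> carrier M \<Longrightarrow> w \<in> carrier V \<Longrightarrow> frag_of (m, w) \<in> K"
  shows "carrier T = {K}"
proof -
  have all: "t \<in> K" if "Poly_Mapping.keys t \<subseteq> carrier M \<times> carrier V" for t
    using that by (rule free_Abelian_group_induct) (use assms K_simps in auto)
  have "X = K" if X: "X \<in> carrier T" for X
  proof -
    obtain t where t: "Poly_Mapping.keys t \<subseteq> carrier M \<times> carrier V" "X = K #>\<^bsub>F\<^esub> t"
      using X unfolding tensor_sel(1) FactGroup_def by (auto simp: RCOSETS_def)
    then show ?thesis using coset_eq[of t 0] all[OF t(1)] by (simp add: coset_zero)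
  qed
  moreover have "K \<in> carrier T"
    using coset_zero unfolding tensor_sel(1) FactGroup_def by (auto simp: RCOSETS_def intro!: bexI[of _ 0])
  ultimately show ?thesis by blast
qed

end

section \<open>The quotient of the Laurent polynomials by f\<close>

lemma laurent_quot_sel:
  fixes f :: "'k::field poly"
  defines "N \<equiv> {x * laurent_of_poly f | x. True}"
  shows "carrier (laurent_quot f) = {(\<lambda>x. x + y) ` N | y. True}"
    and "X \<oplus>\<^bsub>laurent_quot f\<^esub> Y = {x + y | x y. x \<in> X \<and> y \<in> Y}"
    and "\<zero>\<^bsub>laurent_quot f\<^esub> = N"
    and "a \<odot>\<^bsub>laurent_quot f\<^esub> X = (\<Union>x\<in>X. (\<lambda>z. z + a * x) ` N)"
proof -
  have N: "PIdl\<^bsub>laurent_ring\<^esub> (laurent_of_poly f) = N"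
    by (auto simp: cgenideal_def laurent_ring_def N_def)
  have coset: "I +>\<^bsub>laurent_regular\<^esub> y = (\<lambda>x. x + y) ` I" for I and y :: "'k laurent"
    by (auto simp: a_r_coset_def r_coset_def laurent_regular_def)
  show "carrier (laurent_quot f) = {(\<lambda>x. x + y) ` N | y. True}"
    unfolding laurent_quot_def quot_module_def N A_RCOSETS_def RCOSETS_def a_r_coset_def[symmetric] coset
    by (auto simp: laurent_regular_def)
  show "X \<oplus>\<^bsub>laurent_quot f\<^esub> Y = {x + y | x y. x \<in> X \<and> y \<in> Y}"
    by (auto simp: laurent_quot_def quot_module_def set_add_def set_mult_def laurent_regular_def)
  show "\<zero>\<^bsub>laurent_quot f\<^esub> = N"
    by (simp add: laurent_quot_def quot_module_def N)
  show "a \<odot>\<^bsub>laurent_quot f\<^esub> X = (\<Union>x\<in>X. (\<lambda>z. z + a * x) ` N)"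
    unfolding laurent_quot_def quot_module_def N by (simp add: coset) (simp add: laurent_regular_def)
qed

text \<open>The operations are unions or sums over representatives; that \<open>N\<close> is an
  ideal makes them independent of the choice. The third fact is the essential one: f(T) annihilates
  the module.\<close>

lemma laurent_quot_facts:
  fixes f :: "'k::field poly"
  shows "X \<in> carrier (laurent_quot f) \<Longrightarrow> Y \<in> carrier (laurent_quot f) \<Longrightarrow> X \<oplus>\<^bsub>laurent_quot f\<^esub> Y \<in> carrier (laurent_quot f)"
    and "X \<in> carrier (laurent_quot f) \<Longrightarrow> a \<odot>\<^bsub>laurent_quot f\<^esub> X \<in> carrier (laurent_quot f)"
    and "X \<in> carrier (laurent_quot f) \<Longrightarrow> laurent_of_poly f \<odot>\<^bsub>laurent_quot f\<^esub> X = \<zero>\<^bsub>laurent_quot f\<^esub>"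
    and "\<zero>\<^bsub>laurent_quot f\<^esub> \<oplus>\<^bsub>laurent_quot f\<^esub> \<zero>\<^bsub>laurent_quot f\<^esub> = \<zero>\<^bsub>laurent_quot f\<^esub>"
    and "\<zero>\<^bsub>laurent_quot f\<^esub> \<in> carrier (laurent_quot f)"
proof -
  define N where "N = {x * laurent_of_poly f | x. True}"
  note sel = laurent_quot_sel[of f, folded N_def]
  have N: "0 \<in> N" "\<And>x y. x \<in> N \<Longrightarrow> y \<in> N \<Longrightarrow> x + y \<in> N" "\<And>x y. x \<in> N \<Longrightarrow> y \<in> N \<Longrightarrow> x - y \<in> N"
    "\<And>a x. x \<in> N \<Longrightarrow> a * x \<in> N"
  proof -
    show "0 \<in> N" unfolding N_def by (auto intro: exI[of _ 0])
    show "x + y \<in> N" "x - y \<in> N" if "x \<in> N" "y \<in> N" for x y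
      using that unfolding N_def by (auto simp flip: distrib_right left_diff_distrib)
    show "a * x \<in> N" if "x \<in> N" for a x
      using that unfolding N_def by (auto simp flip: mult.assoc)
  qed
  have lf: "laurent_of_poly f * x \<in> N" for x unfolding N_def by (auto simp: mult.commute)
  have mem: "z \<in> (\<lambda>x. x + y) ` N \<longleftrightarrow> z - y \<in> N" for y z
    by (auto intro: image_eqI[of _ _ "z - y"])
  have eq: "(\<lambda>x. x + y) ` N = (\<lambda>x. x + z) ` N" if "y - z \<in> N" for y z
  proof -
    have "u - y \<in> N \<longleftrightarrow> u - z \<in> N" for u
      using N(2)[OF _ that, of "u - y"] N(3)[OF _ that, of "u - z"] by auto
    then show ?thesis by (simp add: set_eq_iff mem)
  qed
  have add: "((\<lambda>x. x + y) ` N) \<oplus>\<^bsub>laurent_quot f\<^esub> ((\<lambda>x. x + z) ` N) = (\<lambda>x. x + (y + z)) ` N" for y z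
  proof -
    have "u - (y + z) \<in> N \<longleftrightarrow> (\<exists>a b. u = a + b \<and> a - y \<in> N \<and> b - z \<in> N)" for u
    proof
      assume "u - (y + z) \<in> N"
      then show "\<exists>a b. u = a + b \<and> a - y \<in> N \<and> b - z \<in> N"
        using N(1) by (intro exI[of _ "u - z"] exI[of _ z]) (simp add: algebra_simps)
    next
      assume "\<exists>a b. u = a + b \<and> a - y \<in> N \<and> b - z \<in> N"
      then obtain a b where "u = a + b" "a - y \<in> N" "b - z \<in> N" by blast
      then show "u - (y + z) \<in> N" using N(2)[of "a - y" "b - z"] by (simp add: algebra_simps)
    qed
    then show ?thesis unfolding sel(2) by (simp add: set_eq_iff mem)
  qed
  have act: "a \<odot>\<^bsub>laurent_quot f\<^esub> ((\<lambda>x. x + y) ` N) = (\<lambda>x. x + a * y) ` N" for a y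
  proof -
    have "(\<lambda>z. z + a * x) ` N = (\<lambda>z. z + a * y) ` N" if "x \<in> (\<lambda>x. x + y) ` N" for x
      using N(4)[of "x - y" a] that by (intro eq) (simp add: mem algebra_simps)
    then have "(\<Union>x\<in>(\<lambda>x. x + y) ` N. (\<lambda>z. z + a * x) ` N) = (\<Union>x\<in>(\<lambda>x. x + y) ` N. (\<lambda>z. z + a * y) ` N)"
      by (intro SUP_cong refl)
    also have "\<dots> = (\<lambda>z. z + a * y) ` N" using N(1) by auto
    finally show ?thesis unfolding sel(4) .
  qed
  have zero: "\<zero>\<^bsub>laurent_quot f\<^esub> = (\<lambda>x. x + 0) ` N" by (simp add: sel(3))
  show "X \<oplus>\<^bsub>laurent_quot f\<^esub> Y \<in> carrier (laurent_quot f)" if "X \<in> carrier (laurent_quot f)" "Y \<in> carrier (laurent_quot f)"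
    using that add unfolding sel(1) by auto
  show "a \<odot>\<^bsub>laurent_quot f\<^esub> X \<in> carrier (laurent_quot f)" if "X \<in> carrier (laurent_quot f)"
    using that act unfolding sel(1) by auto
  show "laurent_of_poly f \<odot>\<^bsub>laurent_quot f\<^esub> X = \<zero>\<^bsub>laurent_quot f\<^esub>" if "X \<in> carrier (laurent_quot f)"
  proof -
    from that obtain y where "X = (\<lambda>x. x + y) ` N" unfolding sel(1) by blast
    then show ?thesis unfolding zero using act eq[of "laurent_of_poly f * y" 0] lf by simp
  qed
  show "\<zero>\<^bsub>laurent_quot f\<^esub> \<oplus>\<^bsub>laurent_quot f\<^esub> \<zero>\<^bsub>laurent_quot f\<^esub> = \<zero>\<^bsub>laurent_quot f\<^esub>"
    unfolding zero add by simp
  show "\<zero>\<^bsub>laurent_quot f\<^esub> \<in> carrier (laurent_quot f)"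
    unfolding sel(1) zero by blast
qed

section \<open>A nonzero vector of the primitive simple module annihilated by f of the cycle\<close>

context primitive_path
begin

text \<open>Some tensor of a basis vector b_j with w is nonzero. It is the image, under a path, of
  the tensor of a basis vector at a multiple of \<open>n\<close>, which is therefore nonzero as
  well. There f of the cycle acts as f(T), which passes to the second factor and kills it.\<close>

lemma primitive_simple_element:
  fixes S :: "(('v, 'a, 'k::field) alg_elt, 's) module" and f :: "'k poly"
  assumes S: "left_module (\<Lambda> Q \<rho>) S" "carrier S \<noteq> {\<zero>\<^bsub>S\<^esub>}"
    and iso: "module_iso (\<Lambda> Q \<rho>) S (band_module Q (power_biinf (cycle_word xs)) (laurent_quot f))"
  shows "\<exists>s\<in>carrier S. s \<noteq> \<zero>\<^bsub>S\<^esub> \<and> vertex_elt base 1 \<odot>\<^bsub>S\<^esub> s = s \<and> poly_elt base xs f \<odot>\<^bsub>S\<^esub> s = \<zero>\<^bsub>S\<^esub>"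
proof -
  interpret S: algebra_module Q \<rho> S
    using S string_algebra_axioms by (simp add: algebra_module_def)
  let ?X = "word_module Q loop_word :: (('v, 'a, 'k) alg_elt, int \<Rightarrow>\<^sub>0 'k) module"
  let ?V = "laurent_quot f"
  interpret X: algebra_module Q \<rho> ?X by (rule loop_algebra_module)
  note V = laurent_quot_facts[where f = f]
  interpret T: tensor_modules ?X "word_ract loop_word" laurent_ring ?V
    by unfold_locales (auto intro: V)
  have band: "band_module Q (power_biinf (cycle_word xs)) ?V = T.T"
    by (simp add: band_module_def power_biinf_eq loop_word_def)
  obtain h where bij: "bij_betw h (carrier S) (carrier T.T)" and lin: "linear_on (\<Lambda> Q \<rho>) S T.T h"
    using iso unfolding band module_iso_linear by blast
  note h = linear_onD[OF lin]
  have act: "a \<odot>\<^bsub>T.T\<^esub> T.pure m w = T.pure (a \<odot>\<^bsub>?X\<^esub> m) w" "a \<odot>\<^bsub>T.T\<^esub> T.K = T.K"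
    if "a \<in> carrier (\<Lambda> Q \<rho>)" for a m w
    by (rule T.act_pure; simp add: loop_act_add[OF that] loop_act_ract[OF that])+
  have R: "r \<in> carrier laurent_ring" for r by (simp add: laurent_ring_def)
  have Xc: "m \<in> carrier ?X" for m by simp
  have pure_K: "T.pure m w = T.K \<longleftrightarrow> frag_of (m, w) \<in> T.K" for m w
    unfolding T.pure_def using T.coset_eq[of "frag_of (m, w)" 0] by (simp add: T.coset_zero)
  have "\<exists>j w. w \<in> carrier ?V \<and> frag_of (Poly_Mapping.single j 1, w) \<notin> T.K"
  proof (rule ccontr)
    assume no: "\<not> ?thesis"
    \<comment> \<open>The coefficient \<open>c\<close> is moved to the second factor as a constant
      Laurent polynomial.\<close>
    have single: "frag_of (Poly_Mapping.single j c, w) \<in> T.K" if w: "w \<in> carrier ?V" for j c w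
    proof -
      have "T.pure (word_ract loop_word (Poly_Mapping.single j 1) (Poly_Mapping.single 0 c)) w =
          T.pure (Poly_Mapping.single j 1) (Poly_Mapping.single 0 c \<odot>\<^bsub>?V\<^esub> w)"
        by (rule T.pure_ract[OF Xc R w])
      moreover have "frag_of (Poly_Mapping.single j 1, Poly_Mapping.single 0 c \<odot>\<^bsub>?V\<^esub> w) \<in> T.K"
        using no V(2)[OF w] by blast
      ultimately show ?thesis using pure_K[of "Poly_Mapping.single j c" w] pure_K[of "Poly_Mapping.single j 1"] by simp
    qed
    have "frag_of (m, w) \<in> T.K" if w: "w \<in> carrier ?V" for m w
    proof (induction m rule: poly_mapping_single_induct)
      case zero
      show ?case using single[OF w, of 0 0] by simp
    next
      case (single i c)
      show ?case by (rule \<open>\<And>j c w. w \<in> carrier ?V \<Longrightarrow> frag_of (Poly_Mapping.single j c, w) \<in> T.K\<close>[OF w])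
    next
      case (add y z)
      have "frag_of (y + z, w) - frag_of (y, w) - frag_of (z, w) + (frag_of (y, w) + frag_of (z, w)) \<in> T.K"
        using T.pure_add_left[OF Xc Xc w, of y z] add by (intro T.K_simps(2)) simp_all
      then show ?case by simp
    qed
    then have triv: "carrier T.T = {T.K}" by (intro T.carrier_trivial) blast
    have "x = \<zero>\<^bsub>S\<^esub>" if "x \<in> carrier S" for x
    proof -
      have "h x = h \<zero>\<^bsub>S\<^esub>"
        using h(1)[OF that] h(1)[OF S.zero_closed] unfolding triv by simp
      then show ?thesis by (rule inj_onD[OF bij_betw_imp_inj_on[OF bij] _ that S.zero_closed])
    qed
    then have "carrier S = {\<zero>\<^bsub>S\<^esub>}"
      using S.zero_closed by (intro equalityI subsetI) simp_all
    then show False using S(2) by simp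
  qed
  then obtain j w where w: "w \<in> carrier ?V" and jw: "frag_of (Poly_Mapping.single j 1, w) \<notin> T.K" by blast
  \<comment> \<open>Any multiple of \<open>n\<close> at or above \<open>j\<close> would do; the
    arrows move basis vectors downwards, so \<open>j\<close> can be reached from it.\<close>
  define q where "q = \<bar>j\<bar>"
  have "q * 1 \<le> q * n" using n_pos by (intro mult_left_mono) (linarith, simp add: q_def)
  then have jq: "j \<le> n * q" by (simp add: q_def mult.commute)
  let ?b = "Poly_Mapping.single (n * q) (1 :: 'k)"
  have base: "head Q (p (n * q + 1)) = base" by (rule base_shift)
  have bw: "frag_of (?b, w) \<notin> T.K"
  proof
    assume "frag_of (?b, w) \<in> T.K"
    then have K: "T.pure ?b w = T.K" by (simp add: pure_K)
    let ?a = "path_elt (head Q (p (j + 1))) (map p [j + 1..n * q]) (head Q (p (n * q + 1))) :: ('v, 'a, 'k) alg_elt"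
    have a: "?a \<in> carrier (\<Lambda> Q \<rho>)" by (rule path_elt_closed[OF segment_path[OF jq]])
    have "?a \<odot>\<^bsub>?X\<^esub> ?b = Poly_Mapping.single j 1"
      using loop_segment_op[OF jq, of "1 :: 'k"] by (simp add: path_elt_act_single[OF loop_word_is_word])
    then have "T.pure (Poly_Mapping.single j 1) w = T.K"
      using act[OF a] unfolding K[symmetric] by metis
    then show False using jw by (simp add: pure_K)
  qed
  have e: "poly_elt base xs f \<in> carrier (\<Lambda> Q \<rho> :: ('v, 'a, 'k) alg_elt ring)" by (rule poly_elt_closed[OF cycle_path])
  have v: "base \<in> verts Q" using qpaths_verts[OF cycle_path] by simp
  have evb: "vertex_elt base 1 \<odot>\<^bsub>T.T\<^esub> T.pure ?b w = T.pure ?b w"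
    using act(1)[OF vertex_elt_closed[OF v], of 1 ?b w] base
      vertex_elt_act_single[OF loop_word_is_word, of "n * q" base 1 "1 :: 'k"] by simp
  have "poly_elt base xs f \<odot>\<^bsub>T.T\<^esub> T.pure ?b w = T.pure ?b (laurent_of_poly f \<odot>\<^bsub>?V\<^esub> w)"
    using act(1)[OF e, of ?b w] loop_poly_act[of f q] T.pure_ract[OF Xc R w, of ?b "laurent_of_poly f"] by simp
  also have "\<dots> = T.K"
  proof -
    have "- frag_of (?b, \<zero>\<^bsub>?V\<^esub>) \<in> T.K"
      using T.pure_add_right[OF Xc V(5) V(5), of ?b] by (simp add: V(4))
    then have "frag_of (?b, \<zero>\<^bsub>?V\<^esub>) \<in> T.K" using T.K_simps(3) by fastforce
    then show ?thesis by (simp add: V(3)[OF w] pure_K)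
  qed
  finally have efb: "poly_elt base xs f \<odot>\<^bsub>T.T\<^esub> T.pure ?b w = T.K" .
  obtain s where s: "s \<in> carrier S" "h s = T.pure ?b w"
    using bij T.pure_mem_carrier[OF Xc w, of ?b] unfolding bij_betw_def by (metis imageE)
  have inj: "x = y" if "x \<in> carrier S" "y \<in> carrier S" "h x = h y" for x y
    by (rule inj_onD[OF bij_betw_imp_inj_on[OF bij] that(3,1,2)])
  have zero_iff: "x = \<zero>\<^bsub>S\<^esub>" if "x \<in> carrier S" "h x = T.K" for x
  proof -
    have "h (x \<oplus>\<^bsub>S\<^esub> x) = T.K"
      using h(2)[OF that(1,1)] that(2) T.coset_sum[of 0 0] by (simp add: T.coset_zero)
    then have "x \<oplus>\<^bsub>S\<^esub> x = x" using that by (intro inj) simp_all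
    then show ?thesis using that(1) by (simp add: S.add.l_cancel_one)
  qed
  have s0: "s \<noteq> \<zero>\<^bsub>S\<^esub>"
  proof
    assume "s = \<zero>\<^bsub>S\<^esub>"
    then have "T.pure ?b w \<oplus>\<^bsub>T.T\<^esub> T.pure ?b w = T.pure ?b w"
      using h(2)[OF s(1,1)] s(2) by simp
    then have "frag_of (?b, w) + frag_of (?b, w) - frag_of (?b, w) \<in> T.K"
      using T.coset_sum[of "frag_of (?b, w)" "frag_of (?b, w)"] w unfolding T.pure_def by (simp add: T.coset_eq)
    then show False using bw by simp
  qed
  have "vertex_elt base 1 \<odot>\<^bsub>S\<^esub> s = s"
    using h(3)[OF vertex_elt_closed[OF v] s(1), of 1] evb s v by (intro inj) (simp_all add: vertex_elt_closed)
  moreover have "poly_elt base xs f \<odot>\<^bsub>S\<^esub> s = \<zero>\<^bsub>S\<^esub>"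
    using h(3)[OF e s(1)] efb s e by (intro zero_iff) simp_all
  ultimately show ?thesis using s(1) s0 by blast
qed

end

section \<open>Direct sums\<close>

context algebra_module
begin

lemma carrier_submodule: "submodule (carrier M) (\<Lambda> Q \<rho>) M"
  by (rule submoduleI') auto

text \<open>The finite sums form a submodule that contains every \<open>A i\<close> and lies in
  every submodule that does. To add two of them, both are extended by zeros to the union of their
  index sets.\<close>

lemma submodule_sum_mem_iff:
  assumes A: "\<And>i. i \<in> I \<Longrightarrow> submodule (A i) (\<Lambda> Q \<rho>) M"
  shows "y \<in> submodule_sum (\<Lambda> Q \<rho>) M I A \<longleftrightarrow>
    (\<exists>J x. finite J \<and> J \<subseteq> I \<and> (\<forall>i\<in>J. x i \<in> A i) \<and> y = (\<Oplus>i\<in>J. x i))"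
proof -
  define D where "D = {y. \<exists>J x. finite J \<and> J \<subseteq> I \<and> (\<forall>i\<in>J. x i \<in> A i) \<and> y = (\<Oplus>i\<in>J. x i)}"
  have c: "x \<in> carrier M" if "i \<in> I" "x \<in> A i" for i x
    using submoduleD(1)[OF A[OF that(1)]] that(2) by blast
  have DI: "(\<Oplus>i\<in>J. x i) \<in> D" if "finite J" "J \<subseteq> I" "\<forall>i\<in>J. x i \<in> A i" for J x
    using that unfolding D_def by blast
  have ext: "(\<Oplus>i\<in>J. x i) = (\<Oplus>i\<in>J'. if i \<in> J then x i else \<zero>)"
    if "finite J'" "J \<subseteq> J'" "J' \<subseteq> I" "\<forall>i\<in>J. x i \<in> A i" for J J' x
    using that c by (intro add.finprod_mono_neutral_cong_left) (auto simp: subset_iff)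
  have D: "submodule D (\<Lambda> Q \<rho>) M"
  proof (rule submoduleI')
    show "D \<subseteq> carrier M"
      using c unfolding D_def by (auto intro!: finsum_closed)
    show "\<zero> \<in> D" using DI[of "{}"] by simp
    fix y assume "y \<in> D"
    then obtain J x where y: "finite J" "J \<subseteq> I" "\<forall>i\<in>J. x i \<in> A i" "y = (\<Oplus>i\<in>J. x i)" unfolding D_def by blast
    have xc: "x i \<in> carrier M" if "i \<in> J" for i using c y(2,3) that by blast
    show "a \<odot> y \<in> D" if a: "a \<in> carrier (\<Lambda> Q \<rho>)" for a
    proof -
      have "a \<odot> y = (\<Oplus>i\<in>J. a \<odot> x i)" using act_finsum[OF a, of J x] xc y(4) by simp
      moreover have "\<forall>i\<in>J. a \<odot> x i \<in> A i" using submoduleD(5)[OF A a] y(2,3) by blast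
      ultimately show ?thesis using DI[OF y(1,2)] by simp
    qed
    show "\<ominus> y \<in> D"
    proof -
      have "(\<Oplus>i\<in>J. \<ominus> x i) \<oplus> y = (\<Oplus>i\<in>J. \<ominus> x i \<oplus> x i)"
        using xc unfolding y(4) by (intro finsum_addf[symmetric]) auto
      also have "\<dots> = (\<Oplus>i\<in>J. \<zero>)" using xc by (intro add.finprod_cong') (auto simp: l_neg)
      also have "\<dots> = \<zero>" by simp
      finally have "\<ominus> y = (\<Oplus>i\<in>J. \<ominus> x i)"
        using xc by (intro minus_equality) (auto simp: y(4))
      moreover have "\<forall>i\<in>J. \<ominus> x i \<in> A i" using submoduleD(4)[OF A] y(2,3) by blast
      ultimately show ?thesis using DI[OF y(1,2)] by simp
    qed
    fix y' assume "y' \<in> D"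
    then obtain J' x' where y': "finite J'" "J' \<subseteq> I" "\<forall>i\<in>J'. x' i \<in> A i" "y' = (\<Oplus>i\<in>J'. x' i)" unfolding D_def by blast
    let ?K = "J \<union> J'" and ?f = "\<lambda>i. if i \<in> J then x i else \<zero>" and ?g = "\<lambda>i. if i \<in> J' then x' i else \<zero>"
    have K: "finite ?K" "?K \<subseteq> I" using y(1,2) y'(1,2) by simp_all
    have fg: "?f i \<in> A i" "?g i \<in> A i" if "i \<in> ?K" for i
      using that submoduleD(2)[OF A] K(2) y(3) y'(3) by auto
    have "y \<oplus> y' = (\<Oplus>i\<in>?K. ?f i) \<oplus> (\<Oplus>i\<in>?K. ?g i)"
      using ext[OF K(1) _ K(2) y(3)] ext[OF K(1) _ K(2) y'(3)] y(4) y'(4) by simp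
    also have "\<dots> = (\<Oplus>i\<in>?K. ?f i \<oplus> ?g i)"
      using c[OF subsetD[OF K(2)] fg(1)] c[OF subsetD[OF K(2)] fg(2)] by (intro finsum_addf[symmetric]) (blast intro: Pi_I)+
    finally show "y \<oplus> y' \<in> D"
      using DI[OF K, of "\<lambda>i. ?f i \<oplus> ?g i"] submoduleD(3)[OF A fg] K(2) by auto
  qed
  have "A i \<subseteq> D" if "i \<in> I" for i
  proof
    fix x assume "x \<in> A i"
    then show "x \<in> D" using DI[of "{i}" "\<lambda>_. x"] c[OF that, of x] that by simp
  qed
  then have "submodule_sum (\<Lambda> Q \<rho>) M I A \<subseteq> D"
    unfolding submodule_sum_def gen_submodule_def using D by blast
  moreover have "y \<in> submodule_sum (\<Lambda> Q \<rho>) M I A" if "y \<in> D" for y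
    unfolding submodule_sum_def gen_submodule_def
  proof (intro InterI, elim CollectE conjE)
    fix H assume H: "submodule H (\<Lambda> Q \<rho>) M" "(\<Union>i\<in>I. A i) \<subseteq> H"
    from that obtain J x where J: "J \<subseteq> I" "\<forall>i\<in>J. x i \<in> A i" "y = (\<Oplus>i\<in>J. x i)" unfolding D_def mem_Collect_eq by (elim exE conjE)
    have "x i \<in> H" if "i \<in> J" for i
    proof (rule subsetD[OF H(2)])
      show "x i \<in> (\<Union>i\<in>I. A i)" using J(1,2) that by (intro UN_I[of i]) auto
    qed
    then show "y \<in> H" unfolding J(3) by (rule finsum_mem_subgroup[OF submodule_subgroup[OF H(1)]])
  qed
  ultimately have "submodule_sum (\<Lambda> Q \<rho>) M I A = D" by (intro equalityI subsetI) (rule subsetD)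
  then show ?thesis unfolding D_def by simp
qed

lemma submodule_submodule_sum: "submodule (submodule_sum (\<Lambda> Q \<rho>) M I A) (\<Lambda> Q \<rho>) M"
  if "\<And>i. i \<in> I \<Longrightarrow> A i \<subseteq> carrier M"
proof (rule submoduleI')
  show "submodule_sum (\<Lambda> Q \<rho>) M I A \<subseteq> carrier M"
    unfolding submodule_sum_def gen_submodule_def using carrier_submodule that by blast
qed (auto simp: submodule_sum_def gen_submodule_def dest: submoduleD)

lemma submodule_sum_remove:
  assumes A: "\<And>i. i \<in> I \<Longrightarrow> submodule (A i) (\<Lambda> Q \<rho>) M" and \<mu>: "\<mu> \<in> I"
    and y: "y \<in> submodule_sum (\<Lambda> Q \<rho>) M I A"
  shows "\<exists>a\<in>A \<mu>. \<exists>b\<in>submodule_sum (\<Lambda> Q \<rho>) M (I - {\<mu>}) A. y = a \<oplus> b"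
proof -
  have "\<exists>J x. finite J \<and> J \<subseteq> I \<and> (\<forall>i\<in>J. x i \<in> A i) \<and> y = (\<Oplus>i\<in>J. x i)"
    by (rule iffD1[OF submodule_sum_mem_iff y]) (rule A)
  then obtain J x where J: "finite J" "J \<subseteq> I" "\<forall>i\<in>J. x i \<in> A i" "y = (\<Oplus>i\<in>J. x i)"
    by (elim exE conjE)
  have xc: "x i \<in> carrier M" if "i \<in> J" for i
    by (rule subsetD[OF submoduleD(1)[OF A[OF subsetD[OF J(2) that]]] bspec[OF J(3) that]])
  have b: "(\<Oplus>i\<in>J - {\<mu>}. x i) \<in> submodule_sum (\<Lambda> Q \<rho>) M (I - {\<mu>}) A"
  proof (rule iffD2[OF submodule_sum_mem_iff])
    show "\<exists>J' x'. finite J' \<and> J' \<subseteq> I - {\<mu>} \<and> (\<forall>i\<in>J'. x' i \<in> A i) \<and> (\<Oplus>i\<in>J - {\<mu>}. x i) = (\<Oplus>i\<in>J'. x' i)"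
      using J(1-3) by (intro exI[of _ "J - {\<mu>}"] exI[of _ x]) auto
  qed (rule A, simp)
  show ?thesis
  proof (cases "\<mu> \<in> J")
    case True
    have "y = (\<Oplus>i\<in>insert \<mu> (J - {\<mu>}). x i)" using J(4) by (simp only: insert_Diff[OF True])
    also have "\<dots> = x \<mu> \<oplus> (\<Oplus>i\<in>J - {\<mu>}. x i)"
      using J(1) xc True by (intro finsum_insert) auto
    finally show ?thesis by (intro bexI[OF _ bspec[OF J(3) True]] bexI[OF _ b])
  next
    case False
    then have "J - {\<mu>} = J" by simp
    moreover have "y \<in> carrier M" using xc unfolding J(4) by (intro finsum_closed) auto
    ultimately have "y = \<zero> \<oplus> (\<Oplus>i\<in>J - {\<mu>}. x i)" using J(4) by simp
    then show ?thesis by (intro bexI[OF _ submoduleD(2)[OF A[OF \<mu>]]] bexI[OF _ b])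
  qed
qed

lemma direct_sum_split:
  assumes sum: "is_direct_sum (\<Lambda> Q \<rho>) M \<Phi> A N" and \<mu>: "\<mu> \<in> \<Phi>"
  defines "N' \<equiv> submodule_sum (\<Lambda> Q \<rho>) M (\<Phi> - {\<mu>}) A"
  shows "submodule N' (\<Lambda> Q \<rho>) M" "A \<mu> \<inter> N' \<subseteq> {\<zero>}" "N' \<subseteq> N" "A \<mu> \<subseteq> N"
    "y \<in> N \<Longrightarrow> \<exists>a\<in>A \<mu>. \<exists>b\<in>N'. y = a \<oplus> b"
proof -
  have A: "\<And>i. i \<in> \<Phi> \<Longrightarrow> submodule (A i) (\<Lambda> Q \<rho>) M" and N_eq: "N = submodule_sum (\<Lambda> Q \<rho>) M \<Phi> A"
    and indep: "\<And>J x. finite J \<Longrightarrow> J \<subseteq> \<Phi> \<Longrightarrow> \<forall>i\<in>J. x i \<in> A i \<Longrightarrow> (\<Oplus>i\<in>J. x i) = \<zero> \<Longrightarrow> \<forall>i\<in>J. x i = \<zero>"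
    using sum unfolding is_direct_sum_def by blast+
  have A': "\<And>i. i \<in> \<Phi> - {\<mu>} \<Longrightarrow> submodule (A i) (\<Lambda> Q \<rho>) M" using A by blast
  have c: "x \<in> carrier M" if "i \<in> \<Phi>" "x \<in> A i" for i x
    using submoduleD(1)[OF A[OF that(1)]] that(2) by blast
  show "submodule N' (\<Lambda> Q \<rho>) M"
    unfolding N'_def using c by (intro submodule_submodule_sum) blast
  show "N' \<subseteq> N" unfolding N'_def N_eq submodule_sum_def gen_submodule_def by blast
  show "A \<mu> \<subseteq> N" unfolding N_eq submodule_sum_def gen_submodule_def using \<mu> by blast
  show "A \<mu> \<inter> N' \<subseteq> {\<zero>}"
  proof
    fix y assume y: "y \<in> A \<mu> \<inter> N'"
    then have mem: "y \<in> submodule_sum (\<Lambda> Q \<rho>) M (\<Phi> - {\<mu>}) A" by (simp add: N'_def)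
    have "\<exists>J x. finite J \<and> J \<subseteq> \<Phi> - {\<mu>} \<and> (\<forall>i\<in>J. x i \<in> A i) \<and> y = (\<Oplus>i\<in>J. x i)"
      by (rule iffD1[OF submodule_sum_mem_iff mem]) (rule A')
    then obtain J x where J: "finite J" "J \<subseteq> \<Phi> - {\<mu>}" "\<forall>i\<in>J. x i \<in> A i" "y = (\<Oplus>i\<in>J. x i)"
      by (elim exE conjE)
    \<comment> \<open>An element common to \<open>A \<mu>\<close> and the other summands becomes a
      relation between the summands once its negative is entered at \<mu>; independence then makes
      it zero.\<close>
    let ?x = "x(\<mu> := \<ominus> y)"
    have ymu: "\<ominus> y \<in> A \<mu>" "y \<in> carrier M" using y submoduleD(4)[OF A[OF \<mu>]] c[OF \<mu>] by blast+
    have xc: "x \<in> J \<rightarrow> carrier M" using c J(2,3) by blast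
    have mu: "\<mu> \<notin> J" using J(2) by blast
    then have eq: "?x i = x i" if "i \<in> J" for i using that by auto
    have "(\<Oplus>i\<in>J. ?x i) = (\<Oplus>i\<in>J. x i)" by (rule add.finprod_cong'[OF refl xc]) (rule eq)
    moreover have "(\<Oplus>i\<in>insert \<mu> J. ?x i) = ?x \<mu> \<oplus> (\<Oplus>i\<in>J. ?x i)"
    proof (rule finsum_insert[OF J(1) mu])
      show "?x \<in> J \<rightarrow> carrier M" using xc eq by (metis (no_types, lifting) Pi_cong)
      show "?x \<mu> \<in> carrier M" using ymu(2) by simp
    qed
    ultimately have "(\<Oplus>i\<in>insert \<mu> J. ?x i) = \<zero>"
      using ymu(2) J(4) by (simp add: l_neg)
    moreover have "\<forall>i\<in>insert \<mu> J. ?x i \<in> A i" using J(3) ymu(1) mu by auto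
    ultimately have "\<forall>i\<in>insert \<mu> J. ?x i = \<zero>" using J(1,2) \<mu> by (intro indep) auto
    then have y0: "\<ominus> y = \<zero>" by simp
    have "\<ominus> (\<ominus> y) = \<zero>" unfolding y0 by simp
    then show "y \<in> {\<zero>}" unfolding minus_minus[OF ymu(2)] by simp
  qed
  show "\<exists>a\<in>A \<mu>. \<exists>b\<in>N'. y = a \<oplus> b" if y: "y \<in> N"
  proof -
    have "y \<in> submodule_sum (\<Lambda> Q \<rho>) M \<Phi> A" by (rule subsetD[OF equalityD1[OF N_eq] y])
    with A \<mu> show ?thesis unfolding N'_def by (rule submodule_sum_remove[where A = A and I = \<Phi> and \<mu> = \<mu>])
  qed
qed

end

section \<open>Primitive torsion\<close>

lemma (in primitive_path) cyclic_0: "p 0 = last xs"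
proof -
  have "xs \<noteq> []" using n_pos by auto
  moreover have "(- 1) mod n = n - 1" using n_pos by (simp add: zmod_minus1)
  ultimately show ?thesis by (simp add: cyclic_def last_conv_nth nat_diff_distrib')
qed

text \<open>The arrow that acts first determines the cycle: each following arrow is forced by the
  string algebra axiom. The two periodic sequences agree at all numbers up to 0, hence everywhere by
  periodicity, and having the same minimal period they have the same length.\<close>

lemma (in primitive_path) primitive_path_eq:
  assumes ys: "primitive_path Q \<rho> ys" and last: "last ys = last xs"
  shows "ys = xs"
proof -
  interpret Y: primitive_path Q \<rho> ys by fact
  have neg: "cyclic ys (- int m) = p (- int m)" for m
  proof (induction m)
    case 0
    then show ?case using cyclic_0 Y.cyclic_0 last by simp
  next
    case (Suc m)
    have t: "- int (Suc m) + 1 = - int m" by simp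
    have IH: "cyclic ys (- int m) = p (- int m)" by (rule Suc.IH)
    show ?case
    proof (rule left_unique[of _ _ "p (- int m)"])
      show "tail Q (cyclic ys (- int (Suc m))) = head Q (p (- int m))" "[cyclic ys (- int (Suc m)), p (- int m)] \<notin> \<rho>"
        using Y.p_consecutive[of "- int (Suc m)"] Y.p_not_relation[of "- int (Suc m)"] unfolding t IH .
      show "tail Q (p (- int (Suc m))) = head Q (p (- int m))" "[p (- int (Suc m)), p (- int m)] \<notin> \<rho>"
        using p_consecutive[of "- int (Suc m)"] p_not_relation[of "- int (Suc m)"] unfolding t .
    qed (rule Y.p_arc p_arc)+
  qed
  have eq: "cyclic ys t = p t" for t
  proof -
    \<comment> \<open>A common multiple of both periods that is at least \<open>t\<close>, so that
      \<open>t - a\<close> falls where agreement is known.\<close>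
    define a where "a = n * int (length ys) * \<bar>t\<bar>"
    have "1 * \<bar>t\<bar> \<le> n * int (length ys) * \<bar>t\<bar>"
    proof (intro mult_right_mono)
      have "0 < n * int (length ys)" using n_pos Y.n_pos by (rule mult_pos_pos)
      then show "1 \<le> n * int (length ys)" by linarith
    qed simp
    then have "t \<le> a" by (simp add: a_def)
    then have ta: "- int (nat (a - t)) = t - a" by simp
    have "t - a = t + int (length ys) * - (n * \<bar>t\<bar>)" "t - a = t + n * - (int (length ys) * \<bar>t\<bar>)"
      by (simp_all add: a_def)
    then have "cyclic ys (t - a) = cyclic ys t" "p (t - a) = p t"
      using Y.p_periodic[of t "- (n * \<bar>t\<bar>)"] p_periodic[of t "- (int (length ys) * \<bar>t\<bar>)"] by (simp_all only:)
    then show ?thesis using neg[of "nat (a - t)"] unfolding ta by (simp only:)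
  qed
  have "power_biinf (cycle_word ys) = (power_biinf (cycle_word xs) :: ('v, 'a) word)"
    unfolding power_biinf_eq Y.power_biinf_eq eq ..
  then have "length ys = length xs"
    using period_power Y.period_power by (simp only:)
  then have "map (cyclic ys) [1..int (length ys)] = map p [1..n]" unfolding eq by (simp only:)
  then show ?thesis by (rule trans[OF trans[OF Y.xs_eq] xs_eq[symmetric]])
qed

locale cycle_module = primitive_path Q \<rho> xs + algebra_module Q \<rho> M
  for Q :: "('v, 'a) pre_digraph" and \<rho> :: "'a list set" and xs :: "'a list"
    and M :: "(('v, 'a, 'k::field) alg_elt, 'm) module" (structure)
begin

abbreviation P :: "('v, 'a, 'k) alg_elt" where "P \<equiv> path_elt base xs base"
abbreviation e :: "'k poly \<Rightarrow> ('v, 'a, 'k) alg_elt" where "e \<equiv> poly_elt base xs"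

lemma P_closed: "P \<in> carrier (\<Lambda> Q \<rho>)"
  by (rule path_elt_closed[OF cycle_path])

lemma e_closed: "e h \<in> carrier (\<Lambda> Q \<rho>)"
  by (rule poly_elt_closed[OF cycle_path])

lemma base_vert: "base \<in> verts Q"
  using qpaths_verts[OF cycle_path] by simp

lemma e_base: "x \<in> carrier M \<Longrightarrow> vertex_elt base 1 \<odot> (P \<odot> x) = P \<odot> x"
  by (rule vertex_act_path_act[OF cycle_path])

lemma e_P: "x \<in> carrier M \<Longrightarrow> e h \<odot> (P \<odot> x) = P \<odot> (e h \<odot> x)"
  by (rule poly_act_path[OF cycle_path])

lemma e_mult: "x \<in> carrier M \<Longrightarrow> e (g * h) \<odot> x = e g \<odot> (e h \<odot> x)"
  by (rule poly_act_mult[OF cycle_path])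

lemma e_add: "x \<in> carrier M \<Longrightarrow> e (g + h) \<odot> x = e g \<odot> x \<oplus> e h \<odot> x"
  by (rule poly_act_add[OF cycle_path])

lemma e_zero: "x \<in> carrier M \<Longrightarrow> e 0 \<odot> x = \<zero>"
  by (simp add: poly_elt_def \<Lambda>_zero[symmetric])

lemma e_one: "x \<in> carrier M \<Longrightarrow> e 1 \<odot> (P \<odot> x) = P \<odot> x"
  by (rule poly_act_1) (rule e_base)

lemma e_sum:
  assumes "x \<in> carrier M"
  shows "e (\<Sum>i\<in>I. h i) \<odot> x = (\<Oplus>i\<in>I. e (h i) \<odot> x)"
proof (induction I rule: infinite_finite_induct)
  case (insert i I)
  have "e (\<Sum>i\<in>insert i I. h i) \<odot> x = e (h i) \<odot> x \<oplus> e (\<Sum>i\<in>I. h i) \<odot> x"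
    using insert.hyps assms by (simp add: e_add)
  also have "\<dots> = (\<Oplus>i\<in>insert i I. e (h i) \<odot> x)"
    unfolding insert.IH using insert.hyps assms e_closed by (intro finsum_insert[symmetric]) auto
  finally show ?case .
qed (use assms in \<open>simp_all add: e_zero\<close>)

text \<open>A different primitive cycle at the same vertex has a different last arrow. That arrow
  meets \<open>p 1\<close>, the arrow applied last by P, and is not \<open>p 0\<close>, so the
  product vanishes.\<close>

lemma other_cycle_annihilates:
  assumes ys: "primitive_path Q \<rho> ys" "head Q (hd ys) = base" "ys \<noteq> xs" and x: "x \<in> carrier M"
  shows "path_elt base ys base \<odot> (P \<odot> x) = \<zero>"
proof -
  interpret Y: primitive_path Q \<rho> ys by fact
  let ?q = "cyclic ys" and ?m = "int (length ys)"
  have ne: "ys \<noteq> []" using Y.n_pos by auto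
  have hd: "hd ys = ?q 1" using Y.cyclic_nth[of 0] ne by (simp add: hd_conv_nth)
  have qm: "?q ?m = last ys" using Y.p_periodic[of 0 1] Y.cyclic_0 by simp
  have lne: "last ys \<noteq> p 0" using primitive_path_eq[OF ys(1)] ys(3) cyclic_0 by auto
  have la: "last ys \<in> arcs Q" using Y.p_arc[of ?m] by (simp add: qm)
  let ?y = "P \<odot> x"
  have yc: "?y \<in> carrier M" using P_closed x by simp
  have m1: "1 \<le> ?m" using Y.n_pos by linarith
  have "ys = map ?q ([1..?m - 1] @ [?m])" by (rule trans[OF Y.xs_eq arg_cong[where f = "map ?q", OF upto_rec2[OF m1]]])
  then have split: "ys = map ?q [1..?m - 1] @ [last ys]" by (simp only: map_append list.map qm)
  have p1: "(base, map ?q [1..?m - 1], head Q (last ys)) \<in> qpaths Q"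
    using Y.segment_path[of 0 "?m - 1"] m1 ne qm hd ys(2) by simp
  have tl: "tail Q (last ys) = base"
    using Y.p_consecutive[of 0] unfolding Y.cyclic_0 using hd ys(2) by simp
  have "path_elt base ys base \<odot> ?y = path_elt base (map ?q [1..?m - 1]) (head Q (last ys)) \<odot> (path_elt (head Q (last ys)) [last ys] base \<odot> ?y)"
    using path_act_append[OF p1 _ yc, of "[last ys]" base] arrow_path[OF la] unfolding tl split[symmetric] by simp
  also have "path_elt (head Q (last ys)) [last ys] base \<odot> ?y = arrow_elt (last ys) \<odot> ?y"
    unfolding tl[symmetric] path_elt_arrow by (rule refl)
  also have "\<dots> = \<zero>"
  proof -
    have "xs = p 1 # map p [2..n]"
    proof -
      have "1 \<le> n" using n_pos by linarith
      then have u: "[1..n] = 1 # [2..n]" by (simp add: upto_rec1)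
      have "xs = map p (1 # [2..n])" by (rule trans[OF xs_eq arg_cong[where f = "map p", OF u]])
      then show ?thesis by (simp only: list.map)
    qed
    then obtain zs where zs: "xs = p 1 # zs" by blast
    have cp: "(base, p 1 # zs, base) \<in> qpaths Q" using cycle_path unfolding zs[symmetric] .
    define z where "z = path_elt (tail Q (p 1)) zs base \<odot> x"
    have "(tail Q (p 1), zs, base) \<in> qpaths Q" using cp by (simp add: qpaths_Cons)
    then have zc: "z \<in> carrier M" unfolding z_def by (intro act_closed path_elt_closed x)
    have "?y = arrow_elt (p 1) \<odot> z"
      using path_act_Cons[OF cp x] unfolding zs[symmetric] z_def .
    then have "arrow_elt (last ys) \<odot> ?y = (arrow_elt (last ys) \<otimes>\<^bsub>\<Lambda> Q \<rho>\<^esub> arrow_elt (p (0 + 1))) \<odot> z"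
      using act_mult[OF arrow_elt_closed[OF la] arrow_elt_closed[OF p_arc[of 1]] zc] by simp
    also have "\<dots> = \<zero>" unfolding other_arrow_annihilates[OF la lne] using zc by simp
    finally show ?thesis .
  qed
  also have "path_elt base (map ?q [1..?m - 1]) (head Q (last ys)) \<odot> \<zero> = \<zero>"
    by (rule act_zero[OF path_elt_closed[OF p1]])
  finally show ?thesis .
qed

text \<open>On the image of P all other cycles in the sum vanish. The sum has to be shown finite
  before P can be split off: a cycle is determined by its last arrow, and few arrows leave the
  vertex.\<close>

lemma z_elt_act:
  assumes x: "x \<in> carrier M"
  shows "z_elt Q \<rho> base \<odot> (P \<odot> x) = P \<odot> (P \<odot> x)"
proof -
  let ?Z = "{ys. primitive_cycle Q \<rho> (cycle_word ys :: ('v, 'a) word) \<and> head Q (hd ys) = base}"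
  let ?s = "\<lambda>ys. Poly_Mapping.single (base, ys, base) (1 :: 'k)"
  let ?y = "P \<odot> x"
  have yc: "?y \<in> carrier M" using P_closed x by simp
  have pp: "primitive_path Q \<rho> ys" if "ys \<in> ?Z" for ys
    using that string_algebra_axioms by (simp add: primitive_path_def primitive_path_axioms_def)
  have ne: "xs \<noteq> []" using n_pos by auto
  have xsZ: "xs \<in> ?Z" using primitive cyclic_nth[of 0] ne by (simp add: hd_conv_nth)
  have "inj_on last ?Z"
  proof (rule inj_onI)
    fix ys zs assume "ys \<in> ?Z" "zs \<in> ?Z" "last ys = last zs"
    then show "ys = zs" using primitive_path.primitive_path_eq[OF pp pp] by simp
  qed
  moreover have "last ` ?Z \<subseteq> out_arcs Q base"
  proof (rule image_subsetI)
    fix ys assume ys: "ys \<in> ?Z"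
    interpret Y: primitive_path Q \<rho> ys by (rule pp[OF ys])
    have "hd ys = cyclic ys 1" using Y.cyclic_nth[of 0] Y.n_pos by (simp add: hd_conv_nth)
    then show "last ys \<in> out_arcs Q base"
      using Y.p_arc[of 0] Y.p_consecutive[of 0] Y.cyclic_0 ys by (simp add: out_arcs_def)
  qed
  ultimately have fin: "finite ?Z"
    using two_out[OF base_vert] by (meson inj_on_finite)
  have cyc: "(base, ys, base) \<in> qpaths Q" if "ys \<in> ?Z" for ys
  proof -
    interpret Y: primitive_path Q \<rho> ys by (rule pp[OF that])
    have "hd ys = cyclic ys 1" using Y.cyclic_nth[of 0] Y.n_pos by (simp add: hd_conv_nth)
    then show ?thesis using Y.cycle_path that by simp
  qed
  have others: "Poly_Mapping.keys (sum ?s Z) \<subseteq> qpaths Q \<and> residue Q \<rho> (sum ?s Z) \<odot> ?y = \<zero>"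
    if "finite Z" "Z \<subseteq> ?Z - {xs}" for Z
    using that
  proof (induction Z)
    case empty
    then show ?case using yc by (simp add: \<Lambda>_zero[symmetric])
  next
    case (insert ys Z)
    then have ys: "ys \<in> ?Z" "ys \<noteq> xs" and IH: "Poly_Mapping.keys (sum ?s Z) \<subseteq> qpaths Q" "residue Q \<rho> (sum ?s Z) \<odot> ?y = \<zero>"
      by auto
    have k: "Poly_Mapping.keys (?s ys) \<subseteq> qpaths Q" using cyc[OF ys(1)] by simp
    have "residue Q \<rho> (?s ys) \<odot> ?y = \<zero>"
      using other_cycle_annihilates[OF pp[OF ys(1)] _ ys(2) x] ys(1) by (simp add: path_elt_def)
    then have "residue Q \<rho> (sum ?s (insert ys Z)) \<odot> ?y = \<zero>"
      using act_add[OF residue_closed[OF k] residue_closed[OF IH(1)] yc] IH insert.hyps by (simp add: \<Lambda>_add)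
    moreover have "Poly_Mapping.keys (sum ?s (insert ys Z)) \<subseteq> qpaths Q"
      using Poly_Mapping.keys_add[of "?s ys" "sum ?s Z"] k IH(1) insert.hyps by auto
    ultimately show ?case by simp
  qed
  have o: "Poly_Mapping.keys (sum ?s (?Z - {xs})) \<subseteq> qpaths Q" "residue Q \<rho> (sum ?s (?Z - {xs})) \<odot> ?y = \<zero>"
    using others[of "?Z - {xs}"] fin by simp_all
  have "z_elt Q \<rho> base = residue Q \<rho> (sum ?s ?Z)"
    by (simp add: z_elt_def cycle_word_def)
  also have "sum ?s ?Z = ?s xs + sum ?s (?Z - {xs})"
    by (rule sum.remove[OF fin xsZ])
  finally have "z_elt Q \<rho> base = P \<oplus>\<^bsub>\<Lambda> Q \<rho>\<^esub> residue Q \<rho> (sum ?s (?Z - {xs}))"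
    by (simp add: \<Lambda>_add path_elt_def)
  then show ?thesis
    using act_add[OF P_closed residue_closed[OF o(1)] yc] o(2) yc P_closed by simp
qed

lemma module_support_base:
  assumes "x \<in> carrier M" "vertex_elt base 1 \<odot> x = x"
  shows "module_support Q \<rho> M x = (if x = \<zero> then {} else {base})"
proof -
  have "vertex_elt w 1 \<odot> x = \<zero>" if "w \<in> verts Q" "w \<noteq> base" for w
    using vertex_act_vertex_act[OF that(1) base_vert assms(1), of 1 1] assms that(2) by simp
  then show ?thesis
    using assms base_vert vertex_elt_closed by (auto simp: module_support_def)
qed

text \<open>On the image of P the variable of a polynomial acts as P and its coefficients act
  through the single vertex \<open>base\<close>, so the action defining \<open>tau1\<close> becomes
  that of \<open>e h\<close>. This is why all vectors are brought into the image of P.\<close>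

lemma mem_tau1:
  assumes x: "x \<in> carrier M" and h: "poly h 0 = 1" "e h \<odot> (P \<odot> x) = \<zero>"
  shows "P \<odot> x \<in> tau1 Q \<rho> M"
proof -
  have single: "(\<Oplus>v\<in>{base}. g v) = g base" if "g base \<in> carrier M" for g
    using finsum_insert[of "{}" base g] that by simp
  have scalar: "scalar_act Q \<rho> M c (P \<odot> y) = vertex_elt base c \<odot> (P \<odot> y)" if "y \<in> carrier M" for c y
    unfolding scalar_act_def module_support_base[OF act_closed[OF P_closed that] e_base[OF that]]
    using single[of "\<lambda>v. vertex_elt v c \<odot> (P \<odot> y)"] that P_closed act_closed[OF vertex_elt_closed[OF base_vert]] act_zero[OF vertex_elt_closed[OF base_vert]]
    by (simp split: if_split)
  have z: "z_act Q \<rho> M (P \<odot> y) = P \<odot> (P \<odot> y)" if "y \<in> carrier M" for y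
    unfolding z_act_def module_support_base[OF act_closed[OF P_closed that] e_base[OF that]]
    using single[of "\<lambda>v. z_elt Q \<rho> v \<odot> (vertex_elt v 1 \<odot> (P \<odot> y))"] that P_closed act_zero[OF P_closed]
    by (simp add: e_base[OF that] z_elt_act[OF that] split: if_split)
  have zpow: "(z_act Q \<rho> M ^^ i) (P \<odot> x) = P \<odot> (e (monom 1 i) \<odot> x)" for i
  proof (induction i)
    case 0
    have "P \<odot> (e 1 \<odot> x) = P \<odot> x" unfolding e_P[OF x, symmetric] by (rule e_one[OF x])
    then show ?case by (simp add: monom_0 one_pCons)
  next
    case (Suc i)
    have "e (monom 1 (Suc i)) \<odot> x = P \<odot> (e (monom 1 i) \<odot> x)"
      unfolding monom_Suc by (rule poly_act_pCons_0[OF cycle_path x])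
    then show ?case
      unfolding funpow.simps o_def Suc.IH by (simp only: z[OF act_closed[OF e_closed x]])
  qed
  have "poly_act Q \<rho> M h (P \<odot> x) = (\<Oplus>i\<in>{..degree h}. e (monom (coeff h i) i) \<odot> (P \<odot> x))"
    unfolding poly_act_def
  proof (rule add.finprod_cong'[OF refl])
    show "(\<lambda>i. e (monom (coeff h i) i) \<odot> (P \<odot> x)) \<in> {..degree h} \<rightarrow> carrier M"
      by (intro Pi_I act_closed e_closed P_closed x)
    fix i
    have "monom (coeff h i) i = [:coeff h i:] * monom 1 i" by (simp add: smult_monom)
    then have eq: "e (monom (coeff h i) i) \<odot> (P \<odot> x) = vertex_elt base (coeff h i) \<odot> (e (monom 1 i) \<odot> (P \<odot> x))"
      using e_mult[OF act_closed[OF P_closed x]] by (simp add: poly_elt_const del: mult_pCons_left)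
    show "scalar_act Q \<rho> M (coeff h i) ((z_act Q \<rho> M ^^ i) (P \<odot> x)) = e (monom (coeff h i) i) \<odot> (P \<odot> x)"
      unfolding zpow scalar[OF act_closed[OF e_closed x]] unfolding e_P[OF x, symmetric] by (rule eq[symmetric])
  qed
  also have "\<dots> = e h \<odot> (P \<odot> x)"
    using e_sum[OF act_closed[OF P_closed x], where I = "{..degree h}" and h = "\<lambda>i. monom (coeff h i) i"]
    by (simp add: poly_as_sum_of_monoms)
  finally show ?thesis
    unfolding tau1_def using h by (intro CollectI conjI exI[of _ h] act_closed P_closed x) simp_all
qed

end

section \<open>Linear dependence and quotient maps\<close>

text \<open>More vectors than coordinates are dependent; \<open>c i b\<close> is coordinate
  \<open>b\<close> of vector \<open>i\<close>. The induction removes one coordinate by Gaussian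
  elimination.\<close>

lemma linear_dependence:
  fixes c :: "'i \<Rightarrow> 'b \<Rightarrow> 'k::field"
  assumes "finite B" "finite I" "card B < card I"
  shows "\<exists>a. (\<exists>i\<in>I. a i \<noteq> 0) \<and> (\<forall>b\<in>B. (\<Sum>i\<in>I. a i * c i b) = 0)"
  using assms
proof (induction B arbitrary: I c)
  case empty
  then have "I \<noteq> {}" by auto
  then show ?case by (intro exI[of _ "\<lambda>_. 1"]) auto
next
  case (insert b B)
  show ?case
  proof (cases "\<forall>i\<in>I. c i b = 0")
    case True
    have "card B < card I" using insert.prems(2) insert.hyps by simp
    from insert.IH[OF insert.prems(1) this] obtain a where
      a: "\<exists>i\<in>I. a i \<noteq> 0" "\<forall>x\<in>B. (\<Sum>i\<in>I. a i * c i x) = 0" by blast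
    have "(\<Sum>i\<in>I. a i * c i b) = 0" using True by (simp add: sum.neutral)
    then show ?thesis using a by (intro exI[of _ a]) simp
  next
    case False
    then obtain l where l: "l \<in> I" "c l b \<noteq> 0" by blast
    let ?I = "I - {l}"
    have "card B < card ?I" using insert.prems insert.hyps l by simp
    from insert.IH[OF _ this, of "\<lambda>i x. c i x - c i b / c l b * c l x"] obtain a where
      a: "\<exists>i\<in>?I. a i \<noteq> 0" "\<forall>x\<in>B. (\<Sum>i\<in>?I. a i * (c i x - c i b / c l b * c l x)) = 0"
      using insert.prems by blast
    define s where "s = (\<Sum>i\<in>?I. a i * c i b)"
    \<comment> \<open>The coefficient of the pivot \<open>l\<close> is chosen to cancel coordinate
      \<open>b\<close>; in the other coordinates it restores the multiples of the pivot subtracted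
      before the induction hypothesis was applied.\<close>
    define a' where "a' = a(l := - s / c l b)"
    have split: "(\<Sum>i\<in>I. a' i * c i x) = - s / c l b * c l x + (\<Sum>i\<in>?I. a i * c i x)" for x
    proof -
      have "(\<Sum>i\<in>?I. a' i * c i x) = (\<Sum>i\<in>?I. a i * c i x)"
        by (intro sum.cong) (auto simp: a'_def)
      then show ?thesis
        using sum.remove[OF insert.prems(1) l(1), of "\<lambda>i. a' i * c i x"] by (simp add: a'_def)
    qed
    have "(\<Sum>i\<in>I. a' i * c i x) = 0" if "x \<in> B" for x
    proof -
      have "0 = (\<Sum>i\<in>?I. a i * (c i x - c i b / c l b * c l x))" using a(2) that by simp
      also have "\<dots> = (\<Sum>i\<in>?I. a i * c i x) - (\<Sum>i\<in>?I. a i * c i b * (c l x / c l b))"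
        by (simp add: algebra_simps sum_subtractf)
      also have "(\<Sum>i\<in>?I. a i * c i b * (c l x / c l b)) = s * (c l x / c l b)"
        unfolding s_def by (rule sum_distrib_right[symmetric])
      finally show ?thesis unfolding split by simp
    qed
    moreover have "(\<Sum>i\<in>I. a' i * c i b) = 0"
      unfolding split using l by (simp flip: s_def)
    moreover have "\<exists>i\<in>I. a' i \<noteq> 0" using a(1) by (auto simp: a'_def)
    ultimately show ?thesis by (intro exI[of _ a']) simp
  qed
qed

context algebra_module
begin

lemma finsum_submodule:
  assumes A: "submodule A (\<Lambda> Q \<rho>) M" and g: "\<And>i. i \<in> I \<Longrightarrow> g i \<in> A"
  shows "finsum (M\<lparr>carrier := A\<rparr>) g I = finsum M g I"
proof -
  interpret A: left_module "\<Lambda> Q \<rho>" "M\<lparr>carrier := A\<rparr>" by (rule submodule_left_module[OF A])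
  show ?thesis
    using g
  proof (induction I rule: infinite_finite_induct)
    case (insert i I)
    have "g \<in> I \<rightarrow> carrier M" "g i \<in> carrier M" "g \<in> I \<rightarrow> A" "g i \<in> A"
      using insert.prems submoduleD(1)[OF A] by auto
    then show ?case using insert by simp
  qed simp_all
qed

text \<open>Replaces the quotient module by a surjection with kernel \<open>N\<close>, so that
  cosets need not appear again.\<close>

lemma quotient_epi:
  assumes N: "submodule N (\<Lambda> Q \<rho>) M" and S: "left_module (\<Lambda> Q \<rho>) S"
    and iso: "module_iso (\<Lambda> Q \<rho>) (quot_module M N) S"
  shows "\<exists>\<psi>. linear_on (\<Lambda> Q \<rho>) M S \<psi> \<and> \<psi> ` carrier M = carrier S \<and>
    (\<forall>x\<in>carrier M. \<psi> x = \<zero>\<^bsub>S\<^esub> \<longleftrightarrow> x \<in> N)"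
proof -
  interpret S: left_module "\<Lambda> Q \<rho>" S by (rule S)
  have subgroup: "subgroup N (add_monoid M)" by (rule submodule_subgroup[OF N])
  interpret N: abelian_subgroup N M
    using abelian_subgroupI3[OF additive_subgroupI[OF subgroup]] abelian_group_axioms by blast
  note N1 = submoduleD[OF N]
  obtain h where bij: "bij_betw h (a_rcosets N) (carrier S)"
    and add: "\<And>X Y. X \<in> a_rcosets N \<Longrightarrow> Y \<in> a_rcosets N \<Longrightarrow> h (X <+> Y) = h X \<oplus>\<^bsub>S\<^esub> h Y"
    and smult: "\<And>a X. a \<in> carrier (\<Lambda> Q \<rho>) \<Longrightarrow> X \<in> a_rcosets N \<Longrightarrow>
      h (\<Union>x\<in>X. N +> (a \<odot> x)) = a \<odot>\<^bsub>S\<^esub> h X"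
    using iso by (auto simp: module_iso_def quot_module_def)
  have cosets: "a_rcosets N = (\<lambda>x. N +> x) ` carrier M"
    by (auto simp: a_r_coset_def A_RCOSETS_def RCOSETS_def)
  have in_cosets: "N +> x \<in> a_rcosets N" if "x \<in> carrier M" for x using that by (simp add: cosets)
  \<comment> \<open>Scalar multiplication in \<open>quot_module\<close> is a union over a coset, all
    of whose elements give the same result because \<open>N\<close> is a submodule.\<close>
  have act: "(\<Union>y\<in>N +> x. N +> (a \<odot> y)) = N +> (a \<odot> x)" if a: "a \<in> carrier (\<Lambda> Q \<rho>)" and x: "x \<in> carrier M" for a x
  proof -
    have "N +> (a \<odot> y) = N +> (a \<odot> x)" if y: "y \<in> N +> x" for y
    proof -
      have "y \<ominus> x \<in> N" using N.a_rcos_module_imp[OF x y] by (simp add: minus_eq)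
      moreover have yc: "y \<in> carrier M"
        using y x N1(1) by (auto simp: a_r_coset_def r_coset_def)
      ultimately have "a \<odot> y \<ominus> a \<odot> x \<in> N"
        using N1(5)[OF a] act_diff[OF a yc x] by metis
      then have "a \<odot> y \<in> N +> (a \<odot> x)"
        using N.a_rcos_module_rev[of "a \<odot> x" "a \<odot> y"] a x yc by (simp add: minus_eq)
      then show ?thesis
        using a_repr_independence[OF _ _ subgroup] a x by (metis act_closed)
    qed
    moreover have "x \<in> N +> x" by (rule N.a_rcos_self[OF x])
    ultimately show ?thesis by blast
  qed
  define \<psi> where "\<psi> x = h (N +> x)" for x
  have lin: "linear_on (\<Lambda> Q \<rho>) M S \<psi>"
    unfolding linear_on_def \<psi>_def
  proof (intro conjI ballI)
    show "h (N +> x) \<in> carrier S" if "x \<in> carrier M" for x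
      using bij_betw_apply[OF bij in_cosets[OF that]] .
    show "h (N +> (x \<oplus> y)) = h (N +> x) \<oplus>\<^bsub>S\<^esub> h (N +> y)" if "x \<in> carrier M" "y \<in> carrier M" for x y
      using add[OF in_cosets in_cosets, OF that] N.a_rcos_sum[OF that] by simp
    show "h (N +> (a \<odot> x)) = a \<odot>\<^bsub>S\<^esub> h (N +> x)" if "a \<in> carrier (\<Lambda> Q \<rho>)" "x \<in> carrier M" for a x
      using smult[OF that(1) in_cosets[OF that(2)]] act[OF that] by simp
  qed
  have zero: "\<psi> \<zero> = \<zero>\<^bsub>S\<^esub>"
    by (rule linear_on_zero[OF lin]) unfold_locales
  have "\<psi> ` carrier M = carrier S"
    using bij_betw_imp_surj_on[OF bij] by (simp add: cosets \<psi>_def image_image)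
  moreover have "\<psi> x = \<zero>\<^bsub>S\<^esub> \<longleftrightarrow> x \<in> N" if x: "x \<in> carrier M" for x
  proof
    assume "x \<in> N"
    then have "N +> x = N +> \<zero>" using N.a_rcos_const N1(2) by simp
    then show "\<psi> x = \<zero>\<^bsub>S\<^esub>" using zero by (simp add: \<psi>_def)
  next
    assume "\<psi> x = \<zero>\<^bsub>S\<^esub>"
    then have "h (N +> x) = h (N +> \<zero>)" using zero by (simp add: \<psi>_def)
    then have "N +> x = N +> \<zero>"
      using inj_onD[OF bij_betw_imp_inj_on[OF bij]] in_cosets x zero_closed by blast
    then have "N +> x = N" using N.a_rcos_const N1(2) by simp
    then show "x \<in> N" using N.a_rcos_self[OF x] by simp
  qed
  ultimately show ?thesis using lin by (intro exI[of _ \<psi>]) simp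
qed

end

section \<open>Divisibility modulo primitive torsion\<close>

context cycle_module
begin

text \<open>The condition says that \<open>h(P)\<close> annihilates \<open>t - f(P) u\<close>.\<close>

definition almost_divisible :: "'k poly \<Rightarrow> 'm set \<Rightarrow> 'm \<Rightarrow> bool" where
  "almost_divisible f H t \<longleftrightarrow> t \<in> carrier M \<and> (\<exists>u\<in>H. \<exists>h. poly h 0 = 1 \<and> e h \<odot> t = e (h * f) \<odot> u)"

lemma almost_divisible_act:
  assumes "submodule H (\<Lambda> Q \<rho>) M" "u \<in> H"
  shows "almost_divisible f H (e f \<odot> u)"
proof -
  have u: "u \<in> carrier M" using submoduleD(1)[OF assms(1)] assms(2) by blast
  then have "e 1 \<odot> (e f \<odot> u) = e (1 * f) \<odot> u" by (rule e_mult[symmetric])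
  then show ?thesis
    unfolding almost_divisible_def using act_closed[OF e_closed u] assms(2)
    by (intro conjI bexI[OF _ assms(2)] exI[of _ 1]) simp_all
qed

lemma almost_divisible_zero:
  assumes "submodule H (\<Lambda> Q \<rho>) M"
  shows "almost_divisible f H \<zero>"
  using almost_divisible_act[OF assms submoduleD(2)[OF assms], of f] act_zero[OF e_closed] by simp

text \<open>The product of the two denominators serves for both summands and still has value 1 at
  0.\<close>

lemma almost_divisible_add:
  assumes H: "submodule H (\<Lambda> Q \<rho>) M" and t: "almost_divisible f H t" and t': "almost_divisible f H t'"
  shows "almost_divisible f H (t \<oplus> t')"
proof -
  obtain u h where u: "t \<in> carrier M" "u \<in> H" "poly h 0 = 1" "e h \<odot> t = e (h * f) \<odot> u"
    using t by (auto simp: almost_divisible_def)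
  obtain u' h' where u': "t' \<in> carrier M" "u' \<in> H" "poly h' 0 = 1" "e h' \<odot> t' = e (h' * f) \<odot> u'"
    using t' by (auto simp: almost_divisible_def)
  have uc: "u \<in> carrier M" "u' \<in> carrier M" using submoduleD(1)[OF H] u(2) u'(2) by auto
  have 1: "e (h * h') \<odot> t = e (h * h' * f) \<odot> u"
    using e_mult[OF u(1), of h' h] e_mult[OF uc(1), of h' "h * f"] u(4) by (simp add: ac_simps)
  have 2: "e (h * h') \<odot> t' = e (h * h' * f) \<odot> u'"
    using e_mult[OF u'(1), of h h'] e_mult[OF uc(2), of h "h' * f"] u'(4) by (simp add: ac_simps)
  have "e (h * h') \<odot> (t \<oplus> t') = e (h * h' * f) \<odot> (u \<oplus> u')"
    using smult_r_distr[OF e_closed u(1) u'(1)] smult_r_distr[OF e_closed uc] 1 2 by simp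
  then show ?thesis
    unfolding almost_divisible_def using u(1,3) u'(1,3)
    by (intro conjI bexI[OF _ submoduleD(3)[OF H u(2) u'(2)]] exI[of _ "h * h'"]) simp_all
qed

lemma almost_divisible_finsum:
  assumes H: "submodule H (\<Lambda> Q \<rho>) M"
  shows "(\<And>i. i \<in> I \<Longrightarrow> almost_divisible f H (t i)) \<Longrightarrow> almost_divisible f H (\<Oplus>i\<in>I. t i)"
proof (induction I rule: infinite_finite_induct)
  case (insert i I)
  have "t \<in> I \<rightarrow> carrier M" "t i \<in> carrier M"
    using insert.prems by (auto simp: almost_divisible_def)
  then have "(\<Oplus>j\<in>insert i I. t j) = t i \<oplus> (\<Oplus>j\<in>I. t j)"
    using insert.hyps by (intro finsum_insert)
  then show ?case
    using almost_divisible_add[OF H] insert by simp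
qed (simp_all add: almost_divisible_zero[OF H])

text \<open>Write g = T^a g1 with g1(0) nonzero and scale g1 to \<open>h\<close> with h(0) = 1.
  Since f(0) = 1, f is invertible modulo T^a, say f q = 1 modulo T^a. As T^a h kills
  \<open>t\<close>, it follows that h t = (h f) q t.\<close>

lemma almost_divisible_annihilated:
  assumes H: "submodule H (\<Lambda> Q \<rho>) M" and t: "t \<in> H" and g: "g \<noteq> 0" "e g \<odot> t = \<zero>" and f: "poly f 0 = 1"
  shows "almost_divisible f H t"
proof -
  have tc: "t \<in> carrier M" using submoduleD(1)[OF H] t by blast
  obtain a g1 where g1: "g = [:- 0, 1:] ^ a * g1" "\<not> [:- 0, 1:] dvd g1"
    using order_decomp[OF g(1), of 0] by blast
  then have nz: "poly g1 0 \<noteq> 0" using poly_eq_0_iff_dvd by blast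
  define h where "h = [:inverse (poly g1 0):] * g1"
  have h0: "poly h 0 = 1" using nz by (simp add: h_def)
  have "e ([:0, 1:] ^ a * h) \<odot> t = e ([:inverse (poly g1 0):] * g) \<odot> t"
    by (simp add: h_def g1(1) ac_simps)
  also have "\<dots> = \<zero>" unfolding e_mult[OF tc] g(2) by (rule act_zero[OF e_closed])
  finally have kill: "e ([:0, 1:] ^ a * h) \<odot> t = \<zero>" .
  have "poly (1 - f) 0 = 0" using f by simp
  then have "[:0, 1:] dvd 1 - f" unfolding poly_eq_0_iff_dvd minus_zero .
  then obtain k where k: "1 - f = [:0, 1:] * k" by (rule dvdE)
  \<comment> \<open>The truncated geometric series in 1 - f, which is an inverse of f modulo T^a
    because T divides 1 - f.\<close>
  define q where "q = (\<Sum>i<a. (1 - f) ^ i)"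
  have "1 - (1 - f) ^ a = (1 - (1 - f)) * q" unfolding q_def by (rule one_diff_power_eq)
  then have one: "(1 - f) ^ a + f * q = 1" by (simp add: algebra_simps)
  have "h = ((1 - f) ^ a + f * q) * h" unfolding one by simp
  also have "\<dots> = k ^ a * ([:0, 1:] ^ a * h) + (h * f) * q"
    unfolding k by (simp only: power_mult_distrib ring_distribs ac_simps)
  finally have "e h \<odot> t = e (k ^ a * ([:0, 1:] ^ a * h) + (h * f) * q) \<odot> t" by (simp only:)
  also have "\<dots> = e (h * f) \<odot> (e q \<odot> t)"
    unfolding e_add[OF tc] e_mult[OF tc, of "k ^ a"] e_mult[OF tc, of "h * f"] kill act_zero[OF e_closed]
    using e_closed tc by simp
  finally show ?thesis
    unfolding almost_divisible_def using h0 tc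
    by (intro conjI bexI[OF _ submoduleD(5)[OF H e_closed t]] exI[of _ h]) simp_all
qed

text \<open>Among \<open>t\<close>, P t, P^2 t and so on, one more vector than there are spanning
  elements gives a linear dependence, that is, a polynomial. Finite dimensionality is phrased
  through \<open>scalar_act\<close>, so everything is first projected to the vertex of the cycle,
  where scalars are multiples of one algebra element.\<close>

lemma finite_dimensional_annihilator:
  assumes A: "submodule A (\<Lambda> Q \<rho>) M" and fd: "finite_dimensional Q \<rho> (M\<lparr>carrier := A\<rparr>)" and t: "t \<in> A"
  shows "\<exists>g. g \<noteq> 0 \<and> e g \<odot> t = \<zero>"
proof -
  let ?v = "\<lambda>c. vertex_elt base c :: ('v, 'a, 'k) alg_elt"
  note A1 = submoduleD[OF A]
  have tc: "t \<in> carrier M" using A1(1) t by blast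
  have vc: "?v c \<in> carrier (\<Lambda> Q \<rho>)" for c by (rule vertex_elt_closed[OF base_vert])
  obtain B where B: "finite B" "B \<subseteq> A"
    and span: "\<And>m. m \<in> A \<Longrightarrow> \<exists>c. m = finsum (M\<lparr>carrier := A\<rparr>) (\<lambda>b. scalar_act Q \<rho> (M\<lparr>carrier := A\<rparr>) (c b) b) B"
    using fd by (auto simp: finite_dimensional_def)
  have Bc: "b \<in> carrier M" if "b \<in> B" for b using B(2) A1(1) that by blast
  let ?supp = "module_support Q \<rho> M"
  \<comment> \<open>For an element of infinite support the sum in \<open>scalar_act\<close> defaults
    to zero, so such an element contributes nothing to the span and is replaced by zero.\<close>
  define b' where "b' b = (if finite (?supp b) then b else \<zero>)" for b
  have b'c: "b' b \<in> carrier M" if "b \<in> B" for b using Bc[OF that] by (simp add: b'_def)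
  have scalar_eq: "scalar_act Q \<rho> (M\<lparr>carrier := A\<rparr>) c b = (\<Oplus>w\<in>?supp b. vertex_elt w c \<odot> b)"
    and scalar_mem: "(\<Oplus>w\<in>?supp b. vertex_elt w c \<odot> b) \<in> A" if "b \<in> B" for b c
  proof -
    have mem: "vertex_elt w c \<odot> b \<in> A" if "w \<in> ?supp b" for w
      using A1(5)[OF vertex_elt_closed] that \<open>b \<in> B\<close> B(2) by (auto simp: module_support_def)
    have "?supp b = module_support Q \<rho> (M\<lparr>carrier := A\<rparr>) b" by (simp add: module_support_def)
    then show "scalar_act Q \<rho> (M\<lparr>carrier := A\<rparr>) c b = (\<Oplus>w\<in>?supp b. vertex_elt w c \<odot> b)"
      using finsum_submodule[OF A mem, of "?supp b" "\<lambda>w. w"] by (simp add: scalar_act_def)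
    show "(\<Oplus>w\<in>?supp b. vertex_elt w c \<odot> b) \<in> A"
      by (rule finsum_mem_subgroup[OF submodule_subgroup[OF A] mem])
  qed
  have scalar_v: "?v 1 \<odot> (\<Oplus>w\<in>?supp b. vertex_elt w c \<odot> b) = ?v c \<odot> b' b" if b: "b \<in> B" for b c
  proof (cases "finite (?supp b)")
    case True
    have supp: "w \<in> verts Q" if "w \<in> ?supp b" for w using that by (simp add: module_support_def)
    have "?v 1 \<odot> (\<Oplus>w\<in>?supp b. vertex_elt w c \<odot> b) = (\<Oplus>w\<in>?supp b. ?v 1 \<odot> (vertex_elt w c \<odot> b))"
      by (intro act_finsum vc act_closed vertex_elt_closed[OF supp] Bc[OF b])
    also have "\<dots> = (\<Oplus>w\<in>?supp b. if base = w then ?v c \<odot> b else \<zero>)"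
      using vertex_act_vertex_act[OF base_vert supp Bc[OF b], of _ 1 c] vc Bc[OF b]
      by (intro add.finprod_cong' refl) auto
    also have "\<dots> = ?v c \<odot> b"
    proof (cases "base \<in> ?supp b")
      case base: True
      show ?thesis
        using add.finprod_singleton[OF base True, of "\<lambda>_. ?v c \<odot> b"] vc Bc[OF b] by (simp add: finsum_def)
    next
      case False
      then have "?v 1 \<odot> b = \<zero>" using base_vert by (simp add: module_support_def)
      then have "?v c \<odot> b = \<zero>"
        using vertex_act_vertex_act[OF base_vert base_vert Bc[OF b], of c 1] act_zero[OF vc] by simp
      moreover have "(\<Oplus>w\<in>?supp b. if base = w then ?v c \<odot> b else \<zero>) = (\<Oplus>w\<in>?supp b. \<zero>)"
        using False by (intro add.finprod_cong' refl) auto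
      ultimately show ?thesis by simp
    qed
    finally show ?thesis using True by (simp add: b'_def)
  next
    case False
    then show ?thesis using act_zero[OF vc] by (simp add: b'_def)
  qed
  have "\<exists>c. e (monom 1 r) \<odot> t = (\<Oplus>b\<in>B. ?v (c b) \<odot> b' b)" for r
  proof -
    have "e (monom 1 r) \<odot> t \<in> A" by (rule A1(5)[OF e_closed t])
    then obtain c where "e (monom 1 r) \<odot> t = finsum (M\<lparr>carrier := A\<rparr>) (\<lambda>b. scalar_act Q \<rho> (M\<lparr>carrier := A\<rparr>) (c b) b) B"
      using span by blast
    also have "\<dots> = (\<Oplus>b\<in>B. scalar_act Q \<rho> (M\<lparr>carrier := A\<rparr>) (c b) b)"
      using scalar_eq scalar_mem by (intro finsum_submodule[OF A]) simp
    also have "\<dots> = (\<Oplus>b\<in>B. \<Oplus>w\<in>?supp b. vertex_elt w (c b) \<odot> b)"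
      using scalar_eq scalar_mem A1(1) by (intro add.finprod_cong' refl) auto
    finally have "?v 1 \<odot> (e (monom 1 r) \<odot> t) = ?v 1 \<odot> (\<Oplus>b\<in>B. \<Oplus>w\<in>?supp b. vertex_elt w (c b) \<odot> b)"
      by simp
    also have "\<dots> = (\<Oplus>b\<in>B. ?v 1 \<odot> (\<Oplus>w\<in>?supp b. vertex_elt w (c b) \<odot> b))"
      using scalar_mem A1(1) by (intro act_finsum vc) auto
    also have "\<dots> = (\<Oplus>b\<in>B. ?v (c b) \<odot> b' b)"
      using scalar_v vc b'c by (intro add.finprod_cong' refl) auto
    also have "?v 1 \<odot> (e (monom 1 r) \<odot> t) = e (monom 1 r) \<odot> t"
      using e_mult[OF tc, of 1 "monom 1 r"] by (simp add: poly_elt_const one_pCons)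
    finally show ?thesis by blast
  qed
  then have "\<forall>r. \<exists>c. e (monom 1 r) \<odot> t = (\<Oplus>b\<in>B. ?v (c b) \<odot> b' b)" by (rule allI)
  then obtain c where c: "\<forall>r. e (monom 1 r) \<odot> t = (\<Oplus>b\<in>B. ?v (c r b) \<odot> b' b)"
    by (rule exE[OF choice])
  note c = c[rule_format]
  have "\<exists>a. (\<exists>r\<in>{..card B}. a r \<noteq> 0) \<and> (\<forall>b\<in>B. (\<Sum>r\<in>{..card B}. a r * c r b) = 0)"
    by (rule linear_dependence[OF B(1)]) simp_all
  then obtain a where a: "\<exists>r\<in>{..card B}. a r \<noteq> 0" "\<forall>b\<in>B. (\<Sum>r\<in>{..card B}. a r * c r b) = 0"
    by (elim exE conjE)
  define g where "g = (\<Sum>r\<in>{..card B}. monom (a r) r)"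
  have "coeff g r = (if r \<le> card B then a r else 0)" for r
    by (simp add: g_def coeff_sum if_distrib cong: if_cong)
  note coeff_g = this
  have g0: "g \<noteq> 0"
  proof
    assume "g = 0"
    then have "a r = 0" if "r \<in> {..card B}" for r using coeff_g[of r] that by simp
    then show False using a(1) by blast
  qed
  have vB: "?v d \<odot> b' b \<in> carrier M" if "b \<in> B" for d b using vc b'c[OF that] by simp
  have summand: "e (monom (a r) r) \<odot> t = (\<Oplus>b\<in>B. ?v (a r * c r b) \<odot> b' b)" for r
  proof -
    have "monom (a r) r = [:a r:] * monom 1 r" by (simp add: smult_monom)
    then have "e (monom (a r) r) \<odot> t = ?v (a r) \<odot> (\<Oplus>b\<in>B. ?v (c r b) \<odot> b' b)"
      using e_mult[OF tc, of "[:a r:]" "monom 1 r"] by (simp add: poly_elt_const c del: mult_pCons_left)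
    also have "\<dots> = (\<Oplus>b\<in>B. ?v (a r) \<odot> (?v (c r b) \<odot> b' b))"
      using vB by (intro act_finsum vc)
    also have "\<dots> = (\<Oplus>b\<in>B. ?v (a r * c r b) \<odot> b' b)"
      using vertex_act_vertex_act[OF base_vert base_vert b'c] vB by (intro add.finprod_cong' refl) auto
    finally show ?thesis .
  qed
  have "e (\<Sum>r\<in>I. monom (a r) r) \<odot> t = (\<Oplus>b\<in>B. ?v (\<Sum>r\<in>I. a r * c r b) \<odot> b' b)" if "finite I" for I
    using that
  proof (induction I)
    case empty
    have "(\<Oplus>b\<in>B. ?v 0 \<odot> b' b) = (\<Oplus>b\<in>B. \<zero>)"
      using b'c by (intro add.finprod_cong' refl) (auto simp: vertex_elt_zero)
    then show ?case using e_zero[OF tc] by simp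
  next
    case (insert r I)
    have "e (\<Sum>r\<in>insert r I. monom (a r) r) \<odot> t = e (monom (a r) r) \<odot> t \<oplus> e (\<Sum>r\<in>I. monom (a r) r) \<odot> t"
      using insert.hyps e_add[OF tc] by simp
    also have "\<dots> = (\<Oplus>b\<in>B. ?v (a r * c r b) \<odot> b' b \<oplus> ?v (\<Sum>r\<in>I. a r * c r b) \<odot> b' b)"
      unfolding insert.IH summand using vB by (intro finsum_addf[symmetric]) auto
    also have "\<dots> = (\<Oplus>b\<in>B. ?v (\<Sum>r\<in>insert r I. a r * c r b) \<odot> b' b)"
      using insert.hyps vB act_add[OF vc vc b'c] by (intro add.finprod_cong' refl) (auto simp: vertex_elt_add)
    finally show ?case .
  qed
  from this[of "{..card B}"] have "e g \<odot> t = (\<Oplus>b\<in>B. ?v (\<Sum>r\<in>{..card B}. a r * c r b) \<odot> b' b)"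
    by (simp add: g_def)
  also have "\<dots> = (\<Oplus>b\<in>B. \<zero>)"
    using a(2) b'c by (intro add.finprod_cong' refl) (auto simp: vertex_elt_zero)
  also have "\<dots> = \<zero>" by simp
  finally show ?thesis using g0 by blast
qed

end

section \<open>The rays of a word and the summand in which divisibility fails\<close>

context primitive_path
begin

text \<open>The second ray stops at a letter that is not direct, and all letters of the first ray
  are direct, so the first cannot extend past that point. By symmetry, all rays of one direction
  have the same zone.\<close>

lemma ray_zone_subset:
  assumes "ray Q \<rho> xs C d i k" "ray Q \<rho> xs C d i' k'"
  shows "(\<lambda>t. i + d * t) ` {..k} \<subseteq> (\<lambda>t. i' + d * t) ` {..k'}"
proof (rule image_subsetI)
  interpret R: ray Q \<rho> xs C d i k by fact
  interpret R': ray Q \<rho> xs C d i' k' by fact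
  fix t assume t: "t \<in> {..k}"
  have dd: "d * (d * u) = u" for u using R.direction by auto
  define s where "s = k' + 1 + d * (i' - i)"
  have "oriented_letter C d (i + d * (d * (i' - i))) (k' + 1) = oriented_letter C d i (d * (i' - i) + (k' + 1))"
    by (rule oriented_letter_shift[OF R.direction])
  moreover have "i + d * (d * (i' - i)) = i'" "d * (i' - i) + (k' + 1) = s"
    by (simp_all add: dd s_def)
  ultimately have "oriented_letter C d i' (k' + 1) = oriented_letter C d i s" by (simp only:)
  then have "\<not> s \<le> k" using R.ray_letter[of s] R'.ray_end by metis
  then have "t + d * (i - i') \<in> {..k'}" using t by (simp add: s_def right_diff_distrib)
  moreover have "i + d * t = i' + d * (t + d * (i - i'))" by (simp add: distrib_left dd)
  ultimately show "i + d * t \<in> (\<lambda>t. i' + d * t) ` {..k'}" by (rule image_eqI[rotated])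
qed

text \<open>The letter between positions \<open>t\<close> and \<open>t + 1\<close> of the first ray
  is direct there and would be inverse when seen from the second. For this the letter numbered
  \<open>t + 1\<close> must belong to the first ray, which negativity of \<open>t\<close>
  guarantees; at the end of the zone the argument would fail.\<close>

lemma ray_zones_opposite:
  assumes "ray Q \<rho> xs C 1 i k" "ray Q \<rho> xs C (- 1) i' k'" "t < 0" "t' \<le> k'"
  shows "i + 1 * t \<noteq> i' + - 1 * t'"
proof
  interpret R: ray Q \<rho> xs C 1 i k by fact
  interpret R': ray Q \<rho> xs C "- 1" i' k' by fact
  assume eq: "i + 1 * t = i' + - 1 * t'"
  have "letters C (i + (t + 1)) = Some (Dir (p (t + 1)))"
    using R.ray_letter[of "t + 1"] R.k_bounds assms(3) by (simp add: oriented_letter_def)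
  moreover have "map_option letter_inv (letters C (i' + 1 - t')) = Some (Dir (p t'))"
    using R'.ray_letter[OF assms(4)] by (simp add: oriented_letter_def)
  moreover have "i' + 1 - t' = i + (t + 1)" using eq by simp
  ultimately show False by simp
qed

end

context cycle_module
begin

text \<open>The vector P x splits into its parts on the zones of the two directions and the rest.
  The rest is a combination of basis vectors killed by powers of P and is thus almost divisible; if
  the parts on the zones were too, so would be the whole.\<close>

lemma string_ray:
  fixes C :: "('v, 'a) word" and x :: "int \<Rightarrow>\<^sub>0 'k"
  assumes C: "is_word Q \<rho> C" "\<not> periodic_word Q \<rho> C"
    and eta: "linear_on (\<Lambda> Q \<rho>) (word_module Q C) M \<eta>"
    and H: "submodule H (\<Lambda> Q \<rho>) M" and eta_H: "\<And>x. x \<in> carrier (word_module Q C) \<Longrightarrow> \<eta> x \<in> H"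
    and f: "poly f 0 = 1" and x: "Poly_Mapping.keys x \<subseteq> word_index C"
    and not: "\<not> almost_divisible f H (\<eta> (P \<odot>\<^bsub>word_module Q C\<^esub> x))"
  shows "\<exists>d i k. ray Q \<rho> xs C d i k \<and>
    \<not> almost_divisible f H (\<eta> (restriction (P \<odot>\<^bsub>word_module Q C\<^esub> x) ((\<lambda>t. i + d * t) ` {..k})))"
proof (rule ccontr)
  let ?X = "word_module Q C :: (('v, 'a, 'k) alg_elt, int \<Rightarrow>\<^sub>0 'k) module"
  let ?ad = "almost_divisible f H"
  assume contra: "\<not> ?thesis"
  define z where "z = P \<odot>\<^bsub>?X\<^esub> x"
  have ray_ad: "?ad (\<eta> (restriction z ((\<lambda>t. i + d * t) ` {..k})))" if "ray Q \<rho> xs C d i k" for d i k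
    using contra that unfolding z_def by blast
  interpret X: algebra_module Q \<rho> ?X
    using left_module_word_module[OF C(1)] string_algebra_axioms by (simp add: algebra_module_def)
  note eta1 = linear_onD[OF eta]
  have eta0: "\<eta> 0 = \<zero>"
    using linear_on_zero[OF eta X.abelian_group_axioms abelian_group_axioms] by simp
  have zc: "Poly_Mapping.keys z \<subseteq> word_index C"
    using X.act_closed[OF P_closed, of x] x by (simp add: z_def)
  have rc: "Poly_Mapping.keys (restriction z Z) \<subseteq> word_index C" for Z
    using zc by (auto simp: in_keys_iff lookup_restriction split: if_splits)
  \<comment> \<open>A union in form only: if there is any ray in direction \<open>d\<close>, this is
    its zone.\<close>
  define Z where "Z d = {j. \<exists>i k t. ray Q \<rho> xs C d i k \<and> t \<le> k \<and> j = i + d * t}" for d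
  have Z_ad: "?ad (\<eta> (restriction z (Z d)))" for d
  proof (cases "\<exists>i k. ray Q \<rho> xs C d i k")
    case True
    then obtain i k where r: "ray Q \<rho> xs C d i k" by (elim exE)
    have "Z d = (\<lambda>t. i + d * t) ` {..k}"
    proof (intro equalityI subsetI)
      fix j assume "j \<in> Z d"
      then obtain i' k' t where r': "ray Q \<rho> xs C d i' k'" "t \<le> k'" "j = i' + d * t"
        unfolding Z_def by (elim CollectE exE conjE)
      have "j \<in> (\<lambda>t. i' + d * t) ` {..k'}" unfolding r'(3) using r'(2) by (intro imageI) simp
      then show "j \<in> (\<lambda>t. i + d * t) ` {..k}" using ray_zone_subset[OF r'(1) r] by (rule rev_subsetD)
    next
      fix j assume "j \<in> (\<lambda>t. i + d * t) ` {..k}"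
      then obtain t where "t \<le> k" "j = i + d * t" by (elim imageE) simp
      then show "j \<in> Z d" unfolding Z_def using r by (intro CollectI exI conjI)
    qed
    then show ?thesis using ray_ad[OF r] by simp
  next
    case False
    then have "Z d = {}" unfolding Z_def by simp
    then have "restriction z (Z d) = 0" by (simp add: restriction_def)
    then show ?thesis using almost_divisible_zero[OF H] eta0 by simp
  qed
  define R where "R = - (Z 1 \<union> Z (- 1))"
  \<comment> \<open>By \<open>nilpotent_or_ray\<close> a basis vector on no ray is killed by a power
    of P, and the corresponding monomial is a nonzero polynomial to which
    \<open>almost_divisible_annihilated\<close> applies.\<close>
  have single_ad: "?ad (\<eta> (Poly_Mapping.single j c))" if j: "j \<in> word_index C" "j \<in> R" for j c
  proof -
    have b: "Poly_Mapping.single j c \<in> carrier ?X" using j by simp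
    have "\<exists>r. poly_elt base xs (monom 1 r) \<odot>\<^bsub>?X\<^esub> Poly_Mapping.single j (1 :: 'k) = 0"
    proof (rule ccontr)
      assume "\<not> ?thesis"
      then have nn: "\<And>r. poly_elt base xs (monom 1 r) \<odot>\<^bsub>?X\<^esub> Poly_Mapping.single j (1 :: 'k) \<noteq> 0" by simp
      from nilpotent_or_ray[OF C j(1) nn] obtain d i k t where r: "ray Q \<rho> xs C d i k" "t \<le> k" "j = i + d * t"
        by (elim exE conjE)
      then have "j \<in> Z d" unfolding Z_def by (intro CollectI exI conjI)
      moreover have "d \<in> {1, - 1}" using ray.direction[OF r(1)] .
      ultimately show False using j(2) by (auto simp: R_def)
    qed
    then obtain r where r: "e (monom 1 r) \<odot>\<^bsub>?X\<^esub> Poly_Mapping.single j (1 :: 'k) = 0" by (rule exE)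
    have act: "e (monom 1 r) \<odot>\<^bsub>?X\<^esub> m = path_algebra_op Q C (path_poly base xs (monom 1 r)) m"
      if "Poly_Mapping.keys m \<subseteq> word_index C" for m
      unfolding poly_elt_def by (rule word_module_act[OF C(1) that])
    have "e (monom 1 r) \<odot>\<^bsub>?X\<^esub> scale c (Poly_Mapping.single j 1) = scale c (e (monom 1 r) \<odot>\<^bsub>?X\<^esub> Poly_Mapping.single j 1)"
      using j(1) act[of "Poly_Mapping.single j 1"] act[of "scale c (Poly_Mapping.single j 1)"]
        path_algebra_op_scale[of Q C "path_poly base xs (monom 1 r)" c "Poly_Mapping.single j 1"] by simp
    then have "e (monom 1 r) \<odot>\<^bsub>?X\<^esub> Poly_Mapping.single j c = 0" unfolding r by simp
    then have "e (monom 1 r) \<odot> \<eta> (Poly_Mapping.single j c) = \<zero>"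
      using eta1(3)[OF e_closed b, of "monom 1 r"] eta0 by simp
    then show ?thesis
      by (intro almost_divisible_annihilated[OF H eta_H[OF b], of "monom 1 r"] f) (simp_all add: monom_eq_0_iff)
  qed
  have sum_ad: "?ad (\<eta> (\<Sum>j\<in>J. Poly_Mapping.single j (Poly_Mapping.lookup z j)))"
    if "finite J" "J \<subseteq> word_index C \<inter> R" for J
    using that
  proof (induction J)
    case empty
    then show ?case using almost_divisible_zero[OF H] eta0 by simp
  next
    case (insert j J)
    let ?s = "\<lambda>j. Poly_Mapping.single j (Poly_Mapping.lookup z j)"
    have c: "Poly_Mapping.keys (\<Sum>j\<in>J. ?s j) \<subseteq> word_index C"
    proof -
      have "Poly_Mapping.keys (\<Sum>j\<in>J. ?s j) \<subseteq> (\<Union>j\<in>J. Poly_Mapping.keys (?s j))" by (rule keys_sum)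
      also have "\<dots> \<subseteq> word_index C" using insert.prems by (auto split: if_splits)
      finally show ?thesis .
    qed
    have "\<eta> (?s j + (\<Sum>j\<in>J. ?s j)) = \<eta> (?s j) \<oplus> \<eta> (\<Sum>j\<in>J. ?s j)"
      using eta1(2)[of "?s j" "\<Sum>j\<in>J. ?s j"] c insert.prems by simp
    then show ?case
      using almost_divisible_add[OF H single_ad insert.IH] insert.prems insert.hyps by simp
  qed
  have R_ad: "?ad (\<eta> (restriction z R))"
    unfolding restriction_def using zc by (intro sum_ad) auto
  \<comment> \<open>The parts on the two zones may be added without counting a position twice, since
    P x meets a zone only at negative offsets, where opposite rays do not overlap.\<close>
  have disjoint: "\<not> (j \<in> Z 1 \<and> j \<in> Z (- 1))" if nz: "Poly_Mapping.lookup z j \<noteq> 0" for j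
  proof
    assume "j \<in> Z 1 \<and> j \<in> Z (- 1)"
    then obtain i k t i' k' t' where r: "ray Q \<rho> xs C 1 i k" "t \<le> k" "j = i + 1 * t"
      and r': "ray Q \<rho> xs C (- 1) i' k'" "t' \<le> k'" "j = i' + - 1 * t'"
      unfolding Z_def by (elim CollectE exE conjE)
    have "t < 0"
      using ray.zone_keys(2)[OF r(1) x r(2)] nz unfolding z_def r(3) by simp
    then show False using ray_zones_opposite[OF r(1) r'(1) _ r'(2)] r(3) r'(3) by metis
  qed
  have "z = restriction z (Z 1) + (restriction z (Z (- 1)) + restriction z R)"
    using disjoint by (intro poly_mapping_eqI) (auto simp: lookup_add lookup_restriction R_def)
  then have "\<eta> z = \<eta> (restriction z (Z 1)) \<oplus> (\<eta> (restriction z (Z (- 1))) \<oplus> \<eta> (restriction z R))"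
    using eta1(2)[of "restriction z (Z 1)" "restriction z (Z (- 1)) + restriction z R"]
      eta1(2)[of "restriction z (Z (- 1))" "restriction z R"] rc
      X.a_closed[of "restriction z (Z (- 1))" "restriction z R"] by simp
  then have "?ad (\<eta> z)"
    using almost_divisible_add[OF H Z_ad almost_divisible_add[OF H Z_ad R_ad]] by simp
  then show False using not by (simp add: z_def)
qed

end

section \<open>Splitting off the peak summand\<close>

context cycle_module
begin

lemma peak_summand:
  fixes S :: "(('v, 'a, 'k) alg_elt, 's) module" and \<sigma> :: "'a letter \<Rightarrow> int"
    and f :: "'k poly" and N :: "'m set" and \<Phi> :: "'i set" and A :: "'i \<Rightarrow> 'm set"
  assumes \<sigma>: "sign_choice Q \<rho> \<sigma>"
    and S: "left_module (\<Lambda> Q \<rho>) S" "simple_module (\<Lambda> Q \<rho>) S"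
    and f: "irreducible f" "poly f 0 = 1"
    and band: "module_iso (\<Lambda> Q \<rho>) S (band_module Q (power_biinf (cycle_word xs)) (laurent_quot f))"
    and N: "submodule N (\<Lambda> Q \<rho>) M" "tau1 Q \<rho> M \<subseteq> N" and quot: "module_iso (\<Lambda> Q \<rho>) (quot_module M N) S"
    and sum: "is_direct_sum (\<Lambda> Q \<rho>) M \<Phi> A N"
    and summands: "\<And>i. i \<in> \<Phi> \<Longrightarrow>
      is_string_module Q \<rho> (M\<lparr>carrier := A i\<rparr>) \<or> finite_dimensional Q \<rho> (M\<lparr>carrier := A i\<rparr>)"
  shows "\<exists>\<mu>\<in>\<Phi>.
    (\<exists>C. is_word Q \<rho> C \<and> has_peak Q \<rho> \<sigma> (cycle_word xs) C \<and>
       module_iso (\<Lambda> Q \<rho>) (M\<lparr>carrier := A \<mu>\<rparr>) (word_module Q C)) \<and>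
    (\<exists>B. is_direct_sum2 (\<Lambda> Q \<rho>) M B (submodule_sum (\<Lambda> Q \<rho>) M (\<Phi> - {\<mu>}) A) \<and>
       module_iso (\<Lambda> Q \<rho>) (M\<lparr>carrier := B\<rparr>) (M\<lparr>carrier := A \<mu>\<rparr>))"
proof -
  interpret S: algebra_module Q \<rho> S
    using S(1) string_algebra_axioms by (simp add: algebra_module_def)
  let ?ad = "almost_divisible f N"
  let ?v = "vertex_elt base 1 :: ('v, 'a, 'k) alg_elt"
  note N1 = submoduleD[OF N(1)]
  have vc: "?v \<in> carrier (\<Lambda> Q \<rho>)" by (rule vertex_elt_closed[OF base_vert])
  have vv: "?v \<odot> (?v \<odot> y) = ?v \<odot> y" if "y \<in> carrier M" for y
    using vertex_act_vertex_act[OF base_vert base_vert that, of 1 1] by simp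
  have nontriv: "carrier S \<noteq> {\<zero>\<^bsub>S\<^esub>}" using S(2) by (simp add: simple_module_def)
  obtain s where s: "s \<in> carrier S" "s \<noteq> \<zero>\<^bsub>S\<^esub>" "?v \<odot>\<^bsub>S\<^esub> s = s" "e f \<odot>\<^bsub>S\<^esub> s = \<zero>\<^bsub>S\<^esub>"
    using primitive_simple_element[OF S(1) nontriv band] by (elim bexE conjE)
  obtain \<psi> where psi: "linear_on (\<Lambda> Q \<rho>) M S \<psi>" "\<psi> ` carrier M = carrier S"
    and ker: "\<forall>x\<in>carrier M. \<psi> x = \<zero>\<^bsub>S\<^esub> \<longleftrightarrow> x \<in> N"
    using quotient_epi[OF N(1) S(1) quot] by (elim exE conjE)
  note psi1 = linear_onD[OF psi(1)]
  have "s \<in> \<psi> ` carrier M" unfolding psi(2) by (rule s(1))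
  then obtain m0 where m0: "s = \<psi> m0" "m0 \<in> carrier M" by (rule imageE)
  define m1 where "m1 = ?v \<odot> m0"
  have m1: "m1 \<in> carrier M" "?v \<odot> m1 = m1" "\<psi> m1 = s"
    unfolding m1_def using act_closed[OF vc m0(2)] vv[OF m0(2)] psi1(3)[OF vc m0(2)] m0(1) s(3) by simp_all
  have n1: "e f \<odot> m1 \<in> N"
    using ker[rule_format, OF act_closed[OF e_closed m1(1), of f]] psi1(3)[OF e_closed m1(1), of f] m1(3) s(4) by simp
  \<comment> \<open>With f = 1 + T g, the lift satisfies m1 = f(P) m1 - P g(P) m1, and the first
    term lies in \<open>N\<close>. The second term, named \<open>m\<close>, therefore represents the
    same element of \<open>S\<close> and lies in the image of P.\<close>
  obtain a g where "f = pCons a g" by (rule pCons_cases)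
  then have g: "f = pCons 1 g" using f(2) by simp
  define m2 where "m2 = \<ominus> (e g \<odot> m1)"
  have gc: "e g \<odot> m1 \<in> carrier M" by (rule act_closed[OF e_closed m1(1)])
  have m2: "m2 \<in> carrier M" unfolding m2_def by (rule a_inv_closed[OF gc])
  define m where "m = P \<odot> m2"
  have m: "m \<in> carrier M" unfolding m_def by (rule act_closed[OF P_closed m2])
  have m_neg: "m = \<ominus> (P \<odot> (e g \<odot> m1))" unfolding m_def m2_def by (rule act_neg[OF P_closed gc])
  have "e f \<odot> m1 = m1 \<oplus> P \<odot> (e g \<odot> m1)"
    unfolding g using poly_act_pCons[OF cycle_path m1(1), of 1 g] m1(2) by simp
  then have m1_eq: "m1 = e f \<odot> m1 \<oplus> m"
    unfolding m_neg using m1(1) act_closed[OF P_closed gc] by (simp add: a_assoc r_neg)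
  have m_notin: "m \<notin> N"
  proof
    assume "m \<in> N"
    then have "e f \<odot> m1 \<oplus> m \<in> N" by (rule N1(3)[OF n1])
    then have "m1 \<in> N" by (simp only: m1_eq[symmetric])
    then show False using ker[rule_format, OF m1(1)] m1(3) s(2) by simp
  qed
  have vm: "?v \<odot> m = m" unfolding m_def by (rule e_base[OF m2])
  \<comment> \<open>Simplicity of \<open>S\<close>: the image of \<open>H\<close> is nonzero, hence
    everything, and \<open>H\<close> contains the kernel.\<close>
  have top: "H = carrier M" if H: "submodule H (\<Lambda> Q \<rho>) M" "N \<subseteq> H" "m \<in> H" for H
  proof
    note H1 = submoduleD[OF H(1)]
    show "H \<subseteq> carrier M" by (rule H1(1))
    have "submodule (\<psi> ` H) (\<Lambda> Q \<rho>) S"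
      by (rule S.submodule_linear_image[OF left_module_axioms H(1) psi(1)])
    moreover have "\<psi> m \<in> \<psi> ` H" "\<psi> m \<noteq> \<zero>\<^bsub>S\<^esub>" using ker H(3) m m_notin by simp_all
    ultimately have full: "\<psi> ` H = carrier S" using S(2) unfolding simple_module_def by blast
    show "carrier M \<subseteq> H"
    proof
      fix x assume x: "x \<in> carrier M"
      then have "\<psi> x \<in> \<psi> ` H" unfolding full by (rule psi1(1))
      then obtain y where y: "\<psi> x = \<psi> y" "y \<in> H" by (rule imageE)
      have yc: "y \<in> carrier M" using H1(1) y(2) by blast
      have "\<psi> (x \<ominus> y) \<oplus>\<^bsub>S\<^esub> \<psi> y = \<psi> y"
        using psi1(2)[of "x \<ominus> y" y] x yc y(1) by (simp add: diff_add_cancel)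
      then have "\<psi> (x \<ominus> y) = \<zero>\<^bsub>S\<^esub>"
        using psi1(1)[of "x \<ominus> y"] psi1(1)[of y] x yc by simp
      then have "x \<ominus> y \<in> N" using ker x yc by simp
      then have "x \<ominus> y \<oplus> y \<in> H" using H(2) H1(3) y(2) by blast
      then show "x \<in> H" using x yc by (simp add: diff_add_cancel)
    qed
  qed
  \<comment> \<open>Commuting f(P) past P and g(P) shows that f(P) m is not only in \<open>N\<close>
    but equals P y with \<open>y\<close> in \<open>N\<close>; this allows the components of
    \<open>y\<close> to be studied inside the summands.\<close>
  define y where "y = e f \<odot> m2"
  have "y = \<ominus> (e g \<odot> (e f \<odot> m1))"
    unfolding y_def m2_def act_neg[OF e_closed gc] poly_act_commute[OF cycle_path m1(1), of f g] by (rule refl)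
  then have y: "y \<in> N" using N1(4)[OF N1(5)[OF e_closed n1]] by simp
  have fm: "e f \<odot> m = P \<odot> y" unfolding m_def y_def by (rule e_P[OF m2])
  \<comment> \<open>Otherwise some (h f)(P) kills the difference \<open>w\<close> of
    \<open>m\<close> and the part of u at the vertex. Since h f = 1 + T g', the relation itself
    writes \<open>w\<close> as an element of the image of P, so \<open>mem_tau1\<close> puts it into
    \<open>tau1\<close> and hence into \<open>N\<close>, and \<open>m\<close> would lie in
    \<open>N\<close>.\<close>
  have not_ad: "\<not> ?ad (P \<odot> y)"
  proof
    assume "?ad (P \<odot> y)"
    then obtain u h where u: "u \<in> N" "poly h 0 = 1" "e h \<odot> (e f \<odot> m) = e (h * f) \<odot> u"
      unfolding almost_divisible_def fm by (elim conjE bexE exE)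
    have uc: "u \<in> carrier M" using N1(1) u(1) by blast
    obtain b g' where "h * f = pCons b g'" by (rule pCons_cases)
    moreover have "poly (h * f) 0 = 1" using u(2) f(2) by simp
    ultimately have g': "h * f = pCons 1 g'" by simp
    define w where "w = m \<ominus> ?v \<odot> u"
    have vu: "?v \<odot> u \<in> N" by (rule N1(5)[OF vc u(1)])
    have vuc: "?v \<odot> u \<in> carrier M" by (rule act_closed[OF vc uc])
    have wc: "w \<in> carrier M" unfolding w_def using m vuc by simp
    have vw: "?v \<odot> w = w" unfolding w_def act_diff[OF vc m vuc] vm vv[OF uc] by (rule refl)
    have "e (h * f) \<odot> (?v \<odot> u) = e (h * f) \<odot> u"
      using e_mult[OF uc, of "h * f" 1] by (simp add: poly_elt_const one_pCons)
    then have ew: "e (h * f) \<odot> w = \<zero>"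
      unfolding w_def act_diff[OF e_closed m vuc] using e_mult[OF m, of h f] u(3) diff_eq_zero act_closed[OF e_closed uc] by simp
    define x where "x = \<ominus> (e g' \<odot> w)"
    have g'c: "e g' \<odot> w \<in> carrier M" by (rule act_closed[OF e_closed wc])
    have xc: "x \<in> carrier M" unfolding x_def by (rule a_inv_closed[OF g'c])
    have "w \<oplus> P \<odot> (e g' \<odot> w) = \<zero>"
      using ew poly_act_pCons[OF cycle_path wc, of 1 g'] vw unfolding g' by simp
    then have "w = \<ominus> (P \<odot> (e g' \<odot> w))"
      using minus_equality[OF _ act_closed[OF P_closed g'c] wc] by simp
    then have w: "w = P \<odot> x" unfolding x_def act_neg[OF P_closed g'c] .
    have "P \<odot> x \<in> tau1 Q \<rho> M"
      by (rule mem_tau1[OF xc, of "h * f"]) (use \<open>poly (h * f) 0 = 1\<close> ew w in simp_all)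
    then have "w \<in> N" using N(2) w by blast
    then have "w \<oplus> ?v \<odot> u \<in> N" using N1(3) vu by blast
    then show False using m_notin diff_add_cancel[OF m vuc] by (simp add: w_def)
  qed
  have A: "\<And>i. i \<in> \<Phi> \<Longrightarrow> submodule (A i) (\<Lambda> Q \<rho>) M" and N_sum: "N = submodule_sum (\<Lambda> Q \<rho>) M \<Phi> A"
    using sum by (simp_all add: is_direct_sum_def)
  have "\<exists>J x. finite J \<and> J \<subseteq> \<Phi> \<and> (\<forall>i\<in>J. x i \<in> A i) \<and> y = (\<Oplus>i\<in>J. x i)"
    using y unfolding N_sum by (subst (asm) submodule_sum_mem_iff) (rule A)
  then obtain J x where J: "finite J" "J \<subseteq> \<Phi>" "\<forall>i\<in>J. x i \<in> A i" "y = (\<Oplus>i\<in>J. x i)"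
    by (elim exE conjE)
  have xc: "x i \<in> carrier M" if "i \<in> J" for i
    using J(2,3) that submoduleD(1)[OF A] by blast
  have "\<exists>\<mu>\<in>J. \<not> ?ad (P \<odot> x \<mu>)"
  proof (rule ccontr)
    assume "\<not> ?thesis"
    then have "\<And>i. i \<in> J \<Longrightarrow> ?ad (P \<odot> x i)" by simp
    then have "?ad (\<Oplus>i\<in>J. P \<odot> x i)" by (rule almost_divisible_finsum[OF N(1)])
    moreover have "P \<odot> y = (\<Oplus>i\<in>J. P \<odot> x i)"
      unfolding J(4) by (rule act_finsum[OF P_closed]) (rule xc)
    ultimately show False using not_ad by simp
  qed
  then obtain \<mu> where mu: "\<mu> \<in> J" "\<not> ?ad (P \<odot> x \<mu>)" by (rule bexE)
  have \<mu>: "\<mu> \<in> \<Phi>" using mu(1) J(2) by blast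
  define N' where "N' = submodule_sum (\<Lambda> Q \<rho>) M (\<Phi> - {\<mu>}) A"
  note split = direct_sum_split[OF sum \<mu>, folded N'_def]
  note A1 = submoduleD[OF A[OF \<mu>]]
  define b where "b = (\<Oplus>i\<in>J - {\<mu>}. x i)"
  have "b \<in> N'"
    unfolding N'_def
  proof (rule iffD2[OF submodule_sum_mem_iff])
    show "submodule (A i) (\<Lambda> Q \<rho>) M" if "i \<in> \<Phi> - {\<mu>}" for i using A that by simp
    show "\<exists>J x. finite J \<and> J \<subseteq> \<Phi> - {\<mu>} \<and> (\<forall>i\<in>J. x i \<in> A i) \<and> b = (\<Oplus>i\<in>J. x i)"
      unfolding b_def using J(1-3) by (intro exI[of _ "J - {\<mu>}"] exI[of _ x]) auto
  qed
  have bc: "b \<in> carrier M" using \<open>b \<in> N'\<close> submoduleD(1)[OF split(1)] by blast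
  have "y = x \<mu> \<oplus> b"
    unfolding J(4) b_def using finsum_insert[of "J - {\<mu>}" \<mu> x] J(1) mu(1) xc by (simp add: insert_absorb)
  then have Py: "P \<odot> y = P \<odot> x \<mu> \<oplus> P \<odot> b"
    using smult_r_distr[OF P_closed xc[OF mu(1)] bc] by simp
  have Pb: "P \<odot> b \<in> N'" using submoduleD(5)[OF split(1) P_closed \<open>b \<in> N'\<close>] .
  have x\<mu>: "x \<mu> \<in> A \<mu>" using J(3) mu(1) by blast
  have Px\<mu>: "P \<odot> x \<mu> \<in> A \<mu>" by (rule A1(5)[OF P_closed x\<mu>])
  have "\<not> finite_dimensional Q \<rho> (M\<lparr>carrier := A \<mu>\<rparr>)"
  proof
    assume "finite_dimensional Q \<rho> (M\<lparr>carrier := A \<mu>\<rparr>)"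
    from finite_dimensional_annihilator[OF A[OF \<mu>] this Px\<mu>]
    obtain q where "q \<noteq> 0" "e q \<odot> (P \<odot> x \<mu>) = \<zero>" by (elim exE conjE)
    moreover have "P \<odot> x \<mu> \<in> N" using split(4) Px\<mu> by blast
    ultimately show False using almost_divisible_annihilated[OF N(1) _ _ _ f(2)] mu(2) by blast
  qed
  then obtain C where C: "is_word Q \<rho> C" "\<not> periodic_word Q \<rho> C"
    and iso: "module_iso (\<Lambda> Q \<rho>) (M\<lparr>carrier := A \<mu>\<rparr>) (word_module Q C)"
    using summands[OF \<mu>] unfolding is_string_module_def by blast
  let ?X = "word_module Q C :: (('v, 'a, 'k) alg_elt, int \<Rightarrow>\<^sub>0 'k) module"
  have X: "left_module (\<Lambda> Q \<rho>) ?X" by (rule left_module_word_module[OF C(1)])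
  have iso': "module_iso (\<Lambda> Q \<rho>) ?X (M\<lparr>carrier := A \<mu>\<rparr>)"
    by (rule module_iso_sym[OF submodule_left_module[OF A[OF \<mu>]] iso])
  then obtain \<eta> where bij: "bij_betw \<eta> (carrier ?X) (A \<mu>)" and lin: "linear_on (\<Lambda> Q \<rho>) ?X (M\<lparr>carrier := A \<mu>\<rparr>) \<eta>"
    unfolding module_iso_linear by (elim exE conjE) simp
  have eta: "linear_on (\<Lambda> Q \<rho>) ?X M \<eta>"
    using lin A1(1) unfolding linear_on_def by auto
  have eta_img: "\<eta> ` carrier ?X = A \<mu>" using bij by (rule bij_betw_imp_surj_on)
  have eta_N: "\<eta> z \<in> N" if "z \<in> carrier ?X" for z
    using that split(4) eta_img by blast
  obtain x' where x': "x \<mu> = \<eta> x'" "x' \<in> carrier ?X"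
    using x\<mu> unfolding eta_img[symmetric] by (rule imageE)
  let ?z = "P \<odot>\<^bsub>?X\<^esub> x'"
  have eta_z: "\<eta> ?z = P \<odot> x \<mu>" unfolding x'(1) by (rule linear_onD(3)[OF eta P_closed x'(2)])
  have x'k: "Poly_Mapping.keys x' \<subseteq> word_index C" using x'(2) by simp
  have "\<exists>d i k. ray Q \<rho> xs C d i k \<and> \<not> ?ad (\<eta> (restriction ?z ((\<lambda>t. i + d * t) ` {..k})))"
    by (rule string_ray[OF C eta N(1) eta_N f(2) x'k]) (simp_all add: eta_z mu(2))
  then obtain d i k where ray: "ray Q \<rho> xs C d i k" and zone_ad: "\<not> ?ad (\<eta> (restriction ?z ((\<lambda>t. i + d * t) ` {..k})))"
    by (elim exE conjE)
  interpret R: ray Q \<rho> xs C d i k by (rule ray)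
  interpret X: algebra_module Q \<rho> ?X by (rule R.word_algebra_module)
  let ?b = "Poly_Mapping.single i 1 :: int \<Rightarrow>\<^sub>0 'k"
  have b: "?b \<in> carrier ?X" using R.i_index by simp
  obtain h where h: "poly h 0 = 0" "e h \<odot>\<^bsub>?X\<^esub> ?b = restriction ?z R.zone"
    using R.zone_part(1)[OF x'k] by (elim exE conjE)
  have rest: "?z - restriction ?z R.zone \<in> R.off_zone" by (rule R.zone_part(2)[OF x'k])
  \<comment> \<open>A factor f of \<open>h\<close> would exhibit the part on the ray as f(P) applied
    to an element of \<open>N\<close>, hence as almost divisible.\<close>
  have "\<not> f dvd h"
  proof
    assume "f dvd h"
    then obtain q where q: "h = f * q" by (rule dvdE)
    have "\<eta> (restriction ?z R.zone) = e f \<odot> (e q \<odot> \<eta> ?b)"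
      unfolding h(2)[symmetric] q linear_onD(3)[OF eta e_closed b] by (rule e_mult[OF linear_onD(1)[OF eta b]])
    moreover have "?ad (e f \<odot> (e q \<odot> \<eta> ?b))"
      by (rule almost_divisible_act[OF N(1) N1(5)[OF e_closed eta_N[OF b]]])
    ultimately show False using zone_ad by (simp add: R.zone_def)
  qed
  \<comment> \<open>The three contributions are the part on the ray, the part of the same summand
    off the ray, and the contribution of the other summands.\<close>
  have rel: "e f \<odot> m = \<eta> (e h \<odot>\<^bsub>?X\<^esub> ?b \<oplus>\<^bsub>?X\<^esub> (?z - restriction ?z R.zone)) \<oplus> P \<odot> b"
    unfolding fm Py h(2) by (simp add: eta_z)
  have "\<exists>\<phi>. linear_on (\<Lambda> Q \<rho>) ?X M \<phi> \<and> inj_on \<phi> (carrier ?X) \<and> is_direct_sum2 (\<Lambda> Q \<rho>) M (\<phi> ` carrier ?X) N'"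
  proof (rule split_off_extension[OF X eta bij_betw_imp_inj_on[OF bij] split(1) _ _ cycle_path m vm
        R.off_zone_submodule b _ f \<open>\<not> f dvd h\<close> h(1) rel rest Pb])
    show "\<eta> ` carrier ?X \<inter> N' \<subseteq> {\<zero>}" unfolding eta_img by (rule split(2))
    show "H = carrier M" if "submodule H (\<Lambda> Q \<rho>) M" "\<eta> ` carrier ?X \<subseteq> H" "N' \<subseteq> H" "m \<in> H" for H
    proof (rule top[OF that(1) _ that(4)], rule subsetI)
      fix z assume "z \<in> N"
      from split(5)[OF this] obtain a c where "a \<in> A \<mu>" "c \<in> N'" "z = a \<oplus> c" by (elim bexE)
      then show "z \<in> H" using submoduleD(3)[OF that(1), of a c] that(2,3) unfolding eta_img by blast
    qed
    show "?v \<odot>\<^bsub>?X\<^esub> ?b = ?b"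
      using vertex_elt_act_single[OF C(1) R.i_index, of base 1 "1 :: 'k"] R.i_vertex by simp
    show "\<exists>\<theta>. linear_on (\<Lambda> Q \<rho>) ?X M \<theta> \<and> (\<forall>y\<in>R.off_zone. \<theta> y = \<zero>) \<and>
        \<theta> ?b = P \<odot> u \<and> (\<forall>H. submodule H (\<Lambda> Q \<rho>) M \<longrightarrow> u \<in> H \<longrightarrow> \<theta> ` carrier ?X \<subseteq> H)"
      if "u \<in> carrier M" for u
      by (rule R.ray_hom[OF left_module_axioms that])
    show "\<exists>q\<in>carrier (\<Lambda> Q \<rho>). \<exists>h. \<exists>y\<in>R.off_zone.
        q \<odot>\<^bsub>?X\<^esub> z = e h \<odot>\<^bsub>?X\<^esub> ?b \<oplus>\<^bsub>?X\<^esub> y \<and> e h \<odot>\<^bsub>?X\<^esub> ?b \<notin> R.off_zone"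
      if "z \<in> carrier ?X" "z \<notin> R.off_zone" for z
      by (rule R.push_into_zone[OF that])
  qed
  then obtain \<phi> where phi: "linear_on (\<Lambda> Q \<rho>) ?X M \<phi>" "inj_on \<phi> (carrier ?X)"
    and ds: "is_direct_sum2 (\<Lambda> Q \<rho>) M (\<phi> ` carrier ?X) N'"
    by (elim exE conjE)
  have "linear_on (\<Lambda> Q \<rho>) ?X (M\<lparr>carrier := \<phi> ` carrier ?X\<rparr>) \<phi>"
    using phi(1) unfolding linear_on_def by simp
  then have "module_iso (\<Lambda> Q \<rho>) ?X (M\<lparr>carrier := \<phi> ` carrier ?X\<rparr>)"
    unfolding module_iso_linear using inj_on_imp_bij_betw[OF phi(2)] by (intro exI[of _ \<phi>]) simp
  from module_iso_trans[OF module_iso_sym[OF X this] iso']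
  have final: "module_iso (\<Lambda> Q \<rho>) (M\<lparr>carrier := \<phi> ` carrier ?X\<rparr>) (M\<lparr>carrier := A \<mu>\<rparr>)" .
  have "has_peak Q \<rho> \<sigma> (cycle_word xs) C" using R.peak[OF \<sigma>] unfolding has_peak_def by (rule exI)
  then show ?thesis
    using C(1) iso ds final unfolding N'_def by (intro bexI[OF _ \<mu>] conjI exI)
qed

end

theorem theorem11p2:
  fixes Q :: "('v, 'a) pre_digraph"
    and \<rho> :: "'a list set"
    and \<sigma> :: "'a letter \<Rightarrow> int"
    and S :: "(('v, 'a, 'k::field) alg_elt, 's) module"
    and P :: "('v, 'a) word"
    and f :: "'k poly"
    and M :: "(('v, 'a, 'k) alg_elt, 'm) module"
    and N :: "'m set"
    and \<Phi> :: "'i set"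
    and N\<^sub>\<Phi> :: "'i \<Rightarrow> 'm set"
  assumes "string_algebra Q \<rho>"
    and "sign_choice Q \<rho> \<sigma>"
    and "primitive_simple Q \<rho> S"
    and "primitive_cycle Q \<rho> P"
    and "irreducible f" and "poly f 0 = 1"
    and "module_iso (\<Lambda> Q \<rho>) S (band_module Q (power_biinf P) (laurent_quot f))"
    and "\<Lambda>_module Q \<rho> M" and "finitely_controlled Q \<rho> M"
    and "submodule N (\<Lambda> Q \<rho>) M"
    and "tau1 Q \<rho> M \<subseteq> N"
    and "module_iso (\<Lambda> Q \<rho>) (quot_module M N) S"
    and "is_direct_sum (\<Lambda> Q \<rho>) M \<Phi> N\<^sub>\<Phi> N"
    and "\<And>i. i \<in> \<Phi> \<Longrightarrow>
           is_string_module Q \<rho> (M\<lparr>carrier := N\<^sub>\<Phi> i\<rparr>) \<or>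
           is_band_module TYPE('w) Q \<rho> (M\<lparr>carrier := N\<^sub>\<Phi> i\<rparr>) \<and>
             finite_dimensional Q \<rho> (M\<lparr>carrier := N\<^sub>\<Phi> i\<rparr>)"
  shows "\<exists>\<mu>\<in>\<Phi>.
           (\<exists>C. is_word Q \<rho> C \<and> has_peak Q \<rho> \<sigma> P C \<and>
              module_iso (\<Lambda> Q \<rho>) (M\<lparr>carrier := N\<^sub>\<Phi> \<mu>\<rparr>) (word_module Q C)) \<and>
           (\<exists>N\<^sub>\<mu>'. is_direct_sum2 (\<Lambda> Q \<rho>) M N\<^sub>\<mu>' (submodule_sum (\<Lambda> Q \<rho>) M (\<Phi> - {\<mu>}) N\<^sub>\<Phi>) \<and>
              module_iso (\<Lambda> Q \<rho>) (M\<lparr>carrier := N\<^sub>\<mu>'\<rparr>) (M\<lparr>carrier := N\<^sub>\<Phi> \<mu>\<rparr>))"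
proof -
  obtain xs where P: "P = cycle_word xs" using primitive_cycle_cycle_word[OF assms(4)] by (rule exE)
  have S: "left_module (\<Lambda> Q \<rho>) S" "simple_module (\<Lambda> Q \<rho>) S"
    using assms(3) by (simp_all add: primitive_simple_def \<Lambda>_module_def)
  have "cycle_module Q \<rho> xs M"
    using assms(1,4,8)
    by (simp add: P cycle_module_def primitive_path_def primitive_path_axioms_def algebra_module_def \<Lambda>_module_def)
  moreover have "is_string_module Q \<rho> (M\<lparr>carrier := N\<^sub>\<Phi> i\<rparr>) \<or> finite_dimensional Q \<rho> (M\<lparr>carrier := N\<^sub>\<Phi> i\<rparr>)"
    if "i \<in> \<Phi>" for i
    using assms(14)[OF that] by blast
  ultimately show ?thesis
    unfolding P by (intro cycle_module.peak_summand[OF _ assms(2) S assms(5,6) assms(7)[unfolded P] assms(10-13)])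
qed

end
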